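(* Let $\Omega=\mathbb{R}^N$ with $N\ge1$, and $V(x)=|x|^2$. For each fixed $\omega\in\mathbb{R}$, there exists at most one positive solution of $$-\Delta u-u\,\Delta u^2+|x|^2u+u^3=\omega u\ \text{ in }\mathbb{R}^N,$$ that is, at most one positive critical point of $\mathcal A_\omega$, and it exists if and only if $\omega>\lambda_V$, where $\lambda_V$ is the first eigenvalue of $(-\Delta+V(x)\mathrm{Id},\,H)$.
   Context: Let $f:\mathbb{R}\to\mathbb{R}$ be the odd function with $f(0)=0$ and $f'(t)=\frac{1}{\sqrt{1+2f^2(t)}}$ for $t>0$. Let $H=\{u\in H^1(\mathbb{R}^N):\int_{\mathbb{R}^N}|u|^2|x|^2\,dx<\infty\}$ with $\|u\|_H^2=\int_{\mathbb{R}^N}(|\nabla u|^2+|u|^2|x|^2)\,dx$. Solutions $u$ are understood through the substitution $u=f(v)$: $v=f^{-1}(u)\in H$ solves $-\Delta v+(|x|^2-\omega)\frac{f(v)}{\sqrt{1+2f^2(v)}}+\frac{f(v)^3}{\sqrt{1+2f^2(v)}}=0$, i.e. $v$ is a critical point of the $C^1$ functional $$\mathcal A_\omega(v)=\frac12\int_{\mathbb{R}^N}|\nabla v|^2\,dx+\frac12\int_{\mathbb{R}^N}(|x|^2-\omega)f(v)^2\,dx+\frac14\int_{\mathbb{R}^N}f(v)^4\,dx,\quad v\in H.$$ The eigenvalue is $\lambda_V=\inf_{v\in H\setminus\{0\}}\frac{\int_{\mathbb{R}^N}(|\nabla v|^2+|x|^2v^2)\,dx}{\int_{\mathbb{R}^N}v^2\,dx}$.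 Positive means $>0$ in $\mathbb{R}^N$. *)

theory Defs
  imports "HOL-Analysis.Analysis"
begin

section \<open>The change of variables\<close>

text \<open>
  Continuity at 0 is implicit in calling \<open>f\<close> the odd solution of the initial value problem
  \<open>f(0) = 0\<close>, \<open>f' = 1 / sqrt (1 + 2 f^2)\<close> on the positive half-line; without it the initial value
  would not be tied to the values on the half-line.
\<close>

definition is_dual_f :: "(real \<Rightarrow> real) \<Rightarrow> bool" where
  "is_dual_f f \<longleftrightarrow>
     (\<forall>t. f (- t) = - f t) \<and> f 0 = 0 \<and> isCont f 0 \<and>
     (\<forall>t>0. (f has_real_derivative 1 / sqrt (1 + 2 * (f t)\<^sup>2)) (at t))"

definition dual_f :: "real \<Rightarrow> real" where
  "dual_f = (THE f. is_dual_f f)"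

text \<open>The definite description is meaningful: \<open>f\<close> is the inverse of the following primitive of
  \<open>sqrt (1 + 2 s^2)\<close>.\<close>

definition dual_g :: "real \<Rightarrow> real" where
  "dual_g s = s * sqrt (1 + 2 * s\<^sup>2) / 2 + arsinh (sqrt 2 * s) / (2 * sqrt 2)"

lemma dual_g_deriv: "(dual_g has_real_derivative sqrt (1 + 2 * s\<^sup>2)) (at s)"
proof -
  have pos: "1 + 2 * s\<^sup>2 > 0" by (simp add: add_pos_nonneg)
  define r where "r = sqrt (1 + 2 * s\<^sup>2)"
  have r: "r > 0" "r * r = 1 + 2 * s\<^sup>2" using pos by (auto simp: r_def)
  have c: "sqrt ((sqrt 2 * s)\<^sup>2 + 1) = r" by (simp add: r_def power_mult_distrib add.commute)
  have d1: "((\<lambda>s. sqrt (1 + 2 * s\<^sup>2)) has_real_derivative inverse r / 2 * (4 * s)) (at s)"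
    unfolding r_def
    by (rule DERIV_chain2[where f = sqrt and g = "\<lambda>s. 1 + 2 * s\<^sup>2", OF DERIV_real_sqrt[OF pos]]) (auto intro!: derivative_eq_intros)
  have d2: "((\<lambda>s. arsinh (sqrt 2 * s)) has_real_derivative 1 / r * sqrt 2) (at s)"
    unfolding c[symmetric]
    by (rule DERIV_chain2[where f = arsinh and g = "\<lambda>s. sqrt 2 * s", OF arsinh_real_has_field_derivative]) (auto intro!: derivative_eq_intros)
  have "(dual_g has_real_derivative
      (1 * r + inverse r / 2 * (4 * s) * s) / 2 + (1 / r * sqrt 2) / (2 * sqrt 2)) (at s)"
    unfolding dual_g_def [abs_def]
    by (intro DERIV_add DERIV_cdivide)
       (use DERIV_mult[OF DERIV_ident d1] d2 in \<open>auto simp: r_def\<close>)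
  moreover have "(1 * r + inverse r / 2 * (4 * s) * s) / 2 + (1 / r * sqrt 2) / (2 * sqrt 2) = r"
    using r by (simp add: field_simps power2_eq_square)
  ultimately show ?thesis by (simp add: r_def)
qed

lemma dual_g_minus: "dual_g (- s) = - dual_g s"
  by (simp add: dual_g_def)

lemma dual_g_0: "dual_g 0 = 0"
  by (simp add: dual_g_def)

lemma isCont_dual_g: "isCont dual_g s"
  using dual_g_deriv DERIV_isCont by blast

lemma dual_g_strict_mono: "s < t \<Longrightarrow> dual_g s < dual_g t"
  by (rule DERIV_pos_imp_increasing) (use dual_g_deriv in \<open>force simp: add_pos_nonneg\<close>)+

lemma inj_dual_g: "inj dual_g"
  by (rule injI) (metis dual_g_strict_mono linorder_neqE less_irrefl)

lemma surj_dual_g: "surj dual_g"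
proof -
  have *: "\<exists>s. dual_g s = y" if "y \<ge> 0" for y
  proof -
    have "y * 1 \<le> y * sqrt (1 + 2 * (2 * y)\<^sup>2)"
      using that by (intro mult_left_mono) auto
    moreover have "arsinh (sqrt 2 * (2 * y)) \<ge> 0"
      using that by (cases "y = 0") (auto intro!: less_imp_le)
    ultimately have "y \<le> dual_g (2 * y)"
      by (simp add: dual_g_def add_increasing2)
    then show ?thesis
      using IVT[of dual_g 0 y "2 * y"] that by (auto simp: dual_g_0 isCont_dual_g)
  qed
  have "\<exists>s. dual_g s = y" for y
  proof (cases "y \<ge> 0")
    case False
    then obtain s where "dual_g s = - y" using *[of "- y"] by auto
    then show ?thesis using dual_g_minus[of s] by auto
  qed (use * in auto)
  then show ?thesis by (metis surj_def)
qed

lemma is_dual_f_inv: "is_dual_f (inv dual_g)"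
proof -
  let ?f = "inv dual_g"
  have gf: "dual_g (?f t) = t" for t by (simp add: surj_dual_g surj_f_inv_f)
  have fg: "?f (dual_g s) = s" for s by (simp add: inj_dual_g inv_f_f)
  have cont: "isCont ?f t" for t
    using isCont_inverse_function[of 1 "?f t" ?f dual_g] by (simp add: fg gf isCont_dual_g)
  have der: "(?f has_real_derivative inverse (sqrt (1 + 2 * (?f t)\<^sup>2))) (at t)" for t
    by (rule DERIV_inverse_function[where a = "t - 1" and b = "t + 1" and f = dual_g])
       (auto simp: dual_g_deriv gf cont sum_power2_eq_zero_iff add_pos_nonneg less_imp_neq[symmetric])
  show ?thesis
    unfolding is_dual_f_def
  proof (intro conjI allI impI)
    show "?f (- t) = - ?f t" for t by (metis dual_g_minus fg gf)
    show "?f 0 = 0" by (metis dual_g_0 fg)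
  qed (use cont der in \<open>auto simp: divide_inverse\<close>)
qed

lemma is_dual_f_unique:
  assumes f: "is_dual_f f"
  shows "f = inv dual_g"
proof
  fix t
  have odd: "f (- t) = - f t" and f0: "f 0 = 0" and c0: "isCont f 0"
    and der: "\<And>t. t > 0 \<Longrightarrow> (f has_real_derivative 1 / sqrt (1 + 2 * (f t)\<^sup>2)) (at t)" for t
    using f by (auto simp: is_dual_f_def)
  have cont: "isCont f t" if "t \<ge> 0" for t
    using that c0 der[of t] DERIV_isCont by (cases "t = 0") auto
  have *: "dual_g (f t) = t" if "t > 0" for t
  proof -
    let ?h = "\<lambda>t. dual_g (f t) - t"
    have "?h t = ?h 0"
    proof (rule DERIV_isconst_end[OF that])
      have "isCont ?h x" if "x \<ge> 0" for x
        using isCont_o2[OF cont[OF that] isCont_dual_g] by (intro continuous_intros) auto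
      then show "continuous_on {0..t} ?h"
        by (intro continuous_at_imp_continuous_on) auto
    next
      fix x :: real assume x: "0 < x" "x < t"
      have p: "sqrt (1 + 2 * (f x)\<^sup>2) \<noteq> 0"
        by (smt (verit) real_sqrt_eq_zero_cancel_iff zero_le_power2)
      have "(?h has_real_derivative
          sqrt (1 + 2 * (f x)\<^sup>2) * (1 / sqrt (1 + 2 * (f x)\<^sup>2)) - 1) (at x)"
        by (intro derivative_intros DERIV_chain2[OF dual_g_deriv der[OF x(1)]])
      then show "(?h has_real_derivative 0) (at x)" using p by simp
    qed
    then show ?thesis by (simp add: f0 dual_g_0)
  qed
  have "dual_g (f t) = t"
  proof (cases "t > 0 \<or> t = 0")
    case False
    then have "dual_g (f (- t)) = - t" by (intro *) auto
    then show ?thesis by (simp add: odd dual_g_minus)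
  qed (use * in \<open>auto simp: f0 dual_g_0\<close>)
  then show "f t = inv dual_g t" by (metis inj_dual_g inv_f_f)
qed

lemma dual_f_eq: "dual_f = inv dual_g"
  unfolding dual_f_def by (rule the_equality) (auto simp: is_dual_f_inv is_dual_f_unique)

lemma is_dual_f_dual_f: "is_dual_f dual_f"
  by (simp add: dual_f_eq is_dual_f_inv)

lemma bij_dual_f: "bij dual_f"
  unfolding dual_f_eq using inj_dual_g surj_dual_g by (intro bij_imp_bij_inv bijI)


section \<open>Sobolev spaces\<close>

text \<open>
  Elements of the function spaces are represented by functions; two functions represent the same
  element iff they agree almost everywhere.
\<close>

primrec Ck_fun :: "nat \<Rightarrow> ('a::euclidean_space \<Rightarrow> real) \<Rightarrow> bool" where
  "Ck_fun 0 \<phi> \<longleftrightarrow> continuous_on UNIV \<phi>"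
| "Ck_fun (Suc k) \<phi> \<longleftrightarrow>
     (\<forall>x. \<phi> differentiable (at x)) \<and>
     (\<forall>e\<in>Basis. Ck_fun k (\<lambda>x. frechet_derivative \<phi> (at x) e))"

definition test_function :: "('a::euclidean_space \<Rightarrow> real) \<Rightarrow> bool" where
  "test_function \<phi> \<longleftrightarrow> (\<forall>k. Ck_fun k \<phi>) \<and> compact (closure {x. \<phi> x \<noteq> 0})"

definition locally_integrable ::
    "('a::euclidean_space \<Rightarrow> 'b::euclidean_space) \<Rightarrow> bool" where
  "locally_integrable u \<longleftrightarrow> (\<forall>K. compact K \<longrightarrow> set_integrable lborel K u)"

definition is_weak_gradient :: "('a::euclidean_space \<Rightarrow> real) \<Rightarrow> ('a \<Rightarrow> 'a) \<Rightarrow> bool" where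
  "is_weak_gradient u g \<longleftrightarrow>
     locally_integrable u \<and> locally_integrable g \<and>
     (\<forall>\<phi>. test_function \<phi> \<longrightarrow>
       (\<forall>e\<in>Basis. (\<integral>x. u x * frechet_derivative \<phi> (at x) e \<partial>lborel)
                  = - (\<integral>x. (g x \<bullet> e) * \<phi> x \<partial>lborel)))"

text \<open>A weak gradient is unique up to a null set, so the choice below is immaterial.\<close>

definition weak_gradient :: "('a::euclidean_space \<Rightarrow> real) \<Rightarrow> 'a \<Rightarrow> 'a" where
  "weak_gradient u = (SOME g. is_weak_gradient u g)"

definition L2_fun :: "('a::euclidean_space \<Rightarrow> 'b::euclidean_space) \<Rightarrow> bool" where
  "L2_fun u \<longleftrightarrow> u \<in> borel_measurable lborel \<and> integrable lborel (\<lambda>x. (norm (u x))\<^sup>2)"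

definition H1 :: "('a::euclidean_space \<Rightarrow> real) set" where
  "H1 = {u. L2_fun u \<and> (\<exists>g. is_weak_gradient u g \<and> L2_fun g)}"

text \<open>
  The potential \<open>V\<close> is a parameter of the definitions below; they are used with
  \<open>V x = (norm x)^2\<close>.
\<close>

definition H_space :: "('a::euclidean_space \<Rightarrow> real) \<Rightarrow> ('a \<Rightarrow> real) set" where
  "H_space V = {u \<in> H1. integrable lborel (\<lambda>x. V x * (u x)\<^sup>2)}"

definition H_norm :: "('a::euclidean_space \<Rightarrow> real) \<Rightarrow> ('a \<Rightarrow> real) \<Rightarrow> real" where
  "H_norm V u = sqrt (\<integral>x. ((norm (weak_gradient u x))\<^sup>2 + V x * (u x)\<^sup>2) \<partial>lborel)"

definition first_eigenvalue :: "('a::euclidean_space \<Rightarrow> real) \<Rightarrow> real" where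
  "first_eigenvalue V =
     Inf {(\<integral>x. ((norm (weak_gradient v x))\<^sup>2 + V x * (v x)\<^sup>2) \<partial>lborel)
            / (\<integral>x. (v x)\<^sup>2 \<partial>lborel) | v.
          v \<in> H_space V \<and> \<not> (AE x in lborel. v x = 0)}"


section \<open>The functional, critical points and solutions\<close>

definition energy :: "('a::euclidean_space \<Rightarrow> real) \<Rightarrow> real \<Rightarrow> ('a \<Rightarrow> real) \<Rightarrow> real" where
  "energy V \<omega> v =
     1/2 * (\<integral>x. (norm (weak_gradient v x))\<^sup>2 \<partial>lborel)
     + 1/2 * (\<integral>x. (V x - \<omega>) * (dual_f (v x))\<^sup>2 \<partial>lborel)
     + 1/4 * (\<integral>x. (dual_f (v x)) ^ 4 \<partial>lborel)"

text \<open>The Frechet derivative of \<open>J\<close> at \<open>v\<close>, with respect to the norm of \<open>H\<close>, exists and is the zero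
  functional.\<close>

definition critical_point ::
    "('a::euclidean_space \<Rightarrow> real) \<Rightarrow> (('a \<Rightarrow> real) \<Rightarrow> real) \<Rightarrow> ('a \<Rightarrow> real) \<Rightarrow> bool" where
  "critical_point V J v \<longleftrightarrow>
     v \<in> H_space V \<and>
     (\<forall>\<epsilon>>0. \<exists>\<delta>>0. \<forall>h\<in>H_space V. H_norm V h < \<delta> \<longrightarrow>
        \<bar>J (\<lambda>x. v x + h x) - J v\<bar> \<le> \<epsilon> * H_norm V h)"

text \<open>A solution \<open>u\<close> of the quasilinear equation is \<open>f(v)\<close> for a critical point \<open>v\<close>.\<close>

definition solution :: "('a::euclidean_space \<Rightarrow> real) \<Rightarrow> real \<Rightarrow> ('a \<Rightarrow> real) \<Rightarrow> bool" where
  "solution V \<omega> u \<longleftrightarrow> critical_point V (energy V \<omega>) (\<lambda>x. inv dual_f (u x))"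

definition positive_fun :: "('a::euclidean_space \<Rightarrow> real) \<Rightarrow> bool" where
  "positive_fun u \<longleftrightarrow> (AE x in lborel. u x > 0)"

end

theory Submission
  imports Defs
begin

text \<open>
  Uniqueness is hidden convexity: in terms of \<open>\<rho> = u\<^sup>2\<close> the energy is strictly convex, because the
  quasilinear term becomes \<open>|\<nabla>\<rho>|\<^sup>2 / 4\<close>, \<open>|\<nabla>u|\<^sup>2\<close> is convex in \<open>\<rho>\<close>, the potential term is linear and
  \<open>u\<^sup>4\<close> is quadratic. Infinitesimally this is the Brezis-Oswald argument: testing the equations of
  \<open>u\<^sub>1\<close> and \<open>u\<^sub>2\<close> with \<open>(u\<^sub>1\<^sup>2 - u\<^sub>2\<^sup>2) / u\<^sub>1\<close> and \<open>(u\<^sub>2\<^sup>2 - u\<^sub>1\<^sup>2) / u\<^sub>2\<close> and Picone's inequality leave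
  \<open>\<integral> (u\<^sub>1\<^sup>2 - u\<^sub>2\<^sup>2)\<^sup>2 \<le> 0\<close>. Testing the equation of \<open>v\<close> with \<open>u \<cdot> sqrt (1 + 2 u\<^sup>2)\<close>
  gives \<open>\<integral> |\<nabla>u|\<^sup>2 + |x|\<^sup>2 u\<^sup>2 < \<omega> \<integral> u\<^sup>2\<close>, hence \<open>\<omega> > \<lambda>\<close>.

  For \<open>\<omega> > \<lambda>\<close> the energy takes negative values. Reflection and truncation reduce the minimization to
  bounded nonnegative functions, and the uniform convexity in \<open>\<rho>\<close> makes \<open>\<rho>\<close> of a minimizing sequence
  Cauchy in \<open>L\<^sup>2\<close>, so no compact embedding is needed. A minimizer \<open>v\<close> cannot vanish on a set of positive
  measure unless it vanishes everywhere: the test functions \<open>\<phi>\<^sup>2 / (v + \<delta>)\<close> bound the gradient of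
  \<open>ln (1 + v / \<delta>)\<close> in \<open>L\<^sup>2\<^sub>l\<^sub>o\<^sub>c\<close> uniformly in \<open>\<delta>\<close>, whereas this function blows up as \<open>\<delta> \<rightarrow> 0\<close> on the set
  \<open>v > 0\<close> and vanishes on the translate of a part of it.
\<close>

section \<open>Translations and limits of integrals\<close>

text \<open>All regularity comes from one identity: for almost every x, u(x + y) - u(x) is the
  average of g . y over the segment from x to x + y, where g is the weak gradient. It yields the
  difference-quotient estimates, the chain rule, the bound of the L^2 norm by the form, and the
  comparison of a function with its translate that takes the place of a strong maximum principle.
  The chain rule covers outer functions that are differentiable with bounded derivative on a convex
  set of values. This shapes the rest: positive part, absolute value, square root and division are
  replaced by smooth families with a parameter tending to 0, and each limit needs either a majorant
  independent of the parameter or an inequality valid for every parameter. A positive u has no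
  positive lower bound on the whole space, which is why the Brezis-Oswald quotients carry a
  regularisation. An upper bound does exist, and it has to precede uniqueness: it makes the
  gradients of those quotients, and the return from u to v, bounded operations.\<close>

lemma lborel_translate:
  fixes f :: "'a::euclidean_space \<Rightarrow> 'b::{banach, second_countable_topology}"
  assumes "integrable lborel f"
  shows integrable_translate: "integrable lborel (\<lambda>x. f (x + a))"
    and integral_translate: "(\<integral>x. f (x + a) \<partial>lborel) = (\<integral>x. f x \<partial>lborel)"
proof -
  have m: "f \<in> borel_measurable borel" using assms by auto
  show "integrable lborel (\<lambda>x. f (x + a))"
    using integrable_distr_eq[of "(+) a" lborel borel f] m assms
    by (simp add: lborel_distr_plus add.commute)
  show "(\<integral>x. f (x + a) \<partial>lborel) = (\<integral>x. f x \<partial>lborel)"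
    using integral_distr[of "(+) a" lborel borel f] m
    by (simp add: lborel_distr_plus add.commute)
qed

lemma AE_translate:
  fixes a :: "'a::euclidean_space"
  assumes "AE x in lborel. P x"
  shows "AE x in lborel. P (x + a)"
proof -
  have "AE x in distr lborel borel ((+) a). P x"
    unfolding lborel_distr_plus by (rule assms)
  from AE_distrD[OF _ this] show ?thesis by (simp add: add.commute)
qed

section \<open>Continuity of translations in L^1\<close>

lemma L1_translate_triangle:
  fixes f g :: "'a::euclidean_space \<Rightarrow> 'b::{banach, second_countable_topology}"
  assumes f: "integrable lborel f" and g: "integrable lborel g"
  shows "(\<integral>x. norm (f (x + h) - f x) \<partial>lborel)
    \<le> (\<integral>x. norm (g (x + h) - g x) \<partial>lborel) + 2 * (\<integral>x. norm (f x - g x) \<partial>lborel)"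
proof -
  have i: "integrable lborel (\<lambda>x. norm (f x - g x))" using f g by auto
  note i' = integrable_translate[OF i, of h]
  have "(\<integral>x. norm (f (x + h) - f x) \<partial>lborel)
      \<le> (\<integral>x. norm (g (x + h) - g x) + norm (f (x + h) - g (x + h)) + norm (f x - g x) \<partial>lborel)"
  proof (intro integral_mono)
    fix x
    have "f (x + h) - f x = (g (x + h) - g x) + (f (x + h) - g (x + h)) - (f x - g x)" by simp
    then show "norm (f (x + h) - f x) \<le> norm (g (x + h) - g x) + norm (f (x + h) - g (x + h)) + norm (f x - g x)"
      using norm_triangle_ineq4[of "(g (x + h) - g x) + (f (x + h) - g (x + h))" "f x - g x"]
        norm_triangle_ineq[of "g (x + h) - g x" "f (x + h) - g (x + h)"] by simp
  qed (use f g integrable_translate[OF f, of h] integrable_translate[OF g, of h] in auto)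
  also have "\<dots> = (\<integral>x. norm (g (x + h) - g x) \<partial>lborel) + 2 * (\<integral>x. norm (f x - g x) \<partial>lborel)"
    using f g integrable_translate[OF f] integrable_translate[OF g] integral_translate[OF i, of h] by simp
  finally show ?thesis .
qed

text \<open>The integrable functions with continuous translations form a closed class. The distance
  to the approximant is counted twice, translated and untranslated, so \<open>e / 4\<close> for it
  and \<open>e / 2\<close> for the translations of \<open>g\<close> suffice.\<close>

lemma L1_translate_approx:
  fixes f :: "'a::euclidean_space \<Rightarrow> 'b::{banach, second_countable_topology}"
  assumes f: "integrable lborel f" and h: "h \<longlonglongrightarrow> 0"
    and approx: "\<And>e. e > 0 \<Longrightarrow> \<exists>g. integrable lborel g \<and> (\<integral>x. norm (f x - g x) \<partial>lborel) < e
      \<and> (\<lambda>n. \<integral>x. norm (g (x + h n) - g x) \<partial>lborel) \<longlonglongrightarrow> 0"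
  shows "(\<lambda>n. \<integral>x. norm (f (x + h n) - f x) \<partial>lborel) \<longlonglongrightarrow> 0"
proof (rule LIMSEQ_I)
  fix e :: real assume e: "e > 0"
  then obtain g where g: "integrable lborel g" "(\<integral>x. norm (f x - g x) \<partial>lborel) < e / 4"
    and lim: "(\<lambda>n. \<integral>x. norm (g (x + h n) - g x) \<partial>lborel) \<longlonglongrightarrow> 0"
    using approx[of "e / 4"] by auto
  obtain N where N: "\<And>n. n \<ge> N \<Longrightarrow> norm ((\<integral>x. norm (g (x + h n) - g x) \<partial>lborel) - 0) < e / 2"
    using LIMSEQ_D[OF lim, of "e / 2"] e by auto
  show "\<exists>N. \<forall>n\<ge>N. norm ((\<integral>x. norm (f (x + h n) - f x) \<partial>lborel) - 0) < e"
  proof (intro exI allI impI)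
    fix n assume "n \<ge> N"
    then show "norm ((\<integral>x. norm (f (x + h n) - f x) \<partial>lborel) - 0) < e"
      using N[of n] L1_translate_triangle[OF f g(1), of "h n"] g(2) by simp
  qed
qed

text \<open>A point of the open set stays in it under small shifts, and multiplication by the
  indicator of \<open>U\<close> discards all other points; so the integrals of the products tend to
  the measure of \<open>U\<close>. Expanding the absolute difference, translation invariance leaves
  twice that measure minus twice these integrals.\<close>

lemma L1_translate_open:
  fixes U :: "'a::euclidean_space set"
  assumes U: "open U" "emeasure lborel U < \<infinity>" and h: "h \<longlonglongrightarrow> 0"
  shows "(\<lambda>n. \<integral>x. norm (indicat_real U (x + h n) - indicat_real U x) \<partial>lborel) \<longlonglongrightarrow> 0"
proof -
  have i: "integrable lborel (indicat_real U)" using U by auto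
  have [measurable]: "U \<in> sets borel" using U by simp
  have i2: "integrable lborel (\<lambda>x. indicat_real U (x + h n) * indicat_real U x)" for n
    by (rule Bochner_Integration.integrable_bound[OF i]) (measurable, auto simp: indicator_def)
  have lim: "(\<lambda>n. \<integral>x. indicat_real U (x + h n) * indicat_real U x \<partial>lborel) \<longlonglongrightarrow> (\<integral>x. indicat_real U x \<partial>lborel)"
  proof (rule integral_dominated_convergence[where w = "indicat_real U"])
    have "(\<lambda>n. indicat_real U (x + h n) * indicat_real U x) \<longlonglongrightarrow> indicat_real U x" for x
    proof (cases "x \<in> U")
      case True
      have "(\<lambda>n. x + h n) \<longlonglongrightarrow> x" using tendsto_add[OF tendsto_const h, of x] by simp
      then have "\<forall>\<^sub>F n in sequentially. x + h n \<in> U" using U(1) True by (rule topological_tendstoD)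
      then have "\<forall>\<^sub>F n in sequentially. indicat_real U (x + h n) * indicat_real U x = 1"
        by eventually_elim (use True in auto)
      then show ?thesis using True by (simp add: tendsto_eventually)
    qed auto
    then show "AE x in lborel. (\<lambda>n. indicat_real U (x + h n) * indicat_real U x) \<longlonglongrightarrow> indicat_real U x" by simp
  qed (use i i2 in \<open>auto simp: indicator_def\<close>)
  have eq: "norm (indicat_real U (x + y) - indicat_real U x) = indicat_real U (x + y) + indicat_real U x
      - 2 * (indicat_real U (x + y) * indicat_real U x)" for x y
    by (auto simp: indicator_def)
  have "(\<integral>x. norm (indicat_real U (x + h n) - indicat_real U x) \<partial>lborel)
      = 2 * (\<integral>x. indicat_real U x \<partial>lborel) - 2 * (\<integral>x. indicat_real U (x + h n) * indicat_real U x \<partial>lborel)" for n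
    unfolding eq using i i2[of n] integrable_translate[OF i, of "h n"] integral_translate[OF i, of "h n"]
    by (subst Bochner_Integration.integral_diff) (auto simp del: integral_indicator)
  then show ?thesis
    using tendsto_diff[OF tendsto_const tendsto_mult[OF tendsto_const lim], of "2 * (\<integral>x. indicat_real U x \<partial>lborel)" 2] by simp
qed

text \<open>Induction over integrable functions. Outer regularity reduces a set of finite measure to
  an open one of finite measure, where shifting can be followed pointwise.\<close>

lemma L1_translate_seq:
  fixes f :: "'a::euclidean_space \<Rightarrow> 'b::{banach, second_countable_topology}"
  assumes f: "integrable lborel f" and h: "h \<longlonglongrightarrow> 0"
  shows "(\<lambda>n. \<integral>x. norm (f (x + h n) - f x) \<partial>lborel) \<longlonglongrightarrow> 0"
  using f
proof (induction rule: integrable_induct)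
  case (base A c)
  have A: "integrable lborel (indicat_real A)" using base by auto
  have "(\<lambda>n. \<integral>x. norm (indicat_real A (x + h n) - indicat_real A x) \<partial>lborel) \<longlonglongrightarrow> 0"
  proof (rule L1_translate_approx[OF A h])
    fix e :: real assume e: "e > 0"
    then obtain U where U: "open U" "A \<subseteq> U" "emeasure lborel (U - A) < e"
      using outer_regular_lborel[of A e] base by auto
    have "emeasure lborel U \<le> emeasure lborel A + emeasure lborel (U - A)"
      using base U by (metis Un_Diff_cancel Un_absorb1 borel_open emeasure_subadditive sets.Diff sets_lborel)
    also have "\<dots> < \<infinity>" using U(3) base by (simp add: less_top[symmetric]) (metis ennreal_less_top order.strict_trans not_le top.not_eq_extremum)
    finally have fin: "emeasure lborel U < \<infinity>" .
    have "(\<integral>x. norm (indicat_real A x - indicat_real U x) \<partial>lborel) = (\<integral>x. indicat_real (U - A) x \<partial>lborel)"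
      using U(2) by (intro Bochner_Integration.integral_cong) (auto simp: indicator_def)
    also have "\<dots> = measure lborel (U - A)" by simp
    also have "\<dots> < e" using U(3) e
      by (metis Sigma_Algebra.measure_def enn2real_less_iff ennreal_less_top less_le order.strict_trans)
    finally show "\<exists>g. integrable lborel g \<and> (\<integral>x. norm (indicat_real A x - g x) \<partial>lborel) < e
      \<and> (\<lambda>n. \<integral>x. norm (g (x + h n) - g x) \<partial>lborel) \<longlonglongrightarrow> 0"
      using U fin L1_translate_open[OF U(1) fin h] by (intro exI[of _ "indicat_real U"]) auto
  qed
  from tendsto_mult_right[OF this, of "norm c"]
  show ?case using A integrable_translate[OF A] by (simp flip: scaleR_diff_left)
next
  case (add f g)
  show ?case
  proof (rule tendsto_sandwich[OF _ _ tendsto_const])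
    show "(\<lambda>n. (\<integral>x. norm (f (x + h n) - f x) \<partial>lborel) + (\<integral>x. norm (g (x + h n) - g x) \<partial>lborel)) \<longlonglongrightarrow> 0"
      using tendsto_add[OF add.IH] by simp
    show "\<forall>\<^sub>F n in sequentially. (\<integral>x. norm (f (x + h n) + g (x + h n) - (f x + g x)) \<partial>lborel)
        \<le> (\<integral>x. norm (f (x + h n) - f x) \<partial>lborel) + (\<integral>x. norm (g (x + h n) - g x) \<partial>lborel)"
    proof (intro always_eventually allI)
      fix n
      note t = integrable_translate[OF add.hyps(1), of "h n"] integrable_translate[OF add.hyps(2), of "h n"]
      have "(\<integral>x. norm (f (x + h n) + g (x + h n) - (f x + g x)) \<partial>lborel)
          \<le> (\<integral>x. norm (f (x + h n) - f x) + norm (g (x + h n) - g x) \<partial>lborel)"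
        using add.hyps t by (intro integral_mono) (auto simp: norm_diff_triangle_ineq)
      also have "\<dots> = (\<integral>x. norm (f (x + h n) - f x) \<partial>lborel) + (\<integral>x. norm (g (x + h n) - g x) \<partial>lborel)"
        using add.hyps t by simp
      finally show "(\<integral>x. norm (f (x + h n) + g (x + h n) - (f x + g x)) \<partial>lborel)
        \<le> (\<integral>x. norm (f (x + h n) - f x) \<partial>lborel) + (\<integral>x. norm (g (x + h n) - g x) \<partial>lborel)" .
    qed
  qed auto
next
  case (lim f s)
  show ?case
  proof (rule L1_translate_approx[OF lim.hyps(4) h])
    fix e :: real assume e: "e > 0"
    \<comment> \<open>The approximants satisfy \<open>norm (s i x) \<le> 2 * norm (f x)\<close>,
      whence the majorant with factor 3.\<close>
    have "(\<lambda>i. \<integral>x. norm (f x - s i x) \<partial>lborel) \<longlonglongrightarrow> integral\<^sup>L lborel (\<lambda>x::'a. 0::real)"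
    proof (rule integral_dominated_convergence[where w = "\<lambda>x. 3 * norm (f x)"])
      show "AE x in lborel. (\<lambda>i. norm (f x - s i x)) \<longlonglongrightarrow> 0"
      proof (intro AE_I2)
        fix x show "(\<lambda>i. norm (f x - s i x)) \<longlonglongrightarrow> 0"
          using tendsto_norm[OF tendsto_diff[OF tendsto_const lim.hyps(2)[of x]], of "f x"] by simp
      qed
      show "AE x in lborel. norm (norm (f x - s i x)) \<le> 3 * norm (f x)" for i
      proof (intro AE_I2)
        fix x show "norm (norm (f x - s i x)) \<le> 3 * norm (f x)"
          using lim.hyps(3)[of x i] norm_triangle_ineq4[of "f x" "s i x"] by simp
      qed
    qed (use lim.hyps in auto)
    from LIMSEQ_D[OF this e] obtain i where "norm ((\<integral>x. norm (f x - s i x) \<partial>lborel) - 0) < e"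
      by auto
    then show "\<exists>g. integrable lborel g \<and> (\<integral>x. norm (f x - g x) \<partial>lborel) < e
      \<and> (\<lambda>n. \<integral>x. norm (g (x + h n) - g x) \<partial>lborel) \<longlonglongrightarrow> 0"
      using lim.hyps(1) lim.IH by (intro exI[of _ "s i"]) auto
  qed
qed

lemma L1_translate_continuous:
  fixes f :: "'a::euclidean_space \<Rightarrow> 'b::{banach, second_countable_topology}"
  assumes f: "integrable lborel f" and e: "e > 0"
  obtains d where "d > 0" "\<And>h. norm h < d \<Longrightarrow> (\<integral>x. norm (f (x + h) - f x) \<partial>lborel) < e"
proof -
  have "isCont (\<lambda>h. \<integral>x. norm (f (x + h) - f x) \<partial>lborel) 0"
    unfolding continuous_at_sequentially comp_def using L1_translate_seq[OF f] by simp
  then obtain d where "d > 0" "\<And>h. dist h 0 < d \<Longrightarrow> dist (\<integral>x. norm (f (x + h) - f x) \<partial>lborel) (\<integral>x. norm (f (x + 0) - f x) \<partial>lborel) < e"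
    using e unfolding continuous_at_eps_delta by metis
  then show ?thesis by (intro that[of d]) (auto simp: dist_norm)
qed

text \<open>Lebesgue differentiation: almost every value of \<open>g\<close> is the limit of its
  averages over shrinking cubes, and all of these vanish. Faces of boxes are null sets, so open and
  closed boxes may be exchanged.\<close>

lemma AE_zero_box_integrals:
  fixes g :: "'a::euclidean_space \<Rightarrow> real"
  assumes int: "\<And>a b. set_integrable lborel (cbox a b) g"
    and zero: "\<And>a b. (\<integral>x. indicator (box a b) x * g x \<partial>lborel) = 0"
  shows "AE x in lborel. g x = 0"
proof -
  have on: "(g has_integral 0) (cbox a b)" for a b
  proof -
    have "AE x in lborel. x \<notin> frontier (cbox a b)"
      by (rule AE_not_in) (use negligible_frontier_interval[of a b] in
        \<open>simp add: negligible_iff_null_sets null_sets_completion_iff frontier_cbox\<close>)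
    then have "AE x in lborel. indicator (cbox a b) x * g x = indicator (box a b) x * g x"
      by eventually_elim (use box_subset_cbox[of a b] in \<open>auto simp: indicator_def frontier_cbox\<close>)
    moreover have m: "(\<lambda>x. indicator (cbox a b) x * g x) \<in> borel_measurable lborel"
      using int[of a b] unfolding set_integrable_def by auto
    moreover have "(\<lambda>x. indicator (box a b) x * (indicator (cbox a b) x * g x)) \<in> borel_measurable lborel"
      using m by measurable
    moreover have "indicator (box a b) x * (indicator (cbox a b) x * g x) = indicator (box a b) x * g x" for x
      using box_subset_cbox[of a b] by (auto simp: indicator_def)
    ultimately have "(\<integral>x. indicator (cbox a b) x * g x \<partial>lborel) = 0"
      using zero[of a b] by (subst integral_cong_AE[where g = "\<lambda>x. indicator (box a b) x * g x"]) auto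
    then show ?thesis
      using set_borel_integral_eq_integral[OF int[of a b]]
      by (simp add: set_lebesgue_integral_def has_integral_iff)
  qed
  obtain N where N: "negligible N" "\<And>x e. \<lbrakk>x \<notin> N; 0 < e\<rbrakk> \<Longrightarrow>
      \<exists>d>0. \<forall>h. 0 < h \<and> h < d \<longrightarrow> norm (integral (cbox x (x + h *\<^sub>R One)) g /\<^sub>R h ^ DIM('a) - g x) < e"
    using integrable_ccontinuous_explicit[of g] on by blast
  have "g x = 0" if "x \<notin> N" for x
  proof (rule ccontr)
    assume "g x \<noteq> 0"
    then obtain d where "d > 0" "\<And>h. 0 < h \<and> h < d \<Longrightarrow> norm (integral (cbox x (x + h *\<^sub>R One)) g /\<^sub>R h ^ DIM('a) - g x) < \<bar>g x\<bar>"
      using N(2)[OF \<open>x \<notin> N\<close>, of "\<bar>g x\<bar>"] by auto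
    from this(2)[of "d / 2"] \<open>d > 0\<close> show False using on by (simp add: integral_unique[OF on])
  qed
  then have "AE x in lebesgue. g x = 0"
    using N(1) by (intro AE_I'[of N]) (auto simp: negligible_iff_null_sets)
  then show ?thesis by (simp add: AE_completion_iff)
qed

section \<open>Limit theorems for real integrals\<close>

lemma Fatou_real:
  fixes f :: "nat \<Rightarrow> 'a \<Rightarrow> real"
  assumes int: "\<And>n. integrable M (f n)" and nn: "\<And>n. AE x in M. f n x \<ge> 0"
    and lim: "AE x in M. (\<lambda>n. f n x) \<longlonglongrightarrow> g x" and g: "g \<in> borel_measurable M"
    and bound: "\<And>n. (\<integral>x. f n x \<partial>M) \<le> C"
  shows "integrable M g" "(\<integral>x. g x \<partial>M) \<le> C"
proof -
  have nn': "AE x in M. \<forall>n. f n x \<ge> 0" using nn by (simp add: AE_all_countable)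
  have gnn: "AE x in M. g x \<ge> 0"
    using lim nn' by eventually_elim (auto intro: LIMSEQ_le_const)
  have C: "C \<ge> 0" using bound[of 0] integral_nonneg_AE[OF nn[of 0]] by simp
  have "(\<integral>\<^sup>+x. ennreal (g x) \<partial>M) = (\<integral>\<^sup>+x. liminf (\<lambda>n. ennreal (f n x)) \<partial>M)"
    using lim by (intro nn_integral_cong_AE, eventually_elim) (auto intro!: lim_imp_Liminf[symmetric] tendsto_ennrealI)
  also have "\<dots> \<le> liminf (\<lambda>n. \<integral>\<^sup>+x. ennreal (f n x) \<partial>M)"
    using int by (intro nn_integral_liminf) auto
  also have "\<dots> \<le> ennreal C"
  proof (rule Liminf_le[THEN order_trans])
    show "\<forall>\<^sub>F n in sequentially. (\<integral>\<^sup>+x. ennreal (f n x) \<partial>M) \<le> ennreal C"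
      using bound nn by (intro always_eventually allI) (subst nn_integral_eq_integral[OF int], auto intro: ennreal_leI)
  qed auto
  finally have le: "(\<integral>\<^sup>+x. ennreal (g x) \<partial>M) \<le> ennreal C" .
  show ig: "integrable M g"
    using g gnn le by (intro integrableI_nonneg) (auto intro: order.strict_trans1)
  show "(\<integral>x. g x \<partial>M) \<le> C"
    using le C by (subst (asm) nn_integral_eq_integral[OF ig gnn]) simp
qed

text \<open>Truncating \<open>s n\<close> to \<open>[-w, w]\<close> costs at most
  \<open>norm (wn n - w)\<close> in \<open>L\<^sup>1\<close>.\<close>

lemma integral_dominated_convergence_general:
  fixes s wn :: "nat \<Rightarrow> 'a \<Rightarrow> real"
  assumes s: "\<And>n. s n \<in> borel_measurable M" and f: "f \<in> borel_measurable M"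
    and wn: "\<And>n. integrable M (wn n)" and w: "integrable M w"
    and wlim: "(\<lambda>n. \<integral>x. \<bar>wn n x - w x\<bar> \<partial>M) \<longlonglongrightarrow> 0"
    and lim: "AE x in M. (\<lambda>n. s n x) \<longlonglongrightarrow> f x"
    and wlim': "AE x in M. (\<lambda>n. wn n x) \<longlonglongrightarrow> w x"
    and bound: "\<And>n. AE x in M. \<bar>s n x\<bar> \<le> wn n x"
  shows "integrable M f" "(\<lambda>n. \<integral>x. s n x \<partial>M) \<longlonglongrightarrow> (\<integral>x. f x \<partial>M)"
proof -
  have bound': "AE x in M. \<forall>n. \<bar>s n x\<bar> \<le> wn n x" using bound by (simp add: AE_all_countable)
  have fw: "AE x in M. \<bar>f x\<bar> \<le> w x"
    using lim wlim' bound'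
  proof eventually_elim
    case (elim x)
    then show ?case by (intro LIMSEQ_le[OF tendsto_rabs[OF elim(1)] elim(2)]) auto
  qed
  show fi: "integrable M f"
    using fw by (intro Bochner_Integration.integrable_bound[OF w f]) (auto elim!: eventually_mono)
  have si: "integrable M (s n)" for n
    using bound[of n] by (intro Bochner_Integration.integrable_bound[OF wn[of n] s]) (auto elim!: eventually_mono)
  define c where "c n x = max (- w x) (min (w x) (s n x))" for n x
  have wm: "w \<in> borel_measurable M" using w by auto
  have cm: "c n \<in> borel_measurable M" for n
    unfolding c_def[abs_def] using s[of n] wm by measurable
  have cb: "AE x in M. norm (c n x) \<le> w x" for n
    using fw by eventually_elim (auto simp: c_def abs_le_iff)
  have c: "(\<lambda>n. \<integral>x. c n x \<partial>M) \<longlonglongrightarrow> (\<integral>x. f x \<partial>M)"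
  proof (rule integral_dominated_convergence[OF f cm w _ cb])
    show "AE x in M. (\<lambda>n. c n x) \<longlonglongrightarrow> f x"
      using lim fw
    proof eventually_elim
      case (elim x)
      have "(\<lambda>n. c n x) \<longlonglongrightarrow> max (- w x) (min (w x) (f x))"
        unfolding c_def by (intro tendsto_intros elim(1))
      moreover have "max (- w x) (min (w x) (f x)) = f x" using elim(2) by auto
      ultimately show ?case by simp
    qed
  qed
  have ci: "integrable M (c n)" for n
    by (rule Bochner_Integration.integrable_bound[OF w cm]) (use cb[of n] in \<open>auto elim!: eventually_mono\<close>)
  have "(\<lambda>n. (\<integral>x. s n x \<partial>M) - (\<integral>x. c n x \<partial>M)) \<longlonglongrightarrow> 0"
  proof (rule Lim_null_comparison[OF _ wlim], intro always_eventually allI)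
    fix n
    have "norm ((\<integral>x. s n x \<partial>M) - (\<integral>x. c n x \<partial>M)) = \<bar>\<integral>x. s n x - c n x \<partial>M\<bar>" using si ci by simp
    also have "\<dots> \<le> (\<integral>x. \<bar>s n x - c n x\<bar> \<partial>M)" by (rule integral_abs_bound)
    also have "\<dots> \<le> (\<integral>x. \<bar>wn n x - w x\<bar> \<partial>M)"
      using si[of n] ci[of n] wn[of n] w
    proof (intro integral_mono_AE)
      show "AE x in M. \<bar>s n x - c n x\<bar> \<le> \<bar>wn n x - w x\<bar>"
        using bound[of n] fw by eventually_elim (auto simp: c_def max_def min_def abs_if split: if_splits)
    qed auto
    finally show "norm ((\<integral>x. s n x \<partial>M) - (\<integral>x. c n x \<partial>M)) \<le> (\<integral>x. \<bar>wn n x - w x\<bar> \<partial>M)" .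
  qed
  from tendsto_add[OF this c] show "(\<lambda>n. \<integral>x. s n x \<partial>M) \<longlonglongrightarrow> (\<integral>x. f x \<partial>M)" by simp
qed

lemma integrable_comparison:
  fixes f :: "'a \<Rightarrow> real"
  assumes "integrable M g" "f \<in> borel_measurable M" "\<And>x. \<bar>f x\<bar> \<le> g x"
  shows "integrable M f"
  by (rule Bochner_Integration.integrable_bound[OF assms(1,2)])
    (use assms(3) in \<open>auto intro!: AE_I2 order_trans[OF _ abs_ge_self]\<close>)

section \<open>Square-integrable functions and completeness\<close>

lemma L2_funD:
  assumes "L2_fun u"
  shows L2_fun_measurable: "u \<in> borel_measurable borel"
    and L2_fun_integrable: "integrable lborel (\<lambda>x. (norm (u x))\<^sup>2)"
  using assms by (auto simp: L2_fun_def)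

lemma two_norm_mult_le: "2 * (norm a * norm b) \<le> (norm a)\<^sup>2 + (norm b)\<^sup>2"
  using sum_squares_bound[of "norm a" "norm b"] by simp

lemma L2_fun_inner_integrable:
  assumes u: "L2_fun u" and v: "L2_fun v"
  shows "integrable lborel (\<lambda>x. u x \<bullet> v x)"
proof (rule integrable_comparison)
  show "integrable lborel (\<lambda>x. (norm (u x))\<^sup>2 + (norm (v x))\<^sup>2)"
    using L2_fun_integrable[OF u] L2_fun_integrable[OF v] by auto
  show "(\<lambda>x. u x \<bullet> v x) \<in> borel_measurable lborel"
    using L2_fun_measurable[OF u] L2_fun_measurable[OF v] by auto
  show "\<bar>u x \<bullet> v x\<bar> \<le> (norm (u x))\<^sup>2 + (norm (v x))\<^sup>2" for x
    using Cauchy_Schwarz_ineq2[of "u x" "v x"] two_norm_mult_le[of "u x" "v x"]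
      mult_nonneg_nonneg[OF norm_ge_zero[of "u x"] norm_ge_zero[of "v x"]] by linarith
qed

lemma norm_add_square_le: "(norm (a + b))\<^sup>2 \<le> 2 * (norm a)\<^sup>2 + 2 * (norm (b :: 'a::real_inner))\<^sup>2"
proof -
  have "2 * (norm a)\<^sup>2 + 2 * (norm b)\<^sup>2 - (norm (a + b))\<^sup>2 = (norm (a - b))\<^sup>2"
    by (simp add: power2_norm_eq_inner inner_simps inner_commute)
  then show ?thesis by (metis diff_ge_0_iff_ge zero_le_power2)
qed

lemma L2_fun_bound:
  fixes u :: "'a::euclidean_space \<Rightarrow> 'b::euclidean_space"
  assumes u: "u \<in> borel_measurable borel" and w: "integrable lborel w"
    and b: "AE x in lborel. (norm (u x))\<^sup>2 \<le> w x"
  shows "L2_fun u"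
  unfolding L2_fun_def
  using u b by (auto intro!: Bochner_Integration.integrable_bound[OF w] elim!: eventually_mono)

lemma L2_fun_add:
  assumes u: "L2_fun u" and v: "L2_fun v"
  shows "L2_fun (\<lambda>x. u x + v x)"
proof (rule L2_fun_bound)
  show "integrable lborel (\<lambda>x. 2 * (norm (u x))\<^sup>2 + 2 * (norm (v x))\<^sup>2)"
    using L2_fun_integrable[OF u] L2_fun_integrable[OF v] by auto
qed (use L2_fun_measurable[OF u] L2_fun_measurable[OF v] norm_add_square_le in auto)

lemma L2_fun_scaleR: "L2_fun u \<Longrightarrow> L2_fun (\<lambda>x. c *\<^sub>R u x)"
  by (auto simp: L2_fun_def power_mult_distrib)

lemma L2_fun_diff:
  assumes u: "L2_fun u" and v: "L2_fun v"
  shows "L2_fun (\<lambda>x. u x - v x)"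
  using L2_fun_add[OF u L2_fun_scaleR[OF v, of "-1"]] by simp

text \<open>Riesz-Fischer: a subsequence with summable increments converges almost everywhere, and
  Fatou's lemma turns its limit into the L^2 limit of the full sequence. Both modes of convergence
  are exported, since the minimization needs pointwise limits.\<close>

lemma L2_complete:
  fixes G :: "nat \<Rightarrow> 'a::euclidean_space \<Rightarrow> 'b::euclidean_space"
  assumes G: "\<And>n. L2_fun (G n)"
    and cauchy: "\<And>e. e > 0 \<Longrightarrow> \<exists>N. \<forall>m\<ge>N. \<forall>n\<ge>N. (\<integral>x. (norm (G m x - G n x))\<^sup>2 \<partial>lborel) \<le> e"
  obtains g r where "L2_fun g" "strict_mono r" "AE x in lborel. (\<lambda>n. G (r n) x) \<longlonglongrightarrow> g x"
    "(\<lambda>n. \<integral>x. (norm (G n x - g x))\<^sup>2 \<partial>lborel) \<longlonglongrightarrow> 0"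
proof -
  have Gm[measurable]: "G n \<in> borel_measurable borel" for n using L2_fun_measurable[OF G] .
  have d: "integrable lborel (\<lambda>x. (norm (G m x - G n x))\<^sup>2)" for m n
    using L2_fun_integrable[OF L2_fun_diff[OF G[of m] G[of n]]] .
  obtain N where N: "\<And>e m n. e > 0 \<Longrightarrow> m \<ge> N e \<Longrightarrow> n \<ge> N e \<Longrightarrow> (\<integral>x. (norm (G m x - G n x))\<^sup>2 \<partial>lborel) \<le> e"
    using cauchy by metis
  have "\<exists>r. \<forall>n. True \<and> (r (Suc n) > r n \<and> r (Suc n) \<ge> N ((1/4)^n))"
  proof (intro dependent_nat_choice)
    show "\<exists>y. True \<and> (x < y \<and> N ((1/4)^n) \<le> y)" for x n
      by (intro exI[of _ "max (Suc x) (N ((1/4)^n))"]) auto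
  qed auto
  then obtain r0 where r0: "\<And>n. r0 (Suc n) > r0 n" "\<And>n. r0 (Suc n) \<ge> N ((1/4)^n)" by auto
  define r where "r n = r0 (Suc n)" for n
  have sm: "strict_mono r" unfolding r_def strict_mono_Suc_iff using r0(1) by auto
  have rN: "(\<integral>x. (norm (G (r (Suc n)) x - G (r n) x))\<^sup>2 \<partial>lborel) \<le> (1/4)^n" for n
    using r0(2)[of n] r0(1)[of "Suc n"] by (intro N) (auto simp: r_def)
  let ?D = "\<lambda>n x. (norm (G (r (Suc n)) x - G (r n) x))\<^sup>2"
  have "(\<integral>\<^sup>+x. (\<Sum>n. ennreal (2^n * ?D n x)) \<partial>lborel) = (\<Sum>n. \<integral>\<^sup>+x. ennreal (2^n * ?D n x) \<partial>lborel)"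
    by (intro nn_integral_suminf) measurable
  also have "\<dots> \<le> (\<Sum>n. ennreal ((1/2)^n))"
  proof (rule suminf_le)
    fix n
    have "(2::real)^n * (1/4)^n = (2 * (1/4))^n" by (rule power_mult_distrib[symmetric])
    then have eq: "(2::real)^n * (1/4)^n = (1/2)^n" by simp
    have "(\<integral>\<^sup>+x. ennreal (2^n * ?D n x) \<partial>lborel) = ennreal (\<integral>x. 2^n * ?D n x \<partial>lborel)"
      by (rule nn_integral_eq_integral) (auto simp: d)
    also have "(\<integral>x. 2^n * ?D n x \<partial>lborel) = 2^n * (\<integral>x. ?D n x \<partial>lborel)"
      by (rule integral_mult_right_zero)
    also have "ennreal \<dots> \<le> ennreal ((1/2)^n)"
      unfolding eq[symmetric] by (intro ennreal_leI mult_left_mono rN) auto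
    finally show "(\<integral>\<^sup>+x. ennreal (2^n * ?D n x) \<partial>lborel) \<le> ennreal ((1/2)^n)" .
  qed (rule summableI)+
  also have "\<dots> = ennreal 2"
    by (rule suminf_ennreal_eq) (use geometric_sums[of "1/2::real"] in simp_all)
  also have "\<dots> < \<infinity>" by simp
  finally have fin: "(\<integral>\<^sup>+x. (\<Sum>n. ennreal (2^n * ?D n x)) \<partial>lborel) \<noteq> \<infinity>" by (rule less_imp_neq)
  have conv: "AE x in lborel. convergent (\<lambda>n. G (r n) x)"
  proof -
    have "AE x in lborel. (\<Sum>n. ennreal (2^n * ?D n x)) \<noteq> \<infinity>"
      by (rule nn_integral_PInf_AE[OF _ fin]) measurable
    then show ?thesis
    proof eventually_elim
      case (elim x)
      have s: "summable (\<lambda>n. 2^n * ?D n x)"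
      proof (rule summable_suminf_not_top)
        show "(\<Sum>n. ennreal (2^n * ?D n x)) \<noteq> top" using elim unfolding infinity_ennreal_def .
      qed (intro mult_nonneg_nonneg zero_le_power zero_le_power2 zero_le_numeral)
      obtain C where "0 < C" and C0: "\<forall>n. norm (2^n * ?D n x) \<le> C"
        by (rule BseqE[OF summable_imp_Bseq[OF s]])
      have C: "2^n * ?D n x \<le> C" for n
        using spec[OF C0, of n] unfolding real_norm_def by (rule abs_le_D1)
      have bnd: "norm (G (r (Suc n)) x - G (r n) x) \<le> sqrt C * sqrt (1/2) ^ n" for n
      proof -
        have "?D n x \<le> C * (1/2)^n" using C[of n] by (simp add: power_one_over field_simps)
        then have "sqrt (?D n x) \<le> sqrt (C * (1/2)^n)" by (rule real_sqrt_le_mono)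
        then show ?thesis unfolding real_sqrt_abs real_sqrt_mult abs_norm_cancel by (simp only: real_sqrt_power)
      qed
      have "summable (\<lambda>n. sqrt (1/2) ^ n)"
        by (rule summable_geometric) (simp add: real_sqrt_lt_1_iff)
      from summable_comparison_test'[OF summable_mult[OF this, of "sqrt C"] bnd]
      have "summable (\<lambda>n. G (r (Suc n)) x - G (r n) x)" .
      then show ?case
        unfolding summable_iff_convergent sum_lessThan_telescope[of "\<lambda>n. G (r n) x"]
        by (simp only: convergent_diff_const_right_iff)
    qed
  qed
  define g where "g x = lim (\<lambda>n. G (r n) x)" for x
  have gm[measurable]: "g \<in> borel_measurable borel" unfolding g_def by measurable
  have lim: "AE x in lborel. (\<lambda>n. G (r n) x) \<longlonglongrightarrow> g x"
    using conv by eventually_elim (simp add: g_def convergent_LIMSEQ_iff)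
  \<comment> \<open>Fatou in the second index only: \<open>n\<close> is fixed while the other index
    runs through the subsequence, shifted by \<open>N e\<close> into the Cauchy range. The estimate
    therefore holds for the whole sequence.\<close>
  have fat: "integrable lborel (\<lambda>x. (norm (G n x - g x))\<^sup>2)" "(\<integral>x. (norm (G n x - g x))\<^sup>2 \<partial>lborel) \<le> e"
    if "e > 0" "n \<ge> N e" for e n
  proof -
    have l: "AE x in lborel. (\<lambda>k. (norm (G n x - G (r (k + N e)) x))\<^sup>2) \<longlonglongrightarrow> (norm (G n x - g x))\<^sup>2"
      using lim
    proof eventually_elim
      case (elim x)
      then show ?case by (intro tendsto_intros LIMSEQ_ignore_initial_segment[OF elim])
    qed
    have b: "(\<integral>x. (norm (G n x - G (r (k + N e)) x))\<^sup>2 \<partial>lborel) \<le> e" for k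
      using that seq_suble[OF sm, of "k + N e"] by (intro N) auto
    show "integrable lborel (\<lambda>x. (norm (G n x - g x))\<^sup>2)" "(\<integral>x. (norm (G n x - g x))\<^sup>2 \<partial>lborel) \<le> e"
      using Fatou_real[OF d _ l _ b] by auto
  qed
  have gL: "L2_fun g"
  proof -
    have "L2_fun (\<lambda>x. G (N 1) x - g x)" using fat(1)[of 1 "N 1"] by (auto simp: L2_fun_def)
    from L2_fun_diff[OF G[of "N 1"] this] show ?thesis by simp
  qed
  have "(\<lambda>n. \<integral>x. (norm (G n x - g x))\<^sup>2 \<partial>lborel) \<longlonglongrightarrow> 0"
  proof (rule LIMSEQ_I)
    fix e :: real assume "e > 0"
    then show "\<exists>no. \<forall>n\<ge>no. norm ((\<integral>x. (norm (G n x - g x))\<^sup>2 \<partial>lborel) - 0) < e"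
      using fat(2)[of "e/2"] by (intro exI[of _ "N (e/2)"]) fastforce
  qed
  with gL sm lim show thesis by (rule that)
qed

section \<open>Test functions\<close>

lemma frechet_derivative_apply:
  "(f has_derivative D) (at x) \<Longrightarrow> frechet_derivative f (at x) v = D v"
  using frechet_derivative_at by fastforce

lemma Ck_fun_Suc_imp: "Ck_fun (Suc k) f \<Longrightarrow> Ck_fun k f"
proof (induction k arbitrary: f)
  case 0
  then show ?case by (auto intro: continuous_at_imp_continuous_on differentiable_imp_continuous_within)
next
  case (Suc k)
  then show ?case by (metis Ck_fun.simps(2))
qed

lemma Ck_fun_const: "Ck_fun k (\<lambda>x. c)"
  by (induction k arbitrary: c) auto

lemma Ck_fun_add: "Ck_fun k f \<Longrightarrow> Ck_fun k g \<Longrightarrow> Ck_fun k (\<lambda>x. f x + g x)"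
proof (induction k arbitrary: f g)
  case (Suc k)
  have "frechet_derivative (\<lambda>x. f x + g x) (at x) e = frechet_derivative f (at x) e + frechet_derivative g (at x) e" for x e
    using Suc.prems by (intro frechet_derivative_apply has_derivative_add) (auto simp: frechet_derivative_works)
  then show ?case using Suc by auto
qed (auto intro: continuous_intros)

lemma Ck_fun_mult: "Ck_fun k f \<Longrightarrow> Ck_fun k g \<Longrightarrow> Ck_fun k (\<lambda>x. f x * g x)"
proof (induction k arbitrary: f g)
  case (Suc k)
  have "frechet_derivative (\<lambda>x. f x * g x) (at x) e = f x * frechet_derivative g (at x) e + frechet_derivative f (at x) e * g x" for x e
    using Suc.prems by (intro frechet_derivative_apply has_derivative_mult) (auto simp: frechet_derivative_works)
  moreover have "Ck_fun k f" "Ck_fun k g" using Suc.prems Ck_fun_Suc_imp by blast+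
  ultimately show ?case using Suc by (auto intro!: Ck_fun_add)
qed (auto intro: continuous_intros)

lemma Ck_fun_prod: "finite I \<Longrightarrow> (\<And>i. i \<in> I \<Longrightarrow> Ck_fun k (f i)) \<Longrightarrow> Ck_fun k (\<lambda>x. \<Prod>i\<in>I. f i x)"
  by (induction I rule: finite_induct) (auto intro: Ck_fun_const Ck_fun_mult)

lemma frechet_derivative_shift:
  fixes f :: "'a::euclidean_space \<Rightarrow> real"
  assumes "f differentiable (at (x + a))"
  shows "((\<lambda>x. f (x + a)) has_derivative frechet_derivative f (at (x + a))) (at x)"
proof -
  have "(f has_derivative frechet_derivative f (at (x + a))) (at (x + a))"
    using assms frechet_derivative_works by blast
  moreover have "((\<lambda>x. x + a) has_derivative (\<lambda>h. h)) (at x)" by (auto intro!: derivative_eq_intros)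
  ultimately show ?thesis using has_derivative_compose[of "\<lambda>x. x + a" "\<lambda>h. h" x UNIV f] by simp
qed

lemma Ck_fun_shift: "Ck_fun k f \<Longrightarrow> Ck_fun k (\<lambda>x. f (x + a))"
proof (induction k arbitrary: f)
  case 0
  then show ?case by (auto intro!: continuous_on_compose2[of UNIV f] continuous_intros)
next
  case (Suc k)
  have d: "((\<lambda>x. f (x + a)) has_derivative frechet_derivative f (at (x + a))) (at x)" for x
    using Suc.prems by (intro frechet_derivative_shift) auto
  have "frechet_derivative (\<lambda>x. f (x + a)) (at x) e = frechet_derivative f (at (x + a)) e" for x e
    by (rule frechet_derivative_apply[OF d])
  moreover have "(\<lambda>x. f (x + a)) differentiable (at x)" for x using d differentiable_def by blast
  ultimately show ?case using Suc.IH[of "\<lambda>x. frechet_derivative f (at x) e" for e] Suc.prems by simp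
qed

text \<open>The power in the denominator makes the family closed under differentiation up to linear
  combinations, so smoothness of exp(-1/t) is an induction over all \<open>j\<close> at
  once.\<close>

definition flat_exp :: "nat \<Rightarrow> real \<Rightarrow> real" where
  "flat_exp j t = (if t \<le> 0 then 0 else exp (- 1 / t) / t ^ j)"

lemma flat_exp_tendsto_0: "(flat_exp j \<longlongrightarrow> 0) (at 0)"
proof -
  have "((\<lambda>x::real. x ^ j / exp x) \<longlongrightarrow> 0) at_top" by (rule tendsto_power_div_exp_0)
  from filterlim_compose[OF this filterlim_inverse_at_top_right]
  have *: "((\<lambda>t::real. inverse t ^ j / exp (inverse t)) \<longlongrightarrow> 0) (at_right 0)" .
  have "(flat_exp j \<longlongrightarrow> 0) (at_right 0)"
    by (rule Lim_transform_eventually[OF *], unfold eventually_at_right_field)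
      (auto simp: flat_exp_def exp_minus field_simps intro!: exI[of _ 1])
  moreover have "(flat_exp j \<longlongrightarrow> 0) (at_left 0)"
    by (rule Lim_transform_eventually[OF tendsto_const], unfold eventually_at_left_field)
      (auto simp: flat_exp_def intro!: exI[of _ "-1"])
  ultimately show ?thesis by (simp add: filterlim_split_at)
qed

lemma flat_exp_deriv:
  "(flat_exp j has_real_derivative flat_exp (j + 2) t - real j * flat_exp (j + 1) t) (at t)"
proof (cases t "0::real" rule: linorder_cases)
  case greater
  have "((\<lambda>t. exp (- 1 / t) / t ^ j) has_real_derivative flat_exp (j + 2) t - real j * flat_exp (j + 1) t) (at t)"
  proof -
    have "real j * (t ^ (j - 1) * t) = real j * t ^ j" by (cases j) auto
    then show ?thesis using greater
      by (auto intro!: derivative_eq_intros simp: flat_exp_def field_simps power2_eq_square)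
  qed
  moreover have "\<forall>\<^sub>F s in nhds t. flat_exp j s = exp (- 1 / s) / s ^ j"
    using eventually_nhds_in_open[of "{0<..}" t] greater by (auto elim!: eventually_mono simp: flat_exp_def)
  ultimately show ?thesis by (subst DERIV_cong_ev[OF refl _ refl])
next
  case less
  moreover have "\<forall>\<^sub>F s in nhds t. flat_exp j s = 0"
    using eventually_nhds_in_open[of "{..<0}" t] less by (auto elim!: eventually_mono simp: flat_exp_def)
  ultimately show ?thesis by (subst DERIV_cong_ev[OF refl _ refl]) (auto simp: flat_exp_def)
next
  case equal
  \<comment> \<open>At the origin the difference quotient of \<open>flat_exp j\<close> is
    \<open>flat_exp (Suc j)\<close>, which tends to 0.\<close>
  have "((\<lambda>h. (flat_exp j (0 + h) - flat_exp j 0) / h) \<longlongrightarrow> 0) (at 0)"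
    by (rule Lim_transform_eventually[OF flat_exp_tendsto_0[of "Suc j"]])
      (auto simp: eventually_at flat_exp_def field_simps intro!: exI[of _ 1])
  then show ?thesis using equal by (simp add: DERIV_def flat_exp_def)
qed

lemma flat_exp_affine_deriv:
  fixes c :: "'a::euclidean_space"
  shows "((\<lambda>x. flat_exp j (x \<bullet> c + b)) has_derivative
     (\<lambda>h. (h \<bullet> c) * (flat_exp (j + 2) (x \<bullet> c + b) - real j * flat_exp (j + 1) (x \<bullet> c + b)))) (at x)"
  by (rule has_derivative_eq_rhs[OF has_derivative_compose[where g = "flat_exp j", OF _ flat_exp_deriv[unfolded has_field_derivative_def]]])
    (auto intro!: derivative_eq_intros simp: mult.commute)

lemma Ck_fun_flat_exp_affine: "Ck_fun k (\<lambda>x::'a::euclidean_space. flat_exp j (x \<bullet> c + b))"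
proof (induction k arbitrary: j)
  case 0
  have "continuous (at x) (\<lambda>x::'a. flat_exp j (x \<bullet> c + b))" for x
    using flat_exp_affine_deriv has_derivative_continuous by blast
  then show ?case by (auto intro: continuous_at_imp_continuous_on)
next
  case (Suc k)
  have "frechet_derivative (\<lambda>x. flat_exp j (x \<bullet> c + b)) (at x) e
     = (e \<bullet> c) * (flat_exp (j + 2) (x \<bullet> c + b) + (- real j) * flat_exp (j + 1) (x \<bullet> c + b))" for x e
    using frechet_derivative_apply[OF flat_exp_affine_deriv[of j c b x], of e] by simp
  moreover have "Ck_fun k (\<lambda>x. (e \<bullet> c) * (flat_exp (j + 2) (x \<bullet> c + b) + (- real j) * flat_exp (j + 1) (x \<bullet> c + b)))" for e
    by (intro Ck_fun_mult Ck_fun_add Ck_fun_const Suc)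
  moreover have "(\<lambda>x. flat_exp j (x \<bullet> c + b)) differentiable (at x)" for x
    using flat_exp_affine_deriv differentiable_def by blast
  ultimately show ?case by (simp only: Ck_fun.simps) blast
qed

text \<open>For positive \<open>s\<close> the bump is positive exactly on the open box. Increasing
  \<open>s\<close> only steepens its walls, so one formula supplies test functions of prescribed
  support and approximations of the indicator from below.\<close>

definition box_bump :: "'a::euclidean_space \<Rightarrow> 'a \<Rightarrow> real \<Rightarrow> 'a \<Rightarrow> real" where
  "box_bump a b s x = (\<Prod>e\<in>Basis. flat_exp 0 (s * (x \<bullet> e - a \<bullet> e)) * flat_exp 0 (s * (b \<bullet> e - x \<bullet> e)))"

lemma flat_exp_0_bounds: "0 \<le> flat_exp 0 t" "flat_exp 0 t \<le> 1"
  by (auto simp: flat_exp_def)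

lemma flat_exp_0_pos_iff: "0 < flat_exp 0 t \<longleftrightarrow> t > 0"
  by (auto simp: flat_exp_def)

lemma box_bump_bounds: "0 \<le> box_bump a b s x" "box_bump a b s x \<le> 1"
  unfolding box_bump_def using flat_exp_0_bounds
  by (auto intro!: prod_nonneg prod_le_1 mult_nonneg_nonneg mult_le_one)

lemma box_bump_outside:
  assumes "s > 0" "x \<notin> box a b"
  shows "box_bump a b s x = 0"
proof -
  obtain e where "e \<in> Basis" "x \<bullet> e \<le> a \<bullet> e \<or> b \<bullet> e \<le> x \<bullet> e"
    using assms(2) by (auto simp: mem_box not_less)
  then show ?thesis using assms(1)
    by (auto simp: box_bump_def flat_exp_def mult_le_0_iff intro!: bexI[of _ e])
qed

lemma box_bump_pos:
  assumes "s > 0" "x \<in> box a b"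
  shows "box_bump a b s x > 0"
  using assms unfolding box_bump_def by (auto intro!: prod_pos mult_pos_pos simp: flat_exp_0_pos_iff mem_box)

lemma flat_exp_scale_tendsto: "t > 0 \<Longrightarrow> (\<lambda>n. flat_exp 0 (real (Suc n) * t)) \<longlonglongrightarrow> 1"
proof -
  assume t: "t > 0"
  have "(\<lambda>n. exp (- (1 / t) * inverse (real (Suc n)))) \<longlonglongrightarrow> exp (- (1 / t) * 0)"
    by (intro tendsto_intros LIMSEQ_inverse_real_of_nat)
  moreover have "exp (- (1 / t) * inverse (real (Suc n))) = flat_exp 0 (real (Suc n) * t)" for n
    using t mult_pos_pos[of "real (Suc n)" t] by (simp add: flat_exp_def field_simps not_le del: of_nat_Suc)
  ultimately show ?thesis by simp
qed

lemma box_bump_tendsto: "(\<lambda>n. box_bump a b (real (Suc n)) x) \<longlonglongrightarrow> indicator (box a b) x"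
proof (cases "x \<in> box a b")
  case True
  then have "(\<lambda>n. box_bump a b (real (Suc n)) x) \<longlonglongrightarrow> (\<Prod>e\<in>(Basis::'a set). 1 * 1)"
    unfolding box_bump_def by (intro tendsto_prod tendsto_mult flat_exp_scale_tendsto) (auto simp: mem_box)
  then show ?thesis using True by simp
next
  case False
  then show ?thesis by (simp add: box_bump_outside)
qed

lemma test_function_box_bump:
  assumes "s > 0"
  shows "test_function (box_bump a b s)"
  unfolding test_function_def
proof (intro conjI allI)
  show "Ck_fun k (box_bump a b s)" for k
  proof -
    have "box_bump a b s = (\<lambda>x. \<Prod>e\<in>Basis. flat_exp 0 (x \<bullet> (s *\<^sub>R e) + (- s * (a \<bullet> e)))
        * flat_exp 0 (x \<bullet> ((- s) *\<^sub>R e) + s * (b \<bullet> e)))"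
      by (simp add: box_bump_def fun_eq_iff algebra_simps)
    then show ?thesis by (simp only:) (intro Ck_fun_prod Ck_fun_mult Ck_fun_flat_exp_affine finite_Basis)
  qed
  have "{x. box_bump a b s x \<noteq> 0} \<subseteq> cbox a b"
    using box_bump_outside[OF assms] box_subset_cbox by blast
  then show "compact (closure {x. box_bump a b s x \<noteq> 0})"
    by (meson bounded_cbox bounded_subset compact_closure)
qed

section \<open>Bounds, supports and the fundamental lemma\<close>

lemma test_function_derivative:
  assumes "test_function \<phi>"
  shows "(\<phi> has_derivative frechet_derivative \<phi> (at x)) (at x)"
proof -
  have "Ck_fun (Suc 0) \<phi>" using assms by (auto simp only: test_function_def)
  then show ?thesis by (simp add: frechet_derivative_works)
qed

lemma test_function_linear:
  assumes "test_function \<phi>"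
  shows "linear (frechet_derivative \<phi> (at x))"
  using test_function_derivative[OF assms, of x] has_derivative_linear by blast

lemma test_function_continuous: "test_function \<phi> \<Longrightarrow> continuous_on UNIV \<phi>"
  unfolding test_function_def by (metis Ck_fun.simps(1))

lemma frechet_derivative_basis_sum:
  assumes "test_function \<phi>"
  shows "frechet_derivative \<phi> (at x) v = (\<Sum>e\<in>Basis. (v \<bullet> e) * frechet_derivative \<phi> (at x) e)"
proof -
  have "frechet_derivative \<phi> (at x) v = frechet_derivative \<phi> (at x) (\<Sum>e\<in>Basis. (v \<bullet> e) *\<^sub>R e)"
    by (simp add: euclidean_representation)
  also have "\<dots> = (\<Sum>e\<in>Basis. (v \<bullet> e) * frechet_derivative \<phi> (at x) e)"
    using test_function_linear[OF assms, of x] by (simp add: linear_sum linear_cmul)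
  finally show ?thesis .
qed

lemma test_function_continuous_deriv:
  assumes "test_function \<phi>"
  shows "continuous_on UNIV (\<lambda>x. frechet_derivative \<phi> (at x) v)"
proof -
  have "Ck_fun (Suc 0) \<phi>" using assms by (auto simp only: test_function_def)
  then show ?thesis unfolding frechet_derivative_basis_sum[OF assms, of _ v]
    by (intro continuous_intros) auto
qed

lemma test_function_support:
  assumes "test_function \<phi>"
  obtains R where "R > 0" "\<And>x. norm x \<ge> R \<Longrightarrow> \<phi> x = 0" "\<And>x v. norm x \<ge> R \<Longrightarrow> frechet_derivative \<phi> (at x) v = 0"
proof -
  obtain R where R: "R > 0" "\<And>x. \<phi> x \<noteq> 0 \<Longrightarrow> norm x \<le> R"
    proof -
    have "bounded (closure {x. \<phi> x \<noteq> 0})"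
      using assms compact_imp_bounded unfolding test_function_def by blast
    then have "bounded {x. \<phi> x \<noteq> 0}" using bounded_subset closure_subset by blast
    then show ?thesis using that unfolding bounded_pos by auto
  qed
  have "frechet_derivative \<phi> (at x) v = 0" if "norm x \<ge> R + 1" for x v
  proof -
    have "open {x. norm x > R}" by (intro open_Collect_less continuous_intros)
    then have "(\<phi> has_derivative (\<lambda>_. 0)) (at x)"
      by (rule has_derivative_transform_within_open[OF has_derivative_const[of 0]])
        (use that R(2) in force)+
    from frechet_derivative_apply[OF this] show ?thesis by simp
  qed
  then show thesis using R by (intro that[of "R + 1"]) force+
qed

lemma continuous_support_bounded:
  fixes f :: "'a::euclidean_space \<Rightarrow> real"
  assumes "continuous_on UNIV f" "\<And>x. norm x \<ge> R \<Longrightarrow> f x = 0"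
  obtains B where "B > 0" "\<And>x. \<bar>f x\<bar> \<le> B"
proof -
  have "compact (f ` cball 0 R)"
    using assms(1) by (intro compact_continuous_image) (auto intro: continuous_on_subset)
  then have "bounded (f ` cball 0 R)" by (rule compact_imp_bounded)
  then obtain B where B: "B > 0" "\<And>x. x \<in> cball 0 R \<Longrightarrow> \<bar>f x\<bar> \<le> B"
    unfolding bounded_pos by auto
  show thesis
  proof (rule that[OF B(1)])
    fix x show "\<bar>f x\<bar> \<le> B" using B(1) B(2)[of x] assms(2)[of x] by (cases "norm x \<ge> R") auto
  qed
qed

lemma test_function_shift:
  fixes \<phi> :: "'a::euclidean_space \<Rightarrow> real"
  assumes "test_function \<phi>"
  shows "test_function (\<lambda>x. \<phi> (x + a))"
proof -
  obtain R where R: "\<And>x. norm x \<ge> R \<Longrightarrow> \<phi> x = 0" using test_function_support[OF assms] by metis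
  have "{x. \<phi> (x + a) \<noteq> 0} \<subseteq> cball 0 (R + norm a)"
  proof
    fix x assume "x \<in> {x. \<phi> (x + a) \<noteq> 0}"
    then have "norm (x + a) \<le> R" using R[of "x + a"] by force
    then show "x \<in> cball 0 (R + norm a)" using norm_triangle_ineq4[of "x + a" a] by simp
  qed
  then have "compact (closure {x. \<phi> (x + a) \<noteq> 0})"
    by (meson bounded_cball bounded_subset compact_closure)
  then show ?thesis using assms by (auto simp: test_function_def intro: Ck_fun_shift)
qed

lemma locally_integrable_ball:
  "locally_integrable u \<Longrightarrow> integrable lborel (\<lambda>x. indicator (cball a r) x *\<^sub>R u x)"
  by (simp add: locally_integrable_def set_integrable_def)

lemma locally_integrable_measurable:
  fixes u :: "'a::euclidean_space \<Rightarrow> 'b::euclidean_space"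
  assumes "locally_integrable u"
  shows "u \<in> borel_measurable borel"
proof (rule borel_measurable_LIMSEQ_metric)
  show "(\<lambda>x. indicator (cball 0 (real n)) x *\<^sub>R u x) \<in> borel_measurable borel" for n
    using locally_integrable_ball[OF assms, of 0 "real n"] by (auto dest: borel_measurable_integrable)
  show "(\<lambda>n. indicator (cball 0 (real n)) x *\<^sub>R u x) \<longlonglongrightarrow> u x" for x
  proof (rule tendsto_eventually)
    obtain N :: nat where "norm x \<le> real N" using real_arch_simple by blast
    then show "\<forall>\<^sub>F n in sequentially. indicator (cball 0 (real n)) x *\<^sub>R u x = u x"
      unfolding eventually_sequentially by (intro exI[of _ N]) auto
  qed
qed

lemma locally_integrableI:
  fixes u :: "'a::euclidean_space \<Rightarrow> 'b::euclidean_space"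
  assumes m: "u \<in> borel_measurable borel" and i: "\<And>r. integrable lborel (\<lambda>x. indicator (cball 0 r) x *\<^sub>R u x)"
  shows "locally_integrable u"
  unfolding locally_integrable_def set_integrable_def
proof (intro allI impI)
  fix K :: "'a set" assume K: "compact K"
  obtain r where "\<forall>x\<in>K. norm x \<le> r" using compact_imp_bounded[OF K] unfolding bounded_iff by auto
  then have r: "K \<subseteq> cball 0 r" by auto
  have "K \<in> sets borel" using K by (simp add: compact_imp_closed)
  then show "integrable lborel (\<lambda>x. indicator K x *\<^sub>R u x)"
    using r m by (intro Bochner_Integration.integrable_bound[OF i[of r]] AE_I2) (auto simp: indicator_def)
qed

lemma locally_integrable_mult_integrable:
  fixes u :: "'a::euclidean_space \<Rightarrow> 'b::euclidean_space"
  assumes u: "locally_integrable u" and m: "\<phi> \<in> borel_measurable borel"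
    and b: "\<And>x. \<bar>\<phi> x\<bar> \<le> B" and s: "\<And>x. norm x \<ge> R \<Longrightarrow> \<phi> x = 0"
  shows "integrable lborel (\<lambda>x. \<phi> x *\<^sub>R u x)"
proof (rule Bochner_Integration.integrable_bound)
  show "integrable lborel (\<lambda>x. B *\<^sub>R (indicator (cball 0 R) x *\<^sub>R u x))"
    by (intro integrable_scaleR_right locally_integrable_ball[OF u])
  have "norm (\<phi> x *\<^sub>R u x) \<le> norm (B *\<^sub>R (indicator (cball 0 R) x *\<^sub>R u x))" for x
    using b[of x] s[of x] by (cases "norm x \<le> R") (auto intro!: mult_right_mono)
  then show "AE x in lborel. norm (\<phi> x *\<^sub>R u x) \<le> norm (B *\<^sub>R (indicator (cball 0 R) x *\<^sub>R u x))" by simp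
qed (use locally_integrable_measurable[OF u] m in auto)

lemma test_function_mult_integrable:
  fixes u :: "'a::euclidean_space \<Rightarrow> real"
  assumes u: "locally_integrable u" and \<phi>: "test_function \<phi>"
  shows "integrable lborel (\<lambda>x. u x * \<phi> x)" "integrable lborel (\<lambda>x. u x * frechet_derivative \<phi> (at x) v)"
proof -
  obtain R where R: "\<And>x. norm x \<ge> R \<Longrightarrow> \<phi> x = 0" "\<And>x v. norm x \<ge> R \<Longrightarrow> frechet_derivative \<phi> (at x) v = 0"
    using test_function_support[OF \<phi>] by metis
  note c = test_function_continuous[OF \<phi>] test_function_continuous_deriv[OF \<phi>, of v]
  obtain B where B: "\<And>x. \<bar>\<phi> x\<bar> \<le> B" using continuous_support_bounded[OF c(1) R(1)] by metis
  obtain B' where B': "\<And>x. \<bar>frechet_derivative \<phi> (at x) v\<bar> \<le> B'" using continuous_support_bounded[OF c(2) R(2)] by metis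
  show "integrable lborel (\<lambda>x. u x * \<phi> x)"
    using locally_integrable_mult_integrable[OF u borel_measurable_continuous_onI[OF c(1)] B R(1)]
    by (simp add: mult.commute)
  show "integrable lborel (\<lambda>x. u x * frechet_derivative \<phi> (at x) v)"
    using locally_integrable_mult_integrable[OF u borel_measurable_continuous_onI[OF c(2)] B' R(2)]
    by (simp add: mult.commute)
qed

text \<open>The bumps on a box converge to its indicator and stay below it, so dominated convergence
  turns the hypothesis into vanishing integrals over boxes.\<close>

lemma fundamental_lemma:
  fixes g :: "'a::euclidean_space \<Rightarrow> real"
  assumes g: "locally_integrable g" and zero: "\<And>\<phi>. test_function \<phi> \<Longrightarrow> (\<integral>x. g x * \<phi> x \<partial>lborel) = 0"
  shows "AE x in lborel. g x = 0"
proof (rule AE_zero_box_integrals)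
  show "set_integrable lborel (cbox a b) g" for a b using g by (auto simp: locally_integrable_def)
  note gm = locally_integrable_measurable[OF g]
  show "(\<integral>x. indicator (box a b) x * g x \<partial>lborel) = 0" for a b
  proof -
    have "(\<lambda>n. \<integral>x. box_bump a b (real (Suc n)) x * g x \<partial>lborel) \<longlonglongrightarrow> (\<integral>x. indicator (box a b) x * g x \<partial>lborel)"
    proof (rule integral_dominated_convergence[where w = "\<lambda>x. \<bar>indicator (cbox a b) x *\<^sub>R g x\<bar>"])
      show "integrable lborel (\<lambda>x. \<bar>indicator (cbox a b) x *\<^sub>R g x\<bar>)"
        using g by (auto simp: locally_integrable_def set_integrable_def)
      show "AE x in lborel. (\<lambda>n. box_bump a b (real (Suc n)) x * g x) \<longlonglongrightarrow> indicator (box a b) x * g x"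
        by (intro AE_I2 tendsto_intros box_bump_tendsto)
      show "(\<lambda>x. box_bump a b (real (Suc i)) x * g x) \<in> borel_measurable lborel" for i
        using gm borel_measurable_continuous_onI[OF test_function_continuous[OF test_function_box_bump[of "real (Suc i)" a b]]]
        by auto
      show "AE x in lborel. norm (box_bump a b (real (Suc i)) x * g x) \<le> \<bar>indicator (cbox a b) x *\<^sub>R g x\<bar>" for i
      proof (intro AE_I2)
        fix x
        show "norm (box_bump a b (real (Suc i)) x * g x) \<le> \<bar>indicator (cbox a b) x *\<^sub>R g x\<bar>"
        proof (cases "x \<in> box a b")
          case True
          then have "x \<in> cbox a b" using box_subset_cbox by blast
          then show ?thesis using box_bump_bounds[of a b "real (Suc i)" x]
            by (auto simp: abs_mult intro!: mult_left_le_one_le)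
        next
          case False
          then show ?thesis by (simp add: box_bump_outside)
        qed
      qed
    qed (use gm in auto)
    moreover have "(\<integral>x. box_bump a b (real (Suc n)) x * g x \<partial>lborel) = 0" for n
      using zero[OF test_function_box_bump[of "real (Suc n)" a b]] by (simp add: mult.commute)
    ultimately show ?thesis by (simp add: LIMSEQ_const_iff)
  qed
qed

section \<open>Weak gradients along segments\<close>

lemma lborel_pair_integrable_times:
  fixes f :: "'a::euclidean_space \<Rightarrow> real" and g :: "'b::euclidean_space \<Rightarrow> real"
  assumes f: "integrable lborel f" and g: "integrable lborel g"
  shows "integrable (lborel \<Otimes>\<^sub>M lborel) (\<lambda>(s, x). f s * g x)"
proof (rule lborel_pair.Fubini_integrable)
  have [measurable]: "f \<in> borel_measurable borel" "g \<in> borel_measurable borel" using f g by auto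
  show "(\<lambda>(s, x). f s * g x) \<in> borel_measurable (lborel \<Otimes>\<^sub>M lborel)" by measurable
  show "integrable lborel (\<lambda>x. \<integral>y. norm (case (x, y) of (s, x) \<Rightarrow> f s * g x) \<partial>lborel)"
    using f by (simp add: abs_mult)
  show "AE x in lborel. integrable lborel (\<lambda>y. case (x, y) of (s, x) \<Rightarrow> f s * g x)"
    using g by simp
qed

lemma integrable_indicator_unit: "integrable lborel (indicat_real {0..1::real})"
  by (rule integrable_real_indicator) auto

text \<open>\<open>G\<close> is integrable only on bounded sets; the support of
  \<open>\<phi>\<close> confines \<open>x + s *\<^sub>R y\<close> to the ball of radius
  \<open>R + norm y\<close>, where translation invariance bounds the inner integral uniformly in
  \<open>s\<close>.\<close>

lemma line_pair_integrable:
  fixes G :: "'a::euclidean_space \<Rightarrow> real"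
  assumes G: "locally_integrable G" and m: "\<phi> \<in> borel_measurable borel"
    and b: "\<And>x. \<bar>\<phi> x\<bar> \<le> B" and s: "\<And>x. norm x > R \<Longrightarrow> \<phi> x = 0"
  shows "integrable (lborel \<Otimes>\<^sub>M lborel) (\<lambda>(s, x). indicat_real {0..1} s * (\<phi> x * G (x + s *\<^sub>R y)))"
proof (rule lborel_pair.Fubini_integrable)
  note [measurable] = locally_integrable_measurable[OF G] m
  show m1: "(\<lambda>(s, x). indicat_real {0..1} s * (\<phi> x * G (x + s *\<^sub>R y))) \<in> borel_measurable (lborel \<Otimes>\<^sub>M lborel)"
    by measurable
  have B: "B \<ge> 0" using b[of 0] by linarith
  define C where "C = (\<integral>x. indicator (cball 0 (R + norm y)) x * \<bar>G x\<bar> \<partial>lborel)"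
  have iG: "integrable lborel (\<lambda>x. indicator (cball 0 r) x * \<bar>G x\<bar>)" for r
    using integrable_norm[OF locally_integrable_ball[OF G, of 0 r]] by (simp add: abs_mult)
  have C: "C \<ge> 0" unfolding C_def by (intro Bochner_Integration.integral_nonneg) auto
  have pt: "\<bar>\<phi> x * G (x + s *\<^sub>R y)\<bar> \<le> B * (indicator (cball 0 (R + norm y)) (x + s *\<^sub>R y) * \<bar>G (x + s *\<^sub>R y)\<bar>)"
    if "s \<in> {0..1}" for s x
  proof (cases "norm x > R")
    case False
    have "norm (s *\<^sub>R y) \<le> norm y" using that by (simp add: mult_left_le_one_le)
    then have "norm (x + s *\<^sub>R y) \<le> R + norm y"
      using False norm_triangle_ineq[of x "s *\<^sub>R y"] by linarith
    then show ?thesis using b[of x] by (auto simp: abs_mult intro!: mult_right_mono)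
  next
    case True
    then show ?thesis using s[OF True] B by simp
  qed
  have i1: "integrable lborel (\<lambda>x. B * (indicator (cball 0 (R + norm y)) (x + s *\<^sub>R y) * \<bar>G (x + s *\<^sub>R y)\<bar>))" for s
    using integrable_translate[OF iG[of "R + norm y"], of "s *\<^sub>R y"] by auto
  have i2: "integrable lborel (\<lambda>x. \<phi> x * G (x + s *\<^sub>R y))" if "s \<in> {0..1}" for s
    by (rule integrable_comparison[OF i1 _ pt[OF that]]) auto
  show "AE s in lborel. integrable lborel (\<lambda>x. case (s, x) of (s, x) \<Rightarrow> indicat_real {0..1} s * (\<phi> x * G (x + s *\<^sub>R y)))"
  proof (intro AE_I2)
    fix s show "integrable lborel (\<lambda>x. case (s, x) of (s, x) \<Rightarrow> indicat_real {0..1} s * (\<phi> x * G (x + s *\<^sub>R y)))"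
      using i2[of s] by (cases "s \<in> {0..1}") auto
  qed
  show "integrable lborel (\<lambda>s. \<integral>x. norm (case (s, x) of (s, x) \<Rightarrow> indicat_real {0..1} s * (\<phi> x * G (x + s *\<^sub>R y))) \<partial>lborel)"
  proof (rule integrable_comparison)
    show "integrable lborel (\<lambda>s::real. indicat_real {0..1} s * (B * C))"
      by (intro integrable_mult_left integrable_indicator_unit)
    show "(\<lambda>s. \<integral>x. norm (case (s, x) of (s, x) \<Rightarrow> indicat_real {0..1} s * (\<phi> x * G (x + s *\<^sub>R y))) \<partial>lborel) \<in> borel_measurable lborel"
      using m1 by measurable
    fix s :: real
    show "\<bar>\<integral>x. norm (case (s, x) of (s, x) \<Rightarrow> indicat_real {0..1} s * (\<phi> x * G (x + s *\<^sub>R y))) \<partial>lborel\<bar> \<le> indicat_real {0..1} s * (B * C)"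
    proof (cases "s \<in> {0..1}")
      case True
      have "(\<integral>x. \<bar>\<phi> x * G (x + s *\<^sub>R y)\<bar> \<partial>lborel) \<le> (\<integral>x. B * (indicator (cball 0 (R + norm y)) (x + s *\<^sub>R y) * \<bar>G (x + s *\<^sub>R y)\<bar>) \<partial>lborel)"
        using i2[OF True] i1 pt[OF True] by (intro integral_mono) auto
      also have "\<dots> = B * C"
        unfolding C_def using integral_translate[OF iG[of "R + norm y"], of "s *\<^sub>R y"] by simp
      finally show ?thesis using True by simp
    qed simp
  qed
qed

text \<open>On a line where the integrand is not integrable the value is 0. For
  \<open>G = g \<bullet> y\<close> this is the increment that the fundamental theorem of calculus
  would give along the segment from \<open>x\<close> to \<open>x + y\<close>.\<close>

definition line_avg :: "('a::euclidean_space \<Rightarrow> real) \<Rightarrow> 'a \<Rightarrow> 'a \<Rightarrow> real" where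
  "line_avg G y x = (\<integral>s. indicat_real {0..1} s * G (x + s *\<^sub>R y) \<partial>lborel)"

lemma line_avg_integral:
  fixes G :: "'a::euclidean_space \<Rightarrow> real"
  assumes G: "locally_integrable G" and m: "\<phi> \<in> borel_measurable borel"
    and b: "\<And>x. \<bar>\<phi> x\<bar> \<le> B" and s: "\<And>x. norm x > R \<Longrightarrow> \<phi> x = 0"
  shows "integrable lborel (\<lambda>x. \<phi> x * line_avg G y x)"
    and "(\<integral>x. \<phi> x * line_avg G y x \<partial>lborel)
      = (\<integral>s. indicat_real {0..1} s * (\<integral>x. \<phi> x * G (x + s *\<^sub>R y) \<partial>lborel) \<partial>lborel)"
proof -
  note i = line_pair_integrable[OF assms, where y = y]
  have eq: "\<phi> x * line_avg G y x = (\<integral>s. indicat_real {0..1} s * (\<phi> x * G (x + s *\<^sub>R y)) \<partial>lborel)" for x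
    by (simp add: line_avg_def mult.left_commute flip: integral_mult_right_zero)
  show "integrable lborel (\<lambda>x. \<phi> x * line_avg G y x)"
    unfolding eq by (rule lborel_pair.integrable_snd[OF i])
  show "(\<integral>x. \<phi> x * line_avg G y x \<partial>lborel)
      = (\<integral>s. indicat_real {0..1} s * (\<integral>x. \<phi> x * G (x + s *\<^sub>R y) \<partial>lborel) \<partial>lborel)"
    unfolding eq using lborel_pair.Fubini_integral[OF i] by simp
qed

lemma locally_integrable_line_avg:
  fixes G :: "'a::euclidean_space \<Rightarrow> real"
  assumes G: "locally_integrable G"
  shows "locally_integrable (line_avg G y)"
proof (rule locally_integrableI)
  note [measurable] = locally_integrable_measurable[OF G]
  have "(\<lambda>(x, s). indicat_real {0..1} s * G (x + s *\<^sub>R y)) \<in> borel_measurable (borel \<Otimes>\<^sub>M lborel)" by measurable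
  then show "line_avg G y \<in> borel_measurable borel"
    unfolding line_avg_def[abs_def] by measurable
  show "integrable lborel (\<lambda>x. indicator (cball 0 r) x *\<^sub>R line_avg G y x)" for r
    using line_avg_integral(1)[OF G borel_measurable_indicator[of "cball 0 r"], where B = 1 and R = r and y = y]
    by (auto simp: indicator_def borel_measurable_indicator)
qed

lemma is_weak_gradientD:
  assumes "is_weak_gradient u g"
  shows weak_gradient_loc: "locally_integrable u" "locally_integrable g"
    and weak_gradient_meas: "u \<in> borel_measurable borel" "g \<in> borel_measurable borel"
  using assms locally_integrable_measurable by (auto simp: is_weak_gradient_def)

lemma locally_integrable_inner:
  fixes g :: "'a::euclidean_space \<Rightarrow> 'b::euclidean_space"
  assumes "locally_integrable g"
  shows "locally_integrable (\<lambda>x. g x \<bullet> y)"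
proof (rule locally_integrableI)
  show "integrable lborel (\<lambda>x. indicator (cball 0 r) x *\<^sub>R (g x \<bullet> y))" for r
    using integrable_inner_left[of y lborel "\<lambda>x. indicator (cball 0 r) x *\<^sub>R g x"] locally_integrable_ball[OF assms, of 0 r] by simp
qed (use locally_integrable_measurable[OF assms] in auto)

lemma weak_gradient_direction:
  assumes w: "is_weak_gradient u g" and \<phi>: "test_function \<phi>"
  shows "(\<integral>x. u x * frechet_derivative \<phi> (at x) v \<partial>lborel) = - (\<integral>x. (g x \<bullet> v) * \<phi> x \<partial>lborel)"
proof -
  note l = weak_gradient_loc[OF w]
  have "(\<integral>x. u x * frechet_derivative \<phi> (at x) v \<partial>lborel)
      = (\<integral>x. (\<Sum>e\<in>Basis. (v \<bullet> e) * (u x * frechet_derivative \<phi> (at x) e)) \<partial>lborel)"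
    by (simp add: frechet_derivative_basis_sum[OF \<phi>, of _ v] sum_distrib_left mult.left_commute)
  also have "\<dots> = (\<Sum>e\<in>Basis. (v \<bullet> e) * (\<integral>x. u x * frechet_derivative \<phi> (at x) e \<partial>lborel))"
    using test_function_mult_integrable(2)[OF l(1) \<phi>] by (subst Bochner_Integration.integral_sum) auto
  also have "\<dots> = (\<Sum>e\<in>Basis. (v \<bullet> e) * - (\<integral>x. (g x \<bullet> e) * \<phi> x \<partial>lborel))"
    using w \<phi> by (intro sum.cong refl) (auto simp: is_weak_gradient_def)
  also have "\<dots> = - (\<integral>x. (\<Sum>e\<in>Basis. (v \<bullet> e) * ((g x \<bullet> e) * \<phi> x)) \<partial>lborel)"
    using test_function_mult_integrable(1)[OF locally_integrable_inner[OF l(2)] \<phi>]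
    by (subst Bochner_Integration.integral_sum) (auto simp: sum_negf)
  also have "\<dots> = - (\<integral>x. (g x \<bullet> v) * \<phi> x \<partial>lborel)"
    by (simp add: euclidean_inner[of "g _" v] sum_distrib_left sum_distrib_right mult_ac)
  finally show ?thesis .
qed

lemma locally_integrable_diff:
  fixes u v :: "'a::euclidean_space \<Rightarrow> 'b::euclidean_space"
  assumes "locally_integrable u" "locally_integrable v"
  shows "locally_integrable (\<lambda>x. u x - v x)"
  using assms unfolding locally_integrable_def by auto

lemma locally_integrable_translate:
  fixes u :: "'a::euclidean_space \<Rightarrow> 'b::euclidean_space"
  assumes u: "locally_integrable u"
  shows "locally_integrable (\<lambda>x. u (x + y))"
proof (rule locally_integrableI)
  note [measurable] = locally_integrable_measurable[OF u]
  show m: "(\<lambda>x. u (x + y)) \<in> borel_measurable borel" by measurable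
  show "integrable lborel (\<lambda>x. indicator (cball 0 r) x *\<^sub>R u (x + y))" for r
  proof (rule Bochner_Integration.integrable_bound)
    show "integrable lborel (\<lambda>x. indicator (cball 0 (r + norm y)) (x + y) *\<^sub>R u (x + y))"
      by (rule integrable_translate[OF locally_integrable_ball[OF u]])
    show "(\<lambda>x. indicator (cball 0 r) x *\<^sub>R u (x + y)) \<in> borel_measurable lborel"
      by (intro borel_measurable_scaleR borel_measurable_indicator) (use m in auto)
    show "AE x in lborel. norm (indicator (cball 0 r) x *\<^sub>R u (x + y)) \<le> norm (indicator (cball 0 (r + norm y)) (x + y) *\<^sub>R u (x + y))"
    proof (intro AE_I2)
      fix x show "norm (indicator (cball 0 r) x *\<^sub>R u (x + y)) \<le> norm (indicator (cball 0 (r + norm y)) (x + y) *\<^sub>R u (x + y))"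
        using norm_triangle_ineq[of x y] by (auto simp: indicator_def)
    qed
  qed
qed

lemma test_function_line:
  fixes \<phi> :: "'a::euclidean_space \<Rightarrow> real"
  assumes \<phi>: "test_function \<phi>"
  shows "\<phi> x - \<phi> (x - y) = (\<integral>s. indicat_real {0..1} s * frechet_derivative \<phi> (at (x - s *\<^sub>R y)) y \<partial>lborel)"
proof -
  have d: "((\<lambda>s. - \<phi> (x - s *\<^sub>R y)) has_vector_derivative frechet_derivative \<phi> (at (x - s *\<^sub>R y)) y) (at s within {0..1})" for s
  proof -
    have "((\<lambda>s. x - s *\<^sub>R y) has_derivative (\<lambda>h. - (h *\<^sub>R y))) (at s within {0..1})"
      by (auto intro!: derivative_eq_intros)
    from has_derivative_compose[OF this test_function_derivative[OF \<phi>]]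
    have "((\<lambda>s. \<phi> (x - s *\<^sub>R y)) has_derivative (\<lambda>h. frechet_derivative \<phi> (at (x - s *\<^sub>R y)) (- (h *\<^sub>R y)))) (at s within {0..1})" .
    from has_derivative_minus[OF this] show ?thesis
      using test_function_linear[OF \<phi>, of "x - s *\<^sub>R y"]
      by (simp add: has_vector_derivative_def linear_neg linear_cmul)
  qed
  have c: "continuous_on {0..1} (\<lambda>s. frechet_derivative \<phi> (at (x - s *\<^sub>R y)) y)"
    by (rule continuous_on_compose2[OF test_function_continuous_deriv[OF \<phi>, of y]]) (auto intro!: continuous_intros)
  show ?thesis using integral_FTC_atLeastAtMost[of 0 1, OF _ d c] by simp
qed

text \<open>The fundamental theorem of calculus, proved in weak form. Against a test function the
  shift moves onto \<open>\<phi>\<close>, where the classical theorem applies along the segment;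
  Fubini and the definition of the weak gradient, used for each shifted test function, carry the
  derivative back to \<open>g\<close>.\<close>

lemma weak_gradient_translate:
  fixes u :: "'a::euclidean_space \<Rightarrow> real"
  assumes w: "is_weak_gradient u g"
  shows "AE x in lborel. u (x + y) - u x = line_avg (\<lambda>x. g x \<bullet> y) y x"
proof -
  note l = weak_gradient_loc[OF w]
  let ?G = "\<lambda>x. g x \<bullet> y"
  have G: "locally_integrable ?G" using locally_integrable_inner[OF l(2)] .
  have ut: "locally_integrable (\<lambda>x. u (x + y))" by (rule locally_integrable_translate[OF l(1)])
  note la = locally_integrable_line_avg[OF G, of y]
  have "AE x in lborel. (u (x + y) - u x) - line_avg ?G y x = 0"
  proof (rule fundamental_lemma)
    show "locally_integrable (\<lambda>x. (u (x + y) - u x) - line_avg ?G y x)"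
      by (intro locally_integrable_diff ut l la)
    fix \<phi> :: "'a \<Rightarrow> real" assume \<phi>: "test_function \<phi>"
    obtain R where R: "R > 0" "\<And>x. norm x \<ge> R \<Longrightarrow> \<phi> x = 0" "\<And>x v. norm x \<ge> R \<Longrightarrow> frechet_derivative \<phi> (at x) v = 0"
      by (rule test_function_support[OF \<phi>]) (rule that)
    obtain B where "B > 0" and B: "\<And>x. \<bar>\<phi> x\<bar> \<le> B"
      by (rule continuous_support_bounded[where R = R, OF test_function_continuous[OF \<phi>] R(2)]) (assumption, rule that)
    obtain B' where "B' > 0" and B': "\<And>x. \<bar>frechet_derivative \<phi> (at x) y\<bar> \<le> B'"
      by (rule continuous_support_bounded[where R = R, OF test_function_continuous_deriv[OF \<phi>, of y] R(3)[of _ y]]) (assumption, rule that)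
    have \<phi>m[measurable]: "\<phi> \<in> borel_measurable borel" "(\<lambda>x. frechet_derivative \<phi> (at x) y) \<in> borel_measurable borel"
      using test_function_continuous[OF \<phi>] test_function_continuous_deriv[OF \<phi>] borel_measurable_continuous_onI by blast+
    note um[measurable] = weak_gradient_meas[OF w]
    have sh: "test_function (\<lambda>x. \<phi> (x - a))" for a using test_function_shift[OF \<phi>, of "- a"] by simp
    have dsh: "frechet_derivative (\<lambda>x. \<phi> (x - a)) (at x) y = frechet_derivative \<phi> (at (x - a)) y" for a x
    proof -
      have "\<phi> differentiable at (x + - a)" using test_function_derivative[OF \<phi>] differentiable_def by blast
      from frechet_derivative_apply[OF frechet_derivative_shift[OF this]] show ?thesis by simp
    qed
    have i1: "integrable lborel (\<lambda>x. u (x + y) * \<phi> x)" "integrable lborel (\<lambda>x. u x * \<phi> x)"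
        "integrable lborel (\<lambda>x. line_avg ?G y x * \<phi> x)" "integrable lborel (\<lambda>x. u x * \<phi> (x - a))" for a
      using test_function_mult_integrable(1) ut l la \<phi> sh by blast+
    \<comment> \<open>For \<open>norm x > R + norm y\<close> the whole segment misses the support of
      the derivative, so \<open>u\<close> is needed only on a ball.\<close>
    have pi: "integrable (lborel \<Otimes>\<^sub>M lborel) (\<lambda>(s, x). indicat_real {0..1} s * (u x * frechet_derivative \<phi> (at (x - s *\<^sub>R y)) y))"
    proof (rule Bochner_Integration.integrable_bound)
      have "integrable lborel (\<lambda>x. B' * \<bar>indicator (cball 0 (R + norm y)) x *\<^sub>R u x\<bar>)"
        using integrable_norm[OF locally_integrable_ball[OF l(1), of 0 "R + norm y"]] by auto
      from lborel_pair_integrable_times[OF integrable_indicator_unit this]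
      show "integrable (lborel \<Otimes>\<^sub>M lborel) (\<lambda>(s::real, x). indicat_real {0..1} s * (B' * \<bar>indicator (cball 0 (R + norm y)) x *\<^sub>R u x\<bar>))" .
      show "(\<lambda>(s, x). indicat_real {0..1} s * (u x * frechet_derivative \<phi> (at (x - s *\<^sub>R y)) y)) \<in> borel_measurable (lborel \<Otimes>\<^sub>M lborel)"
        by measurable
      have "\<bar>indicat_real {0..1} s * (u x * frechet_derivative \<phi> (at (x - s *\<^sub>R y)) y)\<bar>
          \<le> \<bar>indicat_real {0..1} s * (B' * \<bar>indicator (cball 0 (R + norm y)) x *\<^sub>R u x\<bar>)\<bar>" for s x
      proof (cases "s \<in> {0..1} \<and> norm x > R + norm y")
        case True
        have "norm (s *\<^sub>R y) \<le> norm y" using True by (simp add: mult_left_le_one_le)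
        then have "norm (x - s *\<^sub>R y) \<ge> R" using True norm_triangle_ineq2[of x "s *\<^sub>R y"] by linarith
        then show ?thesis using R(3) by simp
      next
        case False
        then show ?thesis using mult_right_mono[OF B'[of "x - s *\<^sub>R y"], of "\<bar>u x\<bar>"] \<open>B' > 0\<close>
          by (cases "s \<in> {0..1}") (auto simp: abs_mult mult.commute)
      qed
      then show "AE p in lborel \<Otimes>\<^sub>M lborel. norm (case p of (s, x) \<Rightarrow> indicat_real {0..1} s * (u x * frechet_derivative \<phi> (at (x - s *\<^sub>R y)) y))
          \<le> norm (case p of (s::real, x) \<Rightarrow> indicat_real {0..1} s * (B' * \<bar>indicator (cball 0 (R + norm y)) x *\<^sub>R u x\<bar>))"
        by (intro AE_I2) (simp add: split_beta)
    qed
    \<comment> \<open>Change of variables in the translated term only.\<close>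
    have A: "(\<integral>x. (u (x + y) - u x) * \<phi> x \<partial>lborel) = - (\<integral>x. u x * (\<phi> x - \<phi> (x - y)) \<partial>lborel)"
    proof -
      have "(\<integral>x. u (x + y) * \<phi> x \<partial>lborel) = (\<integral>x. u x * \<phi> (x - y) \<partial>lborel)"
        using integral_translate[OF i1(4)[of y], of y] by simp
      then show ?thesis using i1(1,2) i1(4)[of y] by (simp add: left_diff_distrib right_diff_distrib)
    qed
    also have "(\<integral>x. u x * (\<phi> x - \<phi> (x - y)) \<partial>lborel)
        = (\<integral>x. (\<integral>s. indicat_real {0..1} s * (u x * frechet_derivative \<phi> (at (x - s *\<^sub>R y)) y) \<partial>lborel) \<partial>lborel)"
      unfolding test_function_line[OF \<phi>, of _ y]
      by (simp add: mult.left_commute flip: integral_mult_right_zero)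
    also have "\<dots> = (\<integral>s. indicat_real {0..1} s * (\<integral>x. u x * frechet_derivative \<phi> (at (x - s *\<^sub>R y)) y \<partial>lborel) \<partial>lborel)"
      using lborel_pair.Fubini_integral[OF pi] by simp
    also have "\<dots> = (\<integral>s. indicat_real {0..1} s * - (\<integral>x. \<phi> x * ?G (x + s *\<^sub>R y) \<partial>lborel) \<partial>lborel)"
    proof -
      have "(\<integral>x. u x * frechet_derivative \<phi> (at (x - s *\<^sub>R y)) y \<partial>lborel) = - (\<integral>x. \<phi> x * ?G (x + s *\<^sub>R y) \<partial>lborel)" for s
      proof -
        have i: "integrable lborel (\<lambda>x. ?G x * \<phi> (x - s *\<^sub>R y))" by (rule test_function_mult_integrable(1)[OF G sh])
        show ?thesis using weak_gradient_direction[OF w sh[of "s *\<^sub>R y"], of y] integral_translate[OF i, of "s *\<^sub>R y"]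
          by (simp add: dsh mult.commute)
      qed
      then show ?thesis by simp
    qed
    also have "\<dots> = - (\<integral>x. \<phi> x * line_avg ?G y x \<partial>lborel)"
      using line_avg_integral(2)[OF G \<phi>m(1) B, where R = R and y = y] R(2) by simp
    finally have "(\<integral>x. (u (x + y) - u x) * \<phi> x \<partial>lborel) = (\<integral>x. line_avg ?G y x * \<phi> x \<partial>lborel)"
      by (simp add: mult.commute)
    then show "(\<integral>x. ((u (x + y) - u x) - line_avg ?G y x) * \<phi> x \<partial>lborel) = 0"
      using i1 by (simp add: left_diff_distrib)
  qed
  then show ?thesis by eventually_elim simp
qed

section \<open>Uniqueness of weak gradients and translation estimates\<close>

lemma weak_gradient_unique:
  assumes w: "is_weak_gradient u g" and w': "is_weak_gradient u g'"
  shows "AE x in lborel. g x = g' x"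
proof -
  have "AE x in lborel. g x \<bullet> e - g' x \<bullet> e = 0" if e: "e \<in> Basis" for e
  proof (rule fundamental_lemma)
    note l = locally_integrable_inner[OF weak_gradient_loc(2)[OF w], of e] locally_integrable_inner[OF weak_gradient_loc(2)[OF w'], of e]
    show "locally_integrable (\<lambda>x. g x \<bullet> e - g' x \<bullet> e)" by (intro locally_integrable_diff l)
    fix \<phi> :: "'a \<Rightarrow> real" assume \<phi>: "test_function \<phi>"
    show "(\<integral>x. (g x \<bullet> e - g' x \<bullet> e) * \<phi> x \<partial>lborel) = 0"
      using weak_gradient_direction[OF w \<phi>, of e] weak_gradient_direction[OF w' \<phi>, of e]
        test_function_mult_integrable(1)[OF l(1) \<phi>] test_function_mult_integrable(1)[OF l(2) \<phi>]
      by (simp add: left_diff_distrib)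
  qed
  then have "AE x in lborel. \<forall>e\<in>Basis. g x \<bullet> e - g' x \<bullet> e = 0"
    by (intro AE_finite_allI) auto
  then show ?thesis by eventually_elim (auto intro: euclidean_eqI)
qed

lemma nn_integral_translate:
  fixes f :: "'a::euclidean_space \<Rightarrow> ennreal"
  assumes "f \<in> borel_measurable borel"
  shows "(\<integral>\<^sup>+x. f (x + a) \<partial>lborel) = (\<integral>\<^sup>+x. f x \<partial>lborel)"
  using nn_integral_distr[of "(+) a" lborel borel f] assms by (simp add: lborel_distr_plus add.commute)

lemma nn_integral_line:
  fixes F :: "'a::euclidean_space \<Rightarrow> ennreal"
  assumes [measurable]: "F \<in> borel_measurable borel"
  shows "(\<integral>\<^sup>+x. (\<integral>\<^sup>+s. indicator {0..1::real} s * F (x + s *\<^sub>R y) \<partial>lborel) \<partial>lborel) = (\<integral>\<^sup>+x. F x \<partial>lborel)"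
proof -
  have m: "(\<lambda>(x, s). indicator {0..1::real} s * F (x + s *\<^sub>R y)) \<in> borel_measurable (lborel \<Otimes>\<^sub>M lborel)"
    by measurable
  have "(\<integral>\<^sup>+x. (\<integral>\<^sup>+s. indicator {0..1::real} s * F (x + s *\<^sub>R y) \<partial>lborel) \<partial>lborel)
      = (\<integral>\<^sup>+s. (\<integral>\<^sup>+x. indicator {0..1::real} s * F (x + s *\<^sub>R y) \<partial>lborel) \<partial>lborel)"
    using lborel_pair.Fubini'[OF m] by simp
  also have "\<dots> = (\<integral>\<^sup>+s. indicator {0..1::real} s * (\<integral>\<^sup>+x. F x \<partial>lborel) \<partial>lborel)"
    by (simp add: nn_integral_cmult nn_integral_translate)
  also have "\<dots> = (\<integral>\<^sup>+x. F x \<partial>lborel)" by (simp add: nn_integral_multc)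
  finally show ?thesis .
qed

lemma line_avg_norm_le: "G \<in> borel_measurable borel \<Longrightarrow>
  ennreal \<bar>line_avg G y x\<bar> \<le> (\<integral>\<^sup>+s. indicator {0..1::real} s * ennreal \<bar>G (x + s *\<^sub>R y)\<bar> \<partial>lborel)"
proof (cases "integrable lborel (\<lambda>s. indicat_real {0..1} s * G (x + s *\<^sub>R y))")
  case True
  have "(\<integral>\<^sup>+s. ennreal (norm (indicat_real {0..1} s * G (x + s *\<^sub>R y))) \<partial>lborel)
      = (\<integral>\<^sup>+s. indicator {0..1::real} s * ennreal \<bar>G (x + s *\<^sub>R y)\<bar> \<partial>lborel)"
    by (intro nn_integral_cong) (auto simp: indicator_def)
  then show ?thesis using integral_norm_bound_ennreal[OF True] by (simp add: line_avg_def)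
qed (simp add: line_avg_def not_integrable_integral_eq)

text \<open>Jensen's inequality for the square. It is obtained from Cauchy-Schwarz by writing the
  indicator of the unit interval twice; one copy contributes the factor 1.\<close>

lemma line_avg_square_le:
  assumes [measurable]: "G \<in> borel_measurable borel"
  shows "ennreal ((line_avg G y x)\<^sup>2) \<le> (\<integral>\<^sup>+s. indicator {0..1::real} s * ennreal ((G (x + s *\<^sub>R y))\<^sup>2) \<partial>lborel)"
proof -
  have "ennreal ((line_avg G y x)\<^sup>2) = (ennreal \<bar>line_avg G y x\<bar>)\<^sup>2" by (simp add: ennreal_power)
  also have "\<dots> \<le> (\<integral>\<^sup>+s. indicator {0..1::real} s * ennreal \<bar>G (x + s *\<^sub>R y)\<bar> \<partial>lborel)\<^sup>2"
    by (intro power_mono line_avg_norm_le assms) auto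
  also have "\<dots> = (\<integral>\<^sup>+s. indicator {0..1::real} s * (indicator {0..1::real} s * ennreal \<bar>G (x + s *\<^sub>R y)\<bar>) \<partial>lborel)\<^sup>2"
    by (simp flip: mult.assoc indicator_inter_arith)
  also have "\<dots> \<le> (\<integral>\<^sup>+s. (indicator {0..1::real} s)\<^sup>2 \<partial>lborel) * (\<integral>\<^sup>+s. (indicator {0..1::real} s * ennreal \<bar>G (x + s *\<^sub>R y)\<bar>)\<^sup>2 \<partial>lborel)"
    by (intro Cauchy_Schwarz_nn_integral) measurable
  also have "\<dots> = (\<integral>\<^sup>+s. indicator {0..1::real} s * ennreal ((G (x + s *\<^sub>R y))\<^sup>2) \<partial>lborel)"
  proof -
    have "(indicator {0..1::real} s :: ennreal)\<^sup>2 = indicator {0..1} s" for s by (auto simp: indicator_def)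
    then show ?thesis by (simp add: power_mult_distrib ennreal_power)
  qed
  finally show ?thesis .
qed

text \<open>Averaging over the segment does not change the integral over the whole space, so the
  square of the average costs only the square of \<open>g \<bullet> y\<close>. This feeds the bound
  of the L^2 norm by the form.\<close>

lemma weak_gradient_translate_L2:
  fixes u :: "'a::euclidean_space \<Rightarrow> real"
  assumes w: "is_weak_gradient u g" and u: "L2_fun u" and g: "L2_fun g"
  shows "(\<integral>x. (u (x + y) - u x)\<^sup>2 \<partial>lborel) \<le> (norm y)\<^sup>2 * (\<integral>x. (norm (g x))\<^sup>2 \<partial>lborel)"
proof -
  note [measurable] = weak_gradient_meas[OF w]
  have i: "integrable lborel (\<lambda>x. (u (x + y) - u x)\<^sup>2)"
  proof -
    have "L2_fun (\<lambda>x. u (x + y))"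
      using integrable_translate[OF L2_fun_integrable[OF u], of y] by (simp add: L2_fun_def)
    from L2_fun_integrable[OF L2_fun_diff[OF this u]] show ?thesis by simp
  qed
  have "ennreal (\<integral>x. (u (x + y) - u x)\<^sup>2 \<partial>lborel) = (\<integral>\<^sup>+x. ennreal ((u (x + y) - u x)\<^sup>2) \<partial>lborel)"
    by (rule nn_integral_eq_integral[symmetric, OF i]) auto
  also have "\<dots> = (\<integral>\<^sup>+x. ennreal ((line_avg (\<lambda>x. g x \<bullet> y) y x)\<^sup>2) \<partial>lborel)"
    using weak_gradient_translate[OF w, of y] by (intro nn_integral_cong_AE) (auto elim!: eventually_mono)
  also have "\<dots> \<le> (\<integral>\<^sup>+x. (\<integral>\<^sup>+s. indicator {0..1::real} s * ennreal ((g (x + s *\<^sub>R y) \<bullet> y)\<^sup>2) \<partial>lborel) \<partial>lborel)"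
    by (intro nn_integral_mono line_avg_square_le) measurable
  also have "\<dots> = (\<integral>\<^sup>+x. ennreal ((g x \<bullet> y)\<^sup>2) \<partial>lborel)"
    by (rule nn_integral_line) measurable
  also have "\<dots> \<le> (\<integral>\<^sup>+x. ennreal ((norm y)\<^sup>2 * (norm (g x))\<^sup>2) \<partial>lborel)"
  proof (intro nn_integral_mono ennreal_leI)
    fix x show "(g x \<bullet> y)\<^sup>2 \<le> (norm y)\<^sup>2 * (norm (g x))\<^sup>2"
      using power_mono[OF Cauchy_Schwarz_ineq2[of "g x" y] abs_ge_zero, of 2] by (simp add: power_mult_distrib mult.commute)
  qed
  also have "\<dots> = ennreal ((norm y)\<^sup>2 * (\<integral>x. (norm (g x))\<^sup>2 \<partial>lborel))"
    using L2_fun_integrable[OF g] by (subst nn_integral_eq_integral) auto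
  finally show ?thesis by (subst (asm) ennreal_le_iff) (auto intro!: mult_nonneg_nonneg)
qed

text \<open>Local version: \<open>F\<close> has to contain every segment that starts in
  \<open>E\<close>. In the positivity argument \<open>E\<close> is a set of zeros whose translate
  lies where the function is positive.\<close>

lemma weak_gradient_translate_L1:
  fixes u :: "'a::euclidean_space \<Rightarrow> real"
  assumes w: "is_weak_gradient u g" and E: "\<And>x s. x \<in> E \<Longrightarrow> s \<in> {0..1} \<Longrightarrow> x + s *\<^sub>R y \<in> F" 
    and [measurable]: "E \<in> sets borel" "F \<in> sets borel"
  shows "(\<integral>\<^sup>+x. indicator E x * ennreal \<bar>u (x + y) - u x\<bar> \<partial>lborel)
    \<le> ennreal (norm y) * (\<integral>\<^sup>+x. indicator F x * ennreal (norm (g x)) \<partial>lborel)"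
proof -
  note [measurable] = weak_gradient_meas[OF w]
  have "(\<integral>\<^sup>+x. indicator E x * ennreal \<bar>u (x + y) - u x\<bar> \<partial>lborel)
      = (\<integral>\<^sup>+x. indicator E x * ennreal \<bar>line_avg (\<lambda>x. g x \<bullet> y) y x\<bar> \<partial>lborel)"
    using weak_gradient_translate[OF w, of y] by (intro nn_integral_cong_AE) (auto elim!: eventually_mono)
  also have "\<dots> \<le> (\<integral>\<^sup>+x. (\<integral>\<^sup>+s. indicator {0..1::real} s * (indicator F (x + s *\<^sub>R y) * ennreal \<bar>g (x + s *\<^sub>R y) \<bullet> y\<bar>) \<partial>lborel) \<partial>lborel)"
  proof (rule nn_integral_mono)
    fix x
    show "indicator E x * ennreal \<bar>line_avg (\<lambda>x. g x \<bullet> y) y x\<bar>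
      \<le> (\<integral>\<^sup>+s. indicator {0..1::real} s * (indicator F (x + s *\<^sub>R y) * ennreal \<bar>g (x + s *\<^sub>R y) \<bullet> y\<bar>) \<partial>lborel)"
    proof (cases "x \<in> E")
      case True
      have "ennreal \<bar>line_avg (\<lambda>x. g x \<bullet> y) y x\<bar> \<le> (\<integral>\<^sup>+s. indicator {0..1::real} s * ennreal \<bar>g (x + s *\<^sub>R y) \<bullet> y\<bar> \<partial>lborel)"
        by (rule line_avg_norm_le) measurable
      also have "\<dots> = (\<integral>\<^sup>+s. indicator {0..1::real} s * (indicator F (x + s *\<^sub>R y) * ennreal \<bar>g (x + s *\<^sub>R y) \<bullet> y\<bar>) \<partial>lborel)"
        using E[OF True] by (intro nn_integral_cong) (auto simp: indicator_def)
      finally show ?thesis using True by simp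
    qed simp
  qed
  also have "\<dots> = (\<integral>\<^sup>+x. indicator F x * ennreal \<bar>g x \<bullet> y\<bar> \<partial>lborel)"
    by (rule nn_integral_line) measurable
  also have "\<dots> \<le> (\<integral>\<^sup>+x. ennreal (norm y) * (indicator F x * ennreal (norm (g x))) \<partial>lborel)"
  proof (rule nn_integral_mono)
    fix x
    have "ennreal \<bar>g x \<bullet> y\<bar> \<le> ennreal (norm y) * ennreal (norm (g x))"
      using Cauchy_Schwarz_ineq2[of "g x" y] by (subst ennreal_mult[symmetric]) (auto intro!: ennreal_leI simp: mult.commute)
    then show "indicator F x * ennreal \<bar>g x \<bullet> y\<bar> \<le> ennreal (norm y) * (indicator F x * ennreal (norm (g x)))"
      by (auto simp: indicator_def)
  qed
  also have "\<dots> = ennreal (norm y) * (\<integral>\<^sup>+x. indicator F x * ennreal (norm (g x)) \<partial>lborel)"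
    by (rule nn_integral_cmult) measurable
  finally show ?thesis .
qed

section \<open>Difference quotients of test functions\<close>

lemma test_function_bounds:
  fixes \<phi> :: "'a::euclidean_space \<Rightarrow> real"
  assumes \<phi>: "test_function \<phi>"
  obtains R B where "R > 0" "B > 0" "\<And>x. \<bar>\<phi> x\<bar> \<le> B" "\<And>x v. \<bar>frechet_derivative \<phi> (at x) v\<bar> \<le> B * norm v"
    "\<And>x. norm x \<ge> R \<Longrightarrow> \<phi> x = 0" "\<And>x v. norm x \<ge> R \<Longrightarrow> frechet_derivative \<phi> (at x) v = 0"
proof -
  obtain R where R: "R > 0" "\<And>x. norm x \<ge> R \<Longrightarrow> \<phi> x = 0" "\<And>x v. norm x \<ge> R \<Longrightarrow> frechet_derivative \<phi> (at x) v = 0"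
    by (rule test_function_support[OF \<phi>]) (rule that)
  obtain B0 where B0: "B0 > 0" "\<And>x. \<bar>\<phi> x\<bar> \<le> B0"
    by (rule continuous_support_bounded[where R = R, OF test_function_continuous[OF \<phi>] R(2)]) (assumption, rule that)
  have "\<exists>C>0. \<forall>x. \<bar>frechet_derivative \<phi> (at x) e\<bar> \<le> C" for e
    by (rule continuous_support_bounded[where R = R, OF test_function_continuous_deriv[OF \<phi>, of e] R(3)[of _ e]]) (assumption, blast)
  then obtain C where C: "\<And>e. C e > 0" "\<And>e x. \<bar>frechet_derivative \<phi> (at x) e\<bar> \<le> C e" by metis
  show thesis
  proof (rule that[of R "B0 + sum C Basis"])
    have S: "sum C Basis \<ge> 0" using C(1) by (intro sum_nonneg) (simp add: less_imp_le)
    show "B0 + sum C Basis > 0" using B0 S by simp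
    show "\<bar>\<phi> x\<bar> \<le> B0 + sum C Basis" for x using B0(2)[of x] S by simp
    show "\<bar>frechet_derivative \<phi> (at x) v\<bar> \<le> (B0 + sum C Basis) * norm v" for x v
    proof -
      have "\<bar>frechet_derivative \<phi> (at x) v\<bar> \<le> (\<Sum>e\<in>Basis. \<bar>(v \<bullet> e) * frechet_derivative \<phi> (at x) e\<bar>)"
        unfolding frechet_derivative_basis_sum[OF \<phi>, of x v] by (rule sum_abs)
      also have "\<dots> \<le> (\<Sum>e\<in>Basis. norm v * C e)"
        using C(2) Basis_le_norm by (intro sum_mono) (auto simp: abs_mult intro!: mult_mono)
      also have "\<dots> = norm v * sum C Basis" by (rule sum_distrib_left[symmetric])
      also have "\<dots> \<le> (B0 + sum C Basis) * norm v"
        using mult_nonneg_nonneg[of B0 "norm v"] B0(1) by (simp add: algebra_simps)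
      finally show ?thesis .
    qed
  qed (use R in auto)
qed

lemma test_function_lipschitz:
  fixes \<phi> :: "'a::euclidean_space \<Rightarrow> real"
  assumes \<phi>: "test_function \<phi>" and B: "\<And>x v. \<bar>frechet_derivative \<phi> (at x) v\<bar> \<le> B * norm v"
  shows "\<bar>\<phi> x - \<phi> y\<bar> \<le> B * norm (x - y)"
proof -
  have "onorm (frechet_derivative \<phi> (at x)) \<le> B" for x by (rule onorm_le) (simp add: B)
  then show ?thesis
    using differentiable_bound[of UNIV \<phi> "\<lambda>x. frechet_derivative \<phi> (at x)" B x y]
      test_function_derivative[OF \<phi>] by auto
qed

text \<open>The points need not lie on a line through \<open>p\<close>: it suffices that the scaled
  displacements converge. In the chain rule they are pairs of values of two functions at shifted
  points.\<close>

lemma has_derivative_sequence: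
  assumes d: "(F has_derivative D) (at p within S)" and S: "\<And>n. P n \<in> S"
    and t: "t \<longlonglongrightarrow> 0" "\<And>n. t n > 0" and lim: "(\<lambda>n. (P n - p) /\<^sub>R t n) \<longlonglongrightarrow> v"
  shows "(\<lambda>n. (F (P n) - F p) /\<^sub>R t n) \<longlonglongrightarrow> D v"
proof -
  have bl: "bounded_linear D" using d has_derivative_bounded_linear by blast
  have P0: "(\<lambda>n. P n - p) \<longlonglongrightarrow> 0"
  proof -
    have "(\<lambda>n. t n *\<^sub>R ((P n - p) /\<^sub>R t n)) \<longlonglongrightarrow> 0 *\<^sub>R v" by (intro tendsto_intros t lim)
    then show ?thesis using t(2) by (simp add: less_imp_neq[symmetric])
  qed
  have D: "(\<lambda>n. D ((P n - p) /\<^sub>R t n)) \<longlonglongrightarrow> D v"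
    using bounded_linear.tendsto[OF bl lim] .
  have "(\<lambda>n. (F (P n) - F p) /\<^sub>R t n - D ((P n - p) /\<^sub>R t n)) \<longlonglongrightarrow> 0"
  proof (rule LIMSEQ_I)
    fix e :: real assume e: "e > 0"
    \<comment> \<open>The scaled displacements are eventually shorter than
      \<open>norm v + 1\<close>; the 2 in place of 1 makes the final inequality strict.\<close>
    define e' where "e' = e / (norm v + 2)"
    have e': "e' > 0" unfolding e'_def using e norm_ge_zero[of v] by (intro divide_pos_pos) linarith+
    obtain d where d: "d > 0" "\<And>y. y \<in> S \<Longrightarrow> norm (y - p) < d \<Longrightarrow> norm (F y - F p - D (y - p)) \<le> e' * norm (y - p)"
      using d e' unfolding has_derivative_within_alt by metis
    obtain N1 where N1: "\<And>n. n \<ge> N1 \<Longrightarrow> norm (P n - p) < d" using LIMSEQ_D[OF P0 d(1)] by auto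
    have "(\<lambda>n. norm ((P n - p) /\<^sub>R t n)) \<longlonglongrightarrow> norm v" using tendsto_norm[OF lim] .
    from LIMSEQ_D[OF this zero_less_one] obtain N2 where N2: "\<And>n. n \<ge> N2 \<Longrightarrow> norm (norm ((P n - p) /\<^sub>R t n) - norm v) < 1" by auto
    show "\<exists>no. \<forall>n\<ge>no. norm ((F (P n) - F p) /\<^sub>R t n - D ((P n - p) /\<^sub>R t n) - 0) < e"
    proof (intro exI[of _ "max N1 N2"] allI impI)
      fix n assume n: "n \<ge> max N1 N2"
      have "(F (P n) - F p) /\<^sub>R t n - D ((P n - p) /\<^sub>R t n) = (F (P n) - F p - D (P n - p)) /\<^sub>R t n"
        by (simp only: linear_cmul[OF bounded_linear.linear[OF bl]] scaleR_diff_right[of "inverse (t n)" "F (P n) - F p"])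
      then have "norm ((F (P n) - F p) /\<^sub>R t n - D ((P n - p) /\<^sub>R t n) - 0) = norm (F (P n) - F p - D (P n - p)) / t n"
        using t(2)[of n] by (simp add: divide_inverse_commute)
      also have "\<dots> \<le> e' * norm (P n - p) / t n"
        using d(2)[OF S N1] n t(2)[of n] by (intro divide_right_mono) auto
      also have "\<dots> = e' * norm ((P n - p) /\<^sub>R t n)" using t(2)[of n] by (simp add: divide_inverse_commute mult_ac)
      also have "\<dots> \<le> e' * (norm v + 1)" using N2[of n] n e' by (intro mult_left_mono) auto
      also have "\<dots> < e' * (norm v + 2)" using e' by simp
      also have "\<dots> = e" unfolding e'_def using norm_ge_zero[of v] by (simp add: add_nonneg_eq_0_iff)
      finally show "norm ((F (P n) - F p) /\<^sub>R t n - D ((P n - p) /\<^sub>R t n) - 0) < e" .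
    qed
  qed
  from tendsto_add[OF this D] show ?thesis by simp
qed

text \<open>Serves both as increment of difference quotients and as regularisation parameter; it
  lies in (0, 1] for every \<open>n\<close>, the value at 0 being 1.\<close>

abbreviation step :: "nat \<Rightarrow> real" where "step n \<equiv> inverse (real (Suc n))"

lemma step_bounds: "step n > 0" "step n \<le> 1"
  by (auto simp: field_simps)

lemma test_function_diff_quot_lim:
  fixes \<phi> :: "'a::euclidean_space \<Rightarrow> real"
  assumes \<phi>: "test_function \<phi>"
  shows "(\<lambda>n. (\<phi> x - \<phi> (x - step n *\<^sub>R y)) / step n) \<longlonglongrightarrow> frechet_derivative \<phi> (at x) y"
proof -
  have "(\<lambda>n. (\<phi> (x - step n *\<^sub>R y) - \<phi> x) /\<^sub>R step n) \<longlonglongrightarrow> frechet_derivative \<phi> (at x) (- y)"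
    by (rule has_derivative_sequence[OF test_function_derivative[OF \<phi>] _ LIMSEQ_inverse_real_of_nat])
      (auto intro!: tendsto_eventually always_eventually simp del: of_nat_Suc)
  from tendsto_minus[OF this] show ?thesis
    unfolding linear_neg[OF test_function_linear[OF \<phi>, of x], of y] minus_minus
    by (rule Lim_transform_eventually) (auto intro!: always_eventually simp: field_simps simp del: of_nat_Suc)
qed

text \<open>Discrete integration by parts followed by dominated convergence with the Lipschitz
  constant of \<open>\<phi>\<close>. Only local integrability of \<open>u\<close> enters, so it
  applies to a composed function before that function is known to be weakly differentiable.\<close>

lemma integral_test_diff_quot:
  fixes u \<phi> :: "'a::euclidean_space \<Rightarrow> real"
  assumes u: "locally_integrable u" and \<phi>: "test_function \<phi>"
  shows "(\<lambda>n. \<integral>x. (u (x + step n *\<^sub>R y) - u x) / step n * \<phi> x \<partial>lborel)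
     \<longlonglongrightarrow> - (\<integral>x. u x * frechet_derivative \<phi> (at x) y \<partial>lborel)"
proof -
  obtain R B where R: "R > 0" "B > 0" "\<And>x. \<bar>\<phi> x\<bar> \<le> B" "\<And>x v. \<bar>frechet_derivative \<phi> (at x) v\<bar> \<le> B * norm v"
    "\<And>x. norm x \<ge> R \<Longrightarrow> \<phi> x = 0" by (rule test_function_bounds[OF \<phi>]) (rule that)
  have sh: "test_function (\<lambda>x. \<phi> (x - a))" for a using test_function_shift[OF \<phi>, of "- a"] by simp
  note i = test_function_mult_integrable(1)[OF u \<phi>] test_function_mult_integrable(1)[OF u sh]
  note i' = test_function_mult_integrable(1)[OF locally_integrable_translate[OF u] \<phi>]
  have um[measurable]: "u \<in> borel_measurable borel" by (rule locally_integrable_measurable[OF u])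
  have \<phi>m[measurable]: "\<phi> \<in> borel_measurable borel" "(\<lambda>x. frechet_derivative \<phi> (at x) y) \<in> borel_measurable borel"
    using test_function_continuous[OF \<phi>] test_function_continuous_deriv[OF \<phi>] borel_measurable_continuous_onI by blast+
  have eq: "(\<integral>x. (u (x + step n *\<^sub>R y) - u x) / step n * \<phi> x \<partial>lborel)
      = - (\<integral>x. u x * ((\<phi> x - \<phi> (x - step n *\<^sub>R y)) / step n) \<partial>lborel)" for n
  proof -
    let ?t = "step n"
    have "(\<integral>x. u (x + ?t *\<^sub>R y) * \<phi> x \<partial>lborel) = (\<integral>x. u x * \<phi> (x - ?t *\<^sub>R y) \<partial>lborel)"
      using integral_translate[OF i(2)[of "?t *\<^sub>R y"], of "?t *\<^sub>R y"] by simp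
    then have "(\<integral>x. (u (x + ?t *\<^sub>R y) - u x) * \<phi> x \<partial>lborel) = - (\<integral>x. u x * (\<phi> x - \<phi> (x - ?t *\<^sub>R y)) \<partial>lborel)"
      using i(1) i(2)[of "?t *\<^sub>R y"] i'[of "?t *\<^sub>R y"] by (simp add: left_diff_distrib right_diff_distrib)
    then show ?thesis by (simp del: of_nat_Suc)
  qed
  have "(\<lambda>n. \<integral>x. u x * ((\<phi> x - \<phi> (x - step n *\<^sub>R y)) / step n) \<partial>lborel) \<longlonglongrightarrow> (\<integral>x. u x * frechet_derivative \<phi> (at x) y \<partial>lborel)"
  proof (rule integral_dominated_convergence[where w = "\<lambda>x. (B * norm y) * \<bar>indicator (cball 0 (R + norm y)) x *\<^sub>R u x\<bar>"])
    show "integrable lborel (\<lambda>x. (B * norm y) * \<bar>indicator (cball 0 (R + norm y)) x *\<^sub>R u x\<bar>)"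
      using integrable_norm[OF locally_integrable_ball[OF u, of 0 "R + norm y"]] by auto
    show "AE x in lborel. (\<lambda>n. u x * ((\<phi> x - \<phi> (x - step n *\<^sub>R y)) / step n)) \<longlonglongrightarrow> u x * frechet_derivative \<phi> (at x) y"
      by (intro AE_I2 tendsto_intros test_function_diff_quot_lim \<phi>)
    show "AE x in lborel. norm (u x * ((\<phi> x - \<phi> (x - step n *\<^sub>R y)) / step n)) \<le> (B * norm y) * \<bar>indicator (cball 0 (R + norm y)) x *\<^sub>R u x\<bar>" for n
    proof (intro AE_I2)
      fix x
      have n1: "norm (step n *\<^sub>R y) \<le> norm y" using step_bounds[of n] by (simp add: mult_left_le_one_le del: of_nat_Suc)
      show "norm (u x * ((\<phi> x - \<phi> (x - step n *\<^sub>R y)) / step n)) \<le> (B * norm y) * \<bar>indicator (cball 0 (R + norm y)) x *\<^sub>R u x\<bar>"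
      proof (cases "norm x > R + norm y")
        case True
        then have "norm x \<ge> R" "norm (x - step n *\<^sub>R y) \<ge> R"
          using n1 norm_triangle_ineq2[of x "step n *\<^sub>R y"] norm_ge_zero[of y] by linarith+
        then show ?thesis using R(2,5) by simp
      next
        case False
        have "\<bar>(\<phi> x - \<phi> (x - step n *\<^sub>R y)) / step n\<bar> = \<bar>\<phi> x - \<phi> (x - step n *\<^sub>R y)\<bar> / step n"
          using step_bounds[of n] by (simp add: abs_divide del: of_nat_Suc)
        also have "\<dots> \<le> (B * norm (step n *\<^sub>R y)) / step n"
          using test_function_lipschitz[OF \<phi> R(4), of x "x - step n *\<^sub>R y"] step_bounds[of n] by (intro divide_right_mono) auto
        also have "\<dots> = B * norm y" using step_bounds[of n] by (simp add: field_simps del: of_nat_Suc)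
        finally show ?thesis using False mult_left_mono[of "\<bar>(\<phi> x - \<phi> (x - step n *\<^sub>R y)) / step n\<bar>" "B * norm y" "\<bar>u x\<bar>"]
          by (simp add: abs_mult mult.commute del: of_nat_Suc)
      qed
    qed
  qed measurable
  then show ?thesis unfolding eq by (rule tendsto_minus)
qed

lemma test_function_mult:
  fixes \<phi> \<psi> :: "'a::euclidean_space \<Rightarrow> real"
  assumes "test_function \<phi>" "test_function \<psi>"
  shows "test_function (\<lambda>x. \<phi> x * \<psi> x)"
proof -
  have "bounded {x. \<phi> x \<noteq> 0}"
    by (rule bounded_subset[OF compact_imp_bounded closure_subset]) (use assms(1) in \<open>simp add: test_function_def\<close>)
  then have "bounded {x. \<phi> x * \<psi> x \<noteq> 0}" by (rule bounded_subset) auto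
  then have "compact (closure {x. \<phi> x * \<psi> x \<noteq> 0})" by simp
  then show ?thesis using assms by (auto simp: test_function_def intro: Ck_fun_mult)
qed

definition classical_gradient :: "('a::euclidean_space \<Rightarrow> real) \<Rightarrow> 'a \<Rightarrow> 'a" where
  "classical_gradient \<phi> x = (\<Sum>e\<in>Basis. frechet_derivative \<phi> (at x) e *\<^sub>R e)"

lemma classical_gradient_inner:
  assumes "test_function \<phi>"
  shows "classical_gradient \<phi> x \<bullet> v = frechet_derivative \<phi> (at x) v"
proof -
  have "classical_gradient \<phi> x \<bullet> v = (\<Sum>e\<in>Basis. frechet_derivative \<phi> (at x) e * (e \<bullet> v))"
    by (simp add: classical_gradient_def inner_sum_left)
  also have "\<dots> = (\<Sum>e\<in>Basis. (v \<bullet> e) * frechet_derivative \<phi> (at x) e)"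
    by (intro sum.cong refl, subst inner_commute) (rule mult.commute)
  finally show ?thesis by (simp add: frechet_derivative_basis_sum[OF assms, of x v])
qed

lemma locally_integrable_continuous:
  fixes u :: "'a::euclidean_space \<Rightarrow> 'b::euclidean_space"
  assumes "continuous_on UNIV u"
  shows "locally_integrable u"
  unfolding locally_integrable_def set_integrable_def
  using assms by (auto intro!: borel_integrable_compact intro: continuous_on_subset)

text \<open>Discrete integration by parts with \<open>u = 1\<close>, whose difference quotients all
  vanish.\<close>

lemma test_function_integral_deriv:
  fixes \<phi> :: "'a::euclidean_space \<Rightarrow> real"
  assumes \<phi>: "test_function \<phi>"
  shows "(\<integral>x. frechet_derivative \<phi> (at x) v \<partial>lborel) = 0"
  using integral_test_diff_quot[OF locally_integrable_continuous[OF continuous_on_const[of UNIV 1]] \<phi>, of v]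
  by (simp add: LIMSEQ_const_iff)

lemma test_function_weak_gradient:
  fixes \<phi> :: "'a::euclidean_space \<Rightarrow> real"
  assumes \<phi>: "test_function \<phi>"
  shows "is_weak_gradient \<phi> (classical_gradient \<phi>)"
  unfolding is_weak_gradient_def
proof (intro conjI allI impI ballI)
  show l: "locally_integrable \<phi>" by (rule locally_integrable_continuous[OF test_function_continuous[OF \<phi>]])
  have "continuous_on UNIV (classical_gradient \<phi>)"
    unfolding classical_gradient_def[abs_def] by (intro continuous_intros test_function_continuous_deriv \<phi>)
  then show l': "locally_integrable (classical_gradient \<phi>)" by (rule locally_integrable_continuous)
  fix \<psi> :: "'a \<Rightarrow> real" and e :: 'a assume \<psi>: "test_function \<psi>"
  have "frechet_derivative (\<lambda>x. \<phi> x * \<psi> x) (at x) e = \<phi> x * frechet_derivative \<psi> (at x) e + (classical_gradient \<phi> x \<bullet> e) * \<psi> x" for x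
    using frechet_derivative_apply[OF has_derivative_mult[OF test_function_derivative[OF \<phi>] test_function_derivative[OF \<psi>]]]
    by (simp add: classical_gradient_inner[OF \<phi>])
  then have "(\<integral>x. \<phi> x * frechet_derivative \<psi> (at x) e + (classical_gradient \<phi> x \<bullet> e) * \<psi> x \<partial>lborel) = 0"
    using test_function_integral_deriv[OF test_function_mult[OF \<phi> \<psi>], of e] by simp
  then show "(\<integral>x. \<phi> x * frechet_derivative \<psi> (at x) e \<partial>lborel) = - (\<integral>x. (classical_gradient \<phi> x \<bullet> e) * \<psi> x \<partial>lborel)"
    using test_function_mult_integrable(2)[OF l \<psi>, of e] test_function_mult_integrable(1)[OF locally_integrable_inner[OF l', of e] \<psi>]
    by simp
qed

section \<open>The chain rule for weak gradients\<close>

lemma integrable_indicator_cball: "integrable lborel (indicat_real (cball (a::'a::euclidean_space) r))"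
  by (rule integrable_real_indicator) (use emeasure_bounded_finite[OF bounded_cball] in auto)

text \<open>The quotient minus \<open>g x \<bullet> y\<close> is an average over \<open>s\<close> of
  increments of \<open>g \<bullet> y\<close> along the shortened segment. The cut-off
  \<open>G'\<close> agrees with \<open>g \<bullet> y\<close> on all segments starting in the ball of
  radius \<open>R\<close> and is globally integrable, so continuity of translations can be applied
  to it.\<close>

lemma diff_quot_nn_bound:
  fixes u :: "'a::euclidean_space \<Rightarrow> real"
  assumes w: "is_weak_gradient u g" and t: "0 < t" "t \<le> 1"
    and G'_def: "G' = (\<lambda>x. indicator (cball 0 (R + norm y)) x * (g x \<bullet> y))"
    and small: "\<And>s. s \<in> {0..1} \<Longrightarrow> (\<integral>\<^sup>+x. ennreal \<bar>G' (x + (s * t) *\<^sub>R y) - G' x\<bar> \<partial>lborel) \<le> e"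
  shows "(\<integral>\<^sup>+x. ennreal \<bar>indicator (cball 0 R) x * ((u (x + t *\<^sub>R y) - u x) / t - g x \<bullet> y)\<bar> \<partial>lborel) \<le> e"
proof -
  note l = weak_gradient_loc[OF w]
  have gm[measurable]: "g \<in> borel_measurable borel" and [measurable]: "u \<in> borel_measurable borel"
    using weak_gradient_meas[OF w] by auto
  have G'm[measurable]: "G' \<in> borel_measurable borel"
    unfolding G'_def using gm by (intro borel_measurable_times borel_measurable_indicator borel_measurable_inner) auto
  have G'i: "locally_integrable G'"
  proof (rule locally_integrableI[OF G'm])
    fix r
    show "integrable lborel (\<lambda>x. indicator (cball 0 r) x *\<^sub>R G' x)"
    proof (rule integrable_mult_indicator)
      show "integrable lborel G'"
        unfolding G'_def using locally_integrable_ball[OF locally_integrable_inner[OF l(2), of y], of 0 "R + norm y"] by simp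
    qed simp
  qed
  have "AE x in lborel. integrable lborel (\<lambda>s. indicat_real {0..1} s * (indicator (cball 0 R) x * G' (x + s *\<^sub>R (t *\<^sub>R y))))"
    using lborel_pair.AE_integrable_snd[OF line_pair_integrable[OF G'i borel_measurable_indicator[of "cball 0 R"],
      where B = 1 and R = R and y = "t *\<^sub>R y"]] by (auto simp: indicator_def)
  then have "AE x in lborel. ennreal \<bar>indicator (cball 0 R) x * ((u (x + t *\<^sub>R y) - u x) / t - g x \<bullet> y)\<bar>
      \<le> (\<integral>\<^sup>+s. indicator {0..1::real} s * ennreal \<bar>G' (x + (s * t) *\<^sub>R y) - G' x\<bar> \<partial>lborel)"
    using weak_gradient_translate[OF w, of "t *\<^sub>R y"]
  proof eventually_elim
    case (elim x)
    show ?case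
    proof (cases "norm x \<le> R")
      case True
      have in_ball: "norm (x + (s * t) *\<^sub>R y) \<le> R + norm y" if "s \<in> {0..1}" for s
      proof -
        have "\<bar>s * t\<bar> \<le> 1" using t that by (auto simp: abs_mult intro!: mult_le_one)
        then have "norm ((s * t) *\<^sub>R y) \<le> norm y" by (simp add: mult_left_le_one_le)
        then show ?thesis using norm_triangle_ineq[of x "(s * t) *\<^sub>R y"] True by linarith
      qed
      have x_ball: "norm x \<le> R + norm y" using True norm_ge_zero[of y] by linarith
      have i1: "integrable lborel (\<lambda>s. indicat_real {0..1} s * G' (x + (s * t) *\<^sub>R y))"
        using elim(1) True by simp
      have i2: "integrable lborel (\<lambda>s. indicat_real {0..1::real} s * G' x)"
        by (intro Bochner_Integration.integrable_mult_left integrable_indicator_unit)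
      have "line_avg (\<lambda>x. g x \<bullet> (t *\<^sub>R y)) (t *\<^sub>R y) x = t * (\<integral>s. indicat_real {0..1} s * G' (x + (s * t) *\<^sub>R y) \<partial>lborel)"
        unfolding line_avg_def integral_mult_right_zero[symmetric]
      proof (intro Bochner_Integration.integral_cong refl)
        fix s :: real
        show "indicat_real {0..1} s * (g (x + s *\<^sub>R t *\<^sub>R y) \<bullet> (t *\<^sub>R y)) = t * (indicat_real {0..1} s * G' (x + (s * t) *\<^sub>R y))"
          using in_ball[of s] by (cases "s \<in> {0..1}") (auto simp: G'_def)
      qed
      then have "(u (x + t *\<^sub>R y) - u x) / t = (\<integral>s. indicat_real {0..1} s * G' (x + (s * t) *\<^sub>R y) \<partial>lborel)"
        using elim(2) t by simp
      moreover have "g x \<bullet> y = (\<integral>s. indicat_real {0..1::real} s * G' x \<partial>lborel)"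
        using x_ball by (simp add: G'_def)
      ultimately have "(u (x + t *\<^sub>R y) - u x) / t - g x \<bullet> y = (\<integral>s. indicat_real {0..1} s * (G' (x + (s * t) *\<^sub>R y) - G' x) \<partial>lborel)"
        using i1 i2 by (simp add: right_diff_distrib)
      then have "ennreal \<bar>(u (x + t *\<^sub>R y) - u x) / t - g x \<bullet> y\<bar>
          \<le> (\<integral>\<^sup>+s. ennreal (norm (indicat_real {0..1} s * (G' (x + (s * t) *\<^sub>R y) - G' x))) \<partial>lborel)"
        using integral_norm_bound_ennreal[of lborel "\<lambda>s. indicat_real {0..1} s * (G' (x + (s * t) *\<^sub>R y) - G' x)"] i1 i2
        by (simp add: right_diff_distrib)
      also have "\<dots> = (\<integral>\<^sup>+s. indicator {0..1::real} s * ennreal \<bar>G' (x + (s * t) *\<^sub>R y) - G' x\<bar> \<partial>lborel)"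
        by (intro nn_integral_cong) (auto simp: indicator_def)
      finally show ?thesis using True by simp
    qed simp
  qed
  then have "(\<integral>\<^sup>+x. ennreal \<bar>indicator (cball 0 R) x * ((u (x + t *\<^sub>R y) - u x) / t - g x \<bullet> y)\<bar> \<partial>lborel)
    \<le> (\<integral>\<^sup>+x. (\<integral>\<^sup>+s. indicator {0..1::real} s * ennreal \<bar>G' (x + (s * t) *\<^sub>R y) - G' x\<bar> \<partial>lborel) \<partial>lborel)"
    by (rule nn_integral_mono_AE)
  also have "\<dots> = (\<integral>\<^sup>+s. (\<integral>\<^sup>+x. indicator {0..1::real} s * ennreal \<bar>G' (x + (s * t) *\<^sub>R y) - G' x\<bar> \<partial>lborel) \<partial>lborel)"
  proof -
    have m: "(\<lambda>(x, s). indicator {0..1::real} s * ennreal \<bar>G' (x + (s * t) *\<^sub>R y) - G' x\<bar>) \<in> borel_measurable (lborel \<Otimes>\<^sub>M lborel)"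
      by measurable
    show ?thesis using lborel_pair.Fubini'[OF m] by simp
  qed
  also have "\<dots> = (\<integral>\<^sup>+s. indicator {0..1::real} s * (\<integral>\<^sup>+x. ennreal \<bar>G' (x + (s * t) *\<^sub>R y) - G' x\<bar> \<partial>lborel) \<partial>lborel)"
    by (simp add: nn_integral_cmult)
  also have "\<dots> \<le> (\<integral>\<^sup>+s. indicator {0..1::real} s * e \<partial>lborel)"
    using small by (intro nn_integral_mono) (auto simp: indicator_def)
  also have "\<dots> = e" by (simp add: nn_integral_multc)
  finally show ?thesis .
qed

text \<open>For small steps every increment \<open>G' (x + h) - G' x\<close> along the segment is
  small in L^1, uniformly in the position on the segment.\<close>

lemma diff_quot_L1:
  fixes u :: "'a::euclidean_space \<Rightarrow> real"
  assumes w: "is_weak_gradient u g"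
  shows "integrable lborel (\<lambda>x. indicator (cball 0 R) x * ((u (x + step n *\<^sub>R y) - u x) / step n - g x \<bullet> y))" (is "integrable _ (?f n)")
    and "(\<lambda>n. \<integral>x. \<bar>indicator (cball 0 R) x * ((u (x + step n *\<^sub>R y) - u x) / step n - g x \<bullet> y)\<bar> \<partial>lborel) \<longlonglongrightarrow> 0"
proof -
  note l = weak_gradient_loc[OF w]
  show i: "integrable lborel (?f n)" for n
  proof -
    have "integrable lborel (\<lambda>x. (indicator (cball 0 R) x *\<^sub>R u (x + step n *\<^sub>R y) - indicator (cball 0 R) x *\<^sub>R u x) / step n
        - indicator (cball 0 R) x *\<^sub>R (g x \<bullet> y))"
      by (intro Bochner_Integration.integrable_diff Bochner_Integration.integrable_divide_zero locally_integrable_ball locally_integrable_translate locally_integrable_inner l)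
    then show ?thesis by (simp add: right_diff_distrib diff_divide_distrib)
  qed
  define G' where "G' = (\<lambda>x. indicator (cball 0 (R + norm y)) x * (g x \<bullet> y))"
  have G'i: "integrable lborel G'"
    unfolding G'_def using locally_integrable_ball[OF locally_integrable_inner[OF l(2), of y], of 0 "R + norm y"] by simp
  show "(\<lambda>n. \<integral>x. \<bar>?f n x\<bar> \<partial>lborel) \<longlonglongrightarrow> 0"
  proof (rule LIMSEQ_I)
    fix e :: real assume e: "e > 0"
    obtain d where d: "d > 0" "\<And>h. norm h < d \<Longrightarrow> (\<integral>x. norm (G' (x + h) - G' x) \<partial>lborel) < e / 2"
      by (rule L1_translate_continuous[OF G'i half_gt_zero[OF e]]) (rule that)
    have "(\<lambda>n. step n * norm y) \<longlonglongrightarrow> 0 * norm y" by (intro tendsto_intros LIMSEQ_inverse_real_of_nat)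
    then have "(\<lambda>n. step n * norm y) \<longlonglongrightarrow> 0" by simp
    from LIMSEQ_D[OF this d(1)] obtain N where N: "\<And>n. n \<ge> N \<Longrightarrow> norm (step n * norm y - 0) < d" by auto
    show "\<exists>no. \<forall>n\<ge>no. norm ((\<integral>x. \<bar>?f n x\<bar> \<partial>lborel) - 0) < e"
    proof (intro exI[of _ N] allI impI)
      fix n assume n: "n \<ge> N"
      have "(\<integral>\<^sup>+x. ennreal \<bar>?f n x\<bar> \<partial>lborel) \<le> ennreal (e / 2)"
      proof (rule diff_quot_nn_bound[OF w step_bounds G'_def])
        fix s :: real assume s: "s \<in> {0..1}"
        have "norm ((s * step n) *\<^sub>R y) \<le> step n * norm y"
          using s step_bounds[of n] by (simp add: abs_mult mult_right_mono mult_left_le_one_le del: of_nat_Suc)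
        also have "\<dots> < d" using N[OF n] by simp
        finally have "(\<integral>x. norm (G' (x + (s * step n) *\<^sub>R y) - G' x) \<partial>lborel) < e / 2" by (rule d(2))
        then show "(\<integral>\<^sup>+x. ennreal \<bar>G' (x + (s * step n) *\<^sub>R y) - G' x\<bar> \<partial>lborel) \<le> ennreal (e / 2)"
          using G'i integrable_translate[OF G'i, of "(s * step n) *\<^sub>R y"]
          by (subst nn_integral_eq_integral) (auto intro!: ennreal_leI simp del: of_nat_Suc)
      qed
      then have "(\<integral>x. \<bar>?f n x\<bar> \<partial>lborel) \<le> e / 2"
        using i[of n] e by (subst (asm) nn_integral_eq_integral) auto
      moreover have "(\<integral>x. \<bar>?f n x\<bar> \<partial>lborel) \<ge> 0" by (rule Bochner_Integration.integral_nonneg) simp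
      ultimately show "norm ((\<integral>x. \<bar>?f n x\<bar> \<partial>lborel) - 0) < e" using e by simp
    qed
  qed
qed

lemma convex_gradient_lipschitz:
  fixes \<Phi> :: "real \<times> real \<Rightarrow> real"
  assumes S: "convex S" and der: "\<And>p. p \<in> S \<Longrightarrow> (\<Phi> has_derivative (\<lambda>h. D p \<bullet> h)) (at p within S)"
    and bound: "\<And>p. p \<in> S \<Longrightarrow> norm (D p) \<le> L" and pq: "p \<in> S" "q \<in> S"
  shows "\<bar>\<Phi> p - \<Phi> q\<bar> \<le> L * norm (p - q)"
proof -
  have "onorm (\<lambda>h. D p \<bullet> h) \<le> L" if "p \<in> S" for p
  proof (rule onorm_le)
    fix h :: "real \<times> real"
    have "norm (D p \<bullet> h) \<le> norm (D p) * norm h" using Cauchy_Schwarz_ineq2[of "D p" h] by simp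
    also have "\<dots> \<le> L * norm h" by (intro mult_right_mono bound that) auto
    finally show "norm (D p \<bullet> h) \<le> L * norm h" .
  qed
  then show ?thesis using differentiable_bound[OF S der _ pq] by auto
qed

text \<open>Difference quotients of the composition converge pointwise by differentiability of the
  outer function, and the Lipschitz bound dominates them by the quotients of \<open>u1\<close> and
  \<open>u2\<close>, which converge in local L^1 rather than being bounded by a fixed function. Two
  arguments are needed because quotients, products and midpoints mix two functions; restricting the
  values to \<open>S\<close> admits outer functions such as a reciprocal or a logarithm that are
  tame only there.\<close>

lemma weak_gradient_chain2:
  fixes u1 u2 :: "'a::euclidean_space \<Rightarrow> real" and \<Phi> :: "real \<times> real \<Rightarrow> real" and D :: "real \<times> real \<Rightarrow> real \<times> real"
  assumes w1: "is_weak_gradient u1 g1" and w2: "is_weak_gradient u2 g2"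
    and S: "convex S" "p0 \<in> S" and inS: "AE x in lborel. (u1 x, u2 x) \<in> S"
    and der: "\<And>p. p \<in> S \<Longrightarrow> (\<Phi> has_derivative (\<lambda>h. D p \<bullet> h)) (at p within S)"
    and bound: "\<And>p. p \<in> S \<Longrightarrow> norm (D p) \<le> L"
    and m: "(\<lambda>x. \<Phi> (u1 x, u2 x)) \<in> borel_measurable borel"
      "(\<lambda>x. fst (D (u1 x, u2 x))) \<in> borel_measurable borel" "(\<lambda>x. snd (D (u1 x, u2 x))) \<in> borel_measurable borel"
  shows "is_weak_gradient (\<lambda>x. \<Phi> (u1 x, u2 x)) (\<lambda>x. fst (D (u1 x, u2 x)) *\<^sub>R g1 x + snd (D (u1 x, u2 x)) *\<^sub>R g2 x)"
proof -
  note l1 = weak_gradient_loc[OF w1] and l2 = weak_gradient_loc[OF w2]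
  have [measurable]: "u1 \<in> borel_measurable borel" "g1 \<in> borel_measurable borel" "u2 \<in> borel_measurable borel" "g2 \<in> borel_measurable borel"
    using weak_gradient_meas[OF w1] weak_gradient_meas[OF w2] by auto
  note [measurable] = m
  have L: "L \<ge> 0" using bound[OF S(2)] norm_ge_zero order_trans by blast
  define U where "U x = (u1 x, u2 x)" for x
  define w where "w x = \<Phi> (U x)" for x
  define W where "W x = fst (D (U x)) *\<^sub>R g1 x + snd (D (U x)) *\<^sub>R g2 x" for x
  have wm[measurable]: "w \<in> borel_measurable borel" unfolding w_def U_def by (rule m)
  have Wm[measurable]: "W \<in> borel_measurable borel" unfolding W_def U_def by measurable
  have lip: "\<bar>\<Phi> p - \<Phi> q\<bar> \<le> L * norm (p - q)" if "p \<in> S" "q \<in> S" for p q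
    by (rule convex_gradient_lipschitz[OF S(1) der bound that])
  have npair: "norm (a, b) \<le> \<bar>a\<bar> + \<bar>b\<bar>" for a b :: real
    using norm_Pair_le[of a b] by simp
  have wl: "locally_integrable w"
  proof (rule locally_integrableI[OF wm])
    fix r :: real
    show "integrable lborel (\<lambda>x. indicator (cball 0 r) x *\<^sub>R w x)"
    proof (rule Bochner_Integration.integrable_bound)
      show "integrable lborel (\<lambda>x. indicat_real (cball 0 r) x * (\<bar>\<Phi> p0\<bar> + L * norm p0)
          + L * \<bar>indicator (cball 0 r) x *\<^sub>R u1 x\<bar> + L * \<bar>indicator (cball 0 r) x *\<^sub>R u2 x\<bar>)"
        using locally_integrable_ball[OF l1(1), of 0 r] locally_integrable_ball[OF l2(1), of 0 r]
        by (intro Bochner_Integration.integrable_add Bochner_Integration.integrable_mult_left Bochner_Integration.integrable_mult_right Bochner_Integration.integrable_abs)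
          (auto intro: integrable_indicator_cball)
      show "AE x in lborel. norm (indicator (cball 0 r) x *\<^sub>R w x) \<le> norm (indicat_real (cball 0 r) x * (\<bar>\<Phi> p0\<bar> + L * norm p0)
          + L * \<bar>indicator (cball 0 r) x *\<^sub>R u1 x\<bar> + L * \<bar>indicator (cball 0 r) x *\<^sub>R u2 x\<bar>)"
        using inS
      proof eventually_elim
        case (elim x)
        have "\<bar>w x\<bar> \<le> \<bar>\<Phi> p0\<bar> + L * norm (U x - p0)"
          using lip[OF elim S(2)] unfolding w_def U_def by linarith
        also have "\<dots> \<le> \<bar>\<Phi> p0\<bar> + L * (\<bar>u1 x\<bar> + \<bar>u2 x\<bar> + norm p0)"
          using norm_triangle_ineq4[of "U x" p0] npair[of "u1 x" "u2 x"] L unfolding U_def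
          by (intro add_left_mono mult_left_mono) linarith+
        finally have "\<bar>w x\<bar> \<le> \<bar>\<Phi> p0\<bar> + L * (\<bar>u1 x\<bar> + \<bar>u2 x\<bar> + norm p0)" .
        then show ?case using L by (cases "norm x \<le> r") (auto simp: algebra_simps)
      qed
    qed (use wm in \<open>intro borel_measurable_scaleR borel_measurable_indicator, auto\<close>)
  qed
  have Dle: "\<bar>fst (D p)\<bar> \<le> L" "\<bar>snd (D p)\<bar> \<le> L" if "p \<in> S" for p
    using bound[OF that] norm_fst_le[of "fst (D p)" "snd (D p)"] norm_snd_le[of "snd (D p)" "fst (D p)"] by auto
  have Wl: "locally_integrable W"
  proof (rule locally_integrableI[OF Wm])
    fix r :: real
    show "integrable lborel (\<lambda>x. indicator (cball 0 r) x *\<^sub>R W x)"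
    proof (rule Bochner_Integration.integrable_bound)
      show "integrable lborel (\<lambda>x. L * norm (indicator (cball 0 r) x *\<^sub>R g1 x) + L * norm (indicator (cball 0 r) x *\<^sub>R g2 x))"
        using locally_integrable_ball[OF l1(2), of 0 r] locally_integrable_ball[OF l2(2), of 0 r]
        by (intro Bochner_Integration.integrable_add Bochner_Integration.integrable_mult_right integrable_norm)
      show "AE x in lborel. norm (indicator (cball 0 r) x *\<^sub>R W x)
          \<le> norm (L * norm (indicator (cball 0 r) x *\<^sub>R g1 x) + L * norm (indicator (cball 0 r) x *\<^sub>R g2 x))"
        using inS
      proof eventually_elim
        case (elim x)
        have "norm (W x) \<le> \<bar>fst (D (U x))\<bar> * norm (g1 x) + \<bar>snd (D (U x))\<bar> * norm (g2 x)"
          unfolding W_def by (rule norm_triangle_le) simp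
        also have "\<dots> \<le> L * norm (g1 x) + L * norm (g2 x)"
          using Dle[OF elim] unfolding U_def by (intro add_mono mult_right_mono) auto
        finally show ?case using L by (cases "norm x \<le> r") auto
      qed
    qed (use Wm in \<open>intro borel_measurable_scaleR borel_measurable_indicator, auto\<close>)
  qed
  have key: "(\<integral>x. w x * frechet_derivative \<phi> (at x) y \<partial>lborel) = - (\<integral>x. (W x \<bullet> y) * \<phi> x \<partial>lborel)"
    if \<phi>: "test_function \<phi>" for \<phi> y
  proof -
    obtain R B where R: "R > 0" "B > 0" "\<And>x. \<bar>\<phi> x\<bar> \<le> B" "\<And>x v. \<bar>frechet_derivative \<phi> (at x) v\<bar> \<le> B * norm v"
      "\<And>x. norm x \<ge> R \<Longrightarrow> \<phi> x = 0" by (rule test_function_bounds[OF \<phi>]) (rule that)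
    have [measurable]: "\<phi> \<in> borel_measurable borel"
      using test_function_continuous[OF \<phi>] borel_measurable_continuous_onI by blast
    define q1 where "q1 n x = (u1 (x + step n *\<^sub>R y) - u1 x) / step n" for n x
    define q2 where "q2 n x = (u2 (x + step n *\<^sub>R y) - u2 x) / step n" for n x
    define q where "q n x = (w (x + step n *\<^sub>R y) - w x) / step n" for n x
    have qm[measurable]: "q1 n \<in> borel_measurable borel" "q2 n \<in> borel_measurable borel" "q n \<in> borel_measurable borel" for n
      unfolding q1_def[abs_def] q2_def[abs_def] q_def[abs_def] by measurable
    let ?e = "\<lambda>n x. \<bar>indicator (cball 0 R) x * (q1 n x - g1 x \<bullet> y)\<bar> + \<bar>indicator (cball 0 R) x * (q2 n x - g2 x \<bullet> y)\<bar>"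
    have ei: "integrable lborel (?e n)" for n
      using diff_quot_L1(1)[OF w1, of R n y] diff_quot_L1(1)[OF w2, of R n y]
      unfolding q1_def q2_def by (intro Bochner_Integration.integrable_add Bochner_Integration.integrable_abs)
    have "(\<lambda>n. (\<integral>x. \<bar>indicator (cball 0 R) x * (q1 n x - g1 x \<bullet> y)\<bar> \<partial>lborel) + (\<integral>x. \<bar>indicator (cball 0 R) x * (q2 n x - g2 x \<bullet> y)\<bar> \<partial>lborel)) \<longlonglongrightarrow> 0 + 0"
      unfolding q1_def q2_def by (intro tendsto_add diff_quot_L1(2) w1 w2)
    moreover have "(\<integral>x. ?e n x \<partial>lborel) = (\<integral>x. \<bar>indicator (cball 0 R) x * (q1 n x - g1 x \<bullet> y)\<bar> \<partial>lborel) + (\<integral>x. \<bar>indicator (cball 0 R) x * (q2 n x - g2 x \<bullet> y)\<bar> \<partial>lborel)" for n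
      using diff_quot_L1(1)[OF w1, of R n y] diff_quot_L1(1)[OF w2, of R n y]
      unfolding q1_def q2_def by (intro Bochner_Integration.integral_add Bochner_Integration.integrable_abs)
    ultimately have e0: "(\<lambda>n. \<integral>x. ?e n x \<partial>lborel) \<longlonglongrightarrow> 0" by simp
    then have "(\<lambda>n. \<integral>x. norm (?e n x) \<partial>lborel) \<longlonglongrightarrow> 0" by simp
    \<comment> \<open>Pointwise convergence holds only along a subsequence. This is enough, because
      the other evaluation of the limit holds along the full sequence.\<close>
    from tendsto_L1_AE_subseq[OF ei this] obtain r where r: "strict_mono r"
      and ae: "AE x in lborel. (\<lambda>n. ?e (r n) x) \<longlonglongrightarrow> 0" by blast
    \<comment> \<open>Only countably many shifts occur, so a single null set serves all of
      them.\<close>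
    have inS': "AE x in lborel. \<forall>n. (u1 (x + step n *\<^sub>R y), u2 (x + step n *\<^sub>R y)) \<in> S"
      unfolding AE_all_countable using AE_translate[OF inS] by auto
    have qb: "AE x in lborel. \<forall>n. \<bar>q n x\<bar> \<le> L * (\<bar>q1 n x\<bar> + \<bar>q2 n x\<bar>)"
      using inS inS'
    proof eventually_elim
      case (elim x)
      show ?case
      proof
        fix n
        have "\<bar>w (x + step n *\<^sub>R y) - w x\<bar> \<le> L * norm (U (x + step n *\<^sub>R y) - U x)"
          using lip elim unfolding w_def U_def by blast
        also have "\<dots> \<le> L * (\<bar>u1 (x + step n *\<^sub>R y) - u1 x\<bar> + \<bar>u2 (x + step n *\<^sub>R y) - u2 x\<bar>)"
          unfolding U_def using npair L by (intro mult_left_mono) auto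
        finally have "\<bar>w (x + step n *\<^sub>R y) - w x\<bar> / step n \<le> (L * (\<bar>u1 (x + step n *\<^sub>R y) - u1 x\<bar> + \<bar>u2 (x + step n *\<^sub>R y) - u2 x\<bar>)) / step n"
          using step_bounds[of n] by (intro divide_right_mono) auto
        then show "\<bar>q n x\<bar> \<le> L * (\<bar>q1 n x\<bar> + \<bar>q2 n x\<bar>)"
          using step_bounds[of n] unfolding q_def q1_def q2_def by (simp add: abs_divide flip: add_divide_distrib del: of_nat_Suc)
      qed
    qed
    have e_inside: "(\<lambda>n. q1 (r n) x) \<longlonglongrightarrow> g1 x \<bullet> y" "(\<lambda>n. q2 (r n) x) \<longlonglongrightarrow> g2 x \<bullet> y"
      if "norm x \<le> R" "(\<lambda>n. ?e (r n) x) \<longlonglongrightarrow> 0" for x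
    proof -
      have s: "(\<lambda>n. \<bar>q1 (r n) x - g1 x \<bullet> y\<bar> + \<bar>q2 (r n) x - g2 x \<bullet> y\<bar>) \<longlonglongrightarrow> 0" using that by simp
      have "(\<lambda>n. q1 (r n) x - g1 x \<bullet> y) \<longlonglongrightarrow> 0" "(\<lambda>n. q2 (r n) x - g2 x \<bullet> y) \<longlonglongrightarrow> 0"
        by (rule Lim_null_comparison[OF _ s], simp)+
      then show "(\<lambda>n. q1 (r n) x) \<longlonglongrightarrow> g1 x \<bullet> y" "(\<lambda>n. q2 (r n) x) \<longlonglongrightarrow> g2 x \<bullet> y"
        using LIM_zero_iff by (auto simp: LIM_zero_iff)
    qed
    \<comment> \<open>The majorants vary with \<open>n\<close>; they converge to \<open>ww\<close>
      in L^1, which the general form of dominated convergence accepts.\<close>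
    define wn where "wn n x = L * (\<bar>q1 (r n) x\<bar> + \<bar>q2 (r n) x\<bar>) * \<bar>\<phi> x\<bar>" for n x
    define ww where "ww x = L * (\<bar>g1 x \<bullet> y\<bar> + \<bar>g2 x \<bullet> y\<bar>) * \<bar>\<phi> x\<bar>" for x
    have wwi: "integrable lborel ww"
    proof -
      have "integrable lborel (\<lambda>x. L * (\<bar>(g1 x \<bullet> y) * \<phi> x\<bar> + \<bar>(g2 x \<bullet> y) * \<phi> x\<bar>))"
        by (intro Bochner_Integration.integrable_mult_right Bochner_Integration.integrable_add Bochner_Integration.integrable_abs test_function_mult_integrable(1) locally_integrable_inner l1 l2 \<phi>)
      then show ?thesis unfolding ww_def by (simp add: abs_mult distrib_right mult.assoc)
    qed
    have wnd: "\<bar>wn n x - ww x\<bar> \<le> L * B * ?e (r n) x" for n x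
    proof (cases "norm x \<le> R")
      case True
      have "\<bar>wn n x - ww x\<bar> = L * \<bar>(\<bar>q1 (r n) x\<bar> + \<bar>q2 (r n) x\<bar>) - (\<bar>g1 x \<bullet> y\<bar> + \<bar>g2 x \<bullet> y\<bar>)\<bar> * \<bar>\<phi> x\<bar>"
        unfolding wn_def ww_def using L by (simp add: abs_mult flip: left_diff_distrib right_diff_distrib)
      also have "\<dots> \<le> L * (\<bar>q1 (r n) x - g1 x \<bullet> y\<bar> + \<bar>q2 (r n) x - g2 x \<bullet> y\<bar>) * B"
      proof (intro mult_mono)
        show "\<bar>(\<bar>q1 (r n) x\<bar> + \<bar>q2 (r n) x\<bar>) - (\<bar>g1 x \<bullet> y\<bar> + \<bar>g2 x \<bullet> y\<bar>)\<bar> \<le> \<bar>q1 (r n) x - g1 x \<bullet> y\<bar> + \<bar>q2 (r n) x - g2 x \<bullet> y\<bar>"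
          by linarith
      qed (use L R(2,3) in auto)
      finally show ?thesis using True by (simp add: mult_ac)
    next
      case False
      then show ?thesis using R(5)[of x] by (simp add: wn_def ww_def)
    qed
    have wnm: "wn n \<in> borel_measurable borel" "ww \<in> borel_measurable borel" for n
      unfolding wn_def[abs_def] ww_def[abs_def] by measurable
    have wnd_i: "integrable lborel (\<lambda>x. wn n x - ww x)" for n
    proof (rule integrable_comparison[OF _ _ wnd])
      show "integrable lborel (\<lambda>x. L * B * ?e (r n) x)"
        by (intro Bochner_Integration.integrable_mult_right ei)
    qed (use wnm in auto)
    have wni: "integrable lborel (wn n)" for n using Bochner_Integration.integrable_add[OF wnd_i[of n] wwi] by simp
    have lim0: "(\<lambda>n. \<integral>x. \<bar>wn n x - ww x\<bar> \<partial>lborel) \<longlonglongrightarrow> 0"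
    proof (rule Lim_null_comparison)
      have "(\<lambda>n. (L * B) * (\<integral>x. ?e (r n) x \<partial>lborel)) \<longlonglongrightarrow> (L * B) * 0"
        using LIMSEQ_subseq_LIMSEQ[OF e0 r] by (intro tendsto_intros) (simp add: comp_def)
      then show "(\<lambda>n. (L * B) * (\<integral>x. ?e (r n) x \<partial>lborel)) \<longlonglongrightarrow> 0" by simp
      show "\<forall>\<^sub>F n in sequentially. norm (\<integral>x. \<bar>wn n x - ww x\<bar> \<partial>lborel) \<le> L * B * (\<integral>x. ?e (r n) x \<partial>lborel)"
      proof (intro always_eventually allI)
        fix n
        have "(\<integral>x. \<bar>wn n x - ww x\<bar> \<partial>lborel) \<le> (\<integral>x. L * B * ?e (r n) x \<partial>lborel)"
          using wnd_i[of n] ei[of "r n"] wnd[of n] by (intro integral_mono Bochner_Integration.integrable_abs Bochner_Integration.integrable_mult_right) auto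
        then show "norm (\<integral>x. \<bar>wn n x - ww x\<bar> \<partial>lborel) \<le> L * B * (\<integral>x. ?e (r n) x \<partial>lborel)"
          by (simp only: integral_mult_right_zero real_norm_def abs_of_nonneg[OF Bochner_Integration.integral_nonneg[OF abs_ge_zero]])
      qed
    qed
    have "(\<lambda>n. \<integral>x. q (r n) x * \<phi> x \<partial>lborel) \<longlonglongrightarrow> (\<integral>x. (W x \<bullet> y) * \<phi> x \<partial>lborel)"
    proof (rule integral_dominated_convergence_general(2)[OF _ _ wni wwi lim0])
      show "AE x in lborel. (\<lambda>n. q (r n) x * \<phi> x) \<longlonglongrightarrow> (W x \<bullet> y) * \<phi> x"
        using ae inS inS'
      proof eventually_elim
        case (elim x)
        show ?case
        proof (cases "norm x \<le> R")
          case True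
          have "(\<lambda>n. (U (x + step (r n) *\<^sub>R y) - U x) /\<^sub>R step (r n)) \<longlonglongrightarrow> (g1 x \<bullet> y, g2 x \<bullet> y)"
          proof -
            have "(U (x + step (r n) *\<^sub>R y) - U x) /\<^sub>R step (r n) = (q1 (r n) x, q2 (r n) x)" for n
              by (simp add: U_def q1_def q2_def divide_inverse mult.commute)
            then show ?thesis using tendsto_Pair[OF e_inside[OF True elim(1)]] by simp
          qed
          then have "(\<lambda>n. (\<Phi> (U (x + step (r n) *\<^sub>R y)) - \<Phi> (U x)) /\<^sub>R step (r n)) \<longlonglongrightarrow> D (U x) \<bullet> (g1 x \<bullet> y, g2 x \<bullet> y)"
            using elim(2,3) step_bounds LIMSEQ_subseq_LIMSEQ[OF LIMSEQ_inverse_real_of_nat r]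
            by (intro has_derivative_sequence[OF der]) (auto simp: U_def comp_def simp del: of_nat_Suc)
          moreover have "(\<Phi> (U (x + step (r n) *\<^sub>R y)) - \<Phi> (U x)) /\<^sub>R step (r n) = q (r n) x" for n
            by (simp add: q_def w_def divide_inverse mult.commute)
          moreover have "D (U x) \<bullet> (g1 x \<bullet> y, g2 x \<bullet> y) = W x \<bullet> y"
            by (simp add: W_def inner_add_left inner_prod_def)
          ultimately show ?thesis by (intro tendsto_intros) simp
        next
          case False
          then show ?thesis using R(5)[of x] by simp
        qed
      qed
      show "AE x in lborel. (\<lambda>n. wn n x) \<longlonglongrightarrow> ww x"
        using ae
      proof eventually_elim
        case (elim x)
        show ?case
        proof (cases "norm x \<le> R")
          case True
          show ?thesis unfolding wn_def ww_def by (intro tendsto_intros e_inside[OF True elim])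
        next
          case False
          then show ?thesis using R(5)[of x] by (simp add: wn_def ww_def)
        qed
      qed
      show "AE x in lborel. \<bar>q (r n) x * \<phi> x\<bar> \<le> wn n x" for n
        using qb by eventually_elim (auto simp: abs_mult wn_def intro!: mult_right_mono)
    qed (use Wm in measurable)
    \<comment> \<open>The second evaluation of the same limit; comparing the two identifies
      \<open>W\<close> as the weak gradient.\<close>
    moreover have "(\<lambda>n. \<integral>x. q (r n) x * \<phi> x \<partial>lborel) \<longlonglongrightarrow> - (\<integral>x. w x * frechet_derivative \<phi> (at x) y \<partial>lborel)"
      using LIMSEQ_subseq_LIMSEQ[OF integral_test_diff_quot[OF wl \<phi>, of y] r] unfolding q_def comp_def .
    ultimately show ?thesis using LIMSEQ_unique by fastforce
  qed
  have "is_weak_gradient w W" unfolding is_weak_gradient_def using wl Wl key by auto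
  then show ?thesis unfolding w_def[abs_def] W_def[abs_def] U_def .
qed

section \<open>The form domain\<close>

lemma weak_gradient_add:
  assumes u: "is_weak_gradient u g" and v: "is_weak_gradient v h"
  shows "is_weak_gradient (\<lambda>x. u x + v x) (\<lambda>x. g x + h x)"
proof -
  note lu = weak_gradient_loc[OF u] and lv = weak_gradient_loc[OF v]
  have "locally_integrable (\<lambda>x. u x + v x)" "locally_integrable (\<lambda>x. g x + h x)"
    using lu lv unfolding locally_integrable_def by auto
  moreover have "(\<integral>x. (u x + v x) * frechet_derivative \<phi> (at x) e \<partial>lborel) = - (\<integral>x. ((g x + h x) \<bullet> e) * \<phi> x \<partial>lborel)"
    if \<phi>: "test_function \<phi>" for \<phi> e
    using weak_gradient_direction[OF u \<phi>, of e] weak_gradient_direction[OF v \<phi>, of e]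
      test_function_mult_integrable(2)[OF lu(1) \<phi>, of e] test_function_mult_integrable(2)[OF lv(1) \<phi>, of e]
      test_function_mult_integrable(1)[OF locally_integrable_inner[OF lu(2), of e] \<phi>]
      test_function_mult_integrable(1)[OF locally_integrable_inner[OF lv(2), of e] \<phi>]
    by (simp add: distrib_right inner_add_left)
  ultimately show ?thesis unfolding is_weak_gradient_def by blast
qed

lemma weak_gradient_scaleR:
  assumes u: "is_weak_gradient u g"
  shows "is_weak_gradient (\<lambda>x. c * u x) (\<lambda>x. c *\<^sub>R g x)"
proof -
  note lu = weak_gradient_loc[OF u]
  have "locally_integrable (\<lambda>x. c * u x)" "locally_integrable (\<lambda>x. c *\<^sub>R g x)"
    using lu unfolding locally_integrable_def by auto
  moreover have "(\<integral>x. (c * u x) * frechet_derivative \<phi> (at x) e \<partial>lborel) = - (\<integral>x. ((c *\<^sub>R g x) \<bullet> e) * \<phi> x \<partial>lborel)"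
    if \<phi>: "test_function \<phi>" for \<phi> e
    using weak_gradient_direction[OF u \<phi>, of e] by (simp add: mult.assoc)
  ultimately show ?thesis unfolding is_weak_gradient_def by blast
qed

lemma L2_fun_locally_integrable:
  fixes u :: "'a::euclidean_space \<Rightarrow> 'b::euclidean_space"
  assumes u: "L2_fun u"
  shows "locally_integrable u"
proof (rule locally_integrableI)
  show m: "u \<in> borel_measurable borel" by (rule L2_fun_measurable[OF u])
  show "integrable lborel (\<lambda>x. indicator (cball 0 r) x *\<^sub>R u x)" for r
  proof (rule Bochner_Integration.integrable_bound)
    show "integrable lborel (\<lambda>x. indicat_real (cball 0 r) x + (norm (u x))\<^sup>2)"
      by (intro Bochner_Integration.integrable_add integrable_indicator_cball L2_fun_integrable u)
    have "norm (u x) \<le> 1 + (norm (u x))\<^sup>2" for x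
      using sum_squares_bound[of "norm (u x)" 1, simplified] norm_ge_zero[of "u x"] by linarith
    then show "AE x in lborel. norm (indicator (cball 0 r) x *\<^sub>R u x) \<le> norm (indicat_real (cball 0 r) x + (norm (u x))\<^sup>2)"
      by (intro AE_I2) (auto simp: indicator_def)
  qed (use m in \<open>intro borel_measurable_scaleR borel_measurable_indicator, auto\<close>)
qed

abbreviation harm :: "'a::euclidean_space \<Rightarrow> real" where "harm \<equiv> (\<lambda>x. (norm x)\<^sup>2)"

text \<open>The gradient is carried explicitly because calculations such as the chain rule produce a
  concrete representative, whereas \<open>weak_gradient\<close> is a choice that agrees with it only
  almost everywhere.\<close>

definition Hpair :: "('a::euclidean_space \<Rightarrow> real) \<Rightarrow> ('a \<Rightarrow> 'a) \<Rightarrow> bool" where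
  "Hpair u g \<longleftrightarrow> L2_fun u \<and> L2_fun g \<and> is_weak_gradient u g \<and> integrable lborel (\<lambda>x. (norm x)\<^sup>2 * (u x)\<^sup>2)"

lemma HpairD:
  assumes "Hpair u g"
  shows Hpair_L2: "L2_fun u" "L2_fun g" and Hpair_weak: "is_weak_gradient u g"
    and Hpair_pot: "integrable lborel (\<lambda>x. (norm x)\<^sup>2 * (u x)\<^sup>2)"
    and Hpair_meas: "u \<in> borel_measurable borel" "g \<in> borel_measurable borel"
    and Hpair_sq: "integrable lborel (\<lambda>x. (u x)\<^sup>2)" "integrable lborel (\<lambda>x. (norm (g x))\<^sup>2)"
  using assms L2_fun_measurable L2_fun_integrable by (fastforce simp: Hpair_def)+

lemma Hpair_H_space: "Hpair u g \<Longrightarrow> u \<in> H_space harm"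
  by (auto simp: Hpair_def H_space_def H1_def)

lemma H_space_Hpair:
  assumes "u \<in> H_space harm"
  shows "Hpair u (weak_gradient u)"
proof -
  obtain g where g: "is_weak_gradient u g" "L2_fun g" and u: "L2_fun u" "integrable lborel (\<lambda>x. (norm x)\<^sup>2 * (u x)\<^sup>2)"
    using assms by (auto simp: H_space_def H1_def)
  have w: "is_weak_gradient u (weak_gradient u)"
    unfolding weak_gradient_def by (rule someI[of "is_weak_gradient u", OF g(1)])
  have "L2_fun (weak_gradient u)"
    using weak_gradient_unique[OF w g(1)]
    by (intro L2_fun_bound[OF weak_gradient_meas(2)[OF w] L2_fun_integrable[OF g(2)]]) (auto elim!: eventually_mono)
  then show ?thesis using w u by (auto simp: Hpair_def)
qed

lemma Hpair_gradient_AE: "Hpair u g \<Longrightarrow> AE x in lborel. weak_gradient u x = g x"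
  using weak_gradient_unique Hpair_weak H_space_Hpair Hpair_H_space by blast

definition Qform :: "('a::euclidean_space \<Rightarrow> real) \<Rightarrow> ('a \<Rightarrow> 'a) \<Rightarrow> real" where
  "Qform u g = (\<integral>x. (norm (g x))\<^sup>2 + (norm x)\<^sup>2 * (u x)\<^sup>2 \<partial>lborel)"

lemma Qform_weak_gradient:
  assumes "Hpair u g"
  shows "(\<integral>x. ((norm (weak_gradient u x))\<^sup>2 + (norm x)\<^sup>2 * (u x)\<^sup>2) \<partial>lborel) = Qform u g"
  unfolding Qform_def
proof (rule integral_cong_AE)
  note [measurable] = Hpair_meas[OF assms] Hpair_meas(2)[OF H_space_Hpair[OF Hpair_H_space[OF assms]]]
  show "(\<lambda>x. (norm (weak_gradient u x))\<^sup>2 + (norm x)\<^sup>2 * (u x)\<^sup>2) \<in> borel_measurable lborel" by measurable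
  show "(\<lambda>x. (norm (g x))\<^sup>2 + (norm x)\<^sup>2 * (u x)\<^sup>2) \<in> borel_measurable lborel" by measurable
  show "AE x in lborel. (norm (weak_gradient u x))\<^sup>2 + (norm x)\<^sup>2 * (u x)\<^sup>2 = (norm (g x))\<^sup>2 + (norm x)\<^sup>2 * (u x)\<^sup>2"
    using Hpair_gradient_AE[OF assms] by eventually_elim simp
qed

lemma H_norm_eq: "Hpair u g \<Longrightarrow> H_norm harm u = sqrt (Qform u g)"
  by (simp add: H_norm_def Qform_weak_gradient)

lemma Qform_integrable: "Hpair u g \<Longrightarrow> integrable lborel (\<lambda>x. (norm (g x))\<^sup>2 + (norm x)\<^sup>2 * (u x)\<^sup>2)"
  using Hpair_sq Hpair_pot by (intro Bochner_Integration.integrable_add) auto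

lemma Qform_nonneg: "Qform u g \<ge> 0"
  unfolding Qform_def by (rule Bochner_Integration.integral_nonneg) simp

lemma Qform_split: "Hpair u g \<Longrightarrow> Qform u g = (\<integral>x. (norm (g x))\<^sup>2 \<partial>lborel) + (\<integral>x. (norm x)\<^sup>2 * (u x)\<^sup>2 \<partial>lborel)"
  unfolding Qform_def using Hpair_sq Hpair_pot by (intro Bochner_Integration.integral_add) auto

lemma Hpair_add:
  assumes u: "Hpair u g" and v: "Hpair v h"
  shows "Hpair (\<lambda>x. u x + v x) (\<lambda>x. g x + h x)"
proof -
  note [measurable] = Hpair_meas[OF u] Hpair_meas[OF v]
  have "integrable lborel (\<lambda>x. (norm x)\<^sup>2 * (u x + v x)\<^sup>2)"
  proof (rule integrable_comparison)
    show "integrable lborel (\<lambda>x. 2 * ((norm x)\<^sup>2 * (u x)\<^sup>2) + 2 * ((norm x)\<^sup>2 * (v x)\<^sup>2))"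
      using Hpair_pot[OF u] Hpair_pot[OF v] by auto
    fix x
    have "(norm x)\<^sup>2 * (u x + v x)\<^sup>2 \<le> (norm x)\<^sup>2 * (2 * (u x)\<^sup>2 + 2 * (v x)\<^sup>2)"
      using norm_add_square_le[of "u x" "v x"] by (intro mult_left_mono) auto
    then show "\<bar>(norm x)\<^sup>2 * (u x + v x)\<^sup>2\<bar> \<le> 2 * ((norm x)\<^sup>2 * (u x)\<^sup>2) + 2 * ((norm x)\<^sup>2 * (v x)\<^sup>2)"
      by (simp add: algebra_simps)
  qed measurable
  then show ?thesis using u v by (auto simp: Hpair_def intro: L2_fun_add weak_gradient_add)
qed

lemma Hpair_scale:
  assumes u: "Hpair u g"
  shows "Hpair (\<lambda>x. c * u x) (\<lambda>x. c *\<^sub>R g x)"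
proof -
  have "integrable lborel (\<lambda>x. c\<^sup>2 * ((norm x)\<^sup>2 * (u x)\<^sup>2))" using Hpair_pot[OF u] by auto
  then have "integrable lborel (\<lambda>x. (norm x)\<^sup>2 * (c * u x)\<^sup>2)" by (simp add: power_mult_distrib mult_ac)
  then show ?thesis using u L2_fun_scaleR[of u c] L2_fun_scaleR[of g c] weak_gradient_scaleR[of u g c] by (auto simp: Hpair_def)
qed

lemma Qform_scale: "Qform (\<lambda>x. c * u x) (\<lambda>x. c *\<^sub>R g x) = c\<^sup>2 * Qform u g"
  unfolding Qform_def by (simp add: power_mult_distrib distrib_left mult_ac flip: integral_mult_right_zero)

text \<open>Away from the unit ball the potential dominates; the unit ball is moved there by a translation.\<close>

lemma L2_le_Qform:
  fixes u :: "'a::euclidean_space \<Rightarrow> real"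
  assumes u: "Hpair u g"
  shows "(\<integral>x. (u x)\<^sup>2 \<partial>lborel) \<le> 18 * Qform u g"
proof -
  obtain e :: 'a where e: "e \<in> Basis" using nonempty_Basis by blast
  define y where "y = 3 *\<^sub>R e"
  have ny: "norm y = 3" using e by (simp add: y_def)
  note i1 = integrable_translate[OF Hpair_pot[OF u], of y]
  have i2: "integrable lborel (\<lambda>x. (u (x + y) - u x)\<^sup>2)"
  proof -
    have "L2_fun (\<lambda>x. u (x + y))"
      using integrable_translate[OF L2_fun_integrable[OF Hpair_L2(1)[OF u]], of y] Hpair_meas(1)[OF u] by (simp add: L2_fun_def)
    from L2_fun_integrable[OF L2_fun_diff[OF this Hpair_L2(1)[OF u]]] show ?thesis by simp
  qed
  have "(\<integral>x. (u x)\<^sup>2 \<partial>lborel) \<le> (\<integral>x. (norm x)\<^sup>2 * (u x)\<^sup>2 + (2 * ((norm (x + y))\<^sup>2 * (u (x + y))\<^sup>2) + 2 * (u (x + y) - u x)\<^sup>2) \<partial>lborel)"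
  proof (rule integral_mono)
    show "integrable lborel (\<lambda>x. (norm x)\<^sup>2 * (u x)\<^sup>2 + (2 * ((norm (x + y))\<^sup>2 * (u (x + y))\<^sup>2) + 2 * (u (x + y) - u x)\<^sup>2))"
      using i1 i2 Hpair_pot[OF u] by auto
    fix x
    show "(u x)\<^sup>2 \<le> (norm x)\<^sup>2 * (u x)\<^sup>2 + (2 * ((norm (x + y))\<^sup>2 * (u (x + y))\<^sup>2) + 2 * (u (x + y) - u x)\<^sup>2)"
    proof (cases "norm x \<ge> 1")
      case True
      then have "1 * (u x)\<^sup>2 \<le> (norm x)\<^sup>2 * (u x)\<^sup>2" by (intro mult_right_mono) (auto simp: one_le_power)
      moreover have "0 \<le> 2 * ((norm (x + y))\<^sup>2 * (u (x + y))\<^sup>2) + 2 * (u (x + y) - u x)\<^sup>2" by simp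
      ultimately show ?thesis by linarith
    next
      case False
      have "norm (x + y) \<ge> 1" using norm_triangle_ineq4[of "x + y" x] False ny by simp
      then have "1 * (u (x + y))\<^sup>2 \<le> (norm (x + y))\<^sup>2 * (u (x + y))\<^sup>2" by (intro mult_right_mono) (auto simp: one_le_power)
      moreover have "(u x)\<^sup>2 \<le> 2 * (u (x + y))\<^sup>2 + 2 * (u (x + y) - u x)\<^sup>2"
        using norm_add_square_le[of "u (x + y)" "- (u (x + y) - u x)"] by (simp add: power2_commute)
      moreover have "(norm x)\<^sup>2 * (u x)\<^sup>2 \<ge> 0" by simp
      ultimately show ?thesis by linarith
    qed
  qed (use Hpair_sq[OF u] in auto)
  also have "\<dots> = (\<integral>x. (norm x)\<^sup>2 * (u x)\<^sup>2 \<partial>lborel) + (2 * (\<integral>x. (norm x)\<^sup>2 * (u x)\<^sup>2 \<partial>lborel) + 2 * (\<integral>x. (u (x + y) - u x)\<^sup>2 \<partial>lborel))"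
    using i1 i2 Hpair_pot[OF u] integral_translate[OF Hpair_pot[OF u], of y] by simp
  \<comment> \<open>The constant 18 is twice the square of the shift length 3, from the translation
    estimate.\<close>
  also have "\<dots> \<le> 3 * (\<integral>x. (norm x)\<^sup>2 * (u x)\<^sup>2 \<partial>lborel) + 18 * (\<integral>x. (norm (g x))\<^sup>2 \<partial>lborel)"
    using weak_gradient_translate_L2[OF Hpair_weak[OF u] Hpair_L2[OF u], of y] by (simp add: ny)
  also have "\<dots> \<le> 18 * Qform u g"
  proof -
    have "(\<integral>x. (norm x)\<^sup>2 * (u x)\<^sup>2 \<partial>lborel) \<ge> 0" by (rule Bochner_Integration.integral_nonneg) simp
    then show ?thesis unfolding Qform_split[OF u] by simp
  qed
  finally show ?thesis .
qed

section \<open>The dual variable\<close>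

abbreviation f where "f \<equiv> dual_f"

lemma dual_g_f: "dual_g (f t) = t"
  by (simp add: dual_f_eq surj_dual_g surj_f_inv_f)

lemma f_dual_g: "f (dual_g s) = s"
  by (simp add: dual_f_eq inj_dual_g inv_f_f)

lemma inv_f: "inv f = dual_g"
  using bij_dual_f dual_g_f f_dual_g by (intro inv_equality) auto

lemma isCont_f: "isCont f t"
  using isCont_inverse_function[of 1 "f t" f dual_g] by (simp add: f_dual_g dual_g_f isCont_dual_g)

lemma sqrt_pos: "sqrt (1 + 2 * (s::real)\<^sup>2) > 0" "sqrt (1 + 2 * s\<^sup>2) * sqrt (1 + 2 * s\<^sup>2) = 1 + 2 * s\<^sup>2" "1 + 2 * s\<^sup>2 > 0" "sqrt (1 + 2 * s\<^sup>2) \<ge> 1"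
  by (auto simp: add_pos_nonneg)

lemma f_deriv: "(f has_real_derivative 1 / sqrt (1 + 2 * (f t)\<^sup>2)) (at t)"
proof -
  have "1 + 2 * (f t)\<^sup>2 > 0" by (simp add: add_pos_nonneg)
  then have "(f has_real_derivative inverse (sqrt (1 + 2 * (f t)\<^sup>2))) (at t)"
    by (intro DERIV_inverse_function[where a = "t - 1" and b = "t + 1" and f = dual_g])
      (auto simp: dual_g_deriv dual_g_f isCont_f)
  then show ?thesis by (simp add: divide_inverse)
qed

lemma f_minus: "f (- t) = - f t" and f_0[simp]: "f 0 = 0"
  using is_dual_f_dual_f by (auto simp: is_dual_f_def)

lemma dual_g_strict: "dual_g s < dual_g t \<longleftrightarrow> s < t"
  by (metis dual_g_strict_mono linorder_neqE not_less_iff_gr_or_eq)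

lemma f_less_iff: "f s < f t \<longleftrightarrow> s < t"
  using dual_g_strict[of "f s" "f t"] by (simp add: dual_g_f)

lemma f_le_iff: "f s \<le> f t \<longleftrightarrow> s \<le> t"
  using f_less_iff[of t s] by (simp add: not_less[symmetric])

lemma f_sign: "f t > 0 \<longleftrightarrow> t > 0" "f t \<ge> 0 \<longleftrightarrow> t \<ge> 0" "f t = 0 \<longleftrightarrow> t = 0"
  using f_less_iff[of 0 t] f_le_iff[of 0 t] f_less_iff[of t 0] by auto

lemma f_abs: "f \<bar>t\<bar> = \<bar>f t\<bar>"
  using f_minus[of t] f_sign(2)[of t] f_sign(2)[of "- t"] by (cases "t \<ge> 0") auto

lemma abs_f_le: "\<bar>f t\<bar> \<le> \<bar>t\<bar>"
proof -
  have *: "f t \<le> t" if "t \<ge> 0" for t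
  proof (cases "t = 0")
    case False
    have "(\<lambda>t. t - f t) 0 \<le> (\<lambda>t. t - f t) t"
    proof (rule DERIV_nonneg_imp_nondecreasing[OF that])
      fix x
      have "((\<lambda>t. t - f t) has_real_derivative 1 - 1 / sqrt (1 + 2 * (f x)\<^sup>2)) (at x)"
        by (intro derivative_intros f_deriv)
      moreover have "1 - 1 / sqrt (1 + 2 * (f x)\<^sup>2) \<ge> 0"
        using sqrt_pos(4)[of "f x"] unfolding diff_ge_0_iff_ge divide_le_eq_1_pos[OF sqrt_pos(1)] .
      ultimately show "\<exists>y. ((\<lambda>t. t - f t) has_real_derivative y) (at x) \<and> 0 \<le> y" by blast
    qed
    then show ?thesis by simp
  qed simp
  show ?thesis using *[of "\<bar>t\<bar>"] by (simp add: f_abs)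
qed

lemma f_sq_le: "(f t)\<^sup>2 \<le> t\<^sup>2"
  using abs_f_le[of t] by (simp add: abs_le_square_iff)

text \<open>\<open>dual_g s\<close> grows at least like s^2 / sqrt 2, so its inverse grows at most
  like a square root. The quartic term is thereby controlled by the L^2 norm in every dimension,
  without a Sobolev embedding.\<close>

lemma f_pow4_le: "(f t) ^ 4 \<le> 2 * t\<^sup>2"
proof -
  have *: "(f t)\<^sup>2 \<le> sqrt 2 * t" if "t \<ge> 0" for t
  proof -
    let ?s = "f t"
    have s: "?s \<ge> 0" using f_sign that by simp
    have "sqrt 2 * ?s \<le> sqrt (1 + 2 * ?s\<^sup>2)" using s by (intro real_le_rsqrt) (simp add: power_mult_distrib)
    then have "?s * (sqrt 2 * ?s) / 2 \<le> ?s * sqrt (1 + 2 * ?s\<^sup>2) / 2" using s by (intro divide_right_mono mult_left_mono) auto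
    also have "\<dots> \<le> dual_g ?s"
      using s by (cases "?s = 0") (auto simp: dual_g_def intro!: divide_nonneg_nonneg less_imp_le)
    finally have "sqrt 2 * ?s\<^sup>2 \<le> 2 * t" by (simp add: dual_g_f power2_eq_square mult_ac)
    then have "sqrt 2 * (sqrt 2 * ?s\<^sup>2) \<le> sqrt 2 * (2 * t)" by (intro mult_left_mono) auto
    then show ?thesis by (simp flip: mult.assoc)
  qed
  have "(f \<bar>t\<bar>)\<^sup>2 \<le> sqrt 2 * \<bar>t\<bar>" using *[of "\<bar>t\<bar>"] by simp
  then have "((f \<bar>t\<bar>)\<^sup>2)\<^sup>2 \<le> (sqrt 2 * \<bar>t\<bar>)\<^sup>2" by (intro power_mono) auto
  then show ?thesis by (simp add: f_abs power_mult_distrib flip: power_mult)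
qed

text \<open>These are f f' and f^3 f', the derivatives of f^2 / 2 and f^4 / 4: the nonlinearities of
  the dual equation.\<close>

definition ff1 where "ff1 t = f t / sqrt (1 + 2 * (f t)\<^sup>2)"
definition f3f1 where "f3f1 t = (f t) ^ 3 / sqrt (1 + 2 * (f t)\<^sup>2)"

lemma sqrt_deriv: "((\<lambda>s. sqrt (1 + 2 * s\<^sup>2)) has_real_derivative 2 * s / sqrt (1 + 2 * s\<^sup>2)) (at s)"
proof -
  have "((\<lambda>s. sqrt (1 + 2 * s\<^sup>2)) has_real_derivative inverse (sqrt (1 + 2 * s\<^sup>2)) / 2 * (4 * s)) (at s)"
    by (rule DERIV_chain2[where f = sqrt and g = "\<lambda>s. 1 + 2 * s\<^sup>2", OF DERIV_real_sqrt[OF sqrt_pos(3)]]) (auto intro!: derivative_eq_intros)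
  then show ?thesis by (rule DERIV_cong) (simp add: inverse_eq_divide)
qed

lemma half_f2_deriv: "((\<lambda>t. (f t)\<^sup>2 / 2) has_real_derivative ff1 t) (at t)"
  by (auto intro!: derivative_eq_intros f_deriv simp: ff1_def)

lemma quarter_f4_deriv: "((\<lambda>t. (f t) ^ 4 / 4) has_real_derivative f3f1 t) (at t)"
  by (auto intro!: derivative_eq_intros f_deriv simp: f3f1_def)

lemma ff1_deriv: "(ff1 has_real_derivative 1 / (1 + 2 * (f t)\<^sup>2)\<^sup>2) (at t)"
proof -
  let ?s = "f t" and ?r = "sqrt (1 + 2 * (f t)\<^sup>2)"
  have "((\<lambda>s. s / sqrt (1 + 2 * s\<^sup>2)) has_real_derivative (1 * ?r - ?s * (2 * ?s / ?r)) / (?r * ?r)) (at ?s)"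
    using sqrt_pos(1)[of ?s] by (intro DERIV_divide DERIV_ident sqrt_deriv) simp
  from DERIV_chain2[OF this f_deriv[of t]]
  have "(ff1 has_real_derivative ((1 * ?r - ?s * (2 * ?s / ?r)) / (?r * ?r)) * (1 / ?r)) (at t)"
    unfolding ff1_def[abs_def] .
  moreover have "((1 * ?r - ?s * (2 * ?s / ?r)) / (?r * ?r)) * (1 / ?r) = (?r * ?r - 2 * ?s\<^sup>2) / ((?r * ?r) * (?r * ?r))"
    using sqrt_pos(1)[of ?s] by (simp add: divide_simps power2_eq_square) 
  ultimately show ?thesis using sqrt_pos(2)[of ?s] by (simp add: power2_eq_square)
qed

lemma f3f1_deriv: "(f3f1 has_real_derivative (3 * (f t)\<^sup>2 + 4 * (f t) ^ 4) / (1 + 2 * (f t)\<^sup>2)\<^sup>2) (at t)"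
proof -
  let ?s = "f t" and ?r = "sqrt (1 + 2 * (f t)\<^sup>2)"
  have c: "((\<lambda>s. s ^ 3) has_real_derivative 3 * ?s\<^sup>2) (at ?s)" by (auto intro!: derivative_eq_intros)
  have "((\<lambda>s. s ^ 3 / sqrt (1 + 2 * s\<^sup>2)) has_real_derivative (3 * ?s\<^sup>2 * ?r - ?s ^ 3 * (2 * ?s / ?r)) / (?r * ?r)) (at ?s)"
    using sqrt_pos(1)[of ?s] by (intro DERIV_divide c sqrt_deriv) simp
  from DERIV_chain2[OF this f_deriv[of t]]
  have "(f3f1 has_real_derivative ((3 * ?s\<^sup>2 * ?r - ?s ^ 3 * (2 * ?s / ?r)) / (?r * ?r)) * (1 / ?r)) (at t)"
    unfolding f3f1_def[abs_def] .
  moreover have "((3 * ?s\<^sup>2 * ?r - ?s ^ 3 * (2 * ?s / ?r)) / (?r * ?r)) * (1 / ?r) = (3 * ?s\<^sup>2 * (?r * ?r) - 2 * ?s ^ 4) / ((?r * ?r) * (?r * ?r))"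
    using sqrt_pos(1)[of ?s] by (simp add: divide_simps power2_eq_square power3_eq_cube power4_eq_xxxx)
  moreover have "3 * ?s\<^sup>2 * (1 + 2 * ?s\<^sup>2) - 2 * ?s ^ 4 = 3 * ?s\<^sup>2 + 4 * ?s ^ 4"
    by (simp add: algebra_simps power2_eq_square power4_eq_xxxx)
  ultimately show ?thesis
    unfolding sqrt_pos(2) by (simp only: power2_eq_square[of "1 + 2 * ?s\<^sup>2"])
qed

lemma second_order_bound:
  fixes F F' F'' :: "real \<Rightarrow> real"
  assumes d1: "\<And>t. (F has_real_derivative F' t) (at t)" and d2: "\<And>t. (F' has_real_derivative F'' t) (at t)"
    and b: "\<And>t. 0 \<le> F'' t" "\<And>t. F'' t \<le> K"
  shows "\<bar>F (v + h) - F v - F' v * h\<bar> \<le> K / 2 * h\<^sup>2"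
proof (cases "h = 0")
  case False
  define diff where "diff m = (if m = 0 then F else if m = 1 then F' else F'')" for m :: nat
  have "\<exists>t. (if v + h < v then v + h < t \<and> t < v else v < t \<and> t < v + h) \<and>
      F (v + h) = (\<Sum>m<2. (diff m v / fact m) * (v + h - v) ^ m) + (diff 2 t / fact 2) * (v + h - v) ^ 2"
  proof (rule Taylor[of 2 diff F "v - \<bar>h\<bar>" "v + \<bar>h\<bar>"])
    show "\<forall>(m::nat) t. m < 2 \<and> v - \<bar>h\<bar> \<le> t \<and> t \<le> v + \<bar>h\<bar> \<longrightarrow> (diff m has_real_derivative diff (Suc m) t) (at t)"
    proof (intro allI impI)
      fix m :: nat and t assume "m < 2 \<and> v - \<bar>h\<bar> \<le> t \<and> t \<le> v + \<bar>h\<bar>"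
      then have "m = 0 \<or> m = 1" by linarith
      then show "(diff m has_real_derivative diff (Suc m) t) (at t)"
        using d1[of t] d2[of t] unfolding diff_def by (elim disjE) simp_all
    qed
  qed (use False in \<open>simp_all add: diff_def\<close>)
  then obtain t where t: "F (v + h) = (\<Sum>m<2. (diff m v / fact m) * (v + h - v) ^ m) + (diff 2 t / fact 2) * (v + h - v) ^ 2"
    by (elim exE conjE) (rule that)
  have s: "{..<2} = {0, 1::nat}" by auto
  have "F (v + h) = F v + F' v * h + F'' t / 2 * h\<^sup>2"
    unfolding t s by (simp add: diff_def)
  moreover have "0 \<le> F'' t / 2 * h\<^sup>2" "F'' t / 2 * h\<^sup>2 \<le> K / 2 * h\<^sup>2"
    using b[of t] by (auto intro!: mult_right_mono)
  ultimately show ?thesis by simp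
qed simp

section \<open>The energy and its derivative\<close>

lemma f_measurable[measurable]: "f \<in> borel_measurable borel" "ff1 \<in> borel_measurable borel" "f3f1 \<in> borel_measurable borel"
  using isCont_f DERIV_isCont[OF ff1_deriv] DERIV_isCont[OF f3f1_deriv]
  by (auto intro!: borel_measurable_continuous_onI continuous_at_imp_continuous_on)

lemma abs_ff1_le: "\<bar>ff1 t\<bar> \<le> \<bar>t\<bar>"
proof -
  have "\<bar>ff1 t\<bar> = \<bar>f t\<bar> / sqrt (1 + 2 * (f t)\<^sup>2)" using sqrt_pos(3)[of "f t"] by (simp add: ff1_def abs_divide)
  also have "\<dots> \<le> \<bar>f t\<bar> / 1" using sqrt_pos(1,4)[of "f t"] by (intro divide_left_mono mult_pos_pos) simp_all
  finally show ?thesis using abs_f_le[of t] by simp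
qed

text \<open>In the square, the denominator 1 + 2 f^2 absorbs one factor f^2; what is left is f^4 /
  2, which grows quadratically.\<close>

lemma abs_f3f1_le: "\<bar>f3f1 t\<bar> \<le> \<bar>t\<bar>"
proof -
  have p: "1 + 2 * (f t)\<^sup>2 > 0" by (rule sqrt_pos(3))
  have "(f3f1 t)\<^sup>2 = ((f t)\<^sup>2 * (f t) ^ 4) / (1 + 2 * (f t)\<^sup>2)"
    using p by (simp add: f3f1_def power_divide flip: power_mult power_add)
  also have "\<dots> \<le> (f t) ^ 4 / 2"
  proof -
    have "((f t)\<^sup>2 * (f t) ^ 4) * 2 \<le> (f t) ^ 4 * (1 + 2 * (f t)\<^sup>2)" by (simp add: algebra_simps)
    then show ?thesis using p by (simp add: divide_simps)
  qed
  also have "\<dots> \<le> t\<^sup>2" using f_pow4_le[of t] by simp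
  finally show ?thesis by (simp add: abs_le_square_iff)
qed

definition Pot :: "real \<Rightarrow> 'a::euclidean_space \<Rightarrow> real \<Rightarrow> real" where
  "Pot \<omega> x t = ((norm x)\<^sup>2 - \<omega>) * ((f t)\<^sup>2 / 2) + (f t) ^ 4 / 4"

definition dPot :: "real \<Rightarrow> 'a::euclidean_space \<Rightarrow> real \<Rightarrow> real" where
  "dPot \<omega> x t = ((norm x)\<^sup>2 - \<omega>) * ff1 t + f3f1 t"

text \<open>One majorant for the potential, its derivative and its second-order remainder: the first
  two summands cover the coefficient \<open>(norm x)\<^sup>2 - \<omega>\<close>, the 2 covers the
  quartic part.\<close>

definition weight :: "real \<Rightarrow> 'a::euclidean_space \<Rightarrow> real" where
  "weight \<omega> x = (norm x)\<^sup>2 + \<bar>\<omega>\<bar> + 2"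

lemma weight_ge: "weight \<omega> x \<ge> 2" "\<bar>(norm x)\<^sup>2 - \<omega>\<bar> + 2 \<le> weight \<omega> x"
  unfolding weight_def using zero_le_power2[of "norm x"] by linarith+

lemma Pot_bound: "\<bar>Pot \<omega> x t\<bar> \<le> weight \<omega> x * t\<^sup>2"
proof -
  have "\<bar>Pot \<omega> x t\<bar> \<le> \<bar>(norm x)\<^sup>2 - \<omega>\<bar> * ((f t)\<^sup>2 / 2) + (f t) ^ 4 / 4"
    unfolding Pot_def by (rule order_trans[OF abs_triangle_ineq]) (simp add: abs_mult)
  also have "\<dots> \<le> \<bar>(norm x)\<^sup>2 - \<omega>\<bar> * t\<^sup>2 + 2 * t\<^sup>2"
    using f_sq_le[of t] f_pow4_le[of t] zero_le_power2[of t] zero_le_power2[of "f t"]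
    by (intro add_mono mult_left_mono abs_ge_zero; linarith)
  also have "\<dots> = (\<bar>(norm x)\<^sup>2 - \<omega>\<bar> + 2) * t\<^sup>2" by (simp add: algebra_simps)
  also have "\<dots> \<le> weight \<omega> x * t\<^sup>2" by (intro mult_right_mono weight_ge) auto
  finally show ?thesis .
qed

lemma dPot_bound: "\<bar>dPot \<omega> x t\<bar> \<le> weight \<omega> x * \<bar>t\<bar>"
proof -
  have "\<bar>dPot \<omega> x t\<bar> \<le> \<bar>(norm x)\<^sup>2 - \<omega>\<bar> * \<bar>ff1 t\<bar> + \<bar>f3f1 t\<bar>"
    unfolding dPot_def by (rule order_trans[OF abs_triangle_ineq]) (simp add: abs_mult)
  also have "\<dots> \<le> \<bar>(norm x)\<^sup>2 - \<omega>\<bar> * \<bar>t\<bar> + 2 * \<bar>t\<bar>"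
    using abs_ff1_le[of t] abs_f3f1_le[of t] by (intro add_mono mult_left_mono) auto
  also have "\<dots> = (\<bar>(norm x)\<^sup>2 - \<omega>\<bar> + 2) * \<bar>t\<bar>" by (simp add: algebra_simps)
  also have "\<dots> \<le> weight \<omega> x * \<bar>t\<bar>" by (intro mult_right_mono weight_ge) auto
  finally show ?thesis .
qed

text \<open>The second derivatives of f^2 / 2 and f^4 / 4 lie in [0, 1] and [0, 3/2] everywhere, so
  the Taylor remainder is quadratic with a constant independent of \<open>t\<close>.\<close>

lemma Pot_remainder: "\<bar>Pot \<omega> x (t + h) - Pot \<omega> x t - dPot \<omega> x t * h\<bar> \<le> weight \<omega> x * h\<^sup>2"
proof -
  have 1: "\<bar>(f (t + h))\<^sup>2 / 2 - (f t)\<^sup>2 / 2 - ff1 t * h\<bar> \<le> 1 / 2 * h\<^sup>2"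
  proof (rule second_order_bound[OF half_f2_deriv ff1_deriv])
    fix s
    have "1 \<le> (1 + 2 * (f s)\<^sup>2)\<^sup>2" by (rule one_le_power) simp
    then show "1 / (1 + 2 * (f s)\<^sup>2)\<^sup>2 \<le> 1" by (simp add: divide_le_eq)
  qed simp
  have 2: "\<bar>(f (t + h)) ^ 4 / 4 - (f t) ^ 4 / 4 - f3f1 t * h\<bar> \<le> (3 / 2) / 2 * h\<^sup>2"
  proof (rule second_order_bound[OF quarter_f4_deriv f3f1_deriv])
    fix s
    have p: "(1 + 2 * (f s)\<^sup>2)\<^sup>2 > 0" using sqrt_pos(3)[of "f s"] by (rule zero_less_power)
    show "0 \<le> (3 * (f s)\<^sup>2 + 4 * f s ^ 4) / (1 + 2 * (f s)\<^sup>2)\<^sup>2" by simp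
    have "2 * (3 * (f s)\<^sup>2 + 4 * f s ^ 4) \<le> 3 * (1 + 2 * (f s)\<^sup>2)\<^sup>2"
      by (simp add: power2_sum power_mult_distrib algebra_simps flip: power_mult)
    then show "(3 * (f s)\<^sup>2 + 4 * f s ^ 4) / (1 + 2 * (f s)\<^sup>2)\<^sup>2 \<le> 3 / 2"
      using p by (simp add: divide_le_eq)
  qed
  let ?A = "(f (t + h))\<^sup>2 / 2 - (f t)\<^sup>2 / 2 - ff1 t * h"
  let ?B = "(f (t + h)) ^ 4 / 4 - (f t) ^ 4 / 4 - f3f1 t * h"
  have "Pot \<omega> x (t + h) - Pot \<omega> x t - dPot \<omega> x t * h = ((norm x)\<^sup>2 - \<omega>) * ?A + ?B"
    unfolding Pot_def dPot_def by (simp add: algebra_simps)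
  also have "\<bar>\<dots>\<bar> \<le> \<bar>(norm x)\<^sup>2 - \<omega>\<bar> * \<bar>?A\<bar> + \<bar>?B\<bar>"
    by (rule order_trans[OF abs_triangle_ineq]) (simp add: abs_mult)
  also have "\<dots> \<le> \<bar>(norm x)\<^sup>2 - \<omega>\<bar> * h\<^sup>2 + 2 * h\<^sup>2"
    using 1 2 zero_le_power2[of h] by (intro add_mono mult_left_mono) linarith+
  also have "\<dots> = (\<bar>(norm x)\<^sup>2 - \<omega>\<bar> + 2) * h\<^sup>2" by (simp add: algebra_simps)
  also have "\<dots> \<le> weight \<omega> x * h\<^sup>2" by (intro mult_right_mono weight_ge) auto
  finally show ?thesis .
qed

lemma weight_measurable[measurable]: "weight \<omega> \<in> borel_measurable borel"
  unfolding weight_def[abs_def] by measurable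

lemma Pot_measurable[measurable (raw)]:
  assumes [measurable]: "v \<in> borel_measurable borel"
  shows "(\<lambda>x. Pot \<omega> x (v x)) \<in> borel_measurable borel"
  unfolding Pot_def by measurable

lemma dPot_measurable[measurable (raw)]:
  assumes [measurable]: "v \<in> borel_measurable borel"
  shows "(\<lambda>x. dPot \<omega> x (v x)) \<in> borel_measurable borel"
  unfolding dPot_def by measurable

lemma weight_sq_integrable:
  assumes "Hpair u g"
  shows "integrable lborel (\<lambda>x. weight \<omega> x * (u x)\<^sup>2)"
proof -
  have "integrable lborel (\<lambda>x. (norm x)\<^sup>2 * (u x)\<^sup>2 + (\<bar>\<omega>\<bar> + 2) * (u x)\<^sup>2)"
    using Hpair_pot[OF assms] Hpair_sq[OF assms] by auto
  then show ?thesis by (simp add: weight_def algebra_simps)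
qed

lemma weight_prod_integrable:
  assumes u: "Hpair u g" and v: "Hpair v h"
  shows "integrable lborel (\<lambda>x. weight \<omega> x * \<bar>u x\<bar> * \<bar>v x\<bar>)"
proof (rule integrable_comparison)
  note [measurable] = Hpair_meas[OF u] Hpair_meas[OF v]
  show "integrable lborel (\<lambda>x. weight \<omega> x * (u x)\<^sup>2 + weight \<omega> x * (v x)\<^sup>2)"
    by (intro Bochner_Integration.integrable_add weight_sq_integrable[OF u] weight_sq_integrable[OF v])
  show "(\<lambda>x. weight \<omega> x * \<bar>u x\<bar> * \<bar>v x\<bar>) \<in> borel_measurable lborel" by measurable
  fix x
  have "\<bar>u x\<bar> * \<bar>v x\<bar> \<le> (u x)\<^sup>2 + (v x)\<^sup>2"
    using two_norm_mult_le[of "u x" "v x"] mult_nonneg_nonneg[OF abs_ge_zero[of "u x"] abs_ge_zero[of "v x"]]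
    unfolding real_norm_def power2_abs by linarith
  then have "weight \<omega> x * (\<bar>u x\<bar> * \<bar>v x\<bar>) \<le> weight \<omega> x * ((u x)\<^sup>2 + (v x)\<^sup>2)"
    using weight_ge(1)[of \<omega> x] by (intro mult_left_mono) auto
  then show "\<bar>weight \<omega> x * \<bar>u x\<bar> * \<bar>v x\<bar>\<bar> \<le> weight \<omega> x * (u x)\<^sup>2 + weight \<omega> x * (v x)\<^sup>2"
    using weight_ge(1)[of \<omega> x] by (simp add: algebra_simps abs_mult)
qed

lemma Pot_integrable:
  assumes "Hpair u g"
  shows "integrable lborel (\<lambda>x. Pot \<omega> x (u x))"
  by (rule integrable_comparison[OF weight_sq_integrable[OF assms] _ Pot_bound]) (use Hpair_meas[OF assms] in measurable)

lemma dPot_integrable: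
  assumes u: "Hpair u g" and v: "Hpair v h"
  shows "integrable lborel (\<lambda>x. dPot \<omega> x (u x) * v x)"
proof (rule integrable_comparison[OF weight_prod_integrable[OF u v]])
  note [measurable] = Hpair_meas[OF u] Hpair_meas[OF v]
  show "(\<lambda>x. dPot \<omega> x (u x) * v x) \<in> borel_measurable lborel" by measurable
  show "\<bar>dPot \<omega> x (u x) * v x\<bar> \<le> weight \<omega> x * \<bar>u x\<bar> * \<bar>v x\<bar>" for x
    using dPot_bound[of \<omega> x "u x"] by (simp add: abs_mult mult_right_mono)
qed

section \<open>The energy with explicit gradient, its first variation and criticality\<close>

definition energy_pair :: "real \<Rightarrow> ('a::euclidean_space \<Rightarrow> real) \<Rightarrow> ('a \<Rightarrow> 'a) \<Rightarrow> real" where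
  "energy_pair \<omega> v g = (\<integral>x. (norm (g x))\<^sup>2 / 2 \<partial>lborel) + (\<integral>x. Pot \<omega> x (v x) \<partial>lborel)"

definition energy_deriv :: "real \<Rightarrow> ('a::euclidean_space \<Rightarrow> real) \<Rightarrow> ('a \<Rightarrow> 'a) \<Rightarrow> ('a \<Rightarrow> real) \<Rightarrow> ('a \<Rightarrow> 'a) \<Rightarrow> real" where
  "energy_deriv \<omega> v g h k = (\<integral>x. g x \<bullet> k x + dPot \<omega> x (v x) * h x \<partial>lborel)"

lemma energy_deriv_integrable:
  assumes u: "Hpair u g" and v: "Hpair v h"
  shows "integrable lborel (\<lambda>x. g x \<bullet> h x + dPot \<omega> x (u x) * v x)"
  by (intro Bochner_Integration.integrable_add dPot_integrable[OF u v]
      L2_fun_inner_integrable[OF Hpair_L2(2)[OF u] Hpair_L2(2)[OF v]])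

lemma energy_eq:
  assumes v: "Hpair v g"
  shows "energy harm \<omega> v = energy_pair \<omega> v g"
proof -
  note [measurable] = Hpair_meas[OF v] Hpair_meas(2)[OF H_space_Hpair[OF Hpair_H_space[OF v]]]
  have i1: "integrable lborel (\<lambda>x. (f (v x))\<^sup>2)"
    by (rule integrable_comparison[OF Hpair_sq(1)[OF v]]) (use f_sq_le in auto)
  have i2: "integrable lborel (\<lambda>x. (norm x)\<^sup>2 * (f (v x))\<^sup>2)"
    by (rule integrable_comparison[OF Hpair_pot[OF v]]) (use f_sq_le in \<open>auto simp: abs_mult intro!: mult_left_mono\<close>)
  have i4: "integrable lborel (\<lambda>x. (f (v x)) ^ 4)"
  proof (rule integrable_comparison)
    show "integrable lborel (\<lambda>x. 2 * (v x)\<^sup>2)" using Hpair_sq(1)[OF v] by auto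
    show "\<bar>(f (v x)) ^ 4\<bar> \<le> 2 * (v x)\<^sup>2" for x using f_pow4_le[of "v x"] by simp
  qed measurable
  have "(\<integral>x. Pot \<omega> x (v x) \<partial>lborel) = 1/2 * (\<integral>x. ((norm x)\<^sup>2 - \<omega>) * (f (v x))\<^sup>2 \<partial>lborel) + 1/4 * (\<integral>x. (f (v x)) ^ 4 \<partial>lborel)"
    unfolding Pot_def using i1 i2 i4 by (simp add: left_diff_distrib)
  moreover have "(\<integral>x. (norm (weak_gradient v x))\<^sup>2 \<partial>lborel) = (\<integral>x. (norm (g x))\<^sup>2 \<partial>lborel)"
    by (rule integral_cong_AE) (use Hpair_gradient_AE[OF v] in \<open>auto elim!: eventually_mono\<close>)
  ultimately show ?thesis by (simp add: energy_def energy_pair_def)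
qed

text \<open>The 1 pays for the gradient and the harmonic part;
  \<open>\<bar>\<omega>\<bar> + 2\<close> is the bounded part of \<open>weight\<close>, and 18 is
  the constant of \<open>L2_le_Qform\<close>.\<close>

definition remainder_const :: "real \<Rightarrow> real" where "remainder_const \<omega> = 1 + 18 * (\<bar>\<omega>\<bar> + 2)"

lemma remainder_const_pos: "remainder_const \<omega> > 0" by (simp add: remainder_const_def)

text \<open>The error is quadratic in the norm of H, uniformly in the base point. This single
  estimate extracts the weak equation from criticality and, conversely, criticality from
  minimality.\<close>

lemma energy_expansion:
  assumes v: "Hpair v g" and h: "Hpair h k"
  shows "\<bar>energy_pair \<omega> (\<lambda>x. v x + h x) (\<lambda>x. g x + k x) - energy_pair \<omega> v g - energy_deriv \<omega> v g h k\<bar> \<le> remainder_const \<omega> * Qform h k"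
proof -
  note s = Hpair_add[OF v h]
  note i = Hpair_sq(2)[OF v] Hpair_sq(2)[OF h] Hpair_sq(2)[OF s] L2_fun_inner_integrable[OF Hpair_L2(2)[OF v] Hpair_L2(2)[OF h]]
    Pot_integrable[OF v, of \<omega>] Pot_integrable[OF s, of \<omega>] dPot_integrable[OF v h, of \<omega>] weight_sq_integrable[OF h, of \<omega>]
  let ?R = "\<lambda>x. Pot \<omega> x (v x + h x) - Pot \<omega> x (v x) - dPot \<omega> x (v x) * h x"
  have 1: "(\<integral>x. (norm (g x + k x))\<^sup>2 / 2 \<partial>lborel) = (\<integral>x. (norm (g x))\<^sup>2 / 2 \<partial>lborel) + (\<integral>x. g x \<bullet> k x \<partial>lborel) + (\<integral>x. (norm (k x))\<^sup>2 / 2 \<partial>lborel)"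
  proof -
    have "(norm (g x + k x))\<^sup>2 / 2 = (norm (g x))\<^sup>2 / 2 + g x \<bullet> k x + (norm (k x))\<^sup>2 / 2" for x
      by (simp add: power2_norm_eq_inner inner_add inner_commute)
    then show ?thesis using i by simp
  qed
  have R: "(\<integral>x. ?R x \<partial>lborel) = (\<integral>x. Pot \<omega> x (v x + h x) \<partial>lborel) - (\<integral>x. Pot \<omega> x (v x) \<partial>lborel) - (\<integral>x. dPot \<omega> x (v x) * h x \<partial>lborel)"
    using i by simp
  have "\<bar>\<integral>x. ?R x \<partial>lborel\<bar> \<le> (\<integral>x. weight \<omega> x * (h x)\<^sup>2 \<partial>lborel)"
    by (rule integral_abs_bound_integral) (use i Pot_remainder in auto)
  also have "\<dots> = (\<integral>x. (norm x)\<^sup>2 * (h x)\<^sup>2 \<partial>lborel) + (\<bar>\<omega>\<bar> + 2) * (\<integral>x. (h x)\<^sup>2 \<partial>lborel)"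
    using Hpair_pot[OF h] Hpair_sq(1)[OF h] by (simp add: weight_def distrib_right)
  also have "\<dots> \<le> (\<integral>x. (norm x)\<^sup>2 * (h x)\<^sup>2 \<partial>lborel) + (\<bar>\<omega>\<bar> + 2) * (18 * Qform h k)"
    by (intro add_left_mono mult_left_mono L2_le_Qform h) auto
  finally have "\<bar>\<integral>x. ?R x \<partial>lborel\<bar> \<le> (\<integral>x. (norm x)\<^sup>2 * (h x)\<^sup>2 \<partial>lborel) + (\<bar>\<omega>\<bar> + 2) * (18 * Qform h k)" .
  moreover have "energy_pair \<omega> (\<lambda>x. v x + h x) (\<lambda>x. g x + k x) - energy_pair \<omega> v g - energy_deriv \<omega> v g h k = (\<integral>x. (norm (k x))\<^sup>2 / 2 \<partial>lborel) + (\<integral>x. ?R x \<partial>lborel)"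
    unfolding energy_pair_def energy_deriv_def 1 R using i by simp
  moreover have "(\<integral>x. (norm (k x))\<^sup>2 \<partial>lborel) \<ge> 0" by (rule Bochner_Integration.integral_nonneg) simp
  moreover have "(\<integral>x. (norm (k x))\<^sup>2 / 2 \<partial>lborel) = (\<integral>x. (norm (k x))\<^sup>2 \<partial>lborel) / 2" by simp
  moreover have "remainder_const \<omega> * Qform h k = Qform h k + (\<bar>\<omega>\<bar> + 2) * (18 * Qform h k)"
    by (simp add: remainder_const_def algebra_simps)
  ultimately show ?thesis using Qform_split[OF h] by linarith
qed

lemma energy_deriv_scale: "energy_deriv \<omega> v g (\<lambda>x. c * h x) (\<lambda>x. c *\<^sub>R k x) = c * energy_deriv \<omega> v g h k"
  unfolding energy_deriv_def by (simp add: distrib_left mult_ac flip: integral_mult_right_zero)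

text \<open>Along \<open>t h\<close> the first variation contributes order t, the expansion error
  order t^2, and criticality allows at most a small multiple of t; so the first variation is
  arbitrarily small.\<close>

lemma critical_point_energy_deriv:
  assumes v: "Hpair v g" and crit: "critical_point harm (energy harm \<omega>) v" and h: "Hpair h k"
  shows "energy_deriv \<omega> v g h k = 0"
proof -
  define N where "N = sqrt (Qform h k)"
  have n: "N \<ge> 0" unfolding N_def using Qform_nonneg[of h k] by simp
  have "\<bar>energy_deriv \<omega> v g h k\<bar> \<le> e * (N + 1)" if e: "e > 0" for e
  proof -
    obtain d where d: "d > 0" and D: "\<And>h. h \<in> H_space harm \<Longrightarrow> H_norm harm h < d \<Longrightarrow>
        \<bar>energy harm \<omega> (\<lambda>x. v x + h x) - energy harm \<omega> v\<bar> \<le> e * H_norm harm h"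
      using crit e unfolding critical_point_def by blast
    \<comment> \<open>The first entry brings \<open>t h\<close> within the distance
      \<open>d\<close>, the second makes the quadratic error at most \<open>t * e\<close>. The
      summands 1 guard against zero denominators.\<close>
    define t where "t = min (d / (N + 1) / 2) (e / (remainder_const \<omega> * Qform h k + 1))"
    have KQ: "remainder_const \<omega> * Qform h k \<ge> 0" using remainder_const_pos[of \<omega>] Qform_nonneg[of h k] by simp
    have t: "t > 0" unfolding t_def using d e n KQ by (auto intro!: divide_pos_pos)
    have td: "t * N < d"
    proof -
      have "t * (N + 1) \<le> (d / (N + 1) / 2) * (N + 1)" unfolding t_def using n by (intro mult_right_mono) auto
      also have "\<dots> = d / 2" proof -
        have "N + 1 \<noteq> 0" using n by linarith
        then show ?thesis by (simp only: times_divide_eq_left) simp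
      qed
      finally show ?thesis using t d by (simp add: distrib_left)
    qed
    have tK: "t * (remainder_const \<omega> * Qform h k) \<le> e"
    proof -
      have "t * (remainder_const \<omega> * Qform h k + 1) \<le> (e / (remainder_const \<omega> * Qform h k + 1)) * (remainder_const \<omega> * Qform h k + 1)" unfolding t_def using KQ by (intro mult_right_mono) auto
      also have "\<dots> = e" using KQ by simp
      finally show ?thesis using t by (simp add: distrib_left)
    qed
    note th = Hpair_scale[OF h, of t]
    have nt: "H_norm harm (\<lambda>x. t * h x) = t * N"
      unfolding H_norm_eq[OF th] Qform_scale N_def using t by (simp add: real_sqrt_mult)
    have "\<bar>energy_pair \<omega> (\<lambda>x. v x + t * h x) (\<lambda>x. g x + t *\<^sub>R k x) - energy_pair \<omega> v g\<bar> \<le> e * (t * N)"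
      using D[OF Hpair_H_space[OF th]] td unfolding nt energy_eq[OF Hpair_add[OF v th]] energy_eq[OF v] by simp
    moreover have "\<bar>energy_pair \<omega> (\<lambda>x. v x + t * h x) (\<lambda>x. g x + t *\<^sub>R k x) - energy_pair \<omega> v g - t * energy_deriv \<omega> v g h k\<bar> \<le> t * (t * (remainder_const \<omega> * Qform h k))"
      using energy_expansion[OF v th, of \<omega>] unfolding energy_deriv_scale Qform_scale by (simp add: power2_eq_square mult_ac)
    moreover have "t * (t * (remainder_const \<omega> * Qform h k)) \<le> t * e" using tK t by (intro mult_left_mono) auto
    ultimately have "\<bar>t * energy_deriv \<omega> v g h k\<bar> \<le> e * (t * N) + t * e" by linarith
    then have "t * \<bar>energy_deriv \<omega> v g h k\<bar> \<le> t * (e * (N + 1))" using t by (simp add: abs_mult algebra_simps)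
    then show ?thesis using t by simp
  qed
  \<comment> \<open>Apply the bound with \<open>e' / (N + 1)\<close> in place of
    \<open>e\<close>.\<close>
  then have "\<bar>energy_deriv \<omega> v g h k\<bar> \<le> 0 + e'" if "e' > 0" for e'
    using that n by (metis add_0 add_nonneg_pos divide_pos_pos less_numeral_extra(1) nonzero_eq_divide_eq less_irrefl)
  then have "\<bar>energy_deriv \<omega> v g h k\<bar> \<le> 0" by (rule field_le_epsilon)
  then show ?thesis by simp
qed

text \<open>A nonzero first variation would lower the energy below its minimum. Once it vanishes,
  the quadratic expansion error is itself of smaller order than the norm, which is Frechet
  differentiability with derivative zero.\<close>

lemma minimizer_critical:
  fixes v :: "'a::euclidean_space \<Rightarrow> real"
  assumes v: "Hpair v g" and min: "\<And>(w :: 'a \<Rightarrow> real) k. Hpair w k \<Longrightarrow> energy_pair \<omega> v g \<le> energy_pair \<omega> w k"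
  shows "critical_point harm (energy harm \<omega>) v"
proof -
  have L0: "energy_deriv \<omega> v g h k = 0" if h: "Hpair h k" for h k
  proof (rule ccontr)
    assume L: "energy_deriv \<omega> v g h k \<noteq> 0"
    define C where "C = remainder_const \<omega> * Qform h k + 1"
    have C: "C > 0" using remainder_const_pos[of \<omega>] Qform_nonneg[of h k] by (simp add: C_def add_nonneg_pos)
    \<comment> \<open>The vertex of the parabola \<open>t L + t^2 C\<close>, where \<open>L\<close>
      is the first variation; its value is \<open>- L^2 / (4 C)\<close>.\<close>
    define t where "t = - energy_deriv \<omega> v g h k / (2 * C)"
    note th = Hpair_scale[OF h, of t]
    have "0 \<le> energy_pair \<omega> (\<lambda>x. v x + t * h x) (\<lambda>x. g x + t *\<^sub>R k x) - energy_pair \<omega> v g"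
      using min[OF Hpair_add[OF v th]] by simp
    also have "\<dots> \<le> t * energy_deriv \<omega> v g h k + t\<^sup>2 * (remainder_const \<omega> * Qform h k)"
      using energy_expansion[OF v th, of \<omega>] unfolding energy_deriv_scale Qform_scale by (simp add: mult_ac abs_le_iff)
    also have "\<dots> \<le> t * energy_deriv \<omega> v g h k + t\<^sup>2 * C"
      by (intro add_left_mono mult_left_mono) (auto simp: C_def)
    also have "\<dots> = - (energy_deriv \<omega> v g h k)\<^sup>2 / (4 * C)"
      using C by (simp add: t_def power2_eq_square field_simps)
    also have "\<dots> < 0" using L C by (simp add: divide_neg_pos)
    finally show False by simp
  qed
  show ?thesis
    unfolding critical_point_def
  proof (intro conjI allI impI)
    show "v \<in> H_space harm" by (rule Hpair_H_space[OF v])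
    fix e :: real assume e: "e > 0"
    show "\<exists>d>0. \<forall>h\<in>H_space harm. H_norm harm h < d \<longrightarrow> \<bar>energy harm \<omega> (\<lambda>x. v x + h x) - energy harm \<omega> v\<bar> \<le> e * H_norm harm h"
    proof (intro exI[of _ "e / remainder_const \<omega>"] conjI ballI impI)
      show "e / remainder_const \<omega> > 0" using e remainder_const_pos by simp
      fix h :: "'a \<Rightarrow> real" assume "h \<in> H_space harm" and n: "H_norm harm h < e / remainder_const \<omega>"
      then have h: "Hpair h (weak_gradient h)" by (intro H_space_Hpair)
      let ?n = "H_norm harm h"
      have nn: "?n \<ge> 0" "?n * ?n = Qform h (weak_gradient h)"
        unfolding H_norm_eq[OF h] using Qform_nonneg[of h "weak_gradient h"] by auto
      have "\<bar>energy harm \<omega> (\<lambda>x. v x + h x) - energy harm \<omega> v\<bar> \<le> remainder_const \<omega> * (?n * ?n)"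
        unfolding energy_eq[OF Hpair_add[OF v h]] energy_eq[OF v] nn
        using energy_expansion[OF v h, of \<omega>] L0[OF h] by simp
      also have "\<dots> = (remainder_const \<omega> * ?n) * ?n" by simp
      also have "\<dots> \<le> e * ?n"
        using n nn remainder_const_pos[of \<omega>] by (intro mult_right_mono) (auto simp: pos_less_divide_eq mult.commute)
      finally show "\<bar>energy harm \<omega> (\<lambda>x. v x + h x) - energy harm \<omega> v\<bar> \<le> e * ?n" .
    qed
  qed
qed

section \<open>A priori bounds and the eigenvalue\<close>

text \<open>The values of the composition are bounded by \<open>L\<close> times those of the
  arguments because the outer function vanishes at 0; this transfers square integrability and the
  weighted moment, which hold on the whole space and tolerate no added constant.\<close>

lemma Hpair_chain2:
  fixes \<Phi> :: "real \<times> real \<Rightarrow> real"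
  assumes 1: "Hpair u1 g1" and 2: "Hpair u2 g2"
    and S: "convex S" "0 \<in> S" "\<Phi> 0 = 0" and inS: "AE x in lborel. (u1 x, u2 x) \<in> S"
    and der: "\<And>p. p \<in> S \<Longrightarrow> (\<Phi> has_derivative (\<lambda>h. D p \<bullet> h)) (at p within S)"
    and bound: "\<And>p. p \<in> S \<Longrightarrow> norm (D p) \<le> L"
    and m: "(\<lambda>x. \<Phi> (u1 x, u2 x)) \<in> borel_measurable borel"
      "(\<lambda>x. fst (D (u1 x, u2 x))) \<in> borel_measurable borel" "(\<lambda>x. snd (D (u1 x, u2 x))) \<in> borel_measurable borel"
  shows "Hpair (\<lambda>x. \<Phi> (u1 x, u2 x)) (\<lambda>x. fst (D (u1 x, u2 x)) *\<^sub>R g1 x + snd (D (u1 x, u2 x)) *\<^sub>R g2 x)"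
  unfolding Hpair_def
proof (intro conjI)
  note [measurable] = m Hpair_meas[OF 1] Hpair_meas[OF 2]
  have L: "L \<ge> 0" using bound[OF S(2)] norm_ge_zero order_trans by blast
  have Phi: "AE x in lborel. (\<Phi> (u1 x, u2 x))\<^sup>2 \<le> L\<^sup>2 * ((u1 x)\<^sup>2 + (u2 x)\<^sup>2)"
    using inS
  proof eventually_elim
    case (elim x)
    have "\<bar>\<Phi> (u1 x, u2 x)\<bar> \<le> L * norm (u1 x, u2 x)"
      using convex_gradient_lipschitz[OF S(1) der bound elim S(2)] by (simp add: S(3))
    then have "\<bar>\<Phi> (u1 x, u2 x)\<bar>\<^sup>2 \<le> (L * norm (u1 x, u2 x))\<^sup>2" by (intro power_mono) auto
    then show ?case by (simp add: power_mult_distrib norm_Pair)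
  qed
  show "L2_fun (\<lambda>x. \<Phi> (u1 x, u2 x))"
    by (rule L2_fun_bound[where w = "\<lambda>x. L\<^sup>2 * ((u1 x)\<^sup>2 + (u2 x)\<^sup>2)"])
      (use m Phi Hpair_sq[OF 1] Hpair_sq[OF 2] in auto)
  have Dle: "\<bar>fst (D p)\<bar> \<le> L" "\<bar>snd (D p)\<bar> \<le> L" if "p \<in> S" for p
    using bound[OF that] norm_fst_le[of "fst (D p)" "snd (D p)"] norm_snd_le[of "snd (D p)" "fst (D p)"] by auto
  show "L2_fun (\<lambda>x. fst (D (u1 x, u2 x)) *\<^sub>R g1 x + snd (D (u1 x, u2 x)) *\<^sub>R g2 x)"
  proof (rule L2_fun_bound[where w = "\<lambda>x. 2 * L\<^sup>2 * ((norm (g1 x))\<^sup>2 + (norm (g2 x))\<^sup>2)"])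
    show "integrable lborel (\<lambda>x. 2 * L\<^sup>2 * ((norm (g1 x))\<^sup>2 + (norm (g2 x))\<^sup>2))"
      using Hpair_sq[OF 1] Hpair_sq[OF 2] by auto
    show "AE x in lborel. (norm (fst (D (u1 x, u2 x)) *\<^sub>R g1 x + snd (D (u1 x, u2 x)) *\<^sub>R g2 x))\<^sup>2 \<le> 2 * L\<^sup>2 * ((norm (g1 x))\<^sup>2 + (norm (g2 x))\<^sup>2)"
      using inS
    proof eventually_elim
      case (elim x)
      let ?d = "D (u1 x, u2 x)"
      have "(fst ?d)\<^sup>2 \<le> L\<^sup>2" "(snd ?d)\<^sup>2 \<le> L\<^sup>2" using Dle[OF elim] power_mono[of "\<bar>fst ?d\<bar>" L 2] power_mono[of "\<bar>snd ?d\<bar>" L 2] by auto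
      then have "2 * ((fst ?d)\<^sup>2 * (norm (g1 x))\<^sup>2) + 2 * ((snd ?d)\<^sup>2 * (norm (g2 x))\<^sup>2) \<le> 2 * (L\<^sup>2 * (norm (g1 x))\<^sup>2) + 2 * (L\<^sup>2 * (norm (g2 x))\<^sup>2)"
        by (intro add_mono mult_left_mono mult_right_mono) auto
      then show ?case
        using norm_add_square_le[of "fst ?d *\<^sub>R g1 x" "snd ?d *\<^sub>R g2 x"] by (simp add: power_mult_distrib distrib_left mult.assoc)
    qed
  qed measurable
  show "is_weak_gradient (\<lambda>x. \<Phi> (u1 x, u2 x)) (\<lambda>x. fst (D (u1 x, u2 x)) *\<^sub>R g1 x + snd (D (u1 x, u2 x)) *\<^sub>R g2 x)"
    by (rule weak_gradient_chain2[OF Hpair_weak[OF 1] Hpair_weak[OF 2] S(1,2) inS der bound m])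
  show "integrable lborel (\<lambda>x. (norm x)\<^sup>2 * (\<Phi> (u1 x, u2 x))\<^sup>2)"
  proof (rule Bochner_Integration.integrable_bound)
    show "integrable lborel (\<lambda>x. L\<^sup>2 * ((norm x)\<^sup>2 * (u1 x)\<^sup>2 + (norm x)\<^sup>2 * (u2 x)\<^sup>2))"
      using Hpair_pot[OF 1] Hpair_pot[OF 2] by auto
    show "AE x in lborel. norm ((norm x)\<^sup>2 * (\<Phi> (u1 x, u2 x))\<^sup>2) \<le> norm (L\<^sup>2 * ((norm x)\<^sup>2 * (u1 x)\<^sup>2 + (norm x)\<^sup>2 * (u2 x)\<^sup>2))"
      using Phi
    proof eventually_elim
      case (elim x)
      have "(norm x)\<^sup>2 * (\<Phi> (u1 x, u2 x))\<^sup>2 \<le> (norm x)\<^sup>2 * (L\<^sup>2 * ((u1 x)\<^sup>2 + (u2 x)\<^sup>2))"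
        by (rule mult_left_mono[OF elim]) simp
      then show ?case by (simp add: abs_mult algebra_simps)
    qed
  qed measurable
qed

lemma Hpair_chain:
  assumes u: "Hpair u g" and k: "\<And>s. (k has_real_derivative k' s) (at s)" "k 0 = 0" "\<And>s. \<bar>k' s\<bar> \<le> L"
    and m: "k' \<in> borel_measurable borel"
  shows "Hpair (\<lambda>x. k (u x)) (\<lambda>x. k' (u x) *\<^sub>R g x)"
proof -
  note [measurable] = Hpair_meas[OF u] m
  have [measurable]: "k \<in> borel_measurable borel"
    using DERIV_isCont[OF k(1)] by (auto intro!: borel_measurable_continuous_onI continuous_at_imp_continuous_on)
  have der: "((\<lambda>p. k (fst p)) has_derivative (\<lambda>h. (k' (fst p), 0) \<bullet> h)) (at p)" for p :: "real \<times> real"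
  proof -
    have "(k has_derivative (*) (k' (fst p))) (at (fst p))"
      using k(1)[of "fst p"] by (simp only: has_field_derivative_def)
    from has_derivative_compose[OF bounded_linear_imp_has_derivative[OF bounded_linear_fst] this]
    show ?thesis by (simp add: inner_prod_def)
  qed
  have bound: "norm (k' (fst p), 0::real) \<le> L" for p :: "real \<times> real" using k(3)[of "fst p"] by (simp add: norm_Pair)
  show ?thesis
    using Hpair_chain2[OF u u convex_UNIV, of "\<lambda>p. k (fst p)" "\<lambda>p. (k' (fst p), 0)" L] der bound k(2) by simp
qed

lemma Hpair_f:
  assumes "Hpair v g"
  shows "Hpair (\<lambda>x. f (v x)) (\<lambda>x. (1 / sqrt (1 + 2 * (f (v x))\<^sup>2)) *\<^sub>R g x)"
proof (rule Hpair_chain[OF assms f_deriv f_0, where L = 1])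
  show "\<bar>1 / sqrt (1 + 2 * (f s)\<^sup>2)\<bar> \<le> 1" for s using sqrt_pos(3,4)[of "f s"] by (simp add: divide_le_eq_1)
qed measurable

text \<open>A differentiable stand-in for the positive part of \<open>s - M\<close>: zero up to
  \<open>M\<close>, positive beyond, with slope in [0, 1].\<close>

definition ramp :: "real \<Rightarrow> real \<Rightarrow> real" where "ramp M s = sqrt (1 + (max 0 (s - M))\<^sup>2) - 1"
definition ramp' :: "real \<Rightarrow> real \<Rightarrow> real" where "ramp' M s = max 0 (s - M) / sqrt (1 + (max 0 (s - M))\<^sup>2)"

lemma max_sq_deriv: "((\<lambda>s. (max 0 (s - M))\<^sup>2) has_real_derivative 2 * max 0 (s - M)) (at s)"
proof (cases s M rule: linorder_cases)
  case less
  have ev: "\<forall>\<^sub>F r in nhds s. (max 0 (r - M))\<^sup>2 = 0"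
    using eventually_nhds_in_open[of "{..<M}" s] less by (auto elim!: eventually_mono)
  show ?thesis by (rule DERIV_cong_ev[OF refl ev refl, THEN iffD2]) (use less in simp)
next
  case greater
  have ev: "\<forall>\<^sub>F r in nhds s. (max 0 (r - M))\<^sup>2 = (r - M)\<^sup>2"
    using eventually_nhds_in_open[of "{M<..}" s] greater by (auto elim!: eventually_mono)
  have d: "((\<lambda>r. (r - M)\<^sup>2) has_real_derivative 2 * (s - M)) (at s)"
    by (auto intro!: derivative_eq_intros)
  show ?thesis by (rule DERIV_cong_ev[OF refl ev refl, THEN iffD2]) (use greater d in simp)
next
  case equal
  have "((\<lambda>h. ((max 0 (s + h - M))\<^sup>2 - (max 0 (s - M))\<^sup>2) / h) \<longlongrightarrow> 0) (at 0)"
  proof (rule Lim_null_comparison)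
    show "((\<lambda>h::real. \<bar>h\<bar>) \<longlongrightarrow> 0) (at 0)" by (rule tendsto_rabs_zero) (rule tendsto_ident_at)
    show "\<forall>\<^sub>F h in at 0. norm (((max 0 (s + h - M))\<^sup>2 - (max 0 (s - M))\<^sup>2) / h) \<le> \<bar>h\<bar>"
      using equal by (auto simp: eventually_at max_def power2_eq_square intro!: exI[of _ 1])
  qed
  then show ?thesis using equal by (simp add: DERIV_def)
qed

lemma ramp_deriv: "(ramp M has_real_derivative ramp' M s) (at s)"
proof -
  have p: "1 + (max 0 (s - M))\<^sup>2 > 0" by (simp add: add_pos_nonneg)
  have "((\<lambda>s. 1 + (max 0 (s - M))\<^sup>2) has_real_derivative 0 + 2 * max 0 (s - M)) (at s)"
    by (intro DERIV_add DERIV_const max_sq_deriv)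
  from DERIV_chain2[OF DERIV_real_sqrt[OF p] this]
  have "((\<lambda>s. sqrt (1 + (max 0 (s - M))\<^sup>2)) has_real_derivative ramp' M s) (at s)"
    by (rule DERIV_cong) (simp add: ramp'_def inverse_eq_divide)
  from DERIV_diff[OF this DERIV_const[of 1]] show ?thesis unfolding ramp_def[abs_def] by simp
qed

lemma ramp'_bounds: "0 \<le> ramp' M s" "ramp' M s \<le> 1"
proof -
  have "max 0 (s - M) \<le> sqrt (1 + (max 0 (s - M))\<^sup>2)" by (rule real_le_rsqrt) simp
  then show "ramp' M s \<le> 1" unfolding ramp'_def by (simp add: divide_le_eq_1 add_pos_nonneg)
qed (simp add: ramp'_def)

lemma ramp_pos: "s > M \<Longrightarrow> ramp M s > 0"
  by (simp add: ramp_def)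

lemma ramp_zero: "s \<le> M \<Longrightarrow> ramp M s = 0"
  by (simp add: ramp_def)

lemma ramp_measurable[measurable]: "ramp M \<in> borel_measurable borel" "ramp' M \<in> borel_measurable borel"
  unfolding ramp_def[abs_def] ramp'_def[abs_def] by measurable

text \<open>Beyond this level \<open>|x|\<^sup>2 - \<omega> + f(v)\<^sup>2 \<ge> 0\<close>, so no critical point exceeds it.\<close>

definition sup_bound :: "real \<Rightarrow> real" where "sup_bound \<omega> = dual_g (sqrt \<bar>\<omega>\<bar>)"

lemma f_sup_bound: "(f (sup_bound \<omega>))\<^sup>2 = \<bar>\<omega>\<bar>" and sup_bound_nonneg: "sup_bound \<omega> \<ge> 0"
proof -
  show "(f (sup_bound \<omega>))\<^sup>2 = \<bar>\<omega>\<bar>" by (simp add: sup_bound_def f_dual_g)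
  have "f (sup_bound \<omega>) \<ge> 0" by (simp add: sup_bound_def f_dual_g)
  then show "sup_bound \<omega> \<ge> 0" by (simp add: f_sign)
qed

lemma dPot_eq: "dPot \<omega> x t = f t / sqrt (1 + 2 * (f t)\<^sup>2) * ((norm x)\<^sup>2 - \<omega> + (f t)\<^sup>2)"
  unfolding dPot_def ff1_def f3f1_def by (simp add: algebra_simps power3_eq_cube power2_eq_square add_divide_distrib diff_divide_distrib)

lemma dPot_pos:
  assumes "t > sup_bound \<omega>"
  shows "dPot \<omega> x t > 0"
proof -
  have M: "0 \<le> f (sup_bound \<omega>)" using sup_bound_nonneg f_sign by simp
  have l: "f (sup_bound \<omega>) < f t" using assms f_less_iff by simp
  then have "(f (sup_bound \<omega>))\<^sup>2 < (f t)\<^sup>2" using M by (intro power_strict_mono) auto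
  then have "\<omega> < (f t)\<^sup>2" using f_sup_bound[of \<omega>] by linarith
  then have "(norm x)\<^sup>2 - \<omega> + (f t)\<^sup>2 > 0" using zero_le_power2[of "norm x"] by linarith
  then show ?thesis unfolding dPot_eq using l M sqrt_pos(1)[of "f t"] by (intro mult_pos_pos divide_pos_pos) auto
qed

text \<open>Weak maximum principle: tested with the ramp of \<open>v\<close> above the critical
  level, the gradient term and the potential term are both nonnegative and sum to integral zero,
  while the potential term is positive wherever \<open>v\<close> exceeds the level.\<close>

lemma critical_bounded:
  assumes v: "Hpair v g" and crit: "critical_point harm (energy harm \<omega>) v"
  shows "AE x in lborel. v x \<le> sup_bound \<omega>"
proof -
  let ?M = "sup_bound \<omega>"
  have h: "Hpair (\<lambda>x. ramp ?M (v x)) (\<lambda>x. ramp' ?M (v x) *\<^sub>R g x)"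
    by (rule Hpair_chain[OF v ramp_deriv, where L = 1]) (use ramp'_bounds[of ?M] in \<open>auto simp: ramp_zero[OF sup_bound_nonneg] abs_le_iff intro: order_trans[of _ 0]\<close>)
  have nn: "0 \<le> dPot \<omega> x t * ramp ?M t" for x t
    using dPot_pos[of \<omega> t x] ramp_pos[of ?M t] ramp_zero[of t ?M] by (cases "t > ?M") auto
  have i: "integrable lborel (\<lambda>x. g x \<bullet> (ramp' ?M (v x) *\<^sub>R g x) + dPot \<omega> x (v x) * ramp ?M (v x))"
    by (rule energy_deriv_integrable[OF v h])
  have "(\<integral>x. g x \<bullet> (ramp' ?M (v x) *\<^sub>R g x) + dPot \<omega> x (v x) * ramp ?M (v x) \<partial>lborel) = 0"
    using critical_point_energy_deriv[OF v crit h] unfolding energy_deriv_def .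
  then have "AE x in lborel. g x \<bullet> (ramp' ?M (v x) *\<^sub>R g x) + dPot \<omega> x (v x) * ramp ?M (v x) = 0"
    by (subst (asm) integral_nonneg_eq_0_iff_AE[OF i]) (auto intro!: add_nonneg_nonneg nn mult_nonneg_nonneg ramp'_bounds)
  then show ?thesis
  proof eventually_elim
    case (elim x)
    show ?case
    proof (rule ccontr)
      assume "\<not> v x \<le> ?M"
      then have "dPot \<omega> x (v x) * ramp ?M (v x) > 0" by (intro mult_pos_pos dPot_pos ramp_pos) auto
      moreover have "g x \<bullet> (ramp' ?M (v x) *\<^sub>R g x) \<ge> 0" using ramp'_bounds by simp
      ultimately show False using elim by linarith
    qed
  qed
qed

section \<open>The eigenvalue and the necessary condition\<close>

lemma first_eigenvalue_le:
  fixes u :: "'a::euclidean_space \<Rightarrow> real"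
  assumes u: "Hpair u g" and nz: "\<not> (AE x in lborel. u x = 0)"
  shows "first_eigenvalue (harm :: 'a \<Rightarrow> real) \<le> Qform u g / (\<integral>x. (u x)\<^sup>2 \<partial>lborel)"
  unfolding first_eigenvalue_def
proof (rule cInf_lower)
  show "Qform u g / (\<integral>x. (u x)\<^sup>2 \<partial>lborel) \<in> {(\<integral>x. ((norm (weak_gradient v x))\<^sup>2 + (norm x)\<^sup>2 * (v x)\<^sup>2) \<partial>lborel)
            / (\<integral>x. (v x)\<^sup>2 \<partial>lborel) | v::'a \<Rightarrow> real. v \<in> H_space harm \<and> \<not> (AE x in lborel. v x = 0)}"
    using Hpair_H_space[OF u] nz Qform_weak_gradient[OF u] by force
  show "bdd_below {(\<integral>x. ((norm (weak_gradient v x))\<^sup>2 + (norm x)\<^sup>2 * (v x)\<^sup>2) \<partial>lborel)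
            / (\<integral>x. (v x)\<^sup>2 \<partial>lborel) | v::'a \<Rightarrow> real. v \<in> H_space harm \<and> \<not> (AE x in lborel. v x = 0)}"
    by (rule bdd_belowI[of _ 0]) (auto intro!: divide_nonneg_nonneg Bochner_Integration.integral_nonneg)
qed

lemma Hpair_test_function:
  fixes \<phi> :: "'a::euclidean_space \<Rightarrow> real"
  assumes \<phi>: "test_function \<phi>"
  shows "Hpair \<phi> (classical_gradient \<phi>)"
proof -
  obtain R B where R: "R > 0" "B > 0" "\<And>x. \<bar>\<phi> x\<bar> \<le> B" "\<And>x v. \<bar>frechet_derivative \<phi> (at x) v\<bar> \<le> B * norm v"
    "\<And>x. norm x \<ge> R \<Longrightarrow> \<phi> x = 0" "\<And>x v. norm x \<ge> R \<Longrightarrow> frechet_derivative \<phi> (at x) v = 0"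
    by (rule test_function_bounds[OF \<phi>]) (rule that)
  note w = test_function_weak_gradient[OF \<phi>]
  note [measurable] = weak_gradient_meas[OF w]
  have gb: "norm (classical_gradient \<phi> x) \<le> B" for x
  proof -
    have "norm (classical_gradient \<phi> x) * norm (classical_gradient \<phi> x) = frechet_derivative \<phi> (at x) (classical_gradient \<phi> x)"
      by (simp add: classical_gradient_inner[OF \<phi>, symmetric] power2_norm_eq_inner[symmetric] power2_eq_square)
    also have "\<dots> \<le> B * norm (classical_gradient \<phi> x)" using R(4)[of x "classical_gradient \<phi> x"] by linarith
    finally show ?thesis using R(2) by (cases "norm (classical_gradient \<phi> x) = 0") (auto simp: mult_le_cancel_right)
  qed
  have gz: "classical_gradient \<phi> x = 0" if "norm x \<ge> R" for x by (simp add: classical_gradient_def R(6)[OF that])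
  have i: "integrable lborel (\<lambda>x. c * indicat_real (cball (0::'a) R) x)" for c
    by (intro Bochner_Integration.integrable_mult_right integrable_indicator_cball)
  have b2: "(\<phi> x)\<^sup>2 \<le> B\<^sup>2" for x using power_mono[OF R(3)[of x] abs_ge_zero, of 2] by simp
  have "L2_fun \<phi>"
    by (rule L2_fun_bound[OF _ i[of "B\<^sup>2"]]) (use b2 R(5) in \<open>auto simp: indicator_def intro!: AE_I2\<close>)
  moreover have "L2_fun (classical_gradient \<phi>)"
    by (rule L2_fun_bound[OF _ i[of "B\<^sup>2"]]) (use power_mono[OF gb norm_ge_zero] gz in \<open>auto simp: indicator_def intro!: AE_I2\<close>)
  moreover have "integrable lborel (\<lambda>x. (norm x)\<^sup>2 * (\<phi> x)\<^sup>2)"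
  proof (rule integrable_comparison[OF i[of "R\<^sup>2 * B\<^sup>2"]])
    fix x show "\<bar>(norm x)\<^sup>2 * (\<phi> x)\<^sup>2\<bar> \<le> R\<^sup>2 * B\<^sup>2 * indicat_real (cball 0 R) x"
      using b2[of x] R(5)[of x] R(1) by (cases "norm x \<le> R") (auto intro!: mult_mono power_mono)
  qed measurable
  ultimately show ?thesis using w by (auto simp: Hpair_def)
qed

lemma not_AE_zero_iff_integral_pos:
  assumes "integrable lborel (\<lambda>x. (u x :: real)\<^sup>2)"
  shows "\<not> (AE x in lborel. u x = 0) \<longleftrightarrow> (\<integral>x. (u x)\<^sup>2 \<partial>lborel) > 0"
proof -
  have "(\<integral>x. (u x)\<^sup>2 \<partial>lborel) \<ge> 0" by (rule Bochner_Integration.integral_nonneg) simp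
  then have "(\<integral>x. (u x)\<^sup>2 \<partial>lborel) > 0 \<longleftrightarrow> (\<integral>x. (u x)\<^sup>2 \<partial>lborel) \<noteq> 0" by linarith
  then show ?thesis using integral_nonneg_eq_0_iff_AE[OF assms] by simp
qed

lemma box_bump_nonzero:
  fixes a b :: "'a::euclidean_space"
  assumes "box a b \<noteq> {}"
  shows "\<not> (AE x in lborel. box_bump a b 1 x = 0)"
proof
  assume "AE x in lborel. box_bump a b 1 x = 0"
  then have "AE x in lborel. x \<notin> box a b" by eventually_elim (use box_bump_pos[of 1] in force)
  then have "emeasure lborel (box a b) = 0"
    by (subst (asm) AE_iff_measurable[where N = "box a b"]) auto
  moreover have "negligible (box a b) \<longleftrightarrow> box a b = {}" by (rule negligible_interval(2))
  ultimately show False using assms by (simp add: negligible_iff_emeasure0)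
qed

lemma first_eigenvalue_less:
  fixes \<omega> :: real
  assumes "first_eigenvalue (harm :: 'a::euclidean_space \<Rightarrow> real) < \<omega>"
  obtains u :: "'a::euclidean_space \<Rightarrow> real" and g where "Hpair u g" "(\<integral>x. (u x)\<^sup>2 \<partial>lborel) > 0" "Qform u g < \<omega> * (\<integral>x. (u x)\<^sup>2 \<partial>lborel)"
proof -
  let ?A = "{(\<integral>x. ((norm (weak_gradient v x))\<^sup>2 + (norm x)\<^sup>2 * (v x)\<^sup>2) \<partial>lborel)
            / (\<integral>x. (v x)\<^sup>2 \<partial>lborel) | v::'a \<Rightarrow> real. v \<in> H_space harm \<and> \<not> (AE x in lborel. v x = 0)}"
  \<comment> \<open>A bump on the cube supplies one Rayleigh quotient, so the infimum is taken over
    a nonempty set.\<close>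
  have "box (- One) (One :: 'a) \<noteq> {}" by (simp add: box_ne_empty)
  from box_bump_nonzero[OF this] have "?A \<noteq> {}"
    using Hpair_H_space[OF Hpair_test_function[OF test_function_box_bump[of 1 "- One" "One :: 'a"]]] by auto
  from cInf_lessD[OF this assms[unfolded first_eigenvalue_def]]
  obtain v :: "'a \<Rightarrow> real" where v: "v \<in> H_space harm" "\<not> (AE x in lborel. v x = 0)"
    "(\<integral>x. ((norm (weak_gradient v x))\<^sup>2 + (norm x)\<^sup>2 * (v x)\<^sup>2) \<partial>lborel) / (\<integral>x. (v x)\<^sup>2 \<partial>lborel) < \<omega>" by auto
  note h = H_space_Hpair[OF v(1)]
  have p: "(\<integral>x. (v x)\<^sup>2 \<partial>lborel) > 0" using v(2) not_AE_zero_iff_integral_pos[OF Hpair_sq(1)[OF h]] by simp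
  show thesis using that[OF h p] v(3) p by (simp add: Qform_def pos_divide_less_eq)
qed

text \<open>The function is f / f'. Its derivative lies between 1 and 2, so composing it with
  \<open>v\<close> stays in the form domain without a bound on \<open>v\<close>.\<close>

lemma f_times_sqrt_deriv:
  "((\<lambda>t. f t * sqrt (1 + 2 * (f t)\<^sup>2)) has_real_derivative (1 + 4 * (f t)\<^sup>2) / (1 + 2 * (f t)\<^sup>2)) (at t)"
proof -
  let ?s = "f t" and ?r = "sqrt (1 + 2 * (f t)\<^sup>2)"
  have "((\<lambda>s. s * sqrt (1 + 2 * s\<^sup>2)) has_real_derivative 1 * ?r + (2 * ?s / ?r) * ?s) (at ?s)"
    by (intro DERIV_mult DERIV_ident sqrt_deriv)
  from DERIV_chain2[OF this f_deriv[of t]]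
  have "((\<lambda>t. f t * sqrt (1 + 2 * (f t)\<^sup>2)) has_real_derivative (1 * ?r + (2 * ?s / ?r) * ?s) * (1 / ?r)) (at t)" .
  moreover have "(1 * ?r + (2 * ?s / ?r) * ?s) * (1 / ?r) = (?r * ?r + 2 * ?s\<^sup>2) / (?r * ?r)"
    using sqrt_pos(1)[of ?s] by (simp add: divide_simps power2_eq_square)
  moreover have "(?r * ?r + 2 * ?s\<^sup>2) / (?r * ?r) = (1 + 4 * ?s\<^sup>2) / (1 + 2 * ?s\<^sup>2)"
    unfolding sqrt_pos(2) by simp
  ultimately show ?thesis by (simp only:)
qed

text \<open>The root in the test function cancels the denominator of \<open>dPot\<close>, leaving
  the potential terms of \<open>u\<close>. In the gradient term the factor (1 + 4 u^2) / (1 + 2 u^2)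
  exceeds 1 / (1 + 2 u^2), the factor that turns the squared gradient of \<open>v\<close> into that
  of \<open>u\<close>. Strictness comes from the integral of u^4.\<close>

lemma positive_critical_imp_eigenvalue:
  fixes v :: "'a::euclidean_space \<Rightarrow> real"
  assumes v: "Hpair v g" and crit: "critical_point harm (energy harm \<omega>) v" and pos: "AE x in lborel. v x > 0"
  shows "first_eigenvalue (harm :: 'a \<Rightarrow> real) < \<omega>"
proof -
  let ?r = "\<lambda>x. sqrt (1 + 2 * (f (v x))\<^sup>2)"
  let ?k' = "\<lambda>x. (1 + 4 * (f (v x))\<^sup>2) / (1 + 2 * (f (v x))\<^sup>2)"
  note [measurable] = Hpair_meas[OF v]
  have h: "Hpair (\<lambda>x. f (v x) * ?r x) (\<lambda>x. ?k' x *\<^sub>R g x)"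
  proof (rule Hpair_chain[OF v f_times_sqrt_deriv, where L = 2])
    show "\<bar>(1 + 4 * (f s)\<^sup>2) / (1 + 2 * (f s)\<^sup>2)\<bar> \<le> 2" for s
      using sqrt_pos(3)[of "f s"] by (simp add: abs_div divide_le_eq)
  qed auto
  note u = Hpair_f[OF v]
  let ?u = "\<lambda>x. f (v x)" and ?gu = "\<lambda>x. (1 / ?r x) *\<^sub>R g x"
  note iL = energy_deriv_integrable[OF v h, of \<omega>]
  note iQ = Qform_integrable[OF u]
  have i4: "integrable lborel (\<lambda>x. (?u x) ^ 4)"
  proof (rule integrable_comparison)
    show "integrable lborel (\<lambda>x. 2 * (v x)\<^sup>2)" using Hpair_sq(1)[OF v] by auto
    show "\<bar>(f (v x)) ^ 4\<bar> \<le> 2 * (v x)\<^sup>2" for x using f_pow4_le[of "v x"] by simp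
  qed measurable
  have pos4: "(\<integral>x. (?u x) ^ 4 \<partial>lborel) > 0"
  proof -
    have "\<not> (AE x in lborel. (?u x) ^ 4 = 0)"
    proof
      assume "AE x in lborel. (?u x) ^ 4 = 0"
      with pos have "AE x in (lborel :: 'a measure). False" by eventually_elim (auto simp: f_sign)
      then show False by (simp add: AE_iff_measurable[where N = UNIV] emeasure_lborel_UNIV)
    qed
    moreover have "(\<integral>x. (?u x) ^ 4 \<partial>lborel) \<ge> 0" by (rule Bochner_Integration.integral_nonneg) simp
    ultimately show ?thesis using integral_nonneg_eq_0_iff_AE[OF i4] by (auto simp: less_le)
  qed
  have "Qform ?u ?gu - \<omega> * (\<integral>x. (?u x)\<^sup>2 \<partial>lborel) + (\<integral>x. (?u x) ^ 4 \<partial>lborel)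
      = (\<integral>x. ((norm (?gu x))\<^sup>2 + (norm x)\<^sup>2 * (?u x)\<^sup>2) - \<omega> * (?u x)\<^sup>2 + (?u x) ^ 4 \<partial>lborel)"
    unfolding Qform_def using iQ i4 Hpair_sq(1)[OF u] by simp
  also have "\<dots> \<le> (\<integral>x. g x \<bullet> (?k' x *\<^sub>R g x) + dPot \<omega> x (v x) * (f (v x) * ?r x) \<partial>lborel)"
  proof (rule integral_mono)
    show "integrable lborel (\<lambda>x. ((norm (?gu x))\<^sup>2 + (norm x)\<^sup>2 * (?u x)\<^sup>2) - \<omega> * (?u x)\<^sup>2 + (?u x) ^ 4)"
      using iQ i4 Hpair_sq(1)[OF u] by simp
    fix x
    have r: "?r x > 0" "?r x * ?r x = 1 + 2 * (f (v x))\<^sup>2" using sqrt_pos(1,2) by auto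
    have "dPot \<omega> x (v x) * (f (v x) * ?r x) = (f (v x))\<^sup>2 * ((norm x)\<^sup>2 - \<omega> + (f (v x))\<^sup>2)"
      unfolding dPot_eq using r(1) by (simp add: power2_eq_square)
    also have "\<dots> = (norm x)\<^sup>2 * (?u x)\<^sup>2 - \<omega> * (?u x)\<^sup>2 + (?u x) ^ 4"
      by (simp add: algebra_simps power2_eq_square power4_eq_xxxx)
    finally have 1: "dPot \<omega> x (v x) * (f (v x) * ?r x) = (norm x)\<^sup>2 * (?u x)\<^sup>2 - \<omega> * (?u x)\<^sup>2 + (?u x) ^ 4" .
    have "norm (?gu x) = norm (g x) / ?r x" using r(1) by simp
    then have "(norm (?gu x))\<^sup>2 = (norm (g x))\<^sup>2 / (?r x * ?r x)"
      by (simp only: power_divide power2_eq_square[of "?r x"])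
    also have "\<dots> = (norm (g x))\<^sup>2 / (1 + 2 * (f (v x))\<^sup>2)" unfolding r(2) ..
    also have "\<dots> \<le> ?k' x * (norm (g x))\<^sup>2"
      using sqrt_pos(3)[of "f (v x)"] by (simp add: divide_simps distrib_right)
    also have "\<dots> = g x \<bullet> (?k' x *\<^sub>R g x)" by (simp add: power2_norm_eq_inner)
    finally show "((norm (?gu x))\<^sup>2 + (norm x)\<^sup>2 * (?u x)\<^sup>2) - \<omega> * (?u x)\<^sup>2 + (?u x) ^ 4 \<le> g x \<bullet> (?k' x *\<^sub>R g x) + dPot \<omega> x (v x) * (f (v x) * ?r x)"
      unfolding 1 by linarith
  qed (rule iL)
  also have "\<dots> = 0" using critical_point_energy_deriv[OF v crit h] unfolding energy_deriv_def .
  finally have less: "Qform ?u ?gu < \<omega> * (\<integral>x. (?u x)\<^sup>2 \<partial>lborel)" using pos4 by linarith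
  have nz: "\<not> (AE x in lborel. ?u x = 0)"
  proof
    assume "AE x in lborel. ?u x = 0"
    then have "(\<integral>x. (?u x) ^ 4 \<partial>lborel) = 0" by (intro integral_eq_zero_AE) (auto elim!: eventually_mono)
    then show False using pos4 by simp
  qed
  then have "(\<integral>x. (?u x)\<^sup>2 \<partial>lborel) > 0" using not_AE_zero_iff_integral_pos[OF Hpair_sq(1)[OF u]] by simp
  then have "Qform ?u ?gu / (\<integral>x. (?u x)\<^sup>2 \<partial>lborel) < \<omega>" using less by (simp add: pos_divide_less_eq)
  with first_eigenvalue_le[OF u nz] show ?thesis by linarith
qed

section \<open>Uniqueness\<close>

text \<open>The Brezis-Oswald test function \<open>(s\<^sup>2 - t\<^sup>2) / s\<close>, regularised by \<open>e\<close>.\<close>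

definition picone :: "real \<Rightarrow> real \<Rightarrow> real \<Rightarrow> real" where
  "picone e s t = (s + e) - (t + e)\<^sup>2 / (s + e)"

text \<open>The gradient of \<open>picone e s t\<close> when \<open>s\<close> and \<open>t\<close>
  have gradients \<open>p\<close> and \<open>q\<close>.\<close>

definition dpicone :: "real \<Rightarrow> real \<Rightarrow> real \<Rightarrow> 'a::real_inner \<Rightarrow> 'a \<Rightarrow> 'a" where
  "dpicone e s t p q = (1 + ((t + e) / (s + e))\<^sup>2) *\<^sub>R p - (2 * ((t + e) / (s + e))) *\<^sub>R q"

text \<open>On a square of bounded nonnegative values the denominator is at least \<open>e\<close>,
  so the outer function has bounded gradient there; its bound blows up as \<open>e\<close> tends to
  0.\<close>

lemma Hpair_picone:
  assumes 1: "Hpair u1 p" and 2: "Hpair u2 q" and e: "e > 0"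
    and b: "AE x in lborel. 0 \<le> u1 x \<and> u1 x \<le> m" "AE x in lborel. 0 \<le> u2 x \<and> u2 x \<le> m"
  shows "Hpair (\<lambda>x. picone e (u1 x) (u2 x)) (\<lambda>x. dpicone e (u1 x) (u2 x) (p x) (q x))"
proof -
  note [measurable] = Hpair_meas[OF 1] Hpair_meas[OF 2]
  define m' where "m' = max m 0"
  define S where "S = {0..m'} \<times> {0..m'}"
  define \<Phi> where "\<Phi> z = picone e (fst z) (snd z)" for z
  define D where "D z = (1 + ((snd z + e) / (fst z + e))\<^sup>2, - (2 * ((snd z + e) / (fst z + e))))" for z :: "real \<times> real"
  have S: "convex S" "0 \<in> S" unfolding S_def m'_def zero_prod_def by (auto intro: convex_Times)
  have inS: "AE x in lborel. (u1 x, u2 x) \<in> S" using b by eventually_elim (auto simp: S_def m'_def)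
  have der: "(\<Phi> has_derivative (\<lambda>h. D z \<bullet> h)) (at z within S)" if "z \<in> S" for z
  proof -
    have ne: "fst z + e \<noteq> 0" using that e by (auto simp: S_def)
    have d1: "((\<lambda>z :: real \<times> real. fst z + e) has_derivative fst) (at z)"
      using has_derivative_add[OF bounded_linear_imp_has_derivative[OF bounded_linear_fst] has_derivative_const[of e]] by simp
    have d2: "((\<lambda>z :: real \<times> real. snd z + e) has_derivative snd) (at z)"
      using has_derivative_add[OF bounded_linear_imp_has_derivative[OF bounded_linear_snd] has_derivative_const[of e]] by simp
    have q: "a - ((B * b + b * B) * A - (B * B) * a) / (A * A) = (1 + (B / A)\<^sup>2) * a + (- (2 * (B / A))) * b" if "A \<noteq> 0" for a b A B :: real
      using that by (simp add: field_simps power2_eq_square)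
    have "(\<Phi> has_derivative (\<lambda>h. D z \<bullet> h)) (at z)"
      unfolding \<Phi>_def[abs_def] picone_def power2_eq_square[of "snd _ + e"]
      by (rule has_derivative_eq_rhs[OF has_derivative_diff[OF d1 has_derivative_divide'[OF has_derivative_mult[OF d2 d2] d1 ne]]])
        (simp only: q[OF ne] D_def inner_prod_def fst_conv snd_conv inner_real_def)
    then show ?thesis by (rule has_derivative_at_withinI)
  qed
  have bound: "norm (D z) \<le> (1 + ((m' + e) / e)\<^sup>2) + 2 * ((m' + e) / e)" if z: "z \<in> S" for z
  proof -
    define r where "r = (snd z + e) / (fst z + e)"
    define X where "X = (m' + e) / e"
    have r0: "0 \<le> r" unfolding r_def using z e by (auto simp: S_def)
    have r1: "r \<le> X" unfolding r_def X_def using z e by (intro frac_le) (auto simp: S_def)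
    have r2: "0 \<le> r\<^sup>2" "r\<^sup>2 \<le> X\<^sup>2" by (simp, rule power_mono[OF r1 r0])
    have "fst (D z) = 1 + r\<^sup>2" "snd (D z) = - (2 * r)" unfolding D_def r_def fst_conv snd_conv by (rule refl)+
    moreover have "norm (D z) \<le> \<bar>fst (D z)\<bar> + \<bar>snd (D z)\<bar>" using norm_Pair_le[of "fst (D z)" "snd (D z)"] by simp
    ultimately have "norm (D z) \<le> (1 + X\<^sup>2) + 2 * X"
      using r0 r1 r2 by linarith
    then show ?thesis unfolding X_def .
  qed
  have "Hpair (\<lambda>x. \<Phi> (u1 x, u2 x)) (\<lambda>x. fst (D (u1 x, u2 x)) *\<^sub>R p x + snd (D (u1 x, u2 x)) *\<^sub>R q x)"
    by (rule Hpair_chain2[OF 1 2 S _ inS der bound])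
      (simp add: \<Phi>_def picone_def power2_eq_square, unfold \<Phi>_def D_def picone_def fst_conv snd_conv, measurable)
  then show ?thesis by (simp add: \<Phi>_def D_def dpicone_def)
qed

text \<open>Multiplying a test function \<open>w\<close> by sqrt (1 + 2 u^2) turns the tested
  equation of \<open>v\<close> into the quasilinear equation of \<open>u\<close> tested with
  \<open>w\<close>. The derivative of this product is bounded only for bounded \<open>u\<close> and
  \<open>w\<close>.\<close>

lemma Hpair_sqrt_mult:
  assumes 1: "Hpair u p" and 2: "Hpair w r"
    and b: "AE x in lborel. 0 \<le> u x \<and> u x \<le> m" "AE x in lborel. \<bar>w x\<bar> \<le> c"
  shows "Hpair (\<lambda>x. sqrt (1 + 2 * (u x)\<^sup>2) * w x) (\<lambda>x. (2 * u x * w x / sqrt (1 + 2 * (u x)\<^sup>2)) *\<^sub>R p x + sqrt (1 + 2 * (u x)\<^sup>2) *\<^sub>R r x)"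
proof -
  note [measurable] = Hpair_meas[OF 1] Hpair_meas[OF 2]
  define m' where "m' = max m 0"
  define c' where "c' = max c 0"
  define S where "S = {0..m'} \<times> {-c'..c'}"
  define \<Phi> where "\<Phi> z = sqrt (1 + 2 * (fst z)\<^sup>2) * snd z" for z :: "real \<times> real"
  define D where "D z = (2 * fst z * snd z / sqrt (1 + 2 * (fst z)\<^sup>2), sqrt (1 + 2 * (fst z)\<^sup>2))" for z :: "real \<times> real"
  have S: "convex S" "0 \<in> S" unfolding S_def m'_def c'_def zero_prod_def by (auto intro: convex_Times)
  have inS: "AE x in lborel. (u x, w x) \<in> S" using b by eventually_elim (auto simp: S_def m'_def c'_def)
  have der: "(\<Phi> has_derivative (\<lambda>h. D z \<bullet> h)) (at z within S)" if "z \<in> S" for z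
  proof -
    have "((\<lambda>s. sqrt (1 + 2 * s\<^sup>2)) has_derivative (*) (2 * fst z / sqrt (1 + 2 * (fst z)\<^sup>2))) (at (fst z))"
      using sqrt_deriv[of "fst z"] by (simp only: has_field_derivative_def)
    from has_derivative_compose[OF bounded_linear_imp_has_derivative[OF bounded_linear_fst] this]
    have "((\<lambda>z. sqrt (1 + 2 * (fst z)\<^sup>2)) has_derivative (\<lambda>h. 2 * fst z / sqrt (1 + 2 * (fst z)\<^sup>2) * fst h)) (at z)" .
    from has_derivative_mult[OF this bounded_linear_imp_has_derivative[OF bounded_linear_snd]]
    have "(\<Phi> has_derivative (\<lambda>h. D z \<bullet> h)) (at z)"
      unfolding \<Phi>_def[abs_def] by (rule has_derivative_eq_rhs) (auto simp: D_def inner_prod_def fun_eq_iff)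
    then show ?thesis by (rule has_derivative_at_withinI)
  qed
  have bound: "norm (D z) \<le> 2 * (m' * c') + sqrt (1 + 2 * m'\<^sup>2)" if z: "z \<in> S" for z
  proof -
    have a: "0 \<le> fst z" "fst z \<le> m'" "\<bar>snd z\<bar> \<le> c'" using z by (auto simp: S_def)
    have "\<bar>fst (D z)\<bar> = 2 * (fst z * \<bar>snd z\<bar>) / sqrt (1 + 2 * (fst z)\<^sup>2)"
      using a sqrt_pos(3)[of "fst z"] by (simp add: D_def abs_mult)
    also have "\<dots> \<le> 2 * (m' * c') / 1"
      using a sqrt_pos(4)[of "fst z"] by (intro frac_le mult_left_mono mult_mono) auto
    finally have "\<bar>fst (D z)\<bar> \<le> 2 * (m' * c')" by simp
    moreover have "\<bar>snd (D z)\<bar> \<le> sqrt (1 + 2 * m'\<^sup>2)" using a by (simp add: D_def power_mono)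
    ultimately show ?thesis using norm_Pair_le[of "fst (D z)" "snd (D z)"] by simp
  qed
  have "Hpair (\<lambda>x. \<Phi> (u x, w x)) (\<lambda>x. fst (D (u x, w x)) *\<^sub>R p x + snd (D (u x, w x)) *\<^sub>R r x)"
    by (rule Hpair_chain2[OF 1 2 S _ inS der bound])
      (simp add: \<Phi>_def, unfold \<Phi>_def D_def fst_conv snd_conv, measurable)
  then show ?thesis by (simp add: \<Phi>_def D_def)
qed

text \<open>With \<open>w = picone e s t\<close> this is the inner product of the gradients of
  \<open>s^2\<close> and \<open>s w\<close>: the weak form of the term -u Laplacian(u^2) tested with
  \<open>w\<close>.\<close>

definition Ypic :: "real \<Rightarrow> real \<Rightarrow> real \<Rightarrow> 'a::real_inner \<Rightarrow> 'a \<Rightarrow> real" where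
  "Ypic e s t p q = 2 * s\<^sup>2 * (p \<bullet> dpicone e s t p q) + 2 * s * picone e s t * (p \<bullet> p)"

definition Zpic :: "real \<Rightarrow> real \<Rightarrow> real \<Rightarrow> real \<Rightarrow> real" where
  "Zpic e V s t = (V * s + s ^ 3) * picone e s t"

text \<open>Both tested equations added, except for the contribution of the ordinary Laplacian. That
  part contains \<open>t / s\<close> without a compensating factor and has no majorant uniform in
  \<open>e\<close>; it is discarded by sign.\<close>

definition Xpic :: "real \<Rightarrow> real \<Rightarrow> real \<Rightarrow> real \<Rightarrow> 'a::real_inner \<Rightarrow> 'a \<Rightarrow> real" where
  "Xpic e V s t p q = Ypic e s t p q + Ypic e t s q p + (Zpic e V s t + Zpic e V t s)"

text \<open>With \<open>r = (t + e) / (s + e)\<close> the sum is the squared norm of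
  \<open>q - r p\<close> plus that of \<open>p - q / r\<close>.\<close>

lemma picone_inequality:
  fixes p q :: "'a::real_inner"
  assumes "0 < s + e" "0 < t + e"
  shows "p \<bullet> dpicone e s t p q + q \<bullet> dpicone e t s q p \<ge> 0"
proof -
  define r where "r = (t + e) / (s + e)"
  have r': "(s + e) / (t + e) = inverse r" "r \<noteq> 0" using assms by (auto simp: r_def)
  have "p \<bullet> dpicone e s t p q + q \<bullet> dpicone e t s q p = (norm (q - r *\<^sub>R p))\<^sup>2 + (norm (p - inverse r *\<^sub>R q))\<^sup>2"
    unfolding dpicone_def r_def[symmetric] r'(1)
    by (simp only: power2_norm_eq_inner) (simp add: inner_diff inner_commute power2_eq_square algebra_simps)
  then show ?thesis by simp
qed

text \<open>The quotient \<open>(t + e) / (s + e)\<close> is unbounded as \<open>e\<close> tends to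
  0, but in the quasilinear term each of its powers meets at least as many factors \<open>s\<close>,
  and \<open>s / (s + e) \<le> 1\<close> absorbs it. Hence a bound free of \<open>e\<close>.\<close>

lemma Ypic_bound:
  fixes p q :: "'a::real_inner"
  assumes e: "0 < e" "e \<le> 1" and s: "0 \<le> s" "s \<le> m" and t: "0 \<le> t" "t \<le> m"
  shows "\<bar>Ypic e s t p q\<bar> \<le> 10 * (m + 1)\<^sup>2 * ((norm p)\<^sup>2 + (norm q)\<^sup>2)"
proof -
  define a where "a = s + e"
  define b where "b = t + e"
  define r where "r = s / a"
  define C where "C = (m + 1)\<^sup>2"
  have a: "a > 0" "a \<le> m + 1" "s \<le> a" and b: "b > 0" "b \<le> m + 1" using assms by (auto simp: a_def b_def)
  have r: "0 \<le> r" "r \<le> 1" and sr: "s = r * a" using a s by (auto simp: r_def)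
  have C1: "x * y \<le> C" if "0 \<le> x" "x \<le> m + 1" "0 \<le> y" "y \<le> m + 1" for x y
    unfolding C_def power2_eq_square using that by (intro mult_mono) auto
  have rx: "r * x \<le> x" "0 \<le> r * x" if "0 \<le> x" for x using r that by (auto intro: mult_left_le_one_le)
  have rb: "0 \<le> r * b" "r * b \<le> m + 1" using rx[of b] b by linarith+
  have 1: "s\<^sup>2 * (1 + (b / a)\<^sup>2) \<le> 2 * C" "0 \<le> s\<^sup>2 * (1 + (b / a)\<^sup>2)"
  proof -
    have "s\<^sup>2 * (1 + (b / a)\<^sup>2) = s * s + (r * b) * (r * b)" using a(1) by (simp add: sr power2_eq_square field_simps)
    also have "\<dots> \<le> C + C" using rb b s a by (intro add_mono C1) auto
    finally show "s\<^sup>2 * (1 + (b / a)\<^sup>2) \<le> 2 * C" by simp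
  qed simp
  have 2: "s\<^sup>2 * (b / a) \<le> C" "0 \<le> s\<^sup>2 * (b / a)"
  proof -
    have "s\<^sup>2 * (b / a) = s * (r * b)" using a(1) by (simp add: sr power2_eq_square)
    also have "\<dots> \<le> C" using rb b s a by (intro C1) auto
    finally show "s\<^sup>2 * (b / a) \<le> C" .
  qed (use a b in simp)
  have 3: "\<bar>s * picone e s t\<bar> \<le> 2 * C"
  proof -
    have "s * picone e s t = s * a - (r * b) * b" using a(1) unfolding picone_def a_def[symmetric] b_def[symmetric]
      by (simp add: sr power2_eq_square field_simps)
    moreover have "s * a \<le> C" "0 \<le> s * a" "(r * b) * b \<le> C" "0 \<le> (r * b) * b" using rb b s a by (auto intro!: C1)
    ultimately show ?thesis by linarith
  qed
  have cs: "\<bar>p \<bullet> q\<bar> \<le> ((norm p)\<^sup>2 + (norm q)\<^sup>2) / 2"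
    using order_trans[OF mult_left_mono[OF Cauchy_Schwarz_ineq2[of p q], of 2] two_norm_mult_le[of p q]] by simp
  have pp: "p \<bullet> p = (norm p)\<^sup>2" by (simp add: power2_norm_eq_inner)
  have "Ypic e s t p q = 2 * (s\<^sup>2 * (1 + (b / a)\<^sup>2)) * (norm p)\<^sup>2 - 4 * (s\<^sup>2 * (b / a)) * (p \<bullet> q) + 2 * (s * picone e s t) * (norm p)\<^sup>2"
    unfolding Ypic_def dpicone_def a_def[symmetric] b_def[symmetric] by (simp add: inner_diff_right pp algebra_simps)
  also have "\<bar>\<dots>\<bar> \<le> 2 * (s\<^sup>2 * (1 + (b / a)\<^sup>2)) * (norm p)\<^sup>2 + 4 * (s\<^sup>2 * (b / a)) * \<bar>p \<bullet> q\<bar> + 2 * \<bar>s * picone e s t\<bar> * (norm p)\<^sup>2"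
  proof -
    have "\<bar>2 * A * P - 4 * B * Q + 2 * G * P\<bar> \<le> 2 * A * P + 4 * B * \<bar>Q\<bar> + 2 * \<bar>G\<bar> * P" if "0 \<le> A" "0 \<le> B" "0 \<le> P" for A B G P Q :: real
      using that by (intro order_trans[OF abs_triangle_ineq] order_trans[OF abs_triangle_ineq4] add_mono) (auto simp: abs_mult)
    from this[OF 1(2) 2(2) zero_le_power2] show ?thesis .
  qed
  also have "\<dots> \<le> 2 * (2 * C) * (norm p)\<^sup>2 + 4 * C * (((norm p)\<^sup>2 + (norm q)\<^sup>2) / 2) + 2 * (2 * C) * (norm p)\<^sup>2"
  proof (intro add_mono)
    show "2 * (s\<^sup>2 * (1 + (b / a)\<^sup>2)) * (norm p)\<^sup>2 \<le> 2 * (2 * C) * (norm p)\<^sup>2"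
      by (rule mult_right_mono[OF mult_left_mono[OF 1(1)]]) simp_all
    show "2 * \<bar>s * picone e s t\<bar> * (norm p)\<^sup>2 \<le> 2 * (2 * C) * (norm p)\<^sup>2"
      by (rule mult_right_mono[OF mult_left_mono[OF 3]]) simp_all
    have "0 \<le> C" unfolding C_def by simp
    then show "4 * (s\<^sup>2 * (b / a)) * \<bar>p \<bullet> q\<bar> \<le> 4 * C * (((norm p)\<^sup>2 + (norm q)\<^sup>2) / 2)"
      by (intro mult_mono[OF mult_left_mono[OF 2(1)] cs]) simp_all
  qed
  also have "\<dots> \<le> 10 * C * ((norm p)\<^sup>2 + (norm q)\<^sup>2)"
  proof -
    have "C * (norm q)\<^sup>2 \<ge> 0" unfolding C_def by simp
    then show ?thesis by (simp add: algebra_simps)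
  qed
  finally show ?thesis unfolding C_def .
qed

text \<open>The majorant has to be a multiple of \<open>s\<^sup>2 + t\<^sup>2\<close>, since
  constants are not integrable on the whole space. After symmetrisation the coefficient of
  \<open>V\<close> becomes \<open>(s - t)\<^sup>2 * (e / a + e / b)\<close>, with
  \<open>a = s + e\<close> and \<open>b = t + e\<close>, and the last factor is at most 2.\<close>

lemma Zpic_bound:
  assumes e: "0 < e" "e \<le> 1" and s: "0 \<le> s" "s \<le> m" and t: "0 \<le> t" "t \<le> m"
  shows "\<bar>Zpic e V s t + Zpic e V t s\<bar> \<le> (4 * \<bar>V\<bar> + 4 * (m + 1)\<^sup>2) * (s\<^sup>2 + t\<^sup>2)"
proof -
  define a where "a = s + e"
  define b where "b = t + e"
  define c where "c = m + 1"
  have a: "a > 0" "a \<le> c" "s \<le> a" and b: "b > 0" "b \<le> c" "t \<le> b" using assms by (auto simp: a_def b_def c_def)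
  have eta: "picone e s t = (a\<^sup>2 - b\<^sup>2) / a" "picone e t s = - ((a\<^sup>2 - b\<^sup>2) / b)"
    unfolding picone_def a_def[symmetric] b_def[symmetric] using a b by (auto simp: field_simps power2_eq_square)
  have es: "s = a - e" "t = b - e" by (auto simp: a_def b_def)
  have 1: "s * picone e s t + t * picone e t s = (s - t)\<^sup>2 * (e / a + e / b)"
  proof -
    have "s * ((a\<^sup>2 - b\<^sup>2) / a) = (a\<^sup>2 - b\<^sup>2) * (1 - e / a)" "t * ((a\<^sup>2 - b\<^sup>2) / b) = (a\<^sup>2 - b\<^sup>2) * (1 - e / b)"
      using a b by (auto simp: es field_simps)
    then have "s * picone e s t + t * picone e t s = (a\<^sup>2 - b\<^sup>2) * (e / b - e / a)" unfolding eta by (simp add: algebra_simps)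
    also have "\<dots> = (a - b)\<^sup>2 * (e / a + e / b)" using a b by (simp add: divide_simps) (simp add: algebra_simps power2_eq_square)
    finally show ?thesis by (simp add: es)
  qed
  have ef: "0 \<le> e / a + e / b" "e / a + e / b \<le> 2"
  proof -
    have "e / a \<le> 1" "e / b \<le> 1" using s t e by (auto simp: a_def b_def)
    then show "e / a + e / b \<le> 2" by linarith
  qed (use a b e in auto)
  have st: "(s - t)\<^sup>2 \<le> 2 * (s\<^sup>2 + t\<^sup>2)" "(s + t)\<^sup>2 \<le> 2 * (s\<^sup>2 + t\<^sup>2)"
    using norm_add_square_le[of s "- t"] norm_add_square_le[of s t] by simp_all
  have 2: "\<bar>s * picone e s t + t * picone e t s\<bar> \<le> 4 * (s\<^sup>2 + t\<^sup>2)"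
  proof -
    have "(s - t)\<^sup>2 * (e / a + e / b) \<le> (2 * (s\<^sup>2 + t\<^sup>2)) * 2" using ef st by (intro mult_mono) auto
    then show ?thesis unfolding 1 using ef by simp
  qed
  have 3: "\<bar>s ^ 3 * picone e s t + t ^ 3 * picone e t s\<bar> \<le> 4 * c\<^sup>2 * (s\<^sup>2 + t\<^sup>2)"
  proof -
    have "s ^ 3 * picone e s t + t ^ 3 * picone e t s = (a\<^sup>2 - b\<^sup>2) * (s ^ 3 / a - t ^ 3 / b)"
    proof -
      have "x * (K / a) + y * (- (K / b)) = K * (x / a - y / b)" for x y K by (simp add: right_diff_distrib mult.commute)
      then show ?thesis unfolding eta .
    qed
    also have "\<bar>\<dots>\<bar> \<le> (2 * c * (s + t)) * (c * (s + t))"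
      unfolding abs_mult
    proof (rule mult_mono)
      have "a\<^sup>2 - b\<^sup>2 = (s - t) * (a + b)" by (simp add: es power2_eq_square algebra_simps)
      also have "\<bar>\<dots>\<bar> \<le> (s + t) * (2 * c)" unfolding abs_mult using a b s t by (intro mult_mono) auto
      finally show "\<bar>a\<^sup>2 - b\<^sup>2\<bar> \<le> 2 * c * (s + t)" by (simp add: mult_ac)
      have "s ^ 3 / a \<le> s * s" "0 \<le> s ^ 3 / a"
        using a s by (auto simp: divide_le_eq power3_eq_cube mult.assoc intro!: mult_left_mono)
      moreover have "t ^ 3 / b \<le> t * t" "0 \<le> t ^ 3 / b"
        using b t by (auto simp: divide_le_eq power3_eq_cube mult.assoc intro!: mult_left_mono)
      moreover have "s * s \<le> c * s" "t * t \<le> c * t" using s t by (auto intro!: mult_right_mono simp: c_def)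
      ultimately show "\<bar>s ^ 3 / a - t ^ 3 / b\<bar> \<le> c * (s + t)" unfolding distrib_left by linarith
    qed (use s t a in auto)
    also have "\<dots> = 2 * c\<^sup>2 * (s + t)\<^sup>2" by (simp add: power2_eq_square mult_ac)
    also have "\<dots> \<le> 2 * c\<^sup>2 * (2 * (s\<^sup>2 + t\<^sup>2))" using st by (intro mult_left_mono) auto
    also have "\<dots> = 4 * c\<^sup>2 * (s\<^sup>2 + t\<^sup>2)" by simp
    finally show ?thesis .
  qed
  have "Zpic e V s t + Zpic e V t s = V * (s * picone e s t + t * picone e t s) + (s ^ 3 * picone e s t + t ^ 3 * picone e t s)"
    unfolding Zpic_def by (simp add: algebra_simps)
  also have "\<bar>\<dots>\<bar> \<le> \<bar>V\<bar> * \<bar>s * picone e s t + t * picone e t s\<bar> + \<bar>s ^ 3 * picone e s t + t ^ 3 * picone e t s\<bar>"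
    by (rule order_trans[OF abs_triangle_ineq]) (simp add: abs_mult)
  also have "\<dots> \<le> \<bar>V\<bar> * (4 * (s\<^sup>2 + t\<^sup>2)) + 4 * c\<^sup>2 * (s\<^sup>2 + t\<^sup>2)"
    using 2 3 by (intro add_mono mult_left_mono) auto
  finally show ?thesis unfolding c_def by (simp add: algebra_simps)
qed

text \<open>In terms of the squares the limit is the squared norm of the difference of the gradients
  plus the squared difference of the functions; \<open>V\<close> drops out because it multiplies
  opposite differences in the two equations.\<close>

lemma Xpic_tendsto:
  fixes p q :: "'a::real_inner"
  assumes s: "s > 0" and t: "t > 0"
  shows "(\<lambda>n. Xpic (step n) V s t p q) \<longlonglongrightarrow> (norm ((2 * s) *\<^sub>R p - (2 * t) *\<^sub>R q))\<^sup>2 + (s\<^sup>2 - t\<^sup>2)\<^sup>2"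
proof -
  have "(\<lambda>n. Xpic (step n) V s t p q) \<longlonglongrightarrow> Xpic 0 V s t p q"
    unfolding Xpic_def Ypic_def Zpic_def picone_def dpicone_def
    using s t by (intro tendsto_intros LIMSEQ_inverse_real_of_nat) auto
  moreover have "Xpic 0 V s t p q = (norm ((2 * s) *\<^sub>R p - (2 * t) *\<^sub>R q))\<^sup>2 + (s\<^sup>2 - t\<^sup>2)\<^sup>2"
  proof -
    have Y: "Ypic 0 s t p q = 4 * s\<^sup>2 * (p \<bullet> p) - 4 * s * t * (p \<bullet> q)" if "s > 0" "t > 0" for s t and p q :: 'a
      using that unfolding Ypic_def dpicone_def picone_def by (simp add: inner_diff_right power2_eq_square field_simps)
    have Z: "Zpic 0 V s t = (V + s\<^sup>2) * (s\<^sup>2 - t\<^sup>2)" if "s > 0" for s t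
      using that unfolding Zpic_def picone_def by (simp add: power2_eq_square power3_eq_cube field_simps)
    show ?thesis unfolding Xpic_def Y[OF s t] Y[OF t s] Z[OF s] Z[OF t]
      by (simp only: power2_norm_eq_inner) (simp add: inner_diff inner_commute power2_eq_square algebra_simps)
  qed
  ultimately show ?thesis by simp
qed

text \<open>The weak equation of \<open>v1\<close> tested with sqrt (1 + 2 u1^2) times the quotient,
  rewritten in terms of \<open>u1\<close> and its gradient \<open>p\<close>; the three summands are
  the Laplacian, the quasilinear part, and the potential with the cubic term.\<close>

lemma critical_picone:
  fixes v1 v2 :: "'a::euclidean_space \<Rightarrow> real"
  assumes v1: "Hpair v1 g1" and crit: "critical_point harm (energy harm \<omega>) v1"
    and u1_def: "u1 = (\<lambda>x. f (v1 x))" and p_def: "p = (\<lambda>x. (1 / sqrt (1 + 2 * (f (v1 x))\<^sup>2)) *\<^sub>R g1 x)"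
    and u2: "Hpair u2 q" and e: "e > 0"
    and b: "AE x in lborel. 0 \<le> u1 x \<and> u1 x \<le> m" "AE x in lborel. 0 \<le> u2 x \<and> u2 x \<le> m"
  shows "integrable lborel (\<lambda>x. p x \<bullet> dpicone e (u1 x) (u2 x) (p x) (q x) + Ypic e (u1 x) (u2 x) (p x) (q x) + Zpic e ((norm x)\<^sup>2 - \<omega>) (u1 x) (u2 x))"
    and "(\<integral>x. p x \<bullet> dpicone e (u1 x) (u2 x) (p x) (q x) + Ypic e (u1 x) (u2 x) (p x) (q x) + Zpic e ((norm x)\<^sup>2 - \<omega>) (u1 x) (u2 x) \<partial>lborel) = 0"
proof -
  have u1: "Hpair u1 p" unfolding u1_def p_def by (rule Hpair_f[OF v1])
  note w = Hpair_picone[OF u1 u2 e b]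
  have wb: "AE x in lborel. \<bar>picone e (u1 x) (u2 x)\<bar> \<le> (m + e) + (m + e)\<^sup>2 / e"
    using b
  proof eventually_elim
    case (elim x)
    have "0 \<le> (u2 x + e)\<^sup>2 / (u1 x + e)" using elim e by auto
    moreover have "(u2 x + e)\<^sup>2 / (u1 x + e) \<le> (m + e)\<^sup>2 / e" using elim e by (intro frac_le power_mono) auto
    ultimately show ?case unfolding picone_def using elim e by linarith
  qed
  note h = Hpair_sqrt_mult[OF u1 w b(1) wb]
  let ?I = "\<lambda>x. p x \<bullet> dpicone e (u1 x) (u2 x) (p x) (q x) + Ypic e (u1 x) (u2 x) (p x) (q x) + Zpic e ((norm x)\<^sup>2 - \<omega>) (u1 x) (u2 x)"
  \<comment> \<open>The dictionary is \<open>g1 = r p\<close> with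
    \<open>r = sqrt (1 + 2 u1^2)\<close>: the factor r^2 = 1 + 2 u1^2 splits the gradient term into
    its semilinear and quasilinear parts.\<close>
  have eq: "g1 x \<bullet> ((2 * u1 x * picone e (u1 x) (u2 x) / sqrt (1 + 2 * (u1 x)\<^sup>2)) *\<^sub>R p x + sqrt (1 + 2 * (u1 x)\<^sup>2) *\<^sub>R dpicone e (u1 x) (u2 x) (p x) (q x))
      + dPot \<omega> x (v1 x) * (sqrt (1 + 2 * (u1 x)\<^sup>2) * picone e (u1 x) (u2 x)) = ?I x" for x
  proof -
    define r where "r = sqrt (1 + 2 * (u1 x)\<^sup>2)"
    have r: "r > 0" "r * r = 1 + 2 * (u1 x)\<^sup>2" unfolding r_def using sqrt_pos(1,2) by auto
    have g1: "g1 x = r *\<^sub>R p x" using r(1) by (simp add: p_def r_def u1_def)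
    have dP: "dPot \<omega> x (v1 x) = u1 x / r * ((norm x)\<^sup>2 - \<omega> + (u1 x)\<^sup>2)" unfolding dPot_eq by (simp add: r_def u1_def)
    let ?w = "picone e (u1 x) (u2 x)" and ?d = "dpicone e (u1 x) (u2 x) (p x) (q x)"
    have "g1 x \<bullet> ((2 * u1 x * ?w / r) *\<^sub>R p x + r *\<^sub>R ?d) = 2 * u1 x * ?w * (p x \<bullet> p x) + (r * r) * (p x \<bullet> ?d)"
      unfolding g1 using r(1) by (simp add: inner_add_right)
    moreover have "dPot \<omega> x (v1 x) * (r * ?w) = Zpic e ((norm x)\<^sup>2 - \<omega>) (u1 x) (u2 x)"
      unfolding dP Zpic_def using r(1) by (simp add: power3_eq_cube power2_eq_square algebra_simps)
    ultimately show ?thesis unfolding r_def[symmetric] r(2) Ypic_def by (simp add: algebra_simps)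
  qed
  show "integrable lborel ?I" using energy_deriv_integrable[OF v1 h, of \<omega>] unfolding eq .
  show "(\<integral>x. ?I x \<partial>lborel) = 0" using critical_point_energy_deriv[OF v1 crit h] unfolding energy_deriv_def eq .
qed

text \<open>For each \<open>e\<close> the integral of \<open>Xpic\<close> is at most 0, because the
  missing Laplacian part is nonnegative and the complete sum integrates to 0. Dominated convergence
  preserves the inequality, and the limit integrand is a sum of squares.\<close>

lemma positive_critical_unique:
  fixes v1 v2 :: "'a::euclidean_space \<Rightarrow> real"
  assumes v1: "Hpair v1 g1" and c1: "critical_point harm (energy harm \<omega>) v1" and pos1: "AE x in lborel. v1 x > 0"
    and v2: "Hpair v2 g2" and c2: "critical_point harm (energy harm \<omega>) v2" and pos2: "AE x in lborel. v2 x > 0"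
  shows "AE x in lborel. v1 x = v2 x"
proof -
  define m where "m = f (sup_bound \<omega>)"
  define u1 where "u1 = (\<lambda>x. f (v1 x))"
  define u2 where "u2 = (\<lambda>x. f (v2 x))"
  define p where "p = (\<lambda>x. (1 / sqrt (1 + 2 * (f (v1 x))\<^sup>2)) *\<^sub>R g1 x)"
  define q where "q = (\<lambda>x. (1 / sqrt (1 + 2 * (f (v2 x))\<^sup>2)) *\<^sub>R g2 x)"
  have u1: "Hpair u1 p" unfolding u1_def p_def by (rule Hpair_f[OF v1])
  have u2: "Hpair u2 q" unfolding u2_def q_def by (rule Hpair_f[OF v2])
  note [measurable] = Hpair_meas[OF u1] Hpair_meas[OF u2]
  have P: "AE x in lborel. 0 < u1 x \<and> u1 x \<le> m" "AE x in lborel. 0 < u2 x \<and> u2 x \<le> m"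
    using critical_bounded[OF v1 c1] pos1 critical_bounded[OF v2 c2] pos2
    by (eventually_elim, simp add: u1_def u2_def m_def f_sign f_le_iff)+
  have b: "AE x in lborel. 0 \<le> u1 x \<and> u1 x \<le> m" "AE x in lborel. 0 \<le> u2 x \<and> u2 x \<le> m"
    by (rule eventually_mono[OF P(1)], simp, rule eventually_mono[OF P(2)], simp)
  let ?V = "\<lambda>x. (norm x)\<^sup>2 - \<omega>"
  let ?X = "\<lambda>n x. Xpic (step n) (?V x) (u1 x) (u2 x) (p x) (q x)"
  let ?L = "\<lambda>x. (norm ((2 * u1 x) *\<^sub>R p x - (2 * u2 x) *\<^sub>R q x))\<^sup>2 + ((u1 x)\<^sup>2 - (u2 x)\<^sup>2)\<^sup>2"
  define C where "C = (m + 1)\<^sup>2"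
  \<comment> \<open>Independent of \<open>n\<close>: the two quasilinear terms give 20 C, and
    \<open>weight\<close> majorises the unbounded coefficient of the squares.\<close>
  define W where "W = (\<lambda>x. 20 * C * ((norm (p x))\<^sup>2 + (norm (q x))\<^sup>2) + (4 * C) * ((u1 x)\<^sup>2 + (u2 x)\<^sup>2) + 4 * (weight \<omega> x * (u1 x)\<^sup>2 + weight \<omega> x * (u2 x)\<^sup>2))"
  have Wi: "integrable lborel W"
    unfolding W_def using Hpair_sq[OF u1] Hpair_sq[OF u2] weight_sq_integrable[OF u1, of \<omega>] weight_sq_integrable[OF u2, of \<omega>] by auto
  have XW: "AE x in lborel. norm (?X n x) \<le> W x" for n
    using b
  proof eventually_elim
    case (elim x)
    have "\<bar>?X n x\<bar> \<le> \<bar>Ypic (step n) (u1 x) (u2 x) (p x) (q x)\<bar> + \<bar>Ypic (step n) (u2 x) (u1 x) (q x) (p x)\<bar> + \<bar>Zpic (step n) (?V x) (u1 x) (u2 x) + Zpic (step n) (?V x) (u2 x) (u1 x)\<bar>"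
      unfolding Xpic_def by linarith
    also have "\<dots> \<le> 10 * C * ((norm (p x))\<^sup>2 + (norm (q x))\<^sup>2) + 10 * C * ((norm (q x))\<^sup>2 + (norm (p x))\<^sup>2) + (4 * \<bar>?V x\<bar> + 4 * C) * ((u1 x)\<^sup>2 + (u2 x)\<^sup>2)"
      unfolding C_def using elim step_bounds[of n] by (intro add_mono Ypic_bound Zpic_bound) auto
    also have "\<dots> \<le> W x"
    proof -
      have "\<bar>?V x\<bar> * ((u1 x)\<^sup>2 + (u2 x)\<^sup>2) \<le> weight \<omega> x * ((u1 x)\<^sup>2 + (u2 x)\<^sup>2)"
        using weight_ge(2)[where x = x and \<omega> = \<omega>] by (intro mult_right_mono) auto
      then show ?thesis unfolding W_def by (simp add: distrib_left distrib_right)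
    qed
    finally show ?case by simp
  qed
  have Xm: "?X n \<in> borel_measurable lborel" for n
    unfolding Xpic_def Ypic_def Zpic_def picone_def dpicone_def by measurable
  have Lm: "?L \<in> borel_measurable lborel" by measurable
  have Xl: "AE x in lborel. (\<lambda>n. ?X n x) \<longlonglongrightarrow> ?L x"
    using P by eventually_elim (intro Xpic_tendsto, auto)
  note dct = integral_dominated_convergence[OF Lm Xm Wi Xl XW] integrable_dominated_convergence[OF Lm Xm Wi Xl XW]
  have Xi: "integrable lborel (?X n)" for n by (rule integrable_dominated_convergence2[OF Lm Xm Wi Xl XW])
  have "(\<integral>x. ?X n x \<partial>lborel) \<le> 0" for n
  proof -
    note A = critical_picone[OF v1 c1 u1_def p_def u2 step_bounds(1)[of n] b]
    note B = critical_picone[OF v2 c2 u2_def q_def u1 step_bounds(1)[of n] b(2,1)]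
    have "(\<integral>x. ?X n x \<partial>lborel) \<le> (\<integral>x. (p x \<bullet> dpicone (step n) (u1 x) (u2 x) (p x) (q x) + Ypic (step n) (u1 x) (u2 x) (p x) (q x) + Zpic (step n) (?V x) (u1 x) (u2 x))
        + (q x \<bullet> dpicone (step n) (u2 x) (u1 x) (q x) (p x) + Ypic (step n) (u2 x) (u1 x) (q x) (p x) + Zpic (step n) (?V x) (u2 x) (u1 x)) \<partial>lborel)"
    proof (rule integral_mono_AE[OF Xi Bochner_Integration.integrable_add[OF A(1) B(1)]])
      show "AE x in lborel. ?X n x \<le> (p x \<bullet> dpicone (step n) (u1 x) (u2 x) (p x) (q x) + Ypic (step n) (u1 x) (u2 x) (p x) (q x) + Zpic (step n) (?V x) (u1 x) (u2 x))
        + (q x \<bullet> dpicone (step n) (u2 x) (u1 x) (q x) (p x) + Ypic (step n) (u2 x) (u1 x) (q x) (p x) + Zpic (step n) (?V x) (u2 x) (u1 x))"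
        using b
      proof eventually_elim
        case (elim x)
        have "0 < u1 x + step n" "0 < u2 x + step n" using elim step_bounds(1)[of n] by linarith+
        from picone_inequality[OF this, of "p x" "q x"] show ?case unfolding Xpic_def by linarith
      qed
    qed
    also have "\<dots> = 0" using A B by simp
    finally show ?thesis .
  qed
  then have "(\<integral>x. ?L x \<partial>lborel) \<le> 0" by (intro LIMSEQ_le_const2[OF dct(1)]) auto
  moreover have "(\<integral>x. ?L x \<partial>lborel) \<ge> 0" by (rule Bochner_Integration.integral_nonneg) simp
  ultimately have "AE x in lborel. ?L x = 0"
    using integral_nonneg_eq_0_iff_AE[OF dct(2)] by simp
  then show ?thesis using P
  proof eventually_elim
    case (elim x)
    have "((u1 x)\<^sup>2 - (u2 x)\<^sup>2)\<^sup>2 = 0" using elim(1) zero_le_power2[of "norm ((2 * u1 x) *\<^sub>R p x - (2 * u2 x) *\<^sub>R q x)"]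
        zero_le_power2[of "(u1 x)\<^sup>2 - (u2 x)\<^sup>2"] by linarith
    then have "(u1 x)\<^sup>2 = (u2 x)\<^sup>2" by simp
    then have "u1 x = u2 x" using elim(2,3) by (simp add: power2_eq_iff_nonneg)
    from arg_cong[OF this, of dual_g] show ?case by (simp add: u1_def u2_def dual_g_f)
  qed
qed

section \<open>Truncation of the energy\<close>

text \<open>The limit function is only required to be measurable; no gradient of it occurs. This is
  what allows nonsmooth limits such as a truncated absolute value or a midpoint of squares.\<close>

lemma Pot_integral_tendsto:
  fixes z :: "nat \<Rightarrow> 'a::euclidean_space \<Rightarrow> real"
  assumes W: "integrable lborel (\<lambda>x. weight \<omega> x * W x)"
    and m[measurable]: "\<And>n. z n \<in> borel_measurable borel" "y \<in> borel_measurable borel"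
    and lim: "AE x in lborel. (\<lambda>n. z n x) \<longlonglongrightarrow> y x"
    and bd: "\<And>n. AE x in lborel. (z n x)\<^sup>2 \<le> W x"
  shows "(\<lambda>n. \<integral>x. Pot \<omega> x (z n x) \<partial>lborel) \<longlonglongrightarrow> (\<integral>x. Pot \<omega> x (y x) \<partial>lborel)"
proof (rule integral_dominated_convergence[OF _ _ W])
  show "AE x in lborel. (\<lambda>n. Pot \<omega> x (z n x)) \<longlonglongrightarrow> Pot \<omega> x (y x)"
    using lim by eventually_elim (auto simp: Pot_def intro!: tendsto_intros isCont_tendsto_compose[OF isCont_f])
  show "AE x in lborel. norm (Pot \<omega> x (z n x)) \<le> weight \<omega> x * W x" for n
    using bd[of n]
  proof eventually_elim
    case (elim x)
    then have "weight \<omega> x * (z n x)\<^sup>2 \<le> weight \<omega> x * W x" using weight_ge(1)[of \<omega> x] by (intro mult_left_mono) auto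
    then show ?case using Pot_bound[of \<omega> x "z n x"] by simp
  qed
qed measurable

lemma Pot_deriv: "(Pot \<omega> x has_real_derivative dPot \<omega> x t) (at t)"
  unfolding Pot_def[abs_def] dPot_def by (intro DERIV_add DERIV_cmult half_f2_deriv quarter_f4_deriv)

lemma dPot_nonneg:
  assumes "t \<ge> sup_bound \<omega>"
  shows "dPot \<omega> x t \<ge> 0"
proof -
  have M: "0 \<le> f (sup_bound \<omega>)" using sup_bound_nonneg f_sign by simp
  have l: "f (sup_bound \<omega>) \<le> f t" using assms f_le_iff by simp
  then have "(f (sup_bound \<omega>))\<^sup>2 \<le> (f t)\<^sup>2" using M by (intro power_mono) auto
  then have "(norm x)\<^sup>2 - \<omega> + (f t)\<^sup>2 \<ge> 0" using zero_le_power2[of "norm x"] f_sup_bound[of \<omega>] by linarith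
  then show ?thesis unfolding dPot_eq using l M by (intro mult_nonneg_nonneg divide_nonneg_nonneg) auto
qed

lemma Pot_mono:
  assumes "sup_bound \<omega> \<le> s" "s \<le> t"
  shows "Pot \<omega> x s \<le> Pot \<omega> x t"
proof (rule DERIV_nonneg_imp_nondecreasing[OF assms(2)])
  fix r assume "s \<le> r"
  then show "\<exists>y. (Pot \<omega> x has_real_derivative y) (at r) \<and> 0 \<le> y"
    using Pot_deriv dPot_nonneg assms(1) by (meson order_trans)
qed

lemma Pot_abs: "Pot \<omega> x \<bar>t\<bar> = Pot \<omega> x t"
  by (simp add: Pot_def f_abs)

text \<open>A differentiable version of the minimum with \<open>M\<close>: the identity up to
  \<open>M\<close>, then nondecreasing with values in \<open>[M, M + 1]\<close>, since the ramp
  falls short of the positive part by at most 1.\<close>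

definition trunc :: "real \<Rightarrow> real \<Rightarrow> real" where "trunc M s = s - ramp M s"

lemma trunc_deriv: "(trunc M has_real_derivative 1 - ramp' M s) (at s)"
  unfolding trunc_def[abs_def] by (intro DERIV_diff DERIV_ident ramp_deriv)

lemma ramp_bounds: "0 \<le> ramp M s" "ramp M s \<le> max 0 (s - M)" "max 0 (s - M) - 1 \<le> ramp M s"
proof -
  let ?y = "max 0 (s - M)"
  show "0 \<le> ramp M s" by (simp add: ramp_def)
  have "sqrt (1 + ?y\<^sup>2) \<le> 1 + ?y" by (rule real_le_lsqrt) (auto simp: power2_sum)
  then show "ramp M s \<le> ?y" by (simp add: ramp_def)
  have "?y \<le> sqrt (1 + ?y\<^sup>2)" by (rule real_le_rsqrt) simp
  then show "?y - 1 \<le> ramp M s" unfolding ramp_def by linarith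
qed

lemma trunc_bounds:
  assumes "s \<ge> 0" "M \<ge> 0"
  shows "0 \<le> trunc M s" "trunc M s \<le> s" "trunc M s \<le> M + 1" "s \<ge> M \<Longrightarrow> trunc M s \<ge> M" "s \<le> M \<Longrightarrow> trunc M s = s"
  using assms ramp_bounds[where M = M and s = s] ramp_zero[of s M] unfolding trunc_def by (auto simp: max_def split: if_splits)

lemma Pot_trunc:
  assumes "s \<ge> 0"
  shows "Pot \<omega> x (trunc (sup_bound \<omega>) s) \<le> Pot \<omega> x s"
proof (cases "s \<le> sup_bound \<omega>")
  case True
  then show ?thesis using trunc_bounds(5)[OF assms sup_bound_nonneg] by simp
next
  case False
  then show ?thesis using trunc_bounds[OF assms sup_bound_nonneg[of \<omega>]] by (intro Pot_mono) auto
qed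

text \<open>A differentiable absolute value; subtracting \<open>e\<close> makes it vanish at 0, as
  membership in the form domain demands, and keeps it below the true absolute value.\<close>

definition smabs :: "real \<Rightarrow> real \<Rightarrow> real" where "smabs e s = sqrt (s\<^sup>2 + e\<^sup>2) - e"

lemma smabs_deriv: "e > 0 \<Longrightarrow> (smabs e has_real_derivative s / sqrt (s\<^sup>2 + e\<^sup>2)) (at s)"
proof -
  assume e: "e > 0"
  then have p: "s\<^sup>2 + e\<^sup>2 > 0" by (simp add: add_nonneg_pos)
  have "((\<lambda>s. s\<^sup>2 + e\<^sup>2) has_real_derivative 2 * s) (at s)" by (auto intro!: derivative_eq_intros)
  from DERIV_chain2[OF DERIV_real_sqrt[OF p] this]
  have "((\<lambda>s. sqrt (s\<^sup>2 + e\<^sup>2)) has_real_derivative s / sqrt (s\<^sup>2 + e\<^sup>2)) (at s)"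
    by (rule DERIV_cong) (simp add: inverse_eq_divide)
  from DERIV_diff[OF this DERIV_const[of e]] show ?thesis unfolding smabs_def[abs_def] by simp
qed

lemma smabs_bounds:
  assumes "e > 0"
  shows "0 \<le> smabs e s" "smabs e s \<le> \<bar>s\<bar>" "\<bar>s / sqrt (s\<^sup>2 + e\<^sup>2)\<bar> \<le> 1"
proof -
  have "e \<le> sqrt (s\<^sup>2 + e\<^sup>2)" by (rule real_le_rsqrt) simp
  then show "0 \<le> smabs e s" by (simp add: smabs_def)
  have "sqrt (s\<^sup>2 + e\<^sup>2) \<le> \<bar>s\<bar> + e" using assms by (intro real_le_lsqrt) (auto simp: power2_sum)
  then show "smabs e s \<le> \<bar>s\<bar>" by (simp add: smabs_def)
  have "\<bar>s\<bar> \<le> sqrt (s\<^sup>2 + e\<^sup>2)" by (rule real_le_rsqrt) simp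
  moreover have "sqrt (s\<^sup>2 + e\<^sup>2) > 0" using assms by (simp add: add_nonneg_pos)
  ultimately show "\<bar>s / sqrt (s\<^sup>2 + e\<^sup>2)\<bar> \<le> 1" by (simp add: abs_divide divide_le_eq_1)
qed

lemma smabs_tendsto: "(\<lambda>n. smabs (step n) s) \<longlonglongrightarrow> \<bar>s\<bar>"
proof -
  have "(\<lambda>n. smabs (step n) s) \<longlonglongrightarrow> sqrt (s\<^sup>2 + 0\<^sup>2) - 0"
    unfolding smabs_def by (intro tendsto_intros LIMSEQ_inverse_real_of_nat)
  then show ?thesis by simp
qed

text \<open>The margin 1 is the overshoot of the smooth truncation. The upper bound makes
  \<open>dual_g\<close> Lipschitz on the values of \<open>f (v x)\<close>, which the passage to
  midpoints of squares requires.\<close>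

definition admissible :: "real \<Rightarrow> ('a::euclidean_space \<Rightarrow> real) \<Rightarrow> ('a \<Rightarrow> 'a) \<Rightarrow> bool" where
  "admissible \<omega> v g \<longleftrightarrow> Hpair v g \<and> (AE x in lborel. 0 \<le> v x \<and> v x \<le> sup_bound \<omega> + 1)"

text \<open>Smoothed reflection followed by truncation has slope at most 1, so it never increases
  the gradient integral. The potential is even and nondecreasing above
  \<open>sup_bound \<omega>\<close>, so it does not increase once the smoothing has been removed;
  only the potential integral is passed to the limit.\<close>

lemma energy_truncation:
  fixes w :: "'a::euclidean_space \<Rightarrow> real"
  assumes c: "\<And>(v :: 'a \<Rightarrow> real) g. admissible \<omega> v g \<Longrightarrow> c \<le> energy_pair \<omega> v g" and w: "Hpair w k"
  shows "c \<le> energy_pair \<omega> w k"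
proof -
  let ?M = "sup_bound \<omega>"
  note [measurable] = Hpair_meas[OF w]
  define z where "z n x = trunc ?M (smabs (step n) (w x))" for n x
  define y where "y x = trunc ?M \<bar>w x\<bar>" for x
  have mt[measurable]: "trunc ?M \<in> borel_measurable borel" "smabs e \<in> borel_measurable borel" for e
    unfolding trunc_def[abs_def] smabs_def[abs_def] by measurable
  have zm[measurable]: "z n \<in> borel_measurable borel" "y \<in> borel_measurable borel" for n
    unfolding z_def[abs_def] y_def[abs_def] by measurable
  define d where "d n s = (1 - ramp' ?M (smabs (step n) s)) * (s / sqrt (s\<^sup>2 + (step n)\<^sup>2))" for n s
  have db: "\<bar>d n s\<bar> \<le> 1" for n s
    unfolding d_def abs_mult using ramp'_bounds[of ?M "smabs (step n) s"] smabs_bounds(3)[OF step_bounds(1), of s n]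
    by (intro mult_le_one) auto
  have H: "Hpair (z n) (\<lambda>x. d n (w x) *\<^sub>R k x)" for n
    unfolding z_def[abs_def]
  proof (rule Hpair_chain[OF w, where k = "\<lambda>s. trunc ?M (smabs (step n) s)" and L = 1])
    show "((\<lambda>s. trunc ?M (smabs (step n) s)) has_real_derivative d n s) (at s)" for s
      unfolding d_def by (rule DERIV_chain2[OF trunc_deriv smabs_deriv[OF step_bounds(1)]])
    show "trunc ?M (smabs (step n) 0) = 0"
      using step_bounds(1)[of n] trunc_bounds(5)[of 0 ?M] sup_bound_nonneg by (simp add: smabs_def del: of_nat_Suc)
    show "\<bar>d n s\<bar> \<le> 1" for s by (rule db)
    show "d n \<in> borel_measurable borel" unfolding d_def[abs_def] by measurable
  qed
  have zb: "0 \<le> z n x" "z n x \<le> \<bar>w x\<bar>" "z n x \<le> ?M + 1" for n x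
  proof -
    note s = smabs_bounds[OF step_bounds(1)[of n], of "w x"]
    note t = trunc_bounds[OF s(1) sup_bound_nonneg[of \<omega>]]
    show "0 \<le> z n x" "z n x \<le> ?M + 1" unfolding z_def by (rule t)+
    show "z n x \<le> \<bar>w x\<bar>" unfolding z_def using t(2) s(2) by linarith
  qed
  have K: "admissible \<omega> (z n) (\<lambda>x. d n (w x) *\<^sub>R k x)" for n
    unfolding admissible_def using H zb by auto
  have lim: "(\<lambda>n. (\<integral>x. (norm (k x))\<^sup>2 / 2 \<partial>lborel) + (\<integral>x. Pot \<omega> x (z n x) \<partial>lborel)) \<longlonglongrightarrow> (\<integral>x. (norm (k x))\<^sup>2 / 2 \<partial>lborel) + (\<integral>x. Pot \<omega> x (y x) \<partial>lborel)"
  proof (intro tendsto_add tendsto_const Pot_integral_tendsto[OF weight_sq_integrable[OF w] zm])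
    show "AE x in lborel. (\<lambda>n. z n x) \<longlonglongrightarrow> y x"
      unfolding z_def y_def by (intro AE_I2 isCont_tendsto_compose[OF DERIV_isCont[OF trunc_deriv]] smabs_tendsto)
    show "AE x in lborel. (z n x)\<^sup>2 \<le> (w x)\<^sup>2" for n
      using zb[of n] by (intro AE_I2) (simp add: abs_le_square_iff[symmetric])
  qed
  have "c \<le> (\<integral>x. (norm (k x))\<^sup>2 / 2 \<partial>lborel) + (\<integral>x. Pot \<omega> x (z n x) \<partial>lborel)" for n
  proof -
    have "c \<le> energy_pair \<omega> (z n) (\<lambda>x. d n (w x) *\<^sub>R k x)" by (rule c[OF K])
    moreover have "(\<integral>x. (norm (d n (w x) *\<^sub>R k x))\<^sup>2 / 2 \<partial>lborel) \<le> (\<integral>x. (norm (k x))\<^sup>2 / 2 \<partial>lborel)"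
    proof (rule integral_mono)
      show "integrable lborel (\<lambda>x. (norm (d n (w x) *\<^sub>R k x))\<^sup>2 / 2)" "integrable lborel (\<lambda>x. (norm (k x))\<^sup>2 / 2)"
        using Hpair_sq(2)[OF H[of n]] Hpair_sq(2)[OF w] by (auto simp del: norm_scaleR)
      show "(norm (d n (w x) *\<^sub>R k x))\<^sup>2 / 2 \<le> (norm (k x))\<^sup>2 / 2" for x
        using db[of n "w x"] by (intro divide_right_mono power_mono) (auto intro: mult_left_le_one_le)
    qed
    ultimately show ?thesis unfolding energy_pair_def by linarith
  qed
  then have "c \<le> (\<integral>x. (norm (k x))\<^sup>2 / 2 \<partial>lborel) + (\<integral>x. Pot \<omega> x (y x) \<partial>lborel)"
    by (intro LIMSEQ_le_const[OF lim]) auto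
  also have "(\<integral>x. Pot \<omega> x (y x) \<partial>lborel) \<le> (\<integral>x. Pot \<omega> x (w x) \<partial>lborel)"
  proof (rule integral_mono[OF _ Pot_integrable[OF w]])
    show "integrable lborel (\<lambda>x. Pot \<omega> x (y x))"
    proof (rule integrable_comparison[OF weight_sq_integrable[OF w]])
      fix x
      have "(y x)\<^sup>2 \<le> (w x)\<^sup>2" using trunc_bounds[of "\<bar>w x\<bar>" ?M] sup_bound_nonneg unfolding y_def by (simp add: abs_le_square_iff[symmetric])
      then have "weight \<omega> x * (y x)\<^sup>2 \<le> weight \<omega> x * (w x)\<^sup>2" using weight_ge(1)[of \<omega> x] by (intro mult_left_mono) auto
      then show "\<bar>Pot \<omega> x (y x)\<bar> \<le> weight \<omega> x * (w x)\<^sup>2" using Pot_bound[of \<omega> x "y x"] by simp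
    qed measurable
    show "Pot \<omega> x (y x) \<le> Pot \<omega> x (w x)" for x
      using Pot_trunc[of "\<bar>w x\<bar>" \<omega> x] unfolding y_def Pot_abs[of \<omega> x "w x"] by simp
  qed
  finally show ?thesis unfolding energy_pair_def by simp
qed

section \<open>Returning from u to v, and the gradient inequality at midpoints\<close>

lemma dual_g_bound:
  assumes "0 \<le> s" "s \<le> m"
  shows "dual_g s \<le> sqrt (1 + 2 * m\<^sup>2) * s"
proof -
  have "(\<lambda>s. sqrt (1 + 2 * m\<^sup>2) * s - dual_g s) 0 \<le> (\<lambda>s. sqrt (1 + 2 * m\<^sup>2) * s - dual_g s) s"
  proof (rule DERIV_nonneg_imp_nondecreasing[OF assms(1)])
    fix x assume x: "0 \<le> x" "x \<le> s"
    have "((\<lambda>s. sqrt (1 + 2 * m\<^sup>2) * s - dual_g s) has_real_derivative sqrt (1 + 2 * m\<^sup>2) * 1 - sqrt (1 + 2 * x\<^sup>2)) (at x)"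
      by (intro DERIV_diff DERIV_cmult DERIV_ident dual_g_deriv)
    moreover have "0 \<le> sqrt (1 + 2 * m\<^sup>2) * 1 - sqrt (1 + 2 * x\<^sup>2)" using x assms by (simp add: power_mono)
    ultimately show "\<exists>y. ((\<lambda>s. sqrt (1 + 2 * m\<^sup>2) * s - dual_g s) has_real_derivative y) (at x) \<and> 0 \<le> y" by blast
  qed
  then show ?thesis by (simp add: dual_g_0)
qed

lemma dual_g_measurable[measurable]: "dual_g \<in> borel_measurable borel"
  using isCont_dual_g by (auto intro!: borel_measurable_continuous_onI continuous_at_imp_continuous_on)

lemma Hpair_dual_g:
  assumes u: "Hpair u g" and b: "AE x in lborel. 0 \<le> u x \<and> u x \<le> m"
  shows "Hpair (\<lambda>x. dual_g (u x)) (\<lambda>x. sqrt (1 + 2 * (u x)\<^sup>2) *\<^sub>R g x)"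
proof -
  note [measurable] = Hpair_meas[OF u]
  define m' where "m' = max m 0"
  define S where "S = {0..m'} \<times> (UNIV :: real set)"
  have S: "convex S" "0 \<in> S" unfolding S_def m'_def zero_prod_def by (auto intro: convex_Times)
  have inS: "AE x in lborel. (u x, u x) \<in> S" using b by eventually_elim (auto simp: S_def m'_def)
  have der: "((\<lambda>p. dual_g (fst p)) has_derivative (\<lambda>h. (sqrt (1 + 2 * (fst p)\<^sup>2), 0) \<bullet> h)) (at p within S)" for p :: "real \<times> real"
  proof (rule has_derivative_at_withinI)
    have "(dual_g has_derivative (*) (sqrt (1 + 2 * (fst p)\<^sup>2))) (at (fst p))"
      using dual_g_deriv[of "fst p"] by (simp only: has_field_derivative_def)
    from has_derivative_compose[OF bounded_linear_imp_has_derivative[OF bounded_linear_fst] this]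
    show "((\<lambda>p. dual_g (fst p)) has_derivative (\<lambda>h. (sqrt (1 + 2 * (fst p)\<^sup>2), 0) \<bullet> h)) (at p)" by (simp add: inner_prod_def)
  qed
  have bound: "norm (sqrt (1 + 2 * (fst p)\<^sup>2), 0::real) \<le> sqrt (1 + 2 * m'\<^sup>2)" if "p \<in> S" for p
    using that by (auto simp: norm_Pair S_def power_mono)
  show ?thesis
    using Hpair_chain2[OF u u S _ inS, of "\<lambda>p. dual_g (fst p)" "\<lambda>p. (sqrt (1 + 2 * (fst p)\<^sup>2), 0)" "sqrt (1 + 2 * m'\<^sup>2)"] der bound
    by (simp add: dual_g_0)
qed

text \<open>The weight \<open>1 + 2 w^2\<close> yields two estimates for the midpoint gradient. For
  the 1, Cauchy-Schwarz on \<open>s p + t q\<close> expresses that the squared gradient of a square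
  root is convex in its radicand; for \<open>2 w^2\<close>, the bound
  \<open>w\<^sup>2 \<le> R\<^sup>2\<close> cancels the denominator and leaves convexity of the
  squared gradient of the square itself. \<open>R\<close> and \<open>w\<close> are separate because
  smoothing raises the root in the denominator and lowers the function.\<close>

lemma midpoint_gradient:
  fixes p q :: "'a::real_inner"
  assumes R: "R > 0" "(s\<^sup>2 + t\<^sup>2) / 2 \<le> R\<^sup>2" and w: "w\<^sup>2 \<le> (s\<^sup>2 + t\<^sup>2) / 2"
  shows "(1 + 2 * w\<^sup>2) * (norm ((s / (2 * R)) *\<^sub>R p + (t / (2 * R)) *\<^sub>R q))\<^sup>2
    \<le> ((1 + 2 * s\<^sup>2) * (norm p)\<^sup>2 + (1 + 2 * t\<^sup>2) * (norm q)\<^sup>2) / 2"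
proof -
  define N where "N = (norm (s *\<^sub>R p + t *\<^sub>R q))\<^sup>2"
  have eq: "(norm ((s / (2 * R)) *\<^sub>R p + (t / (2 * R)) *\<^sub>R q))\<^sup>2 = N / (4 * R\<^sup>2)"
  proof -
    have "(s / (2 * R)) *\<^sub>R p + (t / (2 * R)) *\<^sub>R q = (1 / (2 * R)) *\<^sub>R (s *\<^sub>R p + t *\<^sub>R q)" by (simp add: scaleR_add_right)
    then show ?thesis using R(1) by (simp add: N_def power_mult_distrib power_divide)
  qed
  have N1: "N \<le> (s\<^sup>2 + t\<^sup>2) * ((norm p)\<^sup>2 + (norm q)\<^sup>2)"
  proof -
    have "(s\<^sup>2 + t\<^sup>2) * ((norm p)\<^sup>2 + (norm q)\<^sup>2) - N = (norm (s *\<^sub>R q - t *\<^sub>R p))\<^sup>2"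
      unfolding N_def by (simp only: power2_norm_eq_inner) (simp add: inner_add inner_diff inner_commute power2_eq_square algebra_simps)
    then show ?thesis by (metis diff_ge_0_iff_ge zero_le_power2)
  qed
  have N2: "N \<le> 2 * (s\<^sup>2 * (norm p)\<^sup>2 + t\<^sup>2 * (norm q)\<^sup>2)"
    using norm_add_square_le[of "s *\<^sub>R p" "t *\<^sub>R q"] unfolding N_def by (simp add: power_mult_distrib)
  have N0: "N \<ge> 0" unfolding N_def by simp
  have R2: "R\<^sup>2 > 0" using R by simp
  have a: "N / (4 * R\<^sup>2) \<le> ((norm p)\<^sup>2 + (norm q)\<^sup>2) / 2"
  proof -
    have "(s\<^sup>2 + t\<^sup>2) * ((norm p)\<^sup>2 + (norm q)\<^sup>2) \<le> (2 * R\<^sup>2) * ((norm p)\<^sup>2 + (norm q)\<^sup>2)"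
      using R(2) by (intro mult_right_mono) auto
    with N1 have "N \<le> (2 * R\<^sup>2) * ((norm p)\<^sup>2 + (norm q)\<^sup>2)" by linarith
    then show ?thesis using R2 by (simp add: divide_le_eq mult_ac)
  qed
  have b: "w\<^sup>2 * (N / (4 * R\<^sup>2)) \<le> N / 4"
  proof -
    have "w\<^sup>2 * N \<le> R\<^sup>2 * N" using w R(2) N0 by (intro mult_right_mono) auto
    then show ?thesis using R2 by (simp add: divide_le_eq mult_ac)
  qed
  have "(1 + 2 * w\<^sup>2) * (N / (4 * R\<^sup>2)) = N / (4 * R\<^sup>2) + 2 * (w\<^sup>2 * (N / (4 * R\<^sup>2)))" by (simp only: distrib_right mult.assoc mult_1)
  also have "\<dots> \<le> ((norm p)\<^sup>2 + (norm q)\<^sup>2) / 2 + 2 * (N / 4)" using a b by linarith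
  also have "\<dots> \<le> ((norm p)\<^sup>2 + (norm q)\<^sup>2) / 2 + (s\<^sup>2 * (norm p)\<^sup>2 + t\<^sup>2 * (norm q)\<^sup>2)"
    by (intro add_left_mono) (use N2 in simp)
  also have "\<dots> = ((1 + 2 * s\<^sup>2) * (norm p)\<^sup>2 + (1 + 2 * t\<^sup>2) * (norm q)\<^sup>2) / 2" by (simp add: field_simps)
  finally show ?thesis unfolding eq .
qed

section \<open>Hidden convexity\<close>

text \<open>The midpoint is taken in \<open>u\<^sup>2\<close>; \<open>e\<close> smoothes the square root at the origin.\<close>

lemma Hpair_midpoint:
  assumes 1: "Hpair u1 p" and 2: "Hpair u2 q" and e: "e > 0"
  shows "Hpair (\<lambda>x. sqrt (((u1 x)\<^sup>2 + (u2 x)\<^sup>2) / 2 + e\<^sup>2) - e)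
    (\<lambda>x. (u1 x / (2 * sqrt (((u1 x)\<^sup>2 + (u2 x)\<^sup>2) / 2 + e\<^sup>2))) *\<^sub>R p x + (u2 x / (2 * sqrt (((u1 x)\<^sup>2 + (u2 x)\<^sup>2) / 2 + e\<^sup>2))) *\<^sub>R q x)"
proof -
  note [measurable] = Hpair_meas[OF 1] Hpair_meas[OF 2]
  define R where "R z = sqrt (((fst z)\<^sup>2 + (snd z)\<^sup>2) / 2 + e\<^sup>2)" for z :: "real \<times> real"
  define \<Phi> where "\<Phi> z = R z - e" for z
  define D where "D z = (fst z / (2 * R z), snd z / (2 * R z))" for z
  have q0: "((fst z)\<^sup>2 + (snd z)\<^sup>2) / 2 + e\<^sup>2 > 0" for z :: "real \<times> real"
    using e by (intro add_nonneg_pos) auto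
  have R0: "R z > 0" for z unfolding R_def using q0 by simp
  have der: "(\<Phi> has_derivative (\<lambda>h. D z \<bullet> h)) (at z within UNIV)" for z
  proof -
    note f = bounded_linear_imp_has_derivative[OF bounded_linear_fst, of "at z"]
    note s = bounded_linear_imp_has_derivative[OF bounded_linear_snd, of "at z"]
    have "((\<lambda>z :: real \<times> real. ((fst z)\<^sup>2 + (snd z)\<^sup>2) / 2 + e\<^sup>2) has_derivative (\<lambda>h. fst z * fst h + snd z * snd h)) (at z)"
      unfolding power2_eq_square
      by (rule has_derivative_eq_rhs[OF has_derivative_add[OF bounded_linear.has_derivative[OF bounded_linear_divide has_derivative_add[OF has_derivative_mult[OF f f] has_derivative_mult[OF s s]]] has_derivative_const]])
        (auto simp: fun_eq_iff algebra_simps)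
    moreover have "(sqrt has_derivative (*) (inverse (R z) / 2)) (at (((fst z)\<^sup>2 + (snd z)\<^sup>2) / 2 + e\<^sup>2))"
      using DERIV_real_sqrt[OF q0] unfolding R_def has_field_derivative_def .
    ultimately have "(R has_derivative (\<lambda>h. inverse (R z) / 2 * (fst z * fst h + snd z * snd h))) (at z)"
      unfolding R_def[abs_def] by (rule has_derivative_compose)
    from has_derivative_diff[OF this has_derivative_const[of e]]
    show ?thesis unfolding \<Phi>_def[abs_def]
      by (rule has_derivative_eq_rhs) (auto simp: fun_eq_iff D_def inner_prod_def inverse_eq_divide add_divide_distrib distrib_left mult.commute)
  qed
  have bound: "norm (D z) \<le> 2" for z
  proof -
    have "\<bar>fst z\<bar> \<le> 2 * R z" "\<bar>snd z\<bar> \<le> 2 * R z"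
    proof -
      have r2: "(R z)\<^sup>2 = ((fst z)\<^sup>2 + (snd z)\<^sup>2) / 2 + e\<^sup>2" unfolding R_def using q0[of z] by simp
      have "(2 * R z)\<^sup>2 = 2 * (fst z)\<^sup>2 + 2 * (snd z)\<^sup>2 + 4 * e\<^sup>2"
        unfolding power_mult_distrib r2 by (simp add: field_simps)
      then have "(fst z)\<^sup>2 \<le> (2 * R z)\<^sup>2" "(snd z)\<^sup>2 \<le> (2 * R z)\<^sup>2" by simp_all
      from this[THEN abs_le_square_iff[THEN iffD2]] show "\<bar>fst z\<bar> \<le> 2 * R z" "\<bar>snd z\<bar> \<le> 2 * R z"
        using R0[of z] by simp_all
    qed
    then have "\<bar>fst (D z)\<bar> \<le> 1" "\<bar>snd (D z)\<bar> \<le> 1" using R0[of z] by (simp_all add: D_def abs_divide divide_le_eq_1)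
    moreover have "norm (D z) \<le> \<bar>fst (D z)\<bar> + \<bar>snd (D z)\<bar>" using norm_Pair_le[of "fst (D z)" "snd (D z)"] by simp
    ultimately show ?thesis by linarith
  qed
  have "Hpair (\<lambda>x. \<Phi> (u1 x, u2 x)) (\<lambda>x. fst (D (u1 x, u2 x)) *\<^sub>R p x + snd (D (u1 x, u2 x)) *\<^sub>R q x)"
    by (rule Hpair_chain2[OF 1 2 convex_UNIV _ _ _ der bound])
      (use e in \<open>simp_all add: \<Phi>_def R_def D_def\<close>)
  then show ?thesis by (simp add: \<Phi>_def R_def D_def)
qed

lemma Pot_dual_g: "Pot \<omega> x (dual_g r) = ((norm x)\<^sup>2 - \<omega>) * (r\<^sup>2 / 2) + r ^ 4 / 4"
  by (simp add: Pot_def f_dual_g)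

text \<open>The gap is exact: as u^4 is quadratic in the square, the quartic integrand at the
  midpoint misses the mean by the squared difference over 16, while the other potential term is
  linear. A lower bound \<open>c\<close> replaces the energy of the midpoint because the midpoint is
  only approached by smoothed admissible functions.\<close>

lemma admissible_midpoint:
  fixes v1 v2 :: "'a::euclidean_space \<Rightarrow> real"
  assumes c: "\<And>(v :: 'a \<Rightarrow> real) g. admissible \<omega> v g \<Longrightarrow> c \<le> energy_pair \<omega> v g" and K1: "admissible \<omega> v1 g1" and K2: "admissible \<omega> v2 g2"
  shows "c \<le> (energy_pair \<omega> v1 g1 + energy_pair \<omega> v2 g2) / 2 - (\<integral>x. ((f (v1 x))\<^sup>2 - (f (v2 x))\<^sup>2)\<^sup>2 \<partial>lborel) / 16"
proof -
  have v1: "Hpair v1 g1" and v2: "Hpair v2 g2" and b1: "AE x in lborel. 0 \<le> v1 x \<and> v1 x \<le> sup_bound \<omega> + 1" and b2: "AE x in lborel. 0 \<le> v2 x \<and> v2 x \<le> sup_bound \<omega> + 1"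
    using K1 K2 by (auto simp: admissible_def)
  note [measurable] = Hpair_meas[OF v1] Hpair_meas[OF v2]
  define u1 where "u1 x = f (v1 x)" for x
  define u2 where "u2 x = f (v2 x)" for x
  define p where "p x = (1 / sqrt (1 + 2 * (u1 x)\<^sup>2)) *\<^sub>R g1 x" for x
  define q where "q x = (1 / sqrt (1 + 2 * (u2 x)\<^sup>2)) *\<^sub>R g2 x" for x
  have u1: "Hpair u1 p" and u2: "Hpair u2 q"
    using Hpair_f[OF v1] Hpair_f[OF v2] unfolding u1_def[abs_def] u2_def[abs_def] p_def[abs_def] q_def[abs_def] by auto
  note [measurable] = Hpair_meas[OF u1] Hpair_meas[OF u2]
  define rho where "rho x = ((u1 x)\<^sup>2 + (u2 x)\<^sup>2) / 2" for x
  define R where "R n x = sqrt (rho x + (step n)\<^sup>2)" for n x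
  define w where "w n x = R n x - step n" for n x
  define k where "k n x = (u1 x / (2 * R n x)) *\<^sub>R p x + (u2 x / (2 * R n x)) *\<^sub>R q x" for n x
  have w: "Hpair (w n) (k n)" for n
    using Hpair_midpoint[OF u1 u2 step_bounds(1)[of n]] unfolding w_def[abs_def] k_def[abs_def] R_def[abs_def] rho_def[abs_def] .
  have rho0: "rho x \<ge> 0" for x by (simp add: rho_def)
  have R: "R n x > 0" "(R n x)\<^sup>2 = rho x + (step n)\<^sup>2" "rho x \<le> (R n x)\<^sup>2" for n x
    unfolding R_def using rho0[of x] step_bounds(1)[of n] by (auto intro!: add_nonneg_pos)
  have wb: "0 \<le> w n x" "w n x \<le> sqrt (rho x)" "(w n x)\<^sup>2 \<le> rho x" for n x
  proof -
    have "step n \<le> R n x" unfolding R_def using rho0[of x] by (intro real_le_rsqrt) simp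
    then show w0: "0 \<le> w n x" unfolding w_def by simp
    have "R n x \<le> sqrt (rho x) + step n" unfolding R_def using rho0[of x] step_bounds(1)[of n]
      by (intro real_le_lsqrt) (auto simp: power2_sum simp del: of_nat_Suc)
    then show w1: "w n x \<le> sqrt (rho x)" unfolding w_def by simp
    show "(w n x)\<^sup>2 \<le> rho x" using power_mono[OF w1 w0, of 2] rho0[of x] by simp
  qed
  define m where "m = f (sup_bound \<omega> + 1)"
  have ub: "AE x in lborel. 0 \<le> u1 x \<and> u1 x \<le> m \<and> 0 \<le> u2 x \<and> u2 x \<le> m"
    using b1 b2 by eventually_elim (simp add: u1_def u2_def m_def f_sign f_le_iff)
  \<comment> \<open>The root mean square does not exceed the larger value, so midpoints inherit the
    upper bound.\<close>
  have rmax: "sqrt (rho x) \<le> max (u1 x) (u2 x)" if "0 \<le> u1 x" "0 \<le> u2 x" for x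
  proof (rule real_le_lsqrt)
    have "(u1 x)\<^sup>2 \<le> (max (u1 x) (u2 x))\<^sup>2" "(u2 x)\<^sup>2 \<le> (max (u1 x) (u2 x))\<^sup>2" using that by (auto intro!: power_mono)
    then show "rho x \<le> (max (u1 x) (u2 x))\<^sup>2" unfolding rho_def by simp
  qed (use that in auto)
  have wm: "AE x in lborel. 0 \<le> w n x \<and> w n x \<le> m" for n
    using ub
  proof eventually_elim
    case (elim x)
    then have "sqrt (rho x) \<le> m" using rmax[of x] by auto
    then show ?case using wb[of n x] by auto
  qed
  note W = Hpair_dual_g[OF w wm]
  define z where "z n x = dual_g (w n x)" for n x
  define y where "y x = dual_g (sqrt (rho x))" for x
  have dg_mono: "dual_g a \<le> dual_g b" if "a \<le> b" for a b using that dual_g_strict[of b a] by (simp add: not_less[symmetric])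
  have bnd: "AE x in lborel. 0 \<le> z n x \<and> z n x \<le> y x \<and> y x \<le> max (v1 x) (v2 x)" for n
    using b1 b2 ub
  proof eventually_elim
    case (elim x)
    have "0 \<le> z n x" unfolding z_def using dg_mono[OF wb(1), of n x] by (simp add: dual_g_0)
    moreover have "z n x \<le> y x" unfolding z_def y_def by (rule dg_mono[OF wb(2)])
    moreover have "y x \<le> dual_g (max (u1 x) (u2 x))" unfolding y_def using rmax[of x] elim by (intro dg_mono) auto
    moreover have "dual_g (max (u1 x) (u2 x)) \<le> max (v1 x) (v2 x)" by (auto simp: max_def u1_def u2_def dual_g_f)
    ultimately show ?case by linarith
  qed
  have K: "admissible \<omega> (z n) (\<lambda>x. sqrt (1 + 2 * (w n x)\<^sup>2) *\<^sub>R k n x)" for n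
    unfolding admissible_def
  proof
    show "Hpair (z n) (\<lambda>x. sqrt (1 + 2 * (w n x)\<^sup>2) *\<^sub>R k n x)" unfolding z_def[abs_def] by (rule W)
    show "AE x in lborel. 0 \<le> z n x \<and> z n x \<le> sup_bound \<omega> + 1"
      using bnd[of n] b1 b2 by eventually_elim auto
  qed
  have ym[measurable]: "y \<in> borel_measurable borel" unfolding y_def[abs_def] rho_def[abs_def] by measurable
  have zm: "z n \<in> borel_measurable borel" for n using Hpair_meas(1)[OF W[of n]] unfolding z_def[abs_def] .
  have Wi: "integrable lborel (\<lambda>x. weight \<omega> x * ((v1 x)\<^sup>2 + (v2 x)\<^sup>2))"
    using weight_sq_integrable[OF v1, of \<omega>] weight_sq_integrable[OF v2, of \<omega>] by (simp add: distrib_left)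
  have lim: "(\<lambda>n. \<integral>x. Pot \<omega> x (z n x) \<partial>lborel) \<longlonglongrightarrow> (\<integral>x. Pot \<omega> x (y x) \<partial>lborel)"
  proof (rule Pot_integral_tendsto[OF Wi zm ym])
    show "AE x in lborel. (\<lambda>n. z n x) \<longlonglongrightarrow> y x"
    proof (intro AE_I2)
      fix x
      have "(\<lambda>n. w n x) \<longlonglongrightarrow> sqrt (rho x + 0\<^sup>2) - 0"
        unfolding w_def R_def by (intro tendsto_intros LIMSEQ_inverse_real_of_nat)
      then show "(\<lambda>n. z n x) \<longlonglongrightarrow> y x" unfolding z_def y_def by (intro isCont_tendsto_compose[OF isCont_dual_g]) simp
    qed
    show "AE x in lborel. (z n x)\<^sup>2 \<le> (v1 x)\<^sup>2 + (v2 x)\<^sup>2" for n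
      using bnd[of n]
    proof eventually_elim
      case (elim x)
      then have "(z n x)\<^sup>2 \<le> (max (v1 x) (v2 x))\<^sup>2" by (intro power_mono) auto
      also have "\<dots> \<le> (v1 x)\<^sup>2 + (v2 x)\<^sup>2" by (auto simp: max_def)
      finally show ?case .
    qed
  qed
  define gg where "gg = (\<integral>x. (norm (g1 x))\<^sup>2 / 2 \<partial>lborel) / 2 + (\<integral>x. (norm (g2 x))\<^sup>2 / 2 \<partial>lborel) / 2"
  have "c \<le> gg + (\<integral>x. Pot \<omega> x (z n x) \<partial>lborel)" for n
  proof -
    have "(\<integral>x. (norm (sqrt (1 + 2 * (w n x)\<^sup>2) *\<^sub>R k n x))\<^sup>2 / 2 \<partial>lborel) \<le> (\<integral>x. (norm (g1 x))\<^sup>2 / 2 / 2 + (norm (g2 x))\<^sup>2 / 2 / 2 \<partial>lborel)"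
    proof (rule integral_mono)
      show "integrable lborel (\<lambda>x. (norm (sqrt (1 + 2 * (w n x)\<^sup>2) *\<^sub>R k n x))\<^sup>2 / 2)" using Hpair_sq(2)[OF W[of n]] by (auto simp del: norm_scaleR)
      show "integrable lborel (\<lambda>x. (norm (g1 x))\<^sup>2 / 2 / 2 + (norm (g2 x))\<^sup>2 / 2 / 2)" using Hpair_sq(2)[OF v1] Hpair_sq(2)[OF v2] by auto
      fix x
      have n1: "(1 + 2 * (u1 x)\<^sup>2) * (norm (p x))\<^sup>2 = (norm (g1 x))\<^sup>2" "(1 + 2 * (u2 x)\<^sup>2) * (norm (q x))\<^sup>2 = (norm (g2 x))\<^sup>2"
        unfolding p_def q_def using sqrt_pos(3)[of "u1 x"] sqrt_pos(3)[of "u2 x"] by (simp_all add: power_mult_distrib power_divide)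
      have "(norm (sqrt (1 + 2 * (w n x)\<^sup>2) *\<^sub>R k n x))\<^sup>2 = (1 + 2 * (w n x)\<^sup>2) * (norm (k n x))\<^sup>2"
        using sqrt_pos(3)[of "w n x"] by (simp add: power_mult_distrib)
      also have "\<dots> \<le> ((1 + 2 * (u1 x)\<^sup>2) * (norm (p x))\<^sup>2 + (1 + 2 * (u2 x)\<^sup>2) * (norm (q x))\<^sup>2) / 2"
        unfolding k_def using R(1)[of n x] R(3)[of x n] wb(3)[of n x] by (intro midpoint_gradient) (auto simp: rho_def)
      finally show "(norm (sqrt (1 + 2 * (w n x)\<^sup>2) *\<^sub>R k n x))\<^sup>2 / 2 \<le> (norm (g1 x))\<^sup>2 / 2 / 2 + (norm (g2 x))\<^sup>2 / 2 / 2" unfolding n1 by simp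
    qed
    also have "\<dots> = gg" unfolding gg_def using Hpair_sq(2)[OF v1] Hpair_sq(2)[OF v2] by simp
    finally show ?thesis using c[OF K[of n]] unfolding energy_pair_def by linarith
  qed
  then have "c \<le> gg + (\<integral>x. Pot \<omega> x (y x) \<partial>lborel)"
    by (intro LIMSEQ_le_const[OF tendsto_add[OF tendsto_const lim]]) auto
  also have "(\<integral>x. Pot \<omega> x (y x) \<partial>lborel) = (\<integral>x. (Pot \<omega> x (v1 x) + Pot \<omega> x (v2 x)) / 2 - ((u1 x)\<^sup>2 - (u2 x)\<^sup>2)\<^sup>2 / 16 \<partial>lborel)"
  proof (intro Bochner_Integration.integral_cong refl)
    fix x
    have r4: "sqrt (rho x) ^ 4 = (rho x)\<^sup>2"
    proof -
      have "sqrt (rho x) ^ 4 = ((sqrt (rho x))\<^sup>2)\<^sup>2" by (simp flip: power_mult)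
      then show ?thesis using rho0[of x] by simp
    qed
    \<comment> \<open>Here \<open>dual_g\<close> is undone by \<open>f\<close>, so the potential is
      a polynomial in \<open>rho\<close>.\<close>
    have "Pot \<omega> x (y x) = ((norm x)\<^sup>2 - \<omega>) * (rho x / 2) + (rho x)\<^sup>2 / 4" unfolding y_def Pot_dual_g r4 using rho0[of x] by simp
    also have "\<dots> = (Pot \<omega> x (v1 x) + Pot \<omega> x (v2 x)) / 2 - ((u1 x)\<^sup>2 - (u2 x)\<^sup>2)\<^sup>2 / 16"
      unfolding Pot_def u1_def[symmetric] u2_def[symmetric] rho_def by (simp add: field_simps power2_eq_square power4_eq_xxxx)
    finally show "Pot \<omega> x (y x) = (Pot \<omega> x (v1 x) + Pot \<omega> x (v2 x)) / 2 - ((u1 x)\<^sup>2 - (u2 x)\<^sup>2)\<^sup>2 / 16" .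
  qed
  also have "\<dots> = ((\<integral>x. Pot \<omega> x (v1 x) \<partial>lborel) + (\<integral>x. Pot \<omega> x (v2 x) \<partial>lborel)) / 2 - (\<integral>x. ((u1 x)\<^sup>2 - (u2 x)\<^sup>2)\<^sup>2 \<partial>lborel) / 16"
  proof -
    have "integrable lborel (\<lambda>x. ((u1 x)\<^sup>2 - (u2 x)\<^sup>2)\<^sup>2)"
    proof (rule integrable_comparison)
      show "integrable lborel (\<lambda>x. 2 * (2 * (v1 x)\<^sup>2) + 2 * (2 * (v2 x)\<^sup>2))" using Hpair_sq(1)[OF v1] Hpair_sq(1)[OF v2] by auto
      fix x
      have "((u1 x)\<^sup>2 - (u2 x)\<^sup>2)\<^sup>2 \<le> 2 * (u1 x) ^ 4 + 2 * (u2 x) ^ 4"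
        using norm_add_square_le[of "(u1 x)\<^sup>2" "- (u2 x)\<^sup>2"] by (simp flip: power_mult)
      also have "\<dots> \<le> 2 * (2 * (v1 x)\<^sup>2) + 2 * (2 * (v2 x)\<^sup>2)" unfolding u1_def u2_def by (intro add_mono mult_left_mono f_pow4_le) auto
      finally show "\<bar>((u1 x)\<^sup>2 - (u2 x)\<^sup>2)\<^sup>2\<bar> \<le> 2 * (2 * (v1 x)\<^sup>2) + 2 * (2 * (v2 x)\<^sup>2)" by simp
    qed measurable
    then show ?thesis using Pot_integrable[OF v1, of \<omega>] Pot_integrable[OF v2, of \<omega>] by simp
  qed
  finally show ?thesis unfolding gg_def energy_pair_def u1_def u2_def by (simp add: add_divide_distrib)
qed

text \<open>Compensates the negative part of the potential. With
  \<open>a = \<bar>\<omega>\<bar> / 2 + 1 / 4\<close> and \<open>u = f(t)^2\<close>, inside the ball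
  the deficit is at most \<open>a u - u^2 / 4\<close>, hence at most a^2 by completing the square;
  outside it, |x|^2 is at least \<open>2 * \<bar>\<omega>\<bar> + 1\<close> and absorbs the
  deficit.\<close>

definition Theta :: "real \<Rightarrow> 'a::euclidean_space \<Rightarrow> real" where
  "Theta \<omega> x = (\<bar>\<omega>\<bar> / 2 + 1 / 4)\<^sup>2 * indicat_real (cball 0 (2 * \<bar>\<omega>\<bar> + 1)) x"

lemma Theta_integrable: "integrable lborel (Theta \<omega> :: 'a::euclidean_space \<Rightarrow> real)"
  unfolding Theta_def[abs_def] by (intro Bochner_Integration.integrable_mult_right integrable_indicator_cball)

lemma Pot_lower_f: "((norm x)\<^sup>2 + 1) * (f t)\<^sup>2 \<le> 4 * (Pot \<omega> x t + Theta \<omega> x)"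
proof -
  define u where "u = (f t)\<^sup>2"
  define a where "a = \<bar>\<omega>\<bar> / 2 + 1 / 4"
  define V where "V = (norm x)\<^sup>2"
  have u: "u \<ge> 0" by (simp add: u_def)
  have P: "Pot \<omega> x t = (V - \<omega>) * (u / 2) + u\<^sup>2 / 4" by (simp add: Pot_def u_def V_def flip: power_mult)
  have uo: "u * \<omega> \<le> u * \<bar>\<omega>\<bar>" using u by (intro mult_left_mono) auto
  have eq: "(V + 1) * u = V * u + u"
    "4 * ((V - \<omega>) * (u / 2) + u\<^sup>2 / 4 + Theta \<omega> x) = 2 * (V * u) - 2 * (u * \<omega>) + u\<^sup>2 + 4 * Theta \<omega> x"
    by (simp_all add: field_simps)
  have "V * u + u \<le> 2 * (V * u) - 2 * (u * \<omega>) + u\<^sup>2 + 4 * Theta \<omega> x"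
  proof (cases "norm x \<le> 2 * \<bar>\<omega>\<bar> + 1")
    case True
    have lin: "vu + u \<le> 2 * vu - 2 * uo + u2 + 4 * th"
      if "0 \<le> vu" "0 \<le> u2 / 4 - ua + aa" "ua = uw / 2 + u / 4" "th = aa" "uo \<le> uw" for vu u2 ua aa uw th uo :: real
      using that by linarith
    have 1: "0 \<le> V * u" using u by (simp add: V_def)
    have "(u / 2 - a)\<^sup>2 \<ge> 0" by simp
    then have 2: "0 \<le> u\<^sup>2 / 4 - u * a + a\<^sup>2" by (simp add: power2_eq_square algebra_simps)
    have 3: "u * a = u * \<bar>\<omega>\<bar> / 2 + u / 4" by (simp add: a_def algebra_simps)
    have 4: "Theta \<omega> x = a\<^sup>2" using True by (simp add: Theta_def a_def)
    show ?thesis by (rule lin[OF 1 2 3 4 uo])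
  next
    case False
    have lin: "vu + u \<le> 2 * vu - 2 * uo + u2 + 4 * th"
      if "2 * uw + u \<le> vu" "0 \<le> u2" "th = 0" "uo \<le> uw" for vu u2 uw th uo :: real
      using that by linarith
    have "(2 * \<bar>\<omega>\<bar> + 1) * 1 \<le> (norm x) * (norm x)" using False by (intro mult_mono) auto
    then have "(2 * \<bar>\<omega>\<bar> + 1) * u \<le> V * u" using u by (intro mult_right_mono) (auto simp: V_def power2_eq_square)
    then have 1: "2 * (u * \<bar>\<omega>\<bar>) + u \<le> V * u" by (simp add: algebra_simps)
    have 2: "Theta \<omega> x = 0" using False by (simp add: Theta_def)
    show ?thesis by (rule lin[OF 1 zero_le_power2 2 uo])
  qed
  then show ?thesis unfolding P u_def[symmetric] V_def[symmetric] eq .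
qed

lemma Pot_Theta_nonneg: "Pot \<omega> x t + Theta \<omega> x \<ge> 0"
proof -
  have "0 \<le> ((norm x)\<^sup>2 + 1) * (f t)\<^sup>2" by simp
  from order_trans[OF this Pot_lower_f[of x t \<omega>]] show ?thesis by simp
qed

text \<open>The square of the largest slope of \<open>dual_g\<close> on the range of
  \<open>f\<close> over admissible values; it converts control of \<open>f(v)^2\<close> into control
  of \<open>v^2\<close>.\<close>

definition coercivity_const :: "real \<Rightarrow> real" where "coercivity_const \<omega> = 1 + 2 * (f (sup_bound \<omega> + 1))\<^sup>2"

lemma Pot_lower:
  assumes t: "0 \<le> t" "t \<le> sup_bound \<omega> + 1"
  shows "((norm x)\<^sup>2 + 1) * t\<^sup>2 \<le> 4 * coercivity_const \<omega> * (Pot \<omega> x t + Theta \<omega> x)"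
proof -
  have "t = dual_g (f t)" by (simp add: dual_g_f)
  also have "\<dots> \<le> sqrt (coercivity_const \<omega>) * f t" unfolding coercivity_const_def using t by (intro dual_g_bound) (auto simp: f_sign f_le_iff)
  finally have "t\<^sup>2 \<le> (sqrt (coercivity_const \<omega>) * f t)\<^sup>2" using t by (intro power_mono) auto
  also have "\<dots> = coercivity_const \<omega> * (f t)\<^sup>2" by (simp add: power_mult_distrib coercivity_const_def)
  finally have "((norm x)\<^sup>2 + 1) * t\<^sup>2 \<le> ((norm x)\<^sup>2 + 1) * (coercivity_const \<omega> * (f t)\<^sup>2)" by (intro mult_left_mono) auto
  also have "\<dots> = coercivity_const \<omega> * (((norm x)\<^sup>2 + 1) * (f t)\<^sup>2)" by simp
  also have "\<dots> \<le> coercivity_const \<omega> * (4 * (Pot \<omega> x t + Theta \<omega> x))" by (intro mult_left_mono Pot_lower_f) (simp add: coercivity_const_def)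
  finally show ?thesis by (simp only: mult_ac)
qed

lemma energy_coercive:
  fixes v :: "'a::euclidean_space \<Rightarrow> real"
  assumes K: "admissible \<omega> v g"
  shows "(\<integral>x. (norm (g x))\<^sup>2 / 2 \<partial>lborel) \<le> energy_pair \<omega> v g + (\<integral>x. Theta \<omega> x \<partial>(lborel :: 'a measure))"
    and "(\<integral>x. ((norm x)\<^sup>2 + 1) * (v x)\<^sup>2 \<partial>lborel) \<le> 4 * coercivity_const \<omega> * (energy_pair \<omega> v g + (\<integral>x. Theta \<omega> x \<partial>(lborel :: 'a measure)))"
    and "integrable lborel (\<lambda>x. ((norm x)\<^sup>2 + 1) * (v x)\<^sup>2)"
proof -
  have v: "Hpair v g" and b: "AE x in lborel. 0 \<le> v x \<and> v x \<le> sup_bound \<omega> + 1" using K by (auto simp: admissible_def)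
  note i = Pot_integrable[OF v, of \<omega>] Theta_integrable[of \<omega>, where 'a = 'a]
  have s: "(\<integral>x. Pot \<omega> x (v x) + Theta \<omega> x \<partial>lborel) = (\<integral>x. Pot \<omega> x (v x) \<partial>lborel) + (\<integral>x. Theta \<omega> x \<partial>(lborel :: 'a measure))"
    using i by simp
  have P0: "(\<integral>x. Pot \<omega> x (v x) + Theta \<omega> x \<partial>lborel) \<ge> 0" by (rule Bochner_Integration.integral_nonneg) (rule Pot_Theta_nonneg)
  have g0: "(\<integral>x. (norm (g x))\<^sup>2 / 2 \<partial>lborel) \<ge> 0" by (rule Bochner_Integration.integral_nonneg) simp
  show "(\<integral>x. (norm (g x))\<^sup>2 / 2 \<partial>lborel) \<le> energy_pair \<omega> v g + (\<integral>x. Theta \<omega> x \<partial>(lborel :: 'a measure))"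
    unfolding energy_pair_def using s P0 by linarith
  show i2: "integrable lborel (\<lambda>x. ((norm x)\<^sup>2 + 1) * (v x)\<^sup>2)"
    using Hpair_pot[OF v] Hpair_sq(1)[OF v] by (simp add: distrib_right)
  have "(\<integral>x. ((norm x)\<^sup>2 + 1) * (v x)\<^sup>2 \<partial>lborel) \<le> (\<integral>x. 4 * coercivity_const \<omega> * (Pot \<omega> x (v x) + Theta \<omega> x) \<partial>lborel)"
  proof (intro integral_mono_AE i2 Bochner_Integration.integrable_mult_right Bochner_Integration.integrable_add i)
    show "AE x in lborel. ((norm x)\<^sup>2 + 1) * (v x)\<^sup>2 \<le> 4 * coercivity_const \<omega> * (Pot \<omega> x (v x) + Theta \<omega> x)"
      using b by eventually_elim (intro Pot_lower, auto)
  qed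
  also have "\<dots> = 4 * coercivity_const \<omega> * (\<integral>x. Pot \<omega> x (v x) + Theta \<omega> x \<partial>lborel)" by (rule integral_mult_right_zero)
  also have "\<dots> \<le> 4 * coercivity_const \<omega> * (energy_pair \<omega> v g + (\<integral>x. Theta \<omega> x \<partial>(lborel :: 'a measure)))"
    unfolding s energy_pair_def using g0 by (intro mult_left_mono) (auto simp: coercivity_const_def)
  finally show "(\<integral>x. ((norm x)\<^sup>2 + 1) * (v x)\<^sup>2 \<partial>lborel) \<le> 4 * coercivity_const \<omega> * (energy_pair \<omega> v g + (\<integral>x. Theta \<omega> x \<partial>(lborel :: 'a measure)))" .
qed

section \<open>Existence of a minimizer\<close>

text \<open>Continuity of the pairing under strong L^2 convergence, by Young's inequality with a
  parameter.\<close>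

lemma norm_square_integral_continuous:
  fixes G :: "nat \<Rightarrow> 'a::euclidean_space \<Rightarrow> 'b::euclidean_space"
  assumes G: "\<And>n. L2_fun (G n)" and g: "L2_fun g" and h: "L2_fun h"
    and lim: "(\<lambda>n. \<integral>x. (norm (G n x - g x))\<^sup>2 \<partial>lborel) \<longlonglongrightarrow> 0"
  shows "(\<lambda>n. \<integral>x. G n x \<bullet> h x \<partial>lborel) \<longlonglongrightarrow> (\<integral>x. g x \<bullet> h x \<partial>lborel)"
proof (rule LIMSEQ_I)
  fix e :: real assume e: "e > 0"
  define B where "B = (\<integral>x. (norm (h x))\<^sup>2 \<partial>lborel)"
  have B: "B \<ge> 0" unfolding B_def by (rule Bochner_Integration.integral_nonneg) simp
  \<comment> \<open>The parameter of Young's inequality: \<open>l * B\<close> stays below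
    \<open>e\<close>, while the other term tends to 0 for fixed \<open>l\<close>.\<close>
  define l where "l = e / (B + 1)"
  have l: "l > 0" "l * B < e" using e B unfolding l_def by (auto simp: field_simps)
  define d where "d n = (\<integral>x. (norm (G n x - g x))\<^sup>2 \<partial>lborel)" for n
  have bd: "\<bar>(\<integral>x. G n x \<bullet> h x \<partial>lborel) - (\<integral>x. g x \<bullet> h x \<partial>lborel)\<bar> \<le> d n / l / 2 + l * B / 2" for n
  proof -
    note D = L2_fun_diff[OF G[of n] g]
    have "(\<integral>x. G n x \<bullet> h x \<partial>lborel) - (\<integral>x. g x \<bullet> h x \<partial>lborel) = (\<integral>x. (G n x - g x) \<bullet> h x \<partial>lborel)"
      using L2_fun_inner_integrable[OF G[of n] h] L2_fun_inner_integrable[OF g h] by (simp add: inner_diff_left)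
    also have "\<bar>\<dots>\<bar> \<le> (\<integral>x. (norm (G n x - g x))\<^sup>2 / l / 2 + l * (norm (h x))\<^sup>2 / 2 \<partial>lborel)"
    proof (rule integral_abs_bound_integral)
      show "integrable lborel (\<lambda>x. (G n x - g x) \<bullet> h x)" by (rule L2_fun_inner_integrable[OF D h])
      show "integrable lborel (\<lambda>x. (norm (G n x - g x))\<^sup>2 / l / 2 + l * (norm (h x))\<^sup>2 / 2)"
        using L2_fun_integrable[OF D] L2_fun_integrable[OF h] by auto
      fix x
      have "0 \<le> (norm (G n x - g x) - l * norm (h x))\<^sup>2" by simp
      then have "2 * (norm (G n x - g x) * norm (h x)) * l \<le> (norm (G n x - g x))\<^sup>2 + l * l * (norm (h x))\<^sup>2"
        by (simp add: power2_eq_square algebra_simps)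
      then have "norm (G n x - g x) * norm (h x) \<le> (norm (G n x - g x))\<^sup>2 / l / 2 + l * (norm (h x))\<^sup>2 / 2"
        using l(1) by (simp add: field_simps)
      then show "\<bar>(G n x - g x) \<bullet> h x\<bar> \<le> (norm (G n x - g x))\<^sup>2 / l / 2 + l * (norm (h x))\<^sup>2 / 2"
        using Cauchy_Schwarz_ineq2[of "G n x - g x" "h x"] by (rule order_trans[rotated])
    qed
    also have "\<dots> = d n / l / 2 + l * B / 2"
      unfolding d_def B_def using L2_fun_integrable[OF D] L2_fun_integrable[OF h] by simp
    finally show ?thesis .
  qed
  have "(\<lambda>n. d n / l / 2 + l * B / 2) \<longlonglongrightarrow> 0 / l / 2 + l * B / 2"
    using lim l(1) unfolding d_def by (intro tendsto_intros) auto
  then have "\<forall>\<^sub>F n in sequentially. d n / l / 2 + l * B / 2 < e"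
    by (rule order_tendstoD) (use l B e in auto)
  then obtain N where N: "\<And>n. n \<ge> N \<Longrightarrow> d n / l / 2 + l * B / 2 < e" unfolding eventually_sequentially by auto
  show "\<exists>no. \<forall>n\<ge>no. norm ((\<integral>x. G n x \<bullet> h x \<partial>lborel) - (\<integral>x. g x \<bullet> h x \<partial>lborel)) < e"
  proof (intro exI[of _ N] allI impI)
    fix n assume "n \<ge> N"
    from order.strict_trans1[OF bd N[OF this]] show "norm ((\<integral>x. G n x \<bullet> h x \<partial>lborel) - (\<integral>x. g x \<bullet> h x \<partial>lborel)) < e" by simp
  qed
qed

text \<open>The gradient of the limit is the limit of elements of almost minimal norm in a decreasing family
  of convex sets of approximants; it replaces a weakly convergent subsequence.\<close>

lemma weak_limit_gradient:
  fixes v :: "nat \<Rightarrow> 'a::euclidean_space \<Rightarrow> real"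
  assumes v: "\<And>k. is_weak_gradient (v k) (g k)" "\<And>k. L2_fun (g k)"
    and b: "\<And>k. AE x in lborel. 0 \<le> v k x \<and> v k x \<le> M"
    and y[measurable]: "y \<in> borel_measurable borel" and lim: "AE x in lborel. (\<lambda>k. v k x) \<longlonglongrightarrow> y x"
    and gb: "\<And>k. (\<integral>x. (norm (g k x))\<^sup>2 \<partial>lborel) \<le> B"
  obtains G where "is_weak_gradient y G" "L2_fun G"
    "\<And>e. e > 0 \<Longrightarrow> \<exists>N. \<forall>k\<ge>N. (\<integral>x. (norm (G x))\<^sup>2 \<partial>lborel) \<le> (\<integral>x. (norm (g k x))\<^sup>2 \<partial>lborel) + e"
proof -
  \<comment> \<open>Says that \<open>a\<close> lies in [0, M] and is no farther from
    \<open>y x\<close> than the supremum of the distances of \<open>v k x\<close> for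
    \<open>k \<ge> n\<close>, phrased through upper bounds to avoid the supremum. The condition is
    convex in \<open>a\<close>, satisfied by the tail, and tightens as \<open>n\<close>
    grows.\<close>
  define near where "near n a x \<longleftrightarrow> 0 \<le> a \<and> a \<le> M \<and> (\<forall>c. (\<forall>k\<ge>n. \<bar>v k x - y x\<bar> \<le> c) \<longrightarrow> \<bar>a - y x\<bar> \<le> c)" for n a x
  define C where "C n w G \<longleftrightarrow> is_weak_gradient w G \<and> L2_fun G \<and> (AE x in lborel. near n (w x) x)" for n w and G :: "'a \<Rightarrow> 'a"
  define I where "I G = (\<integral>x. (norm (G x))\<^sup>2 \<partial>lborel)" for G :: "'a \<Rightarrow> 'a"
  have I0: "I G \<ge> 0" for G unfolding I_def by (rule Bochner_Integration.integral_nonneg) simp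
  have Cv: "C n (v k) (g k)" if "k \<ge> n" for n k
  proof -
    have "AE x in lborel. near n (v k x) x" using b[of k] by eventually_elim (use that in \<open>auto simp: near_def\<close>)
    then show ?thesis using v by (simp add: C_def)
  qed
  have near_mono: "near m a x \<Longrightarrow> n \<le> m \<Longrightarrow> near n a x" for m n a x
    unfolding near_def by (meson order_trans)
  have Cmono: "C n w G" if "C m w G" "n \<le> m" for m n w G
  proof -
    have "AE x in lborel. near m (w x) x" using that by (simp add: C_def)
    then have "AE x in lborel. near n (w x) x" by eventually_elim (rule near_mono[OF _ that(2)])
    then show ?thesis using that by (simp add: C_def)
  qed
  have Cmid: "C n (\<lambda>x. (1/2) * (w1 x + w2 x)) (\<lambda>x. (1/2) *\<^sub>R (G1 x + G2 x))" if 1: "C n w1 G1" and 2: "C n w2 G2" for n w1 w2 G1 G2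
  proof -
    have "AE x in lborel. near n (w1 x) x" "AE x in lborel. near n (w2 x) x" using 1 2 by (auto simp: C_def)
    then have "AE x in lborel. near n ((1/2) * (w1 x + w2 x)) x"
    proof eventually_elim
      case (elim x)
      have "\<bar>(1/2) * (w1 x + w2 x) - y x\<bar> \<le> c" if "\<bar>w1 x - y x\<bar> \<le> c" "\<bar>w2 x - y x\<bar> \<le> c" for c
        using that unfolding distrib_left by linarith
      then show ?case using elim unfolding near_def by auto
    qed
    moreover have "is_weak_gradient (\<lambda>x. (1/2) * (w1 x + w2 x)) (\<lambda>x. (1/2) *\<^sub>R (G1 x + G2 x))"
      by (rule weak_gradient_scaleR[OF weak_gradient_add]) (use 1 2 in \<open>auto simp: C_def\<close>)
    moreover have "L2_fun (\<lambda>x. (1/2) *\<^sub>R (G1 x + G2 x))"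
      by (rule L2_fun_scaleR[OF L2_fun_add]) (use 1 2 in \<open>auto simp: C_def\<close>)
    ultimately show ?thesis unfolding C_def by blast
  qed
  \<comment> \<open>The least gradient energy over the n-th class. The classes shrink, so
    \<open>d\<close> is increasing; the tail members bound it by \<open>B\<close>.\<close>
  define d where "d n = Inf {I G | w G. C n w G}" for n
  have bdd: "bdd_below {I G | w G. C n w G}" for n by (rule bdd_belowI[of _ 0]) (auto simp: I0)
  have dle: "d n \<le> I G" if "C n w G" for n w G unfolding d_def using that by (intro cInf_lower bdd) auto
  have ne: "{I G | w G. C n w G} \<noteq> {}" for n using Cv[of n n] by auto
  have dmono: "incseq d"
  proof -
    have "{I G | w G. C n w G} \<subseteq> {I G | w G. C m w G}" if "m \<le> n" for m n using Cmono[OF _ that] by blast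
    then show ?thesis unfolding incseq_def d_def by (intro allI impI cInf_superset_mono ne bdd)
  qed
  have dB: "d n \<le> B" for n using dle[OF Cv[of n n]] gb[of n] unfolding I_def by simp
  obtain D where D: "d \<longlonglongrightarrow> D" "\<And>n. d n \<le> D"
    using incseq_convergent[OF dmono, of B] dB by auto
  have "\<exists>w G. C n w G \<and> I G < d n + step n" for n
  proof -
    have "Inf {I G | w G. C n w G} < d n + step n" unfolding d_def[symmetric] using step_bounds(1)[of n] by linarith
    from cInf_lessD[OF ne this] show ?thesis by auto
  qed
  then obtain w G where wG: "\<And>n. C n (w n) (G n)" "\<And>n. I (G n) < d n + step n" by metis
  have GL: "L2_fun (G n)" for n using wG(1)[of n] by (simp add: C_def)
  have par: "(\<integral>x. (norm (G m x - G n x))\<^sup>2 \<partial>lborel) \<le> 2 * (d m - d n) + 2 * step m + 2 * step n" if "n \<le> m" for m n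
  proof -
    let ?H = "\<lambda>x. (1/2) *\<^sub>R (G m x + G n x)"
    \<comment> \<open>The midpoint of almost minimal elements belongs to the larger class
      \<open>n\<close>; by the parallelogram law it can lie above \<open>d n\<close> only if the two
      gradients are close.\<close>
    have "d n \<le> I ?H" by (rule dle[OF Cmid[OF Cmono[OF wG(1)[of m] that] wG(1)[of n]]])
    moreover have "(\<integral>x. (norm (G m x - G n x))\<^sup>2 \<partial>lborel) = 2 * I (G m) + 2 * I (G n) - 4 * I ?H"
    proof -
      have "(norm (G m x - G n x))\<^sup>2 = 2 * (norm (G m x))\<^sup>2 + 2 * (norm (G n x))\<^sup>2 - 4 * (norm (?H x))\<^sup>2" for x
        by (simp only: power2_norm_eq_inner) (simp add: inner_add inner_diff inner_commute algebra_simps)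
      then show ?thesis unfolding I_def
        using L2_fun_integrable[OF GL] L2_fun_integrable[OF L2_fun_scaleR[OF L2_fun_add[OF GL[of m] GL[of n]], of "1/2"]] by simp
    qed
    ultimately show ?thesis using wG(2)[of m] wG(2)[of n] unfolding right_diff_distrib by linarith
  qed
  have cauchy: "\<exists>N. \<forall>m\<ge>N. \<forall>n\<ge>N. (\<integral>x. (norm (G m x - G n x))\<^sup>2 \<partial>lborel) \<le> e" if e: "e > 0" for e
  proof -
    have "(\<lambda>n. 2 * (D - d n) + 4 * step n) \<longlonglongrightarrow> 2 * (D - D) + 4 * 0"
      by (intro tendsto_intros D LIMSEQ_inverse_real_of_nat)
    then have "\<forall>\<^sub>F n in sequentially. 2 * (D - d n) + 4 * step n < e" by (rule order_tendstoD) (use e in simp)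
    then obtain N where N: "\<And>n. n \<ge> N \<Longrightarrow> 2 * (D - d n) + 4 * step n < e" unfolding eventually_sequentially by auto
    have st: "step m \<le> step n" if "n \<le> m" for m n using that by (simp add: field_simps)
    have one: "(\<integral>x. (norm (G m x - G n x))\<^sup>2 \<partial>lborel) \<le> e" if "n \<ge> N" "n \<le> m" for m n
      using par[OF that(2)] N[OF that(1)] D(2)[of m] st[OF that(2)] unfolding right_diff_distrib by linarith
    show ?thesis
    proof (intro exI[of _ N] allI impI)
      fix m n assume "N \<le> m" "N \<le> n"
      then show "(\<integral>x. (norm (G m x - G n x))\<^sup>2 \<partial>lborel) \<le> e"
        using one[of n m] one[of m n] by (cases "n \<le> m") (auto simp: norm_minus_commute)
    qed
  qed
  obtain h r where h: "L2_fun h" "strict_mono r" "AE x in lborel. (\<lambda>n. G (r n) x) \<longlonglongrightarrow> h x"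
    "(\<lambda>n. \<integral>x. (norm (G n x - h x))\<^sup>2 \<partial>lborel) \<longlonglongrightarrow> 0"
    by (rule L2_complete[OF GL cauchy]) (assumption, rule that)
  have ID: "I h \<le> D"
  proof (rule field_le_epsilon)
    fix e :: real assume e: "e > 0"
    obtain N where N: "\<And>n. n \<ge> N \<Longrightarrow> norm (step n - 0) < e" using LIMSEQ_D[OF LIMSEQ_inverse_real_of_nat e] by auto
    have "(\<integral>x. (norm (h x))\<^sup>2 \<partial>lborel) \<le> D + e"
    proof (rule Fatou_real(2)[where f = "\<lambda>n x. (norm (G (r (n + N)) x))\<^sup>2"])
      show "integrable lborel (\<lambda>x. (norm (G (r (n + N)) x))\<^sup>2)" for n by (rule L2_fun_integrable[OF GL])
      show "AE x in lborel. (\<lambda>n. (norm (G (r (n + N)) x))\<^sup>2) \<longlonglongrightarrow> (norm (h x))\<^sup>2"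
        using h(3) by eventually_elim (intro tendsto_intros LIMSEQ_ignore_initial_segment)
      show "(\<lambda>x. (norm (h x))\<^sup>2) \<in> borel_measurable lborel" using L2_fun_measurable[OF h(1)] by measurable
      show "(\<integral>x. (norm (G (r (n + N)) x))\<^sup>2 \<partial>lborel) \<le> D + e" for n
      proof -
        have "r (n + N) \<ge> N" using seq_suble[OF h(2), of "n + N"] by linarith
        from N[OF this] show ?thesis using wG(2)[of "r (n + N)"] D(2)[of "r (n + N)"] unfolding I_def by simp
      qed
    qed simp
    then show "I h \<le> D + e" unfolding I_def .
  qed
  have wlim: "AE x in lborel. (\<forall>n. 0 \<le> w n x \<and> w n x \<le> M) \<and> (\<lambda>n. w n x) \<longlonglongrightarrow> y x"
  proof -
    have "AE x in lborel. \<forall>n. near n (w n x) x" unfolding AE_all_countable using wG(1) by (auto simp: C_def)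
    then show ?thesis using lim
    proof eventually_elim
      case (elim x)
      have "(\<lambda>n. w n x) \<longlonglongrightarrow> y x"
      proof (rule LIMSEQ_I)
        fix e :: real assume e: "e > 0"
        obtain N where N: "\<And>k. k \<ge> N \<Longrightarrow> norm (v k x - y x) < e / 2" using LIMSEQ_D[OF elim(2), of "e / 2"] e by auto
        show "\<exists>no. \<forall>n\<ge>no. norm (w n x - y x) < e"
        proof (intro exI[of _ N] allI impI)
          fix n assume "n \<ge> N"
          then have "\<forall>k\<ge>n. \<bar>v k x - y x\<bar> \<le> e / 2" using N by (force simp: less_imp_le)
          then have "\<bar>w n x - y x\<bar> \<le> e / 2" using elim(1) unfolding near_def by blast
          then show "norm (w n x - y x) < e" using e by simp
        qed
      qed
      then show ?case using elim(1) by (auto simp: near_def)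
    qed
  qed
  have yb: "AE x in lborel. \<bar>y x\<bar> \<le> M"
    using wlim
  proof eventually_elim
    case (elim x)
    then have "0 \<le> y x" "y x \<le> M" by (auto intro: LIMSEQ_le_const LIMSEQ_le_const2)
    then show ?case by simp
  qed
  have yl: "locally_integrable y"
  proof (rule locally_integrableI[OF y])
    fix s :: real
    show "integrable lborel (\<lambda>x. indicator (cball 0 s) x *\<^sub>R y x)"
    proof (rule Bochner_Integration.integrable_bound)
      show "integrable lborel (\<lambda>x. M * indicat_real (cball (0::'a) s) x)" by (intro Bochner_Integration.integrable_mult_right integrable_indicator_cball)
      show "AE x in lborel. norm (indicator (cball 0 s) x *\<^sub>R y x) \<le> norm (M * indicat_real (cball 0 s) x)"
        using yb by eventually_elim (auto simp: indicator_def)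
    qed (intro borel_measurable_scaleR borel_measurable_indicator, auto)
  qed
  have wy: "is_weak_gradient y h"
    unfolding is_weak_gradient_def
  proof (intro conjI allI impI ballI)
    show "locally_integrable y" by (rule yl)
    show hl: "locally_integrable h" by (rule L2_fun_locally_integrable[OF h(1)])
    fix \<phi> :: "'a \<Rightarrow> real" and e :: 'a assume \<phi>: "test_function \<phi>" and e: "e \<in> Basis"
    have wm: "w n \<in> borel_measurable borel" "is_weak_gradient (w n) (G n)" for n using wG(1)[of n] weak_gradient_meas by (auto simp: C_def)
    note [measurable] = wm(1)
    have dm[measurable]: "(\<lambda>x. frechet_derivative \<phi> (at x) e) \<in> borel_measurable borel" "\<phi> \<in> borel_measurable borel"
      using test_function_continuous_deriv[OF \<phi>] test_function_continuous[OF \<phi>] borel_measurable_continuous_onI by blast+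
    have one: "integrable lborel (\<lambda>x. M * \<bar>1 * frechet_derivative \<phi> (at x) e\<bar>)"
      by (intro Bochner_Integration.integrable_mult_right Bochner_Integration.integrable_abs
        test_function_mult_integrable(2)[OF locally_integrable_continuous[OF continuous_on_const] \<phi>])
    have "(\<lambda>n. \<integral>x. w n x * frechet_derivative \<phi> (at x) e \<partial>lborel) \<longlonglongrightarrow> (\<integral>x. y x * frechet_derivative \<phi> (at x) e \<partial>lborel)"
    proof (rule integral_dominated_convergence[OF _ _ one])
      show "AE x in lborel. (\<lambda>n. w n x * frechet_derivative \<phi> (at x) e) \<longlonglongrightarrow> y x * frechet_derivative \<phi> (at x) e"
        using wlim by eventually_elim (intro tendsto_intros, simp)
      show "AE x in lborel. norm (w n x * frechet_derivative \<phi> (at x) e) \<le> M * \<bar>1 * frechet_derivative \<phi> (at x) e\<bar>" for n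
        using wlim by eventually_elim (auto simp: abs_mult intro!: mult_right_mono)
    qed measurable
    moreover have "(\<lambda>n. \<integral>x. w n x * frechet_derivative \<phi> (at x) e \<partial>lborel) \<longlonglongrightarrow> - (\<integral>x. (h x \<bullet> e) * \<phi> x \<partial>lborel)"
    proof -
      have L: "L2_fun (\<lambda>x. \<phi> x *\<^sub>R e)"
        using Hpair_L2(1)[OF Hpair_test_function[OF \<phi>]] e unfolding L2_fun_def by simp
      have "(\<lambda>n. - (\<integral>x. G n x \<bullet> (\<phi> x *\<^sub>R e) \<partial>lborel)) \<longlonglongrightarrow> - (\<integral>x. h x \<bullet> (\<phi> x *\<^sub>R e) \<partial>lborel)"
        by (intro tendsto_minus norm_square_integral_continuous[OF GL h(1) L h(4)])
      then show ?thesis unfolding weak_gradient_direction[OF wm(2) \<phi>] by (simp add: mult.commute)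
    qed
    ultimately show "(\<integral>x. y x * frechet_derivative \<phi> (at x) e \<partial>lborel) = - (\<integral>x. (h x \<bullet> e) * \<phi> x \<partial>lborel)"
      by (rule LIMSEQ_unique)
  qed
  show thesis
  proof (rule that[OF wy h(1)])
    fix e :: real assume e: "e > 0"
    obtain N where N: "\<And>n. n \<ge> N \<Longrightarrow> norm (d n - D) < e" using LIMSEQ_D[OF D(1) e] by auto
    show "\<exists>N. \<forall>k\<ge>N. (\<integral>x. (norm (h x))\<^sup>2 \<partial>lborel) \<le> (\<integral>x. (norm (g k x))\<^sup>2 \<partial>lborel) + e"
    proof (intro exI[of _ N] allI impI)
      \<comment> \<open>\<open>g k\<close> itself competes in the class \<open>k\<close>, and
        \<open>d k\<close> is already within \<open>e\<close> of its limit, which bounds the energy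
        of \<open>h\<close>.\<close>
      fix k assume "k \<ge> N"
      then have "D < d k + e" using N[of k] by simp
      moreover have "d k \<le> I (g k)" by (rule dle[OF Cv[of k k]]) simp
      ultimately show "(\<integral>x. (norm (h x))\<^sup>2 \<partial>lborel) \<le> (\<integral>x. (norm (g k x))\<^sup>2 \<partial>lborel) + e" using ID unfolding I_def by linarith
    qed
  qed
qed

lemma Hpair_zero: "Hpair (\<lambda>x::'a::euclidean_space. 0) (\<lambda>x. 0)"
  using Hpair_scale[OF Hpair_test_function[OF test_function_box_bump[of 1 0 "0::'a"]], of 0] by simp

lemma minimizer_exists:
  obtains v :: "'a::euclidean_space \<Rightarrow> real" and g where "admissible \<omega> v g"
    "\<And>(w :: 'a \<Rightarrow> real) k. Hpair w k \<Longrightarrow> energy_pair \<omega> v g \<le> energy_pair \<omega> w k"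
proof -
  define A where "A = (\<integral>x. Theta \<omega> x \<partial>(lborel :: 'a measure))"
  define E where "E = {energy_pair \<omega> v g | (v :: 'a \<Rightarrow> real) g. admissible \<omega> v g}"
  have K0: "admissible \<omega> (\<lambda>x::'a. 0) (\<lambda>x. 0)" unfolding admissible_def using Hpair_zero sup_bound_nonneg[of \<omega>] by auto
  then have ne: "E \<noteq> {}" unfolding E_def by blast
  have low: "- A \<le> energy_pair \<omega> v g" if "admissible \<omega> v g" for v :: "'a \<Rightarrow> real" and g
  proof -
    have "(\<integral>x. (norm (g x))\<^sup>2 / 2 \<partial>lborel) \<ge> 0" by (rule Bochner_Integration.integral_nonneg) simp
    then show ?thesis using energy_coercive(1)[OF that] unfolding A_def by linarith
  qed
  have bdd: "bdd_below E" unfolding E_def by (rule bdd_belowI[of _ "- A"]) (use low in auto)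
  define I where "I = Inf E"
  have Ile: "I \<le> energy_pair \<omega> v g" if "admissible \<omega> v g" for v :: "'a \<Rightarrow> real" and g
    unfolding I_def using that by (intro cInf_lower bdd) (auto simp: E_def)
  have "\<exists>v g. admissible \<omega> v g \<and> energy_pair \<omega> (v :: 'a \<Rightarrow> real) g < I + step n" for n
  proof -
    have "Inf E < I + step n" unfolding I_def[symmetric] using step_bounds(1)[of n] by linarith
    from cInf_lessD[OF ne this] show ?thesis unfolding E_def by blast
  qed
  then obtain v :: "nat \<Rightarrow> 'a \<Rightarrow> real" and g where K: "\<And>n. admissible \<omega> (v n) (g n)" and Em: "\<And>n. energy_pair \<omega> (v n) (g n) < I + step n" by metis
  have H: "Hpair (v n) (g n)" and b: "AE x in lborel. 0 \<le> v n x \<and> v n x \<le> sup_bound \<omega> + 1" for n using K[of n] by (auto simp: admissible_def)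
  have vm[measurable]: "v n \<in> borel_measurable borel" for n by (rule Hpair_meas(1)[OF H])
  have E1: "energy_pair \<omega> (v n) (g n) \<le> I + 1" for n using Em[of n] step_bounds(2)[of n] by linarith
  have gb: "(\<integral>x. (norm (g n x))\<^sup>2 \<partial>lborel) \<le> 2 * (I + 1 + A)" for n
    using energy_coercive(1)[OF K[of n]] E1[of n] unfolding A_def by simp
  have vb: "(\<integral>x. ((norm x)\<^sup>2 + 1) * (v n x)\<^sup>2 \<partial>lborel) \<le> 4 * coercivity_const \<omega> * (I + 1 + A)" for n
  proof (rule order_trans[OF energy_coercive(2)[OF K[of n], folded A_def]])
    show "4 * coercivity_const \<omega> * (energy_pair \<omega> (v n) (g n) + A) \<le> 4 * coercivity_const \<omega> * (I + 1 + A)"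
      using E1[of n] by (intro mult_left_mono add_right_mono) (auto simp: coercivity_const_def)
  qed
  define \<alpha> where "\<alpha> n x = (f (v n x))\<^sup>2" for n x
  have \<alpha>L: "L2_fun (\<alpha> n)" for n
  proof (rule L2_fun_bound)
    show "integrable lborel (\<lambda>x. 2 * (v n x)\<^sup>2)" using Hpair_sq(1)[OF H[of n]] by auto
    have "(norm (\<alpha> n x))\<^sup>2 \<le> 2 * (v n x)\<^sup>2" for x
      using f_pow4_le[of "v n x"] by (simp add: \<alpha>_def flip: power_mult)
    then show "AE x in lborel. (norm (\<alpha> n x))\<^sup>2 \<le> 2 * (v n x)\<^sup>2" by simp
  qed (unfold \<alpha>_def, measurable)
  \<comment> \<open>Both energies exceed the infimum by less than their steps, so the midpoint gap
    is at most half the sum of the steps; multiplying by 16 gives the factors 8.\<close>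
  have \<alpha>d: "(\<integral>x. (norm (\<alpha> m x - \<alpha> n x))\<^sup>2 \<partial>lborel) \<le> 8 * step m + 8 * step n" for m n
  proof -
    have "I \<le> (energy_pair \<omega> (v m) (g m) + energy_pair \<omega> (v n) (g n)) / 2 - (\<integral>x. ((f (v m x))\<^sup>2 - (f (v n x))\<^sup>2)\<^sup>2 \<partial>lborel) / 16"
      by (rule admissible_midpoint[OF Ile K K])
    moreover have "J \<le> 8 * s + 8 * t" if "I \<le> (a + b) / 2 - J / 16" "a < I + s" "b < I + t" for J s t a b :: real
      using that by (simp add: field_simps)
    ultimately show ?thesis using Em[of m] Em[of n] unfolding \<alpha>_def real_norm_def power2_abs by blast
  qed
  have cauchy: "\<exists>N. \<forall>m\<ge>N. \<forall>n\<ge>N. (\<integral>x. (norm (\<alpha> m x - \<alpha> n x))\<^sup>2 \<partial>lborel) \<le> e" if e: "e > 0" for e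
  proof -
    have "e / 16 > 0" using e by simp
    from LIMSEQ_D[OF LIMSEQ_inverse_real_of_nat this] obtain N where N: "\<And>n. n \<ge> N \<Longrightarrow> norm (step n - 0) < e / 16" by auto
    have s: "step n < e / 16" if "n \<ge> N" for n using N[OF that] by simp
    show ?thesis
    proof (intro exI[of _ N] allI impI)
      fix m n assume "N \<le> m" "N \<le> n"
      then show "(\<integral>x. (norm (\<alpha> m x - \<alpha> n x))\<^sup>2 \<partial>lborel) \<le> e" using \<alpha>d[of m n] s[of m] s[of n] by linarith
    qed
  qed
  obtain \<beta> r where \<beta>: "L2_fun \<beta>" "strict_mono r" "AE x in lborel. (\<lambda>n. \<alpha> (r n) x) \<longlonglongrightarrow> \<beta> x"
    by (rule L2_complete[OF \<alpha>L cauchy]) (assumption, rule that)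
  \<comment> \<open>Only the squares \<open>f(v)^2\<close> converge by construction. Since
    \<open>v\<close> is nonnegative, it is recovered from them by the continuous map
    \<open>dual_g\<close> of the square root.\<close>
  define y where "y x = dual_g (sqrt (\<beta> x))" for x
  have [measurable]: "\<beta> \<in> borel_measurable borel" by (rule L2_fun_measurable[OF \<beta>(1)])
  have ym[measurable]: "y \<in> borel_measurable borel" unfolding y_def[abs_def] by measurable
  have ball: "AE x in lborel. \<forall>n. 0 \<le> v n x \<and> v n x \<le> sup_bound \<omega> + 1" unfolding AE_all_countable using b by auto
  have lim: "AE x in lborel. (\<lambda>n. v (r n) x) \<longlonglongrightarrow> y x"
    using \<beta>(3) ball
  proof eventually_elim
    case (elim x)
    have "v (r n) x = dual_g (sqrt (\<alpha> (r n) x))" for n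
      using elim(2) by (simp add: \<alpha>_def f_sign dual_g_f)
    then show ?case unfolding y_def by (simp only:) (intro isCont_tendsto_compose[OF isCont_dual_g] tendsto_real_sqrt elim(1))
  qed
  have yb: "AE x in lborel. 0 \<le> y x \<and> y x \<le> sup_bound \<omega> + 1"
    using lim ball by eventually_elim (auto intro: LIMSEQ_le_const LIMSEQ_le_const2)
  obtain G where G: "is_weak_gradient y G" "L2_fun G"
    and lsc: "\<And>e. e > 0 \<Longrightarrow> \<exists>N. \<forall>k\<ge>N. (\<integral>x. (norm (G x))\<^sup>2 \<partial>lborel) \<le> (\<integral>x. (norm (g (r k) x))\<^sup>2 \<partial>lborel) + e"
    by (rule weak_limit_gradient[where v = "\<lambda>n. v (r n)" and g = "\<lambda>n. g (r n)", OF Hpair_weak[OF H] Hpair_L2(2)[OF H] b ym lim gb]) (rule that)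
  have wy: "integrable lborel (\<lambda>x. ((norm x)\<^sup>2 + 1) * (y x)\<^sup>2)"
  proof (rule Fatou_real(1)[where f = "\<lambda>n x. ((norm x)\<^sup>2 + 1) * (v (r n) x)\<^sup>2"])
    show "AE x in lborel. (\<lambda>n. ((norm x)\<^sup>2 + 1) * (v (r n) x)\<^sup>2) \<longlonglongrightarrow> ((norm x)\<^sup>2 + 1) * (y x)\<^sup>2"
      using lim by eventually_elim (intro tendsto_intros)
    show "(\<integral>x. ((norm x)\<^sup>2 + 1) * (v (r n) x)\<^sup>2 \<partial>lborel) \<le> 4 * coercivity_const \<omega> * (I + 1 + A)" for n by (rule vb)
    show "integrable lborel (\<lambda>x. ((norm x)\<^sup>2 + 1) * (v (r n) x)\<^sup>2)" for n by (rule energy_coercive(3)[OF K])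
  qed (simp_all, measurable)
  have Hy: "Hpair y G"
  proof -
    have "integrable lborel (\<lambda>x. (norm x)\<^sup>2 * (y x)\<^sup>2)"
      by (rule integrable_comparison[OF wy]) (auto simp: distrib_right)
    moreover have "L2_fun y"
      by (rule L2_fun_bound[OF ym wy]) (auto simp: distrib_right)
    ultimately show ?thesis using G by (simp add: Hpair_def)
  qed
  have EI: "energy_pair \<omega> y G \<le> I"
  proof (rule field_le_epsilon)
    fix e :: real assume e: "e > 0"
    obtain N1 where N1: "\<And>k. k \<ge> N1 \<Longrightarrow> (\<integral>x. (norm (G x))\<^sup>2 \<partial>lborel) \<le> (\<integral>x. (norm (g (r k) x))\<^sup>2 \<partial>lborel) + e" using lsc[OF e] by blast
    have "e / 2 > 0" using e by simp
    from LIMSEQ_D[OF LIMSEQ_inverse_real_of_nat this] obtain N2 where N2: "\<And>n. n \<ge> N2 \<Longrightarrow> norm (step n - 0) < e / 2" by auto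
    define N where "N = max N1 N2"
    \<comment> \<open>Adding \<open>Theta\<close> makes the integrands nonnegative for Fatou; its
      integral \<open>A\<close> cancels afterwards. The shift \<open>N\<close> places all terms
      where the energy and the gradient estimate are each within \<open>e / 2\<close>.\<close>
    let ?F = "\<lambda>n x. Pot \<omega> x (v (r (n + N)) x) + Theta \<omega> x"
    have Fi: "integrable lborel (?F n)" for n
      by (intro Bochner_Integration.integrable_add Pot_integrable[OF H] Theta_integrable)
    have Fb: "(\<integral>x. ?F n x \<partial>lborel) \<le> I + A + e - (\<integral>x. (norm (G x))\<^sup>2 / 2 \<partial>lborel)" for n
    proof -
      have "(\<integral>x. ?F n x \<partial>lborel) = (\<integral>x. Pot \<omega> x (v (r (n + N)) x) \<partial>lborel) + A"
        unfolding A_def by (intro Bochner_Integration.integral_add Pot_integrable[OF H] Theta_integrable)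
      moreover have "energy_pair \<omega> (v (r (n + N))) (g (r (n + N))) < I + e / 2"
      proof -
        have "r (n + N) \<ge> N2" using seq_suble[OF \<beta>(2), of "n + N"] unfolding N_def by linarith
        from N2[OF this] show ?thesis using Em[of "r (n + N)"] by simp
      qed
      moreover have "(\<integral>x. (norm (G x))\<^sup>2 / 2 \<partial>lborel) \<le> (\<integral>x. (norm (g (r (n + N)) x))\<^sup>2 / 2 \<partial>lborel) + e / 2"
        using N1[of "n + N"] by (simp add: N_def)
      ultimately show ?thesis unfolding energy_pair_def by linarith
    qed
    have Tm: "(Theta \<omega> :: 'a \<Rightarrow> real) \<in> borel_measurable borel" using borel_measurable_integrable[OF Theta_integrable[of \<omega>, where 'a = 'a]] by simp
    have "(\<integral>x. Pot \<omega> x (y x) + Theta \<omega> x \<partial>lborel) \<le> I + A + e - (\<integral>x. (norm (G x))\<^sup>2 / 2 \<partial>lborel)"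
    proof (rule Fatou_real(2)[OF Fi _ _ _ Fb])
      show "AE x in lborel. 0 \<le> ?F n x" for n by (intro AE_I2 Pot_Theta_nonneg)
      show "AE x in lborel. (\<lambda>n. ?F n x) \<longlonglongrightarrow> Pot \<omega> x (y x) + Theta \<omega> x"
        using lim
      proof eventually_elim
        case (elim x)
        show ?case unfolding Pot_def
          by (intro tendsto_intros isCont_tendsto_compose[OF isCont_f] LIMSEQ_ignore_initial_segment[OF elim]) simp_all
      qed
      show "(\<lambda>x. Pot \<omega> x (y x) + Theta \<omega> x) \<in> borel_measurable lborel" using Tm by measurable
    qed
    moreover have "(\<integral>x. Pot \<omega> x (y x) + Theta \<omega> x \<partial>lborel) = (\<integral>x. Pot \<omega> x (y x) \<partial>lborel) + A"
      unfolding A_def by (intro Bochner_Integration.integral_add Pot_integrable[OF Hy] Theta_integrable)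
    ultimately show "energy_pair \<omega> y G \<le> I + e" unfolding energy_pair_def by linarith
  qed
  show thesis
  proof (rule that[of y G])
    show "admissible \<omega> y G" unfolding admissible_def using Hy yb by blast
    show "energy_pair \<omega> y G \<le> energy_pair \<omega> w k" if "Hpair w k" for w :: "'a \<Rightarrow> real" and k
      using energy_truncation[OF Ile that] EI by linarith
  qed
qed

section \<open>Negative energy above the eigenvalue\<close>

lemma f_quotient_tendsto: "(\<lambda>n. f (step n * s) / step n) \<longlonglongrightarrow> s"
proof -
  have "(f has_derivative (*) 1) (at 0)" using f_deriv[of 0] by (simp add: has_field_derivative_def)
  then have "(\<lambda>n. (f (step n * s) - f 0) /\<^sub>R step n) \<longlonglongrightarrow> 1 * s"
    by (rule has_derivative_sequence[where S = UNIV, OF _ _ LIMSEQ_inverse_real_of_nat])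
      (auto intro!: tendsto_eventually always_eventually simp del: of_nat_Suc simp: step_bounds less_imp_neq[symmetric])
  then show ?thesis by (simp add: divide_inverse mult.commute)
qed

text \<open>Since f'(0) = 1, small multiples of \<open>u\<close> see only the quadratic part: the
  energy of \<open>t u\<close> divided by t^2 tends to half of \<open>Qform u g - \<omega> *
  (\<integral>x. (u x)\<^sup>2 \<partial>lborel)\<close>, and the quartic term is of higher
  order.\<close>

lemma negative_energy_exists:
  assumes "first_eigenvalue (harm :: 'a::euclidean_space \<Rightarrow> real) < \<omega>"
  obtains w :: "'a::euclidean_space \<Rightarrow> real" and k where "Hpair w k" "energy_pair \<omega> w k < 0"
proof -
  obtain u :: "'a \<Rightarrow> real" and g where u: "Hpair u g" "Qform u g < \<omega> * (\<integral>x. (u x)\<^sup>2 \<partial>lborel)"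
    by (rule first_eigenvalue_less[OF assms]) (rule that)
  note [measurable] = Hpair_meas[OF u(1)]
  let ?P = "\<lambda>n x. Pot \<omega> x (step n * u x) / (step n)\<^sup>2"
  have lim: "(\<lambda>n. \<integral>x. ?P n x \<partial>lborel) \<longlonglongrightarrow> (\<integral>x. ((norm x)\<^sup>2 - \<omega>) * ((u x)\<^sup>2 / 2) \<partial>lborel)"
  proof (rule integral_dominated_convergence[OF _ _ weight_sq_integrable[OF u(1), of \<omega>]])
    show "AE x in lborel. (\<lambda>n. ?P n x) \<longlonglongrightarrow> ((norm x)\<^sup>2 - \<omega>) * ((u x)\<^sup>2 / 2)"
    proof (intro AE_I2)
      fix x
      let ?q = "\<lambda>n. f (step n * u x) / step n"
      have "(\<lambda>n. f (step n * u x)) \<longlonglongrightarrow> f (0 * u x)"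
        by (intro isCont_tendsto_compose[OF isCont_f] tendsto_intros LIMSEQ_inverse_real_of_nat)
      then have "(\<lambda>n. ((norm x)\<^sup>2 - \<omega>) * ((?q n)\<^sup>2 / 2) + (?q n)\<^sup>2 * (f (step n * u x))\<^sup>2 / 4) \<longlonglongrightarrow> ((norm x)\<^sup>2 - \<omega>) * ((u x)\<^sup>2 / 2) + (u x)\<^sup>2 * (f (0 * u x))\<^sup>2 / 4"
        by (intro tendsto_intros f_quotient_tendsto) auto
      moreover have "((norm x)\<^sup>2 - \<omega>) * ((?q n)\<^sup>2 / 2) + (?q n)\<^sup>2 * (f (step n * u x))\<^sup>2 / 4 = ?P n x" for n
        unfolding Pot_def by (simp add: power_divide add_divide_distrib power4_eq_xxxx power2_eq_square mult.commute del: of_nat_Suc)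
      ultimately show "(\<lambda>n. ?P n x) \<longlonglongrightarrow> ((norm x)\<^sup>2 - \<omega>) * ((u x)\<^sup>2 / 2)" by simp
    qed
    show "AE x in lborel. norm (?P n x) \<le> weight \<omega> x * (u x)\<^sup>2" for n
    proof (intro AE_I2)
      fix x
      have s2: "(step n)\<^sup>2 > 0" using step_bounds(1)[of n] by simp
      have "norm (?P n x) = \<bar>Pot \<omega> x (step n * u x)\<bar> / (step n)\<^sup>2" by (simp add: abs_divide del: of_nat_Suc)
      also have "\<dots> \<le> (weight \<omega> x * (step n * u x)\<^sup>2) / (step n)\<^sup>2" by (intro divide_right_mono Pot_bound) simp
      also have "\<dots> = weight \<omega> x * (u x)\<^sup>2" using s2 by (simp add: power_mult_distrib del: of_nat_Suc)
      finally show "norm (?P n x) \<le> weight \<omega> x * (u x)\<^sup>2" .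
    qed
  qed measurable
  define a where "a = (\<integral>x. (norm (g x))\<^sup>2 / 2 \<partial>lborel)"
  have "a + (\<integral>x. ((norm x)\<^sup>2 - \<omega>) * ((u x)\<^sup>2 / 2) \<partial>lborel) = (Qform u g - \<omega> * (\<integral>x. (u x)\<^sup>2 \<partial>lborel)) / 2"
    unfolding a_def Qform_split[OF u(1)] using Hpair_pot[OF u(1)] Hpair_sq[OF u(1)]
    by (simp add: left_diff_distrib diff_divide_distrib add_divide_distrib)
  then have "a + (\<integral>x. ((norm x)\<^sup>2 - \<omega>) * ((u x)\<^sup>2 / 2) \<partial>lborel) < 0" using u(2) by simp
  with tendsto_add[OF tendsto_const[of a] lim] have "\<forall>\<^sub>F n in sequentially. a + (\<integral>x. ?P n x \<partial>lborel) < 0"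
    by (rule order_tendstoD)
  then obtain n where n: "a + (\<integral>x. ?P n x \<partial>lborel) < 0" unfolding eventually_sequentially by blast
  let ?t = "step n"
  have t2: "?t\<^sup>2 > 0" using step_bounds(1)[of n] by simp
  have "energy_pair \<omega> (\<lambda>x. ?t * u x) (\<lambda>x. ?t *\<^sub>R g x) = ?t\<^sup>2 * (a + (\<integral>x. ?P n x \<partial>lborel))"
  proof -
    have "(\<integral>x. (norm (?t *\<^sub>R g x))\<^sup>2 / 2 \<partial>lborel) = ?t\<^sup>2 * a"
      unfolding a_def integral_mult_right_zero[symmetric] by (simp add: power_mult_distrib power_divide)
    moreover have "(\<integral>x. Pot \<omega> x (?t * u x) \<partial>lborel) = ?t\<^sup>2 * (\<integral>x. ?P n x \<partial>lborel)"
      unfolding integral_mult_right_zero[symmetric] using t2 by (simp del: of_nat_Suc)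
    ultimately show ?thesis unfolding energy_pair_def by (simp add: distrib_left)
  qed
  also have "\<dots> < 0" using n t2 by (simp add: mult_pos_neg del: of_nat_Suc)
  finally show thesis using that[OF Hpair_scale[OF u(1)]] by blast
qed

section \<open>Positivity\<close>

text \<open>By Tonelli the measure of the overlap integrates over all shifts to the product of the
  measures of \<open>A\<close> and \<open>B\<close>, so some shift has positive overlap.\<close>

lemma translate_overlap:
  fixes A B :: "'a::euclidean_space set"
  assumes [measurable]: "A \<in> sets borel" "B \<in> sets borel"
    and pos: "emeasure lborel A > 0" "emeasure lborel B > 0"
  obtains y where "emeasure lborel (A \<inter> {x. x + y \<in> B}) > 0"
proof -
  have "(\<integral>\<^sup>+y. emeasure lborel (A \<inter> {x. x + y \<in> B}) \<partial>lborel)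
      = (\<integral>\<^sup>+y. (\<integral>\<^sup>+x. indicator A x * indicator B (x + y) \<partial>lborel) \<partial>lborel)"
  proof (rule nn_integral_cong)
    fix y :: 'a
    have "emeasure lborel (A \<inter> {x. x + y \<in> B}) = (\<integral>\<^sup>+x. indicator (A \<inter> {x. x + y \<in> B}) x \<partial>lborel)"
      by (rule nn_integral_indicator[symmetric]) measurable
    also have "\<dots> = (\<integral>\<^sup>+x. indicator A x * indicator B (x + y) \<partial>lborel)"
      by (rule nn_integral_cong) (auto split: split_indicator)
    finally show "emeasure lborel (A \<inter> {x. x + y \<in> B}) = (\<integral>\<^sup>+x. indicator A x * indicator B (x + y) \<partial>lborel)" .
  qed
  also have "\<dots> = (\<integral>\<^sup>+x. (\<integral>\<^sup>+y. indicator A x * indicator B (x + y) \<partial>lborel) \<partial>lborel)"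
    by (rule lborel_pair.Fubini') measurable
  also have "\<dots> = (\<integral>\<^sup>+x. indicator A x * emeasure lborel B \<partial>lborel)"
  proof (rule nn_integral_cong)
    fix x :: 'a
    have "(\<integral>\<^sup>+y. indicator A x * indicator B (x + y) \<partial>lborel) = indicator A x * (\<integral>\<^sup>+y. indicator B (y + x) \<partial>lborel)"
      by (simp add: nn_integral_cmult add.commute)
    also have "(\<integral>\<^sup>+y. indicator B (y + x) \<partial>lborel) = (\<integral>\<^sup>+y. indicator B y \<partial>(lborel :: 'a measure))"
      by (rule nn_integral_translate) measurable
    finally show "(\<integral>\<^sup>+y. indicator A x * indicator B (x + y) \<partial>lborel) = indicator A x * emeasure lborel B" by simp
  qed
  also have "\<dots> = emeasure lborel A * emeasure lborel B" by (simp add: nn_integral_multc)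
  also have "\<dots> > 0" using pos by (simp add: ennreal_zero_less_mult_iff)
  finally have i: "(\<integral>\<^sup>+y. emeasure lborel (A \<inter> {x. x + y \<in> B}) \<partial>lborel) > 0" .
  show thesis
  proof (rule ccontr)
    assume "\<not> thesis"
    with that have "emeasure lborel (A \<inter> {x. x + y \<in> B}) = 0" for y by (auto simp: zero_less_iff_neq_zero)
    with i show False by simp
  qed
qed

text \<open>Testing with \<open>\<phi>\<^sup>2 / (v + \<delta>)\<close> gives minus the wanted
  square plus a mixed term with the gradient of \<open>\<phi>\<close>. The potential contributes at
  most \<open>weight\<close> times \<open>v / (v + \<delta>) \<le> 1\<close>, so the right-hand side
  does not depend on \<open>\<delta>\<close>.\<close>

lemma log_gradient_bound:
  fixes v :: "'a::euclidean_space \<Rightarrow> real"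
  assumes v: "Hpair v g" and crit: "critical_point harm (energy harm \<omega>) v" and nn: "AE x in lborel. 0 \<le> v x"
    and \<phi>: "test_function \<phi>" "\<And>x. 0 \<le> \<phi> x" "\<And>x. \<phi> x \<le> 1" and \<delta>: "\<delta> > 0"
  shows "integrable lborel (\<lambda>x. (\<phi> x)\<^sup>2 * (norm (g x) / (v x + \<delta>))\<^sup>2)"
    and "(\<integral>x. (\<phi> x)\<^sup>2 * (norm (g x) / (v x + \<delta>))\<^sup>2 \<partial>lborel)
      \<le> (\<integral>x. 4 * (norm (classical_gradient \<phi> x))\<^sup>2 + 2 * (weight \<omega> x * (\<phi> x)\<^sup>2) \<partial>lborel)"
proof -
  let ?k = "classical_gradient \<phi>"
  note H\<phi> = Hpair_test_function[OF \<phi>(1)]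
  note [measurable] = Hpair_meas[OF v] Hpair_meas[OF H\<phi>]
  define S where "S = {0..1::real} \<times> {0::real..}"
  define \<Phi> where "\<Phi> z = (fst z)\<^sup>2 / (snd z + \<delta>)" for z :: "real \<times> real"
  define D where "D z = (2 * fst z / (snd z + \<delta>), - ((fst z)\<^sup>2 / (snd z + \<delta>)\<^sup>2))" for z :: "real \<times> real"
  have S: "convex S" "0 \<in> S" unfolding S_def zero_prod_def by (auto intro: convex_Times)
  have inS: "AE x in lborel. (\<phi> x, v x) \<in> S" using nn by eventually_elim (auto simp: S_def \<phi>)
  have der: "(\<Phi> has_derivative (\<lambda>h. D z \<bullet> h)) (at z within S)" if "z \<in> S" for z
  proof -
    have ne: "snd z + \<delta> \<noteq> 0" using that \<delta> by (auto simp: S_def)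
    note d1 = bounded_linear_imp_has_derivative[OF bounded_linear_fst, of "at z"]
    have d2: "((\<lambda>z :: real \<times> real. snd z + \<delta>) has_derivative snd) (at z)"
      using has_derivative_add[OF bounded_linear_imp_has_derivative[OF bounded_linear_snd] has_derivative_const[of \<delta>]] by simp
    have q: "((A * a + a * A) * B - (A * A) * b) / (B * B) = 2 * A / B * a + (- (A\<^sup>2 / B\<^sup>2)) * b" if "B \<noteq> 0" for a b A B :: real
      using that by (simp add: field_simps power2_eq_square)
    have "(\<Phi> has_derivative (\<lambda>h. D z \<bullet> h)) (at z)"
      unfolding \<Phi>_def[abs_def] power2_eq_square[of "fst _"]
      by (rule has_derivative_eq_rhs[OF has_derivative_divide'[OF has_derivative_mult[OF d1 d1] d2 ne]])
        (simp only: q[OF ne] D_def inner_prod_def fst_conv snd_conv inner_real_def)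
    then show ?thesis by (rule has_derivative_at_withinI)
  qed
  have bound: "norm (D z) \<le> 2 / \<delta> + 1 / \<delta>\<^sup>2" if z: "z \<in> S" for z
  proof -
    have a: "0 \<le> fst z" "fst z \<le> 1" "\<delta> \<le> snd z + \<delta>" using z by (auto simp: S_def)
    have "\<bar>fst (D z)\<bar> = 2 * fst z / (snd z + \<delta>)" using a \<delta> by (simp add: D_def)
    also have "\<dots> \<le> 2 / \<delta>" using a \<delta> by (intro frac_le) auto
    finally have 1: "\<bar>fst (D z)\<bar> \<le> 2 / \<delta>" .
    have "\<bar>snd (D z)\<bar> = (fst z)\<^sup>2 / (snd z + \<delta>)\<^sup>2" using a \<delta> by (simp add: D_def)
    also have "\<dots> \<le> 1 / \<delta>\<^sup>2" using a \<delta> by (intro frac_le power_mono) (auto simp: power_le_one)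
    finally show ?thesis using 1 norm_Pair_le[of "fst (D z)" "snd (D z)"] by simp
  qed
  define h where "h x = \<Phi> (\<phi> x, v x)" for x
  define k where "k x = fst (D (\<phi> x, v x)) *\<^sub>R ?k x + snd (D (\<phi> x, v x)) *\<^sub>R g x" for x
  have Hh: "Hpair h k" unfolding h_def[abs_def] k_def[abs_def]
    by (rule Hpair_chain2[OF H\<phi> v S _ inS der bound])
      (simp add: \<Phi>_def, unfold \<Phi>_def D_def fst_conv snd_conv, measurable)
  have L0: "(\<integral>x. g x \<bullet> k x + dPot \<omega> x (v x) * h x \<partial>lborel) = 0"
    using critical_point_energy_deriv[OF v crit Hh] by (simp add: energy_deriv_def)
  have Li2: "integrable lborel (\<lambda>x. 2 * (g x \<bullet> k x + dPot \<omega> x (v x) * h x))"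
    by (intro Bochner_Integration.integrable_mult_right energy_deriv_integrable[OF v Hh])
  have Gi: "integrable lborel (\<lambda>x. 4 * (norm (?k x))\<^sup>2 + 2 * (weight \<omega> x * (\<phi> x)\<^sup>2))"
    using Hpair_sq(2)[OF H\<phi>] weight_sq_integrable[OF H\<phi>, of \<omega>] by (intro Bochner_Integration.integrable_add) auto
  have le: "AE x in lborel. (\<phi> x)\<^sup>2 * (norm (g x) / (v x + \<delta>))\<^sup>2
      \<le> 4 * (norm (?k x))\<^sup>2 + 2 * (weight \<omega> x * (\<phi> x)\<^sup>2) - 2 * (g x \<bullet> k x + dPot \<omega> x (v x) * h x)"
    using nn
  proof eventually_elim
    case (elim x)
    \<comment> \<open>\<open>G\<close> is \<open>\<phi>\<close> times the gradient of the logarithm;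
      the square of \<open>G\<close> minus twice the gradient of \<open>\<phi>\<close> absorbs the
      mixed term.\<close>
    define G where "G = (\<phi> x / (v x + \<delta>)) *\<^sub>R g x"
    have p: "v x + \<delta> > 0" using elim \<delta> by simp
    have nG: "(norm G)\<^sup>2 = (\<phi> x)\<^sup>2 * (norm (g x) / (v x + \<delta>))\<^sup>2"
      using p by (simp add: G_def power_mult_distrib power_divide)
    have gk: "g x \<bullet> k x = 2 * (G \<bullet> ?k x) - (norm G)\<^sup>2"
      unfolding nG using p by (simp add: k_def D_def G_def inner_add_right inner_diff_right power_divide power2_norm_eq_inner)
    have "0 \<le> (norm (G - 2 *\<^sub>R ?k x))\<^sup>2" by simp
    also have "\<dots> = (norm G)\<^sup>2 - 4 * (G \<bullet> ?k x) + 4 * (norm (?k x))\<^sup>2"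
      unfolding power2_norm_eq_inner by (simp add: inner_diff_left inner_diff_right inner_commute)
    finally have 1: "4 * (G \<bullet> ?k x) \<le> (norm G)\<^sup>2 + 4 * (norm (?k x))\<^sup>2" by simp
    have "dPot \<omega> x (v x) * h x \<le> weight \<omega> x * v x * h x"
      using dPot_bound[of \<omega> x "v x"] elim p by (intro mult_right_mono) (auto simp: h_def \<Phi>_def)
    also have "\<dots> = weight \<omega> x * (v x / (v x + \<delta>) * (\<phi> x)\<^sup>2)" by (simp add: h_def \<Phi>_def)
    also have "\<dots> \<le> weight \<omega> x * (1 * (\<phi> x)\<^sup>2)"
      using elim p \<delta> weight_ge(1)[of \<omega> x] by (intro mult_left_mono mult_right_mono) auto
    finally show ?case using 1 gk unfolding nG[symmetric] by (simp add: distrib_left)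
  qed
  have Bi: "integrable lborel (\<lambda>x. 4 * (norm (?k x))\<^sup>2 + 2 * (weight \<omega> x * (\<phi> x)\<^sup>2) - 2 * (g x \<bullet> k x + dPot \<omega> x (v x) * h x))"
    by (intro Bochner_Integration.integrable_diff Gi Li2)
  show i: "integrable lborel (\<lambda>x. (\<phi> x)\<^sup>2 * (norm (g x) / (v x + \<delta>))\<^sup>2)"
    by (rule Bochner_Integration.integrable_bound[OF Bi]) (measurable, use le in eventually_elim, auto)
  have "(\<integral>x. (\<phi> x)\<^sup>2 * (norm (g x) / (v x + \<delta>))\<^sup>2 \<partial>lborel)
      \<le> (\<integral>x. 4 * (norm (?k x))\<^sup>2 + 2 * (weight \<omega> x * (\<phi> x)\<^sup>2) - 2 * (g x \<bullet> k x + dPot \<omega> x (v x) * h x) \<partial>lborel)"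
    by (rule integral_mono_AE[OF i Bi le])
  also have "\<dots> = (\<integral>x. 4 * (norm (?k x))\<^sup>2 + 2 * (weight \<omega> x * (\<phi> x)\<^sup>2) \<partial>lborel) - (\<integral>x. 2 * (g x \<bullet> k x + dPot \<omega> x (v x) * h x) \<partial>lborel)"
    by (intro Bochner_Integration.integral_diff Gi Li2)
  also have "(\<integral>x. 2 * (g x \<bullet> k x + dPot \<omega> x (v x) * h x) \<partial>lborel) = 0"
    by (subst Bochner_Integration.integral_mult_right_zero) (simp only: L0 mult_zero_right)
  finally show "(\<integral>x. (\<phi> x)\<^sup>2 * (norm (g x) / (v x + \<delta>))\<^sup>2 \<partial>lborel)
      \<le> (\<integral>x. 4 * (norm (?k x))\<^sup>2 + 2 * (weight \<omega> x * (\<phi> x)\<^sup>2) \<partial>lborel)" by simp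
qed

text \<open>This normalisation differs from the logarithm of \<open>v + \<delta>\<close> by a
  constant, so the gradient is the same, but it vanishes where \<open>v\<close> does and thus stays
  in the form domain.\<close>

lemma Hpair_log:
  assumes v: "Hpair v g" and nn: "AE x in lborel. 0 \<le> v x" and \<delta>: "\<delta> > 0"
  shows "Hpair (\<lambda>x. ln (1 + v x / \<delta>)) (\<lambda>x. (1 / (v x + \<delta>)) *\<^sub>R g x)"
proof -
  note [measurable] = Hpair_meas[OF v]
  define S where "S = {0::real..} \<times> (UNIV :: real set)"
  define \<Phi> where "\<Phi> z = ln (1 + fst z / \<delta>)" for z :: "real \<times> real"
  define D where "D z = (1 / (fst z + \<delta>), 0 :: real)" for z :: "real \<times> real"
  have S: "convex S" "0 \<in> S" unfolding S_def zero_prod_def by (auto intro: convex_Times)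
  have inS: "AE x in lborel. (v x, v x) \<in> S" using nn by eventually_elim (auto simp: S_def)
  have der: "(\<Phi> has_derivative (\<lambda>h. D z \<bullet> h)) (at z within S)" if "z \<in> S" for z
  proof -
    have z: "fst z \<ge> 0" using that by (auto simp: S_def)
    have p: "0 < 1 + fst z / \<delta>" using z \<delta> by (simp add: add_pos_nonneg)
    have "((\<lambda>s. ln (1 + s / \<delta>)) has_real_derivative 1 / (fst z + \<delta>)) (at (fst z))"
      using p z \<delta> by (auto intro!: derivative_eq_intros simp: field_simps)
    then have "((\<lambda>s. ln (1 + s / \<delta>)) has_derivative (*) (1 / (fst z + \<delta>))) (at (fst z))"
      by (simp only: has_field_derivative_def)
    from has_derivative_compose[OF bounded_linear_imp_has_derivative[OF bounded_linear_fst] this]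
    have "(\<Phi> has_derivative (\<lambda>h. D z \<bullet> h)) (at z)"
      unfolding \<Phi>_def[abs_def] by (rule has_derivative_eq_rhs) (auto simp: D_def inner_prod_def fun_eq_iff)
    then show ?thesis by (rule has_derivative_at_withinI)
  qed
  have bound: "norm (D z) \<le> 1 / \<delta>" if z: "z \<in> S" for z
    using z \<delta> by (auto simp: D_def S_def norm_Pair intro!: divide_left_mono)
  have "Hpair (\<lambda>x. \<Phi> (v x, v x)) (\<lambda>x. fst (D (v x, v x)) *\<^sub>R g x + snd (D (v x, v x)) *\<^sub>R g x)"
    by (rule Hpair_chain2[OF v v S _ inS der bound])
      (simp add: \<Phi>_def, unfold \<Phi>_def D_def fst_conv snd_conv, measurable)
  then show ?thesis by (simp add: \<Phi>_def D_def)
qed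

lemma emeasure_Int_UN_pos:
  assumes [measurable]: "A \<in> sets M" "\<And>n::nat. S n \<in> sets M" and pos: "emeasure M A > 0" and sub: "A \<subseteq> (\<Union>n. S n)"
  obtains n where "emeasure M (A \<inter> S n) > 0"
proof (rule ccontr)
  assume "\<not> thesis"
  with that have "emeasure M (A \<inter> S n) = 0" for n by (auto simp: zero_less_iff_neq_zero)
  then have "emeasure M (\<Union>n. A \<inter> S n) = 0" by (intro emeasure_UN_eq_0) auto
  moreover have "(\<Union>n. A \<inter> S n) = A" using sub by auto
  ultimately show False using pos by simp
qed

text \<open>On \<open>E\<close> the function vanishes and its translate by \<open>y\<close> exceeds
  a fixed \<open>\<eta>\<close>, so the logarithm grows by at least ln (1 + \<eta> / \<delta>) along
  each of these segments, while the total growth over \<open>E\<close> is bounded independently of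
  \<open>\<delta>\<close>.\<close>

lemma nonneg_critical_pos:
  fixes v :: "'a::euclidean_space \<Rightarrow> real"
  assumes v: "Hpair v g" and crit: "critical_point harm (energy harm \<omega>) v" and nn: "AE x in lborel. 0 \<le> v x"
    and nz: "\<not> (AE x in lborel. v x = 0)"
  shows "AE x in lborel. v x > 0"
proof (rule ccontr)
  assume np: "\<not> (AE x in lborel. v x > 0)"
  note [measurable] = Hpair_meas[OF v]
  define Z where "Z = {x. v x \<le> 0}"
  define P where "P = {x. v x > 0}"
  have [measurable]: "Z \<in> sets borel" "P \<in> sets borel" unfolding Z_def P_def by measurable
  have Z: "emeasure lborel Z > 0"
    using np AE_iff_measurable[of Z lborel "\<lambda>x. v x > 0"] by (auto simp: Z_def not_less zero_less_iff_neq_zero)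
  have P: "emeasure lborel P > 0"
  proof (rule ccontr)
    assume "\<not> emeasure lborel P > 0"
    then have "AE x in lborel. v x \<le> 0"
      using AE_iff_measurable[of P lborel "\<lambda>x. v x \<le> 0"] by (auto simp: P_def not_le)
    with nn have "AE x in lborel. v x = 0" by eventually_elim auto
    with nz show False ..
  qed
  obtain j :: nat where j: "emeasure lborel (Z \<inter> cball 0 (real j)) > 0"
    by (rule emeasure_Int_UN_pos[of Z lborel "\<lambda>j. cball 0 (real j)"]) (use Z real_arch_simple in auto)
  obtain y where y: "emeasure lborel (Z \<inter> cball 0 (real j) \<inter> {x. x + y \<in> P}) > 0"
    by (rule translate_overlap[OF _ _ j P]) (auto intro: that)
  have m1: "Z \<inter> cball 0 (real j) \<inter> {x. x + y \<in> P} \<in> sets lborel" and m2: "{x. v (x + y) > step n} \<in> sets lborel" for n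
    by measurable
  have sub: "Z \<inter> cball 0 (real j) \<inter> {x. x + y \<in> P} \<subseteq> (\<Union>n. {x. v (x + y) > step n})"
    using reals_Archimedean by (auto simp: P_def simp del: of_nat_Suc)
  \<comment> \<open>A uniform lower bound for the translated values: the sets where they exceed
    \<open>step n\<close> exhaust the overlap, so one of them meets it in positive measure.\<close>
  obtain n where n: "emeasure lborel (Z \<inter> cball 0 (real j) \<inter> {x. x + y \<in> P} \<inter> {x. v (x + y) > step n}) > 0"
    by (rule emeasure_Int_UN_pos[OF m1 m2 y sub]) (rule that)
  define E where "E = Z \<inter> cball 0 (real j) \<inter> {x. x + y \<in> P} \<inter> {x. v (x + y) > step n}"
  define \<eta> where "\<eta> = step n"
  have \<eta>: "\<eta> > 0" by (simp add: \<eta>_def)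
  define r where "r = real j + norm y"
  define F where "F = cball (0::'a) r"
  have r: "r \<ge> 0" by (simp add: r_def)
  have [measurable]: "E \<in> sets borel" "F \<in> sets borel" unfolding E_def F_def by measurable
  have "emeasure lborel E \<le> emeasure lborel (cball (0::'a) (real j))" by (rule emeasure_mono) (auto simp: E_def)
  also have "\<dots> < \<infinity>" by (rule emeasure_bounded_finite) auto
  finally obtain m where m: "emeasure lborel E = ennreal m" "m > 0"
    using n unfolding E_def[symmetric] by (cases "emeasure lborel E") auto
  \<comment> \<open>The cube is larger than the ball \<open>F\<close>, so the bump is positive on
    \<open>F\<close>, and by compactness bounded below there.\<close>
  define \<phi> :: "'a \<Rightarrow> real" where "\<phi> = box_bump (- ((r + 1) *\<^sub>R One)) ((r + 1) *\<^sub>R One) 1"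
  have \<phi>: "test_function \<phi>" "0 \<le> \<phi> x" "\<phi> x \<le> 1" for x
    using test_function_box_bump[of 1] box_bump_bounds by (auto simp: \<phi>_def)
  have Fp: "\<phi> x > 0" if "x \<in> F" for x
    unfolding \<phi>_def
  proof (rule box_bump_pos)
    have "(- ((r + 1) *\<^sub>R One)) \<bullet> e < x \<bullet> e \<and> x \<bullet> e < ((r + 1) *\<^sub>R One) \<bullet> e" if e: "e \<in> Basis" for e
    proof -
      have "\<bar>x \<bullet> e\<bar> \<le> r" using Basis_le_norm[OF e, of x] \<open>x \<in> F\<close> by (simp add: F_def)
      moreover have "((r + 1) *\<^sub>R One) \<bullet> e = r + 1" using e by (simp add: inner_sum_left_Basis)
      ultimately show ?thesis unfolding inner_minus_left by linarith
    qed
    then show "x \<in> box (- ((r + 1) *\<^sub>R One)) ((r + 1) *\<^sub>R One)" unfolding mem_box by blast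
  qed simp
  have "\<exists>x\<in>F. \<forall>z\<in>F. \<phi> x \<le> \<phi> z"
    using r by (intro continuous_attains_inf continuous_on_subset[OF test_function_continuous[OF \<phi>(1)]]) (auto simp: F_def)
  then obtain x0 where x0: "x0 \<in> F" "\<And>z. z \<in> F \<Longrightarrow> \<phi> x0 \<le> \<phi> z" by blast
  define c where "c = (\<phi> x0)\<^sup>2"
  have c: "c > 0" "\<And>z. z \<in> F \<Longrightarrow> c \<le> (\<phi> z)\<^sup>2" using Fp[OF x0(1)] x0(2) by (auto simp: c_def intro: power_mono)
  define C where "C = (\<integral>x. 4 * (norm (classical_gradient \<phi> x))\<^sup>2 + 2 * (weight \<omega> x * (\<phi> x)\<^sup>2) \<partial>lborel)"
  define T where "T = (\<integral>x. indicator F x \<partial>lborel) + C / c"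
  have C0: "C \<ge> 0" unfolding C_def
    by (intro Bochner_Integration.integral_nonneg add_nonneg_nonneg mult_nonneg_nonneg order_trans[OF _ weight_ge(1)]) auto
  have T0: "T \<ge> 0" unfolding T_def using C0 c by (intro add_nonneg_nonneg Bochner_Integration.integral_nonneg) auto
  \<comment> \<open>\<open>T\<close> contains no \<open>\<delta>\<close>: the gradient of the
    logarithm is at most one plus its square, and the square is controlled on \<open>F\<close> by
    \<open>C / c\<close>.\<close>
  have key: "ln (1 + \<eta> / \<delta>) * m \<le> norm y * T" if \<delta>: "\<delta> > 0" for \<delta>
  proof -
    define L where "L x = ln (1 + v x / \<delta>)" for x
    define G where "G x = (1 / (v x + \<delta>)) *\<^sub>R g x" for x
    have HL: "Hpair L G" using Hpair_log[OF v nn \<delta>] by (simp add: L_def[abs_def] G_def[abs_def])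
    note [measurable] = Hpair_meas[OF HL] Hpair_meas[OF Hpair_test_function[OF \<phi>(1)]]
    note lb = log_gradient_bound[OF v crit nn \<phi> \<delta>, folded C_def]
    let ?b = "\<lambda>x. indicat_real F x + (\<phi> x)\<^sup>2 * (norm (g x) / (v x + \<delta>))\<^sup>2 / c"
    have bi: "integrable lborel ?b"
      using lb(1) by (intro Bochner_Integration.integrable_add) (auto simp: F_def integrable_indicator_cball)
    have "ln (1 + \<eta> / \<delta>) \<ge> 0" using \<eta> \<delta> by simp
    have "ennreal (ln (1 + \<eta> / \<delta>) * m) = (\<integral>\<^sup>+x. ennreal (ln (1 + \<eta> / \<delta>)) * indicator E x \<partial>lborel)"
      using m \<eta> \<delta> by (simp add: nn_integral_cmult ennreal_mult)
    also have "\<dots> \<le> (\<integral>\<^sup>+x. indicator E x * ennreal \<bar>L (x + y) - L x\<bar> \<partial>lborel)"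
    proof (rule nn_integral_mono_AE)
      show "AE x in lborel. ennreal (ln (1 + \<eta> / \<delta>)) * indicator E x \<le> indicator E x * ennreal \<bar>L (x + y) - L x\<bar>"
        using nn
      proof eventually_elim
        case (elim x)
        show ?case
        proof (cases "x \<in> E")
          case True
          then have 1: "v x = 0" "\<eta> \<le> v (x + y)" using elim by (auto simp: E_def Z_def \<eta>_def)
          have "ln (1 + \<eta> / \<delta>) \<le> ln (1 + v (x + y) / \<delta>)"
            using 1 \<eta> \<delta> by (intro ln_mono add_left_mono divide_right_mono add_pos_nonneg) auto
          then show ?thesis using True 1 by (auto simp: L_def intro!: ennreal_leI)
        qed simp
      qed
    qed
    also have "\<dots> \<le> ennreal (norm y) * (\<integral>\<^sup>+x. indicator F x * ennreal (norm (G x)) \<partial>lborel)"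
    proof (rule weak_gradient_translate_L1[OF Hpair_weak[OF HL]])
      fix x s assume x: "x \<in> E" "s \<in> {0..1::real}"
      have "norm (x + s *\<^sub>R y) \<le> norm x + s * norm y" using x norm_triangle_ineq[of x "s *\<^sub>R y"] by simp
      also have "\<dots> \<le> real j + 1 * norm y" using x by (intro add_mono mult_right_mono) (auto simp: E_def)
      finally show "x + s *\<^sub>R y \<in> F" by (simp add: F_def r_def)
    qed measurable
    also have "(\<integral>\<^sup>+x. indicator F x * ennreal (norm (G x)) \<partial>lborel) \<le> (\<integral>\<^sup>+x. ennreal (?b x) \<partial>lborel)"
    proof (rule nn_integral_mono_AE)
      show "AE x in lborel. indicator F x * ennreal (norm (G x)) \<le> ennreal (?b x)"
        using nn
      proof eventually_elim
        case (elim x)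
        show ?case
        proof (cases "x \<in> F")
          case True
          define s where "s = norm (g x) / (v x + \<delta>)"
          have G: "norm (G x) = s" using elim \<delta> by (simp add: G_def s_def)
          have "0 \<le> (s - 1)\<^sup>2 + s\<^sup>2 + 1" by simp
          then have "s \<le> 1 + s\<^sup>2" by (simp add: power2_eq_square algebra_simps)
          moreover have "s\<^sup>2 \<le> (\<phi> x)\<^sup>2 * s\<^sup>2 / c" using c(1) mult_right_mono[OF c(2)[OF True], of "s\<^sup>2"] by (simp add: field_simps)
          ultimately have "norm (G x) \<le> ?b x" using True G by (simp add: s_def)
          then show ?thesis using True by (simp add: ennreal_leI)
        qed simp
      qed
    qed
    also have "(\<integral>\<^sup>+x. ennreal (?b x) \<partial>lborel) = ennreal (\<integral>x. ?b x \<partial>lborel)"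
      using c(1) by (intro nn_integral_eq_integral[OF bi]) auto
    also have "(\<integral>x. ?b x \<partial>lborel) \<le> T"
    proof -
      have "(\<integral>x. ?b x \<partial>lborel) = (\<integral>x. indicator F x \<partial>lborel) + (\<integral>x. (\<phi> x)\<^sup>2 * (norm (g x) / (v x + \<delta>))\<^sup>2 \<partial>lborel) / c"
        using lb(1) by (subst Bochner_Integration.integral_add) (auto simp: F_def integrable_indicator_cball)
      then show ?thesis using lb(2) c(1) by (simp add: T_def divide_right_mono)
    qed
    finally have "ennreal (ln (1 + \<eta> / \<delta>) * m) \<le> ennreal (norm y * T)"
      using T0 by (simp add: ennreal_mult ennreal_leI mult_left_mono)
    then show ?thesis using T0 by (simp add: ennreal_le_iff)
  qed
  \<comment> \<open>Chosen so that \<open>K * m\<close> exceeds \<open>norm y * T\<close> by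
    \<open>m\<close>. With \<open>\<delta> = \<eta> / (exp K - 1)\<close> the logarithm in
    \<open>key\<close> equals \<open>K\<close>, which is the contradiction.\<close>
  define K where "K = norm y * T / m + 1"
  have K: "K > 0" "K * m = norm y * T + m" using T0 m by (auto simp: K_def field_simps add_pos_nonneg)
  have "exp K - 1 > 0" using K by simp
  with key[of "\<eta> / (exp K - 1)"] \<eta> have "K * m \<le> norm y * T" by simp
  then show False using K m by simp
qed

text \<open>The zero function has energy 0, so a competitor of negative energy rules out a vanishing
  minimizer, the one case that the positivity lemma leaves open.\<close>

lemma positive_critical_exists:
  fixes \<omega> :: real
  assumes "first_eigenvalue (harm :: 'a::euclidean_space \<Rightarrow> real) < \<omega>"
  obtains v :: "'a::euclidean_space \<Rightarrow> real" where "critical_point harm (energy harm \<omega>) v" "positive_fun v"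
proof -
  obtain v :: "'a \<Rightarrow> real" and g where K: "admissible \<omega> v g" and min: "\<And>(w :: 'a \<Rightarrow> real) k. Hpair w k \<Longrightarrow> energy_pair \<omega> v g \<le> energy_pair \<omega> w k"
    by (rule minimizer_exists[of \<omega>]) (rule that)
  have v: "Hpair v g" and nn: "AE x in lborel. 0 \<le> v x" using K unfolding admissible_def by auto
  obtain w :: "'a \<Rightarrow> real" and k where w: "Hpair w k" "energy_pair \<omega> w k < 0"
    by (rule negative_energy_exists[OF assms]) (rule that)
  have neg: "energy_pair \<omega> v g < 0" using min[OF w(1)] w(2) by simp
  have crit: "critical_point harm (energy harm \<omega>) v" by (rule minimizer_critical[OF v min])
  have "\<not> (AE x in lborel. v x = 0)"
  proof
    assume z: "AE x in lborel. v x = 0"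
    note [measurable] = Hpair_meas[OF v]
    have P0: "(\<integral>x. Pot \<omega> x (v x) \<partial>lborel) = (\<integral>x. 0 \<partial>(lborel :: 'a measure))"
      by (rule integral_cong_AE) (measurable, use z in eventually_elim, simp add: Pot_def)
    have "energy_pair \<omega> v g \<ge> 0" unfolding energy_pair_def P0 by simp
    with neg show False by simp
  qed
  then have "positive_fun v" unfolding positive_fun_def by (rule nonneg_critical_pos[OF v crit nn])
  with crit show thesis by (rule that)
qed

theorem theorem8p2:
  fixes V :: "real ^ 'n \<Rightarrow> real" and \<omega> :: real
  assumes V: "\<And>x. V x = (norm x)\<^sup>2"
  shows
    "(\<forall>u\<^sub>1 u\<^sub>2. solution V \<omega> u\<^sub>1 \<and> positive_fun u\<^sub>1 \<and> solution V \<omega> u\<^sub>2 \<and> positive_fun u\<^sub>2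
        \<longrightarrow> (AE x in lborel. u\<^sub>1 x = u\<^sub>2 x)) \<and>
     (\<forall>v\<^sub>1 v\<^sub>2. critical_point V (energy V \<omega>) v\<^sub>1 \<and> positive_fun v\<^sub>1 \<and>
              critical_point V (energy V \<omega>) v\<^sub>2 \<and> positive_fun v\<^sub>2
        \<longrightarrow> (AE x in lborel. v\<^sub>1 x = v\<^sub>2 x)) \<and>
     ((\<exists>u. solution V \<omega> u \<and> positive_fun u) \<longleftrightarrow> \<omega> > first_eigenvalue V) \<and>
     ((\<exists>v. critical_point V (energy V \<omega>) v \<and> positive_fun v) \<longleftrightarrow> \<omega> > first_eigenvalue V)"
proof -
  have VH: "V = harm" using V by (intro ext)
  let ?crit = "critical_point V (energy V \<omega>)"
  \<comment> \<open>\<open>inv f\<close> is \<open>dual_g\<close>, an increasing bijection fixing 0;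
    existence, positivity and equality therefore transfer between \<open>u\<close> and
    \<open>v\<close>.\<close>
  have sol: "solution V \<omega> u \<longleftrightarrow> ?crit (\<lambda>x. dual_g (u x))" for u
    by (simp add: solution_def inv_f)
  have pos: "positive_fun (\<lambda>x. dual_g (u x)) \<longleftrightarrow> positive_fun u" for u :: "real ^ 'n \<Rightarrow> real"
    using dual_g_strict[of 0] by (simp add: positive_fun_def dual_g_0)
  have H: "Hpair v (weak_gradient v)" if "?crit v" for v
    using that unfolding VH by (intro H_space_Hpair) (simp add: critical_point_def)
  have uniq: "AE x in lborel. v1 x = v2 x" if "?crit v1" "positive_fun v1" "?crit v2" "positive_fun v2" for v1 v2
    using positive_critical_unique[OF H[OF that(1)] _ _ H[OF that(3)]] that unfolding VH positive_fun_def by blast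
  have uniq_u: "AE x in lborel. u1 x = u2 x"
    if "solution V \<omega> u1" "positive_fun u1" "solution V \<omega> u2" "positive_fun u2" for u1 u2
  proof -
    have "AE x in lborel. dual_g (u1 x) = dual_g (u2 x)"
      by (rule uniq) (use that in \<open>simp_all add: sol pos\<close>)
    then show ?thesis by (simp add: inj_eq[OF inj_dual_g])
  qed
  have ex: "(\<exists>v. ?crit v \<and> positive_fun v) \<longleftrightarrow> first_eigenvalue V < \<omega>"
  proof
    assume "\<exists>v. ?crit v \<and> positive_fun v"
    then obtain v where v: "?crit v" "positive_fun v" by blast
    show "first_eigenvalue V < \<omega>"
      using positive_critical_imp_eigenvalue[OF H[OF v(1)]] v unfolding VH positive_fun_def by blast
  next
    assume "first_eigenvalue V < \<omega>"
    then show "\<exists>v. ?crit v \<and> positive_fun v" unfolding VH by (rule positive_critical_exists) blast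
  qed
  have "(\<exists>u. solution V \<omega> u \<and> positive_fun u) \<longleftrightarrow> (\<exists>v. ?crit v \<and> positive_fun v)"
  proof
    assume "\<exists>v. ?crit v \<and> positive_fun v"
    then obtain v where "?crit v" "positive_fun v" by blast
    then have "solution V \<omega> (\<lambda>x. f (v x)) \<and> positive_fun (\<lambda>x. f (v x))"
      by (simp add: sol positive_fun_def dual_g_f f_sign)
    then show "\<exists>u. solution V \<omega> u \<and> positive_fun u" by blast
  next
    assume "\<exists>u. solution V \<omega> u \<and> positive_fun u"
    then obtain u where "?crit (\<lambda>x. dual_g (u x))" "positive_fun (\<lambda>x. dual_g (u x))" by (auto simp: sol pos)
    then show "\<exists>v. ?crit v \<and> positive_fun v" by (intro exI conjI)
  qed
  then have ex_u: "(\<exists>u. solution V \<omega> u \<and> positive_fun u) \<longleftrightarrow> first_eigenvalue V < \<omega>" using ex by (rule trans)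
  show ?thesis
  proof (rule conjI[OF _ conjI[OF _ conjI[OF ex_u ex]]]; intro allI impI; elim conjE)
  qed (rule uniq_u uniq; assumption)+
qed

end
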